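(* Let $d\ge3$, $j\in\{1,\dots,d-2\}$, $K\in\mathcal K^d_s$, and let $\varphi$ be an even, $j$-homogeneous, translation invariant, continuous valuation on $\mathcal K^d$. Then $$\int_{G(d,j)}(\mathbf K_j\varphi)(M)\,\gamma_j(K,dM)=\int_{G(d,j+1)}\varphi(K|L)\,\nu_{j+1}(dL).$$
   Context: $\mathcal K^d$ is the space of convex bodies in $\mathbb R^d$; $\mathcal K^d_s=\{K: K=-K\}$. A valuation is a map $\varphi:\mathcal K^d\to\mathbb R$ with $\varphi(K\cup M)+\varphi(K\cap M)=\varphi(K)+\varphi(M)$ whenever $K,M,K\cup M\in\mathcal K^d$; $j$-homogeneous means $\varphi(\alpha K)=\alpha^j\varphi(K)$, $\alpha\ge0$; even means $\varphi(-K)=\varphi(K)$; continuity is w.r.t. the Hausdorff metric. For such $\varphi$ the Klain function $\mathbf K_j\varphi$ is the continuous function on $G(d,j)$ with $\varphi(K)=(\mathbf K_j\varphi)(L)V_j(K)$ for all convex bodies $K$ contained in $L\in G(d,j)$ ($V_j$ the $j$th intrinsic volume). $G(d,k)$ is the Grassmannian of $k$-dimensional linear subspaces with rotation invariant probability measure $\nu_k$; $K|L$ is orthogonal projection. $\Psi'_j(K|E,\cdot)$ is the $j$th area measure (total mass $V_j$) of $K|E$ computed within $E$. With $F(d,j+1)=\{(u,E): E\in G(d,j+1),\ u\in S^{d-1}\cap E\}$, the flag measure is $\psi_j(K,\cdot)=\int_{G(d,j+1)}\int_{S^{d-1}\cap E}\mathbf 1\{(u,E)\in\cdot\}\,\Psi'_j(K|E,du)\,\nu_{j+1}(dE)$,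 and the Grassmann measure $\gamma_j(K,\cdot)$ is its image on $G(d,j)$ under $(u,L)\mapsto u^\perp\cap L$. *)

theory Defs
  imports "HOL-Probability.Probability"
begin

definition conv_body :: "'a::euclidean_space set \<Rightarrow> bool" where
  "conv_body K \<longleftrightarrow> compact K \<and> convex K \<and> K \<noteq> {}"

definition hausdist :: "'a::euclidean_space set \<Rightarrow> 'a set \<Rightarrow> real" where
  "hausdist K M = max (SUP x\<in>K. infdist x M) (SUP y\<in>M. infdist y K)"

definition valuation :: "('a::euclidean_space set \<Rightarrow> real) \<Rightarrow> bool" where
  "valuation \<phi> \<longleftrightarrow> (\<forall>K M. conv_body K \<and> conv_body M \<and> conv_body (K \<union> M) \<longrightarrow>
      \<phi> (K \<union> M) + \<phi> (K \<inter> M) = \<phi> K + \<phi> M)"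

definition homogeneous_val :: "nat \<Rightarrow> ('a::euclidean_space set \<Rightarrow> real) \<Rightarrow> bool" where
  "homogeneous_val j \<phi> \<longleftrightarrow> (\<forall>K \<alpha>. conv_body K \<and> \<alpha> \<ge> 0 \<longrightarrow> \<phi> ((\<lambda>x. \<alpha> *\<^sub>R x) ` K) = \<alpha> ^ j * \<phi> K)"

definition even_val :: "('a::euclidean_space set \<Rightarrow> real) \<Rightarrow> bool" where
  "even_val \<phi> \<longleftrightarrow> (\<forall>K. conv_body K \<longrightarrow> \<phi> (uminus ` K) = \<phi> K)"

definition translation_invariant :: "('a::euclidean_space set \<Rightarrow> real) \<Rightarrow> bool" where
  "translation_invariant \<phi> \<longleftrightarrow> (\<forall>K t. conv_body K \<longrightarrow> \<phi> ((\<lambda>x. t + x) ` K) = \<phi> K)"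

definition hausdorff_continuous :: "('a::euclidean_space set \<Rightarrow> real) \<Rightarrow> bool" where
  "hausdorff_continuous \<phi> \<longleftrightarrow> (\<forall>K Ks. conv_body K \<and> (\<forall>n. conv_body (Ks n)) \<and>
      (\<lambda>n. hausdist (Ks n) K) \<longlonglongrightarrow> 0 \<longrightarrow> (\<lambda>n. \<phi> (Ks n)) \<longlonglongrightarrow> \<phi> K)"

definition grass :: "nat \<Rightarrow> 'a::euclidean_space set set" where
  "grass k = {L. subspace L \<and> dim L = k}"

definition proj :: "'a::euclidean_space set \<Rightarrow> 'a \<Rightarrow> 'a" where
  "proj L x = closest_point L x"

text \<open>Volume of the unit ball in R^n.\<close>
definition kappa :: "nat \<Rightarrow> real" where
  "kappa n = pi powr (real n / 2) / Gamma (real n / 2 + 1)"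

text \<open>(dim E)-dimensional Lebesgue measure of a set A contained in the linear subspace E,
  computed as the d-volume of the cylinder over A with unit-ball cross-section in the
  orthogonal complement of E, divided by the volume of that cross-section.\<close>
definition volE :: "'a::euclidean_space set \<Rightarrow> 'a set \<Rightarrow> real" where
  "volE E A = measure lborel {x. proj E x \<in> A \<and> norm (x - proj E x) \<le> 1}
              / kappa (DIM('a) - dim E)"

text \<open>Klain function: the value c with phi(K) = c V_j(K) for all convex bodies K in L
  (for a body contained in the j-dimensional L, V_j(K) is its j-dimensional volume).\<close>
definition klain :: "('a::euclidean_space set \<Rightarrow> real) \<Rightarrow> 'a set \<Rightarrow> real" where
  "klain \<phi> L = (THE c. \<forall>K. conv_body K \<and> K \<subseteq> L \<longrightarrow> \<phi> K = c * volE L K)"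

definition grass_space :: "nat \<Rightarrow> 'a::euclidean_space set measure" where
  "grass_space k = vimage_algebra (grass k) (\<lambda>L. Blinfun (proj L)) (borel :: ('a \<Rightarrow>\<^sub>L 'a) measure)"

definition nu :: "nat \<Rightarrow> 'a::euclidean_space set measure" where
  "nu k = (THE M. sets M = sets (grass_space k) \<and> prob_space M \<and>
     (\<forall>T. orthogonal_transformation T \<longrightarrow> distr M M (\<lambda>L. T ` L) = M))"

definition local_par :: "'a::euclidean_space set \<Rightarrow> 'a set \<Rightarrow> real \<Rightarrow> 'a set \<Rightarrow> 'a set" where
  "local_par E P \<epsilon> \<omega> = {x \<in> E. 0 < infdist x P \<and> infdist x P \<le> \<epsilon> \<and>
       (1 / infdist x P) *\<^sub>R (x - closest_point P x) \<in> \<omega>}"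

text \<open>For a linear subspace E of dimension m+1 and a convex body P \<subseteq> E, the m-th area
  measure of P computed within E (total mass V_m(P)), via the local Steiner formula:
  the local parallel volume is eps * kappa_1 * Psi_m(P,omega) + O(eps^2), kappa_1 = 2.\<close>
definition area_codim1 :: "'a::euclidean_space set \<Rightarrow> 'a set \<Rightarrow> 'a measure" where
  "area_codim1 E P = measure_of (sphere 0 1 \<inter> E) (sets (restrict_space borel (sphere 0 1 \<inter> E)))
     (\<lambda>\<omega>. ennreal (Lim (at_right 0) (\<lambda>\<epsilon>. volE E (local_par E P \<epsilon> \<omega>) / (2 * \<epsilon>))))"

definition flags :: "nat \<Rightarrow> ('a::euclidean_space \<times> 'a set) set" where
  "flags k = {(u, E). E \<in> grass k \<and> u \<in> sphere 0 1 \<inter> E}"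

definition flag_measure :: "nat \<Rightarrow> 'a::euclidean_space set \<Rightarrow> ('a \<times> 'a set) measure" where
  "flag_measure j K = measure_of (flags (j + 1))
     (sets (restrict_space (borel \<Otimes>\<^sub>M grass_space (j + 1)) (flags (j + 1))))
     (\<lambda>A. \<integral>\<^sup>+ E. (\<integral>\<^sup>+ u. indicator A (u, E) \<partial>area_codim1 E (proj E ` K)) \<partial>nu (j + 1))"

definition grassmann_measure :: "nat \<Rightarrow> 'a::euclidean_space set \<Rightarrow> 'a set measure" where
  "grassmann_measure j K = distr (flag_measure j K) (grass_space j)
     (\<lambda>(u, L). {v. inner u v = 0} \<inter> L)"

end

theory Submission
  imports Defs
begin

text \<open>
  The theorem reduces to one subspace \<open>E\<close> of dimension \<open>n = j + 1\<close> at a time: every convex body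
  \<open>P \<subseteq> E\<close> satisfies \<open>\<phi> P = \<integral> klain \<phi> (u\<^sup>\<bottom> \<inter> E) \<Psi>\<^sub>j(P, du)\<close>, and integrating this for \<open>P = proj E ` K\<close>
  over the Grassmannian gives the claim.

  Both sides of the formula are even, \<open>j\<close>-homogeneous, translation invariant valuations of \<open>P\<close>,
  continuous under approximation from outside: on the right because the local parallel volume divided
  by its width decreases to the area measure and because the total mass is monotone. They agree on
  bodies in hyperplanes, so their difference \<open>\<theta>\<close> is a simple valuation. Cut the \<open>k\<close>-fold dilate of a path
  simplex along the integer grid into translates of products of path simplices. \<open>\<theta>\<close> vanishes on a
  parallelotope, where it grows like \<open>k\<^sup>n\<close> and like \<open>k\<^sup>j\<close>, and on a prism over a triangle by evenness, as
  a parallelogram consists of two reflected triangles. The remaining \<open>O(k\<^sup>n\<^sup>-\<^sup>2)\<close> pieces cannot account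
  for the value \<open>k\<^sup>n\<^sup>-\<^sup>1 \<theta>\<close> of the dilate unless \<open>\<theta> = 0\<close> on all simplices, hence on polytopes and on all
  bodies. The same dissection shows that in top degree such functionals are multiples of the volume,
  which yields the Klain function.
\<close>

section \<open>Preliminaries on Lebesgue measure and orthogonal projections\<close>

text \<open>One fact carries the metric part: a map that does not increase distances does not
  increase Lebesgue measure in the same dimension. Applied to an orthogonal map and its inverse, it
  gives rotation invariance. Applied to the pull-back of parallel shells along normals, a
  contraction because the normals of a convex body are monotone, it shows that outer layers of equal
  width are at least as large as inner ones. Hence local parallel volume over width is monotone, and
  the limit in \<open>area_codim1\<close> exists without a Steiner polynomial. The obstacle
  throughout is that \<open>klain\<close>, \<open>nu\<close>, \<open>area_codim1\<close> and
  \<open>flag_measure\<close> are given by a definite description, a limit or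
  \<open>measure_of\<close>, and carry no information until existence, uniqueness, additivity and
  measurable dependence on the subspace are proved. In top degree the dissection only relates a
  parallelotope to its own path simplex; different parallelotopes are related because a path simplex
  with its first two vertices swapped belongs to a sheared parallelotope.\<close>

lemma kappa_pos: "kappa n > 0"
  using unit_ball_vol_pos[of "real n"] by (simp add: kappa_def unit_ball_vol_def)

text \<open>Images of disjoint balls under a contraction may overlap, so the Vitali argument needs
  subadditivity over an arbitrary countable index set on the image side.\<close>

lemma emeasure_UN_countable_le_nn_integral:
  assumes C: "countable C" and A[measurable]: "\<And>i. i \<in> C \<Longrightarrow> A i \<in> sets M"
  shows "emeasure M (\<Union>i\<in>C. A i) \<le> (\<integral>\<^sup>+i. emeasure M (A i) \<partial>count_space C)"
proof -
  have [measurable]: "(\<Union>i\<in>C. A i) \<in> sets M" using C A by (intro sets.countable_UN') auto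
  have "emeasure M (\<Union>i\<in>C. A i) = (\<integral>\<^sup>+x. indicator (\<Union>i\<in>C. A i) x \<partial>M)" by simp
  also have "\<dots> \<le> (\<integral>\<^sup>+x. (\<integral>\<^sup>+i. indicator (A i) x \<partial>count_space C) \<partial>M)"
  proof (intro nn_integral_mono)
    fix x
    show "indicator (\<Union>i\<in>C. A i) x \<le> (\<integral>\<^sup>+i. indicator (A i) x \<partial>count_space C)"
    proof (cases "x \<in> (\<Union>i\<in>C. A i)")
      case True
      then obtain i where "i \<in> C" "x \<in> A i" by auto
      then show ?thesis using nn_integral_ge_point[of i C "\<lambda>i. indicator (A i) x :: ennreal"] True by simp
    qed simp
  qed
  also have "\<dots> = (\<integral>\<^sup>+i. (\<integral>\<^sup>+x. indicator (A i) x \<partial>M) \<partial>count_space C)"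
    using C A by (intro nn_integral_count_space_nn_integral) auto
  also have "\<dots> = (\<integral>\<^sup>+i. emeasure M (A i) \<partial>count_space C)"
    using A by (intro nn_integral_cong) simp
  finally show ?thesis .
qed

text \<open>By Vitali, almost all of \<open>S\<close> is covered by disjoint balls inside an open
  set of nearly the same measure, and a contraction maps the part of \<open>S\<close> in a ball into
  a ball of equal radius, hence of equal volume. The set \<open>T\<close> is a separate Borel set
  because the image of \<open>S\<close> need not be Borel.\<close>

lemma emeasure_Lipschitz_image_le:
  fixes f :: "'a::euclidean_space \<Rightarrow> 'a"
  assumes S[measurable]: "S \<in> sets borel" and T[measurable]: "T \<in> sets borel" and TS: "T \<subseteq> f ` S"
    and lip: "\<And>x y. x \<in> S \<Longrightarrow> y \<in> S \<Longrightarrow> dist (f x) (f y) \<le> dist x y"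
  shows "emeasure lborel T \<le> emeasure lborel S"
proof (rule ennreal_le_epsilon)
  fix e :: real assume "0 < e"
  from outer_regular_lborel[OF S \<open>0 < e\<close>]
  obtain U where U: "open U" "S \<subseteq> U" "emeasure lborel (U - S) < ennreal e" by auto
  have Ub[measurable]: "U \<in> sets borel" using U by auto
  have Ule: "emeasure lborel U \<le> emeasure lborel S + ennreal e"
  proof -
    have "emeasure lborel U = emeasure lborel (S \<union> (U - S))"
      using U(2) by (metis Un_Diff_cancel sup.absorb2)
    also have "\<dots> \<le> emeasure lborel S + emeasure lborel (U - S)"
      by (rule emeasure_subadditive) auto
    also have "\<dots> \<le> emeasure lborel S + ennreal e" using U(3) by (intro add_mono) auto
    finally show ?thesis .
  qed
  \<comment> \<open>Centres are taken in \<open>S\<close> because the distance bound on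
    \<open>f\<close> is only available there.\<close>
  define K where "K = {(x, r). x \<in> S \<and> 0 < r \<and> cball x r \<subseteq> U}"
  have "\<exists>i. i \<in> K \<and> x \<in> cball (fst i) (snd i) \<and> snd i < d" if x: "x \<in> S" and d: "0 < d" for x d
  proof -
    obtain r where r: "r > 0" "cball x r \<subseteq> U" using U x open_contains_cball by blast
    then have "(x, min r (d/2)) \<in> K" using x d by (auto simp: K_def)
    then show ?thesis using d r by (intro exI[of _ "(x, min r (d/2))"]) (auto simp: min_def)
  qed
  then obtain C where C: "countable C" "C \<subseteq> K"
     "pairwise (\<lambda>i j. disjnt (cball (fst i) (snd i)) (cball (fst j) (snd j))) C"
     and neg: "negligible (S - (\<Union>i \<in> C. cball (fst i) (snd i)))"
    using Vitali_covering_theorem_cballs[where K=K and S=S and a=fst and r=snd]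
    by (smt (verit) K_def case_prod_beta' mem_Collect_eq prod.collapse)
  let ?N = "S - (\<Union>i \<in> C. cball (fst i) (snd i))"
  \<comment> \<open>The points missed by the balls stay negligible under \<open>f\<close>; their
    image is enlarged to a Borel null set \<open>N\<close>.\<close>
  have "negligible (f ` ?N)"
  proof (rule negligible_locally_Lipschitz_image)
    show "\<exists>T B. open T \<and> x \<in> T \<and> (\<forall>y\<in>?N \<inter> T. norm (f y - f x) \<le> B * norm (y - x))" if "x \<in> ?N" for x
      using that lip by (intro exI[of _ UNIV] exI[of _ 1]) (auto simp: dist_norm)
  qed (use neg in auto)
  then obtain N where N: "N \<in> null_sets lborel" "f ` ?N \<subseteq> N"
    by (metis negligible_iff_null_sets null_sets_completion_iff2)
  have disj: "disjoint_family_on (\<lambda>i. cball (fst i) (snd i)) C"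
    using C(3) by (auto simp: disjoint_family_on_def pairwise_def disjnt_def)
  have sub: "T \<subseteq> N \<union> (\<Union>i\<in>C. cball (f (fst i)) (snd i))"
  proof
    fix y assume "y \<in> T"
    then obtain x where x: "x \<in> S" "y = f x" using TS by auto
    show "y \<in> N \<union> (\<Union>i\<in>C. cball (f (fst i)) (snd i))"
    proof (cases "x \<in> ?N")
      case True then show ?thesis using N x by auto
    next
      case False
      then obtain i where i: "i \<in> C" "x \<in> cball (fst i) (snd i)" using x by auto
      then have "fst i \<in> S" using C by (auto simp: K_def)
      then have "dist (f (fst i)) (f x) \<le> snd i" using lip[of "fst i" x] x i by auto
      then show ?thesis using i x by auto
    qed
  qed
  have "emeasure lborel T \<le> emeasure lborel (N \<union> (\<Union>i\<in>C. cball (f (fst i)) (snd i)))"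
    using sub N(1) C(1) by (intro emeasure_mono) (auto intro!: sets.Un sets.countable_UN')
  also have "\<dots> \<le> emeasure lborel N + emeasure lborel (\<Union>i\<in>C. cball (f (fst i)) (snd i))"
    using N(1) C(1) by (intro emeasure_subadditive) (auto intro!: sets.countable_UN')
  also have "\<dots> = emeasure lborel (\<Union>i\<in>C. cball (f (fst i)) (snd i))" using N by auto
  also have "\<dots> \<le> (\<integral>\<^sup>+i. emeasure lborel (cball (f (fst i)) (snd i)) \<partial>count_space C)"
    using C(1) by (intro emeasure_UN_countable_le_nn_integral) auto
  also have "\<dots> = (\<integral>\<^sup>+i. emeasure lborel (cball (fst i) (snd i)) \<partial>count_space C)"
    using C(2) by (intro nn_integral_cong) (auto simp: K_def emeasure_cball)
  also have "\<dots> = emeasure lborel (\<Union>i\<in>C. cball (fst i) (snd i))"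
    using C(1) disj by (subst emeasure_UN_countable) auto
  also have "\<dots> \<le> emeasure lborel U"
  proof (rule emeasure_mono)
    show "(\<Union>i\<in>C. cball (fst i) (snd i)) \<subseteq> U" using C(2) by (fastforce simp: K_def)
  qed simp
  also have "\<dots> \<le> emeasure lborel S + ennreal e" by (rule Ule)
  finally show "emeasure lborel T \<le> emeasure lborel S + ennreal e" .
qed

lemma borel_measurable_linear: "linear (f :: 'a::euclidean_space \<Rightarrow> 'b::euclidean_space) \<Longrightarrow> f \<in> borel_measurable borel"
  by (intro borel_measurable_continuous_onI linear_continuous_on linear_conv_bounded_linear[THEN iffD1])

text \<open>An orthogonal map and its inverse are both contractions, so the volume inequality holds
  in both directions.\<close>

lemma lborel_distr_orthogonal:
  fixes T :: "'a::euclidean_space \<Rightarrow> 'a"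
  assumes T: "orthogonal_transformation T"
  shows "distr lborel borel T = lborel"
proof (rule measure_eqI)
  have lin: "linear T" using T by (simp add: orthogonal_transformation_linear)
  have [measurable]: "T \<in> borel_measurable borel" using lin by (rule borel_measurable_linear)
  define T' where "T' = inv T"
  have T': "orthogonal_transformation T'" using T by (simp add: T'_def orthogonal_transformation_inv)
  have [measurable]: "T' \<in> borel_measurable borel"
    using T' by (intro borel_measurable_linear orthogonal_transformation_linear)
  have bij: "bij T" using T by (rule orthogonal_transformation_bij)
  have TT': "T (T' x) = x" "T' (T x) = x" for x
    using bij by (auto simp: T'_def bij_is_surj surj_f_inv_f bij_is_inj)
  have iso: "dist (T x) (T y) = dist x y" "dist (T' x) (T' y) = dist x y" for x y
    using T T' by (auto simp: orthogonal_transformation_isometry)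
  fix A assume "A \<in> sets (distr lborel borel T)"
  then have A[measurable]: "A \<in> sets borel" by simp
  have im: "A \<subseteq> T ` (T -` A)" "T -` A \<subseteq> T' ` A"
    using TT' by (auto simp: image_iff) (metis, metis)
  have 1: "emeasure lborel A \<le> emeasure lborel (T -` A)"
    by (rule emeasure_Lipschitz_image_le[where f=T]) (use im in \<open>auto simp: iso intro!: measurable_sets_borel[OF _ A]\<close>)
  have 2: "emeasure lborel (T -` A) \<le> emeasure lborel A"
    by (rule emeasure_Lipschitz_image_le[where f=T']) (use im in \<open>auto simp: iso intro!: measurable_sets_borel[OF _ A]\<close>)
  show "emeasure (distr lborel borel T) A = emeasure lborel A"
    using 1 2 by (subst emeasure_distr) auto
qed simp

text \<open>By Pythagoras an orthogonal residual makes \<open>y\<close> the nearest point. Later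
  computations of \<open>proj\<close> only check orthogonality and never minimise distances.\<close>

lemma proj_eqI:
  assumes L: "subspace L" and y: "y \<in> L" and o: "\<And>w. w \<in> L \<Longrightarrow> (x - y) \<bullet> w = 0"
  shows "proj L x = y"
  unfolding proj_def
proof (rule closest_point_unique[symmetric])
  show "\<forall>z\<in>L. dist x y \<le> dist x z"
  proof
    fix z assume "z \<in> L"
    then have "y - z \<in> L" using L y subspace_diff by blast
    then have "(x - y) \<bullet> (y - z) = 0" using o by blast
    then have "(norm (x - z))\<^sup>2 = (norm (x - y))\<^sup>2 + (norm (y - z))\<^sup>2"
      using norm_add_Pythagorean[of "x - y" "y - z"] by (auto simp: orthogonal_def)
    then have "(norm (x - y))\<^sup>2 \<le> (norm (x - z))\<^sup>2" by simp
    then show "dist x y \<le> dist x z" by (simp add: dist_norm)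
  qed
qed (use L y in \<open>auto simp: subspace_imp_convex closed_subspace\<close>)

lemma
  assumes L: "subspace L"
  shows proj_in: "proj L x \<in> L" and proj_orth: "w \<in> L \<Longrightarrow> (x - proj L x) \<bullet> w = 0"
proof -
  obtain y z where yz: "y \<in> span L" "\<And>w. w \<in> span L \<Longrightarrow> orthogonal z w" "x = y + z"
    using orthogonal_subspace_decomp_exists[of L x] by metis
  have [simp]: "span L = L" using L by (simp add: span_eq_iff)
  have "proj L x = y"
    by (rule proj_eqI[OF L]) (use yz L in \<open>auto simp: orthogonal_def\<close>)
  then show "proj L x \<in> L" "w \<in> L \<Longrightarrow> (x - proj L x) \<bullet> w = 0"
    using yz L by (auto simp: orthogonal_def)
qed

lemma proj_id: "subspace L \<Longrightarrow> x \<in> L \<Longrightarrow> proj L x = x"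
  by (rule proj_eqI) auto

lemma linear_proj: assumes L: "subspace L" shows "linear (proj L)"
proof (rule linearI)
  show "proj L (x + y) = proj L x + proj L y" for x y
    using proj_orth[OF L, of _ x] proj_orth[OF L, of _ y] proj_in[OF L]
    by (intro proj_eqI[OF L]) (auto intro: subspace_add[OF L] simp: inner_add_left algebra_simps inner_diff_left)
  show "proj L (c *\<^sub>R x) = c *\<^sub>R proj L x" for c x
    using proj_orth[OF L, of _ x] proj_in[OF L]
    by (intro proj_eqI[OF L]) (auto intro: subspace_scale[OF L] simp: inner_diff_left)
qed

lemma bounded_linear_proj: "subspace L \<Longrightarrow> bounded_linear (proj L)"
  using linear_proj linear_conv_bounded_linear by blast

lemma norm_proj_sq: "subspace L \<Longrightarrow> (norm x)\<^sup>2 = (norm (proj L x))\<^sup>2 + (norm (x - proj L x))\<^sup>2"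
  using norm_add_Pythagorean[of "proj L x" "x - proj L x"] proj_orth[of L "proj L x" x] proj_in[of L x]
  by (auto simp: orthogonal_def inner_commute)

lemma norm_proj_le: "subspace L \<Longrightarrow> norm (proj L x) \<le> norm x"
  using norm_proj_sq[of L x] by (metis le_add_same_cancel1 norm_ge_zero power2_le_imp_le zero_le_power2)

lemma norm_proj_compl_le: "subspace L \<Longrightarrow> norm (x - proj L x) \<le> norm x"
  using norm_proj_sq[of L x] by (metis le_add_same_cancel2 norm_ge_zero power2_le_imp_le zero_le_power2)

lemma dist_proj_le: "subspace L \<Longrightarrow> dist (proj L x) (proj L y) \<le> dist x y"
  using norm_proj_le[of L "x - y"] linear_diff[OF linear_proj, of L x y] by (simp add: dist_norm)

lemma continuous_on_proj: "subspace L \<Longrightarrow> continuous_on S (proj L)"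
  by (simp add: bounded_linear_proj linear_continuous_on)

lemma borel_measurable_proj[measurable]: "subspace L \<Longrightarrow> proj L \<in> borel_measurable borel"
  by (simp add: borel_measurable_linear linear_proj)

lemma proj_orthogonal_transformation:
  assumes T: "orthogonal_transformation T" and L: "subspace L"
  shows "proj (T ` L) (T x) = T (proj L x)"
proof (rule proj_eqI)
  have lin: "linear T" using T by (simp add: orthogonal_transformation_linear)
  show "subspace (T ` L)" using lin L linear_subspace_image by blast
  show "T (proj L x) \<in> T ` L" using proj_in[OF L] by auto
  show "(T x - T (proj L x)) \<bullet> w = 0" if "w \<in> T ` L" for w
    using that T proj_orth[OF L, of _ x] by (auto simp: linear_diff[OF lin, symmetric] orthogonal_transformation_def)
qed

lemma dim_orthogonal_image:
  "orthogonal_transformation T \<Longrightarrow> dim (T ` L) = dim L" for T :: "'a::euclidean_space \<Rightarrow> 'a"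
  by (meson dim_image_eq inj_on_subset orthogonal_transformation_inj orthogonal_transformation_linear subset_UNIV)

lemma grass_orthogonal_image:
  fixes T :: "'a::euclidean_space \<Rightarrow> 'a"
  assumes "orthogonal_transformation T" "L \<in> grass k" shows "T ` L \<in> grass k"
  using assms by (auto simp: grass_def dim_orthogonal_image orthogonal_transformation_linear linear_subspace_image)

lemma orthogonal_transformation_extend:
  fixes h :: "'a::euclidean_space \<Rightarrow> 'a"
  assumes B: "pairwise orthogonal B" "\<And>b. b \<in> B \<Longrightarrow> norm b = 1" and h: "bij_betw h Basis B"
  defines "T \<equiv> \<lambda>x. \<Sum>i\<in>Basis. (x \<bullet> i) *\<^sub>R h i"
  shows "orthogonal_transformation T" "\<And>i. i \<in> Basis \<Longrightarrow> T i = h i"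
proof -
  show Ti: "T i = h i" if "i \<in> Basis" for i
  proof -
    have "T i = (\<Sum>j\<in>Basis. if j = i then h i else 0)"
      unfolding T_def using that by (intro sum.cong) (auto simp: inner_Basis)
    then show ?thesis using that by simp
  qed
  have lin: "linear T" unfolding T_def
    by (auto intro!: linearI simp: inner_add_left scaleR_left_distrib sum.distrib scaleR_sum_right)
  have hh: "h i \<bullet> h j = (if i = j then 1 else 0)" if "i \<in> Basis" "j \<in> Basis" for i j
  proof (cases "i = j")
    case True
    have "norm (h i) = 1" using that(1) bij_betwE[OF h] B(2) by blast
    then show ?thesis using True by (simp add: norm_eq_1)
  next
    case False
    have "h i \<noteq> h j" using False that h by (auto simp: bij_betw_def inj_on_def)
    then have "orthogonal (h i) (h j)" using that bij_betwE[OF h] B(1) by (auto simp: pairwise_def)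
    then show ?thesis using False by (simp add: orthogonal_def)
  qed
  have "T x \<bullet> T y = x \<bullet> y" for x y
  proof -
    have "T x \<bullet> T y = (\<Sum>i\<in>Basis. \<Sum>j\<in>Basis. (x \<bullet> i) * (y \<bullet> j) * (h i \<bullet> h j))"
      unfolding T_def inner_sum_left unfolding inner_sum_right by (simp only: inner_scaleR_left inner_scaleR_right mult.assoc mult.left_commute)
    also have "\<dots> = (\<Sum>i\<in>Basis. \<Sum>j\<in>Basis. if j = i then (x \<bullet> i) * (y \<bullet> i) else 0)"
    proof (intro sum.cong refl)
      fix i j :: 'a assume ij: "i \<in> Basis" "j \<in> Basis"
      show "(x \<bullet> i) * (y \<bullet> j) * (h i \<bullet> h j) = (if j = i then (x \<bullet> i) * (y \<bullet> i) else 0)"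
        unfolding hh[OF ij] by simp
    qed
    also have "\<dots> = (\<Sum>i\<in>Basis. (x \<bullet> i) * (y \<bullet> i))" by simp
    also have "\<dots> = x \<bullet> y" by (rule euclidean_inner[symmetric])
    finally show ?thesis .
  qed
  then show "orthogonal_transformation T" using lin by (auto simp: orthogonal_transformation_def)
qed

lemma orthonormal_basis_extend:
  fixes B :: "'a::euclidean_space set"
  assumes B: "pairwise orthogonal B" "\<And>b. b \<in> B \<Longrightarrow> norm b = 1"
  obtains C where "B \<inter> C = {}" "pairwise orthogonal (B \<union> C)" "\<And>b. b \<in> B \<union> C \<Longrightarrow> norm b = 1"
    "span (B \<union> C) = UNIV" "finite (B \<union> C)" "card (B \<union> C) = DIM('a)"
proof -
  obtain C0 where C0: "C0 \<inter> insert 0 B = {}" "pairwise orthogonal (B \<union> C0)" "span (B \<union> C0) = span (B \<union> UNIV)"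
    using orthogonal_extension_strong[of B UNIV] B(1) by metis
  define C where "C = (\<lambda>x. x /\<^sub>R norm x) ` C0"
  have nz: "x \<noteq> 0" if "x \<in> C0" for x using that C0 by auto
  have o: "b \<bullet> c = 0" if "b \<in> B" "c \<in> C0" for b c
    using that C0 by (auto simp: pairwise_def orthogonal_def) (metis IntI empty_iff insertI2 UnI1 UnI2)
  have oc: "b \<bullet> c = 0" if "b \<in> C0" "c \<in> C0" "b \<noteq> c" for b c
    using that C0 by (auto simp: pairwise_def orthogonal_def)
  have pw: "pairwise orthogonal (B \<union> C)"
    unfolding pairwise_def orthogonal_def C_def
    using B(1) o oc by (auto simp: pairwise_def orthogonal_def inner_commute) (metis)+
  have n1: "norm b = 1" if "b \<in> B \<union> C" for b using that B(2) nz by (auto simp: C_def)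
  have "B \<inter> C = {}"
  proof (rule ccontr)
    assume "B \<inter> C \<noteq> {}"
    then obtain b c where "b \<in> B" "c \<in> C0" "b = c /\<^sub>R norm c" by (auto simp: C_def)
    then have "b \<bullet> b = 0" using o[of b c] by (metis inner_scaleR_right mult_zero_right)
    then show False using B(2) \<open>b \<in> B\<close> by fastforce
  qed
  moreover have "span (B \<union> C) = UNIV"
  proof -
    have "B \<union> C0 \<subseteq> span (B \<union> C)"
    proof safe
      fix x assume "x \<in> C0"
      then have "norm x *\<^sub>R (x /\<^sub>R norm x) \<in> span (B \<union> C)" by (intro span_scale span_base) (auto simp: C_def)
      then show "x \<in> span (B \<union> C)" using nz[OF \<open>x \<in> C0\<close>] by simp
    qed (auto intro: span_base)
    then have "span (B \<union> C0) \<subseteq> span (B \<union> C)" by (rule span_minimal) auto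
    then show ?thesis using C0 by auto
  qed
  moreover have ind: "independent (B \<union> C)"
    using pw n1 by (intro pairwise_orthogonal_independent) fastforce+
  moreover have "finite (B \<union> C)" using ind by (rule independent_imp_finite)
  moreover have "card (B \<union> C) = DIM('a)"
    by (metis calculation(2) dim_UNIV dim_eq_card ind dim_span)
  ultimately show ?thesis using that pw n1 by blast
qed

text \<open>A rotation carries \<open>Basis\<close> to \<open>B\<close>, and \<open>lborel\<close>
  is rotation invariant; what remains is to reindex the product measure along the bijection.\<close>

lemma lborel_eq_orthonormal:
  fixes B :: "'a::euclidean_space set"
  assumes B: "pairwise orthogonal B" "\<And>b. b \<in> B \<Longrightarrow> norm b = 1" "finite B" "card B = DIM('a)"
  shows "lborel = distr (\<Pi>\<^sub>M b\<in>B. lborel) borel (\<lambda>f. \<Sum>b\<in>B. f b *\<^sub>R b)"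
proof -
  obtain h where h: "bij_betw h (Basis::'a set) B"
    using B(3,4) finite_same_card_bij[OF finite_Basis] by metis
  define T where "T = (\<lambda>x. \<Sum>i\<in>Basis. (x \<bullet> i) *\<^sub>R h i)"
  have T: "orthogonal_transformation T"
    using orthogonal_transformation_extend(1)[OF B(1,2) h] by (simp add: T_def)
  have Ti: "i \<in> Basis \<Longrightarrow> T i = h i" for i
    unfolding T_def using orthogonal_transformation_extend(2)[OF B(1,2) h] by simp
  have [measurable]: "T \<in> borel_measurable borel"
    using T by (intro borel_measurable_linear orthogonal_transformation_linear)
  have lin: "linear T" using T by (simp add: orthogonal_transformation_linear)
  let ?t = "the_inv_into Basis h"
  have t: "bij_betw ?t B Basis" by (rule bij_betw_the_inv_into[OF h])
  have hB: "i \<in> Basis \<Longrightarrow> ?t (h i) = i" for i using h by (simp add: bij_betw_def the_inv_into_f_f)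
  have "lborel = distr lborel borel T" using lborel_distr_orthogonal[OF T] by simp
  also have "\<dots> = distr (distr (\<Pi>\<^sub>M b\<in>Basis. lborel) borel (\<lambda>f. \<Sum>b\<in>Basis. f b *\<^sub>R b)) borel T"
    by (subst lborel_eq) simp
  also have "\<dots> = distr (\<Pi>\<^sub>M b\<in>Basis. lborel) borel (\<lambda>f. T (\<Sum>b\<in>Basis. f b *\<^sub>R b))"
    by (subst distr_distr) (auto simp: comp_def)
  also have "\<dots> = distr (\<Pi>\<^sub>M b\<in>Basis. lborel) borel (\<lambda>f. \<Sum>b\<in>B. (\<lambda>c\<in>B. f (?t c)) b *\<^sub>R b)"
  proof (rule distr_cong)
    fix f :: "'a \<Rightarrow> real"
    have "T (\<Sum>b\<in>Basis. f b *\<^sub>R b) = (\<Sum>b\<in>Basis. f b *\<^sub>R h b)"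
      unfolding linear_sum[OF lin] linear_scale[OF lin] by (intro sum.cong) (simp_all add: Ti)
    also have "\<dots> = (\<Sum>b\<in>B. (\<lambda>c\<in>B. f (?t c)) b *\<^sub>R b)"
      using bij_betwE[OF h] hB by (subst sum.reindex_bij_betw[OF h, symmetric]) (auto intro!: sum.cong)
    finally show "T (\<Sum>b\<in>Basis. f b *\<^sub>R b) = (\<Sum>b\<in>B. (\<lambda>c\<in>B. f (?t c)) b *\<^sub>R b)" .
  qed auto
  also have "\<dots> = distr (distr (\<Pi>\<^sub>M b\<in>Basis. lborel) (\<Pi>\<^sub>M b\<in>B. lborel) (\<lambda>f. \<lambda>c\<in>B. f (?t c))) borel (\<lambda>f. \<Sum>b\<in>B. f b *\<^sub>R b)"
    by (subst distr_distr) (use t in \<open>auto simp: comp_def bij_betw_def intro!: measurable_restrict measurable_component_singleton\<close>)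
  also have "distr (\<Pi>\<^sub>M b\<in>Basis. lborel) (\<Pi>\<^sub>M b\<in>B. lborel) (\<lambda>f. \<lambda>c\<in>B. f (?t c)) = (\<Pi>\<^sub>M b\<in>B. (lborel :: real measure))"
  proof -
    interpret product_sigma_finite "\<lambda>_::'a. lborel :: real measure" ..
    have "distr (\<Pi>\<^sub>M b\<in>Basis. lborel) (\<Pi>\<^sub>M b\<in>B. lborel) (\<lambda>f. \<lambda>c\<in>B. f (?t c)) = PiM B (\<lambda>_. lborel::real measure)"
    proof (rule PiM_eqI)
      fix A :: "'a \<Rightarrow> real set" assume A: "\<And>i. i \<in> B \<Longrightarrow> A i \<in> sets lborel"
      have "(\<lambda>f. \<lambda>c\<in>B. f (?t c)) -` Pi\<^sub>E B A \<inter> space (\<Pi>\<^sub>M b\<in>Basis. lborel) = Pi\<^sub>E Basis (\<lambda>i. A (h i))"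
      proof (intro set_eqI iffI)
        fix f assume f: "f \<in> (\<lambda>f. \<lambda>c\<in>B. f (?t c)) -` Pi\<^sub>E B A \<inter> space (\<Pi>\<^sub>M b\<in>Basis. lborel)"
        have "f i \<in> A (h i)" if "i \<in> Basis" for i
        proof -
          have "h i \<in> B" using that h by (auto simp: bij_betw_def)
          then have "(\<lambda>c\<in>B. f (?t c)) (h i) \<in> A (h i)" using f by auto
          then show ?thesis using hB that \<open>h i \<in> B\<close> by auto
        qed
        then show "f \<in> Pi\<^sub>E Basis (\<lambda>i. A (h i))" using f by (auto simp: space_PiM PiE_def)
      next
        fix f assume f: "f \<in> Pi\<^sub>E Basis (\<lambda>i. A (h i))"
        have "f (?t c) \<in> A c" if "c \<in> B" for c
        proof -
          have "?t c \<in> Basis" using t that by (auto simp: bij_betw_def)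
          then have "f (?t c) \<in> A (h (?t c))" using f by auto
          then show ?thesis using f_the_inv_into_f_bij_betw[OF h] that by simp
        qed
        then show "f \<in> (\<lambda>f. \<lambda>c\<in>B. f (?t c)) -` Pi\<^sub>E B A \<inter> space (\<Pi>\<^sub>M b\<in>Basis. lborel)"
          using f by (simp add: space_PiM PiE_def Pi_def)
      qed
      then show "emeasure (distr (\<Pi>\<^sub>M b\<in>Basis. lborel) (\<Pi>\<^sub>M b\<in>B. lborel) (\<lambda>f. \<lambda>c\<in>B. f (?t c))) (Pi\<^sub>E B A) = (\<Prod>i\<in>B. emeasure lborel (A i))"
      proof (subst emeasure_distr)
        show "(\<lambda>f. \<lambda>c\<in>B. f (?t c)) \<in> (\<Pi>\<^sub>M b\<in>Basis. lborel) \<rightarrow>\<^sub>M (\<Pi>\<^sub>M b\<in>B. lborel)"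
          using bij_betwE[OF t] by (intro measurable_restrict measurable_component_singleton) auto
        show "Pi\<^sub>E B A \<in> sets (\<Pi>\<^sub>M b\<in>B. lborel)" using A B(3) by (intro sets_PiM_I_finite) auto
        have "(\<Prod>i\<in>Basis. emeasure lborel (A (h i))) = (\<Prod>i\<in>B. emeasure lborel (A i))"
          by (rule prod.reindex_bij_betw[OF h])
        moreover assume "(\<lambda>f. \<lambda>c\<in>B. f (?t c)) -` Pi\<^sub>E B A \<inter> space (\<Pi>\<^sub>M b\<in>Basis. lborel) = Pi\<^sub>E Basis (\<lambda>i. A (h i))"
        ultimately show "emeasure (\<Pi>\<^sub>M b\<in>Basis. lborel) ((\<lambda>f. \<lambda>c\<in>B. f (?t c)) -` Pi\<^sub>E B A \<inter> space (\<Pi>\<^sub>M b\<in>Basis. lborel)) = (\<Prod>i\<in>B. emeasure lborel (A i))"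
          using A bij_betwE[OF h] by (simp add: emeasure_PiM)
      qed
    qed (use B in auto)
    then show ?thesis .
  qed
  finally show ?thesis .
qed

section \<open>Lebesgue measure on a subspace\<close>

lemma orthonormal_basis_subspace_obtain:
  assumes "subspace (E::'a::euclidean_space set)"
  obtains B where "B \<subseteq> E" "pairwise orthogonal B" "\<And>b. b \<in> B \<Longrightarrow> norm b = 1" "finite B" "card B = dim E" "span B = E"
  using orthonormal_basis_subspace[OF assms] by (metis independent_imp_finite)

definition cyl :: "'a::euclidean_space set \<Rightarrow> 'a set \<Rightarrow> 'a set" where
  "cyl E A = {x. proj E x \<in> A \<and> norm (x - proj E x) \<le> 1}"

text \<open>The cylinder over \<open>A\<close> in \<open>volE\<close> turns \<open>dim E\<close>-dimensional volume into a measure on the ambient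
  space that is concentrated on \<open>E\<close>.\<close>
definition lamE :: "'a::euclidean_space set \<Rightarrow> 'a measure" where
  "lamE E = distr (density lborel (\<lambda>x. indicator (cyl E UNIV) x / ennreal (kappa (DIM('a) - dim E)))) borel (proj E)"

lemma sets_lamE[simp, measurable_cong]: "sets (lamE E) = sets borel" and space_lamE[simp]: "space (lamE E) = UNIV"
  by (auto simp: lamE_def)

lemma cyl_borel[measurable]:
  assumes E: "subspace E" and A: "A \<in> sets borel"
  shows "cyl E A \<in> sets borel"
proof -
  note [measurable] = borel_measurable_proj[OF E] A
  have "cyl E A = {x \<in> space borel. proj E x \<in> A \<and> norm (x - proj E x) \<le> 1}" by (auto simp: cyl_def)
  also have "\<dots> \<in> sets borel" by measurable
  finally show ?thesis .
qed

lemma emeasure_lamE: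
  assumes E: "subspace E" and A: "A \<in> sets borel"
  shows "emeasure (lamE E) A = emeasure lborel (cyl E A) / ennreal (kappa (DIM('a) - dim (E::'a::euclidean_space set)))"
proof -
  note [measurable] = borel_measurable_proj[OF E] A cyl_borel[OF E]
  have pA: "proj E -` A \<in> sets borel" by (rule measurable_sets_borel[OF _ A]) simp
  have "emeasure (lamE E) A = (\<integral>\<^sup>+x. indicator (cyl E UNIV) x / ennreal (kappa (DIM('a) - dim E)) * indicator (proj E -` A) x \<partial>lborel)"
    unfolding lamE_def using pA by (subst emeasure_distr) (auto simp: emeasure_density)
  also have "\<dots> = (\<integral>\<^sup>+x. indicator (cyl E A) x / ennreal (kappa (DIM('a) - dim E)) \<partial>lborel)"
    by (intro nn_integral_cong) (auto simp: indicator_def cyl_def)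
  also have "\<dots> = emeasure lborel (cyl E A) / ennreal (kappa (DIM('a) - dim E))"
    using assms by (subst nn_integral_divide) auto
  finally show ?thesis .
qed

lemma volE_eq_measure_lamE:
  assumes "subspace E" "A \<in> sets borel"
  shows "volE E A = measure (lamE E) A"
  unfolding measure_def emeasure_lamE[OF assms] volE_def cyl_def
  using kappa_pos by (simp add: divide_ennreal_def enn2real_mult inverse_ennreal divide_inverse less_imp_le)

lemma cyl_subset_cball:
  assumes E: "subspace E" and A: "A \<subseteq> cball 0 r"
  shows "cyl E A \<subseteq> cball 0 (r + 1)"
proof
  fix x assume "x \<in> cyl E A"
  then have "norm (proj E x) \<le> r" "norm (x - proj E x) \<le> 1" using A by (auto simp: cyl_def)
  then show "x \<in> cball 0 (r + 1)" using norm_triangle_ineq[of "proj E x" "x - proj E x"] by simp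
qed

lemma emeasure_lamE_bounded:
  assumes E: "subspace (E::'a::euclidean_space set)" and A: "A \<in> sets borel" "bounded A"
  shows "emeasure (lamE E) A < \<infinity>"
proof -
  obtain r where "A \<subseteq> cball 0 r" using A(2) unfolding bounded_iff by force
  then have "emeasure lborel (cyl E A) \<le> emeasure lborel (cball (0::'a) (r+1))"
    using cyl_subset_cball[OF E] by (intro emeasure_mono) auto
  also have "\<dots> < \<infinity>" by (rule emeasure_lborel_cball_finite)
  finally show ?thesis using kappa_pos[of "DIM('a) - dim E"] E A
    by (auto simp: emeasure_lamE ennreal_divide_eq_top_iff less_top[symmetric])
qed

lemma sigma_finite_lamE: assumes E: "subspace E" shows "sigma_finite_measure (lamE E)"
proof
  show "\<exists>A. countable A \<and> A \<subseteq> sets (lamE E) \<and> \<Union> A = space (lamE E) \<and> (\<forall>a\<in>A. emeasure (lamE E) a \<noteq> \<infinity>)"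
  proof (intro exI conjI)
    show "countable (range (\<lambda>n. cball 0 (real n)))" by simp
    show "\<Union> (range (\<lambda>n. cball 0 (real n))) = space (lamE E)"
      by (auto simp: real_arch_simple)
    show "\<forall>a\<in>range (\<lambda>n. cball 0 (real n)). emeasure (lamE E) a \<noteq> \<infinity>"
      using emeasure_lamE_bounded[OF E] by (metis bounded_cball cball_trivial closed_cball borel_closed imageE less_irrefl)
  qed auto
qed

lemma lamE_not_in: assumes E: "subspace E" shows "AE x in lamE E. x \<in> E"
proof -
  have "E \<in> sets borel" using E by (simp add: borel_closed closed_subspace)
  then have "{x \<in> space borel. x \<in> E} \<in> sets borel" by simp
  then show ?thesis unfolding lamE_def using borel_measurable_proj[OF E] proj_in[OF E] by (subst AE_distr_iff) auto
qed

text \<open>Complete \<open>B\<close> by \<open>C\<close> to an orthonormal basis of the whole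
  space. In these coordinates the cylinder is a product of the set with the unit ball in the
  \<open>C\<close>-coordinates, and the volume of that ball cancels the normalising
  \<open>kappa\<close>.\<close>

lemma lamE_eq:
  assumes B: "pairwise orthogonal B" "\<And>b. b \<in> B \<Longrightarrow> norm b = 1" "finite B" "span B = E"
  shows "lamE E = distr (\<Pi>\<^sub>M b\<in>B. lborel) borel (\<lambda>f. \<Sum>b\<in>B. f b *\<^sub>R (b::'a::euclidean_space))"
proof (rule measure_eqI)
  have E[measurable]: "subspace E" using B(4) by auto
  have indB: "independent B" using B(1,2) by (intro pairwise_orthogonal_independent) fastforce+
  have cB: "card B = dim E" using indB B(4) by (metis dim_eq_card dim_span)
  obtain C where C: "B \<inter> C = {}" "pairwise orthogonal (B \<union> C)" "\<And>b. b \<in> B \<union> C \<Longrightarrow> norm b = 1"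
    "span (B \<union> C) = UNIV" "finite (B \<union> C)" "card (B \<union> C) = DIM('a)"
    using orthonormal_basis_extend[OF B(1,2)] by metis
  have fC: "finite C" using C(5) by auto
  have cC: "card C = DIM('a) - dim E" using C(1,6) fC B(3) cB by (simp add: card_Un_disjoint)
  interpret product_sigma_finite "\<lambda>_::'a. lborel :: real measure" ..
  interpret BC: pair_sigma_finite "\<Pi>\<^sub>M b\<in>B. (lborel::real measure)" "\<Pi>\<^sub>M b\<in>C. (lborel::real measure)"
    by (intro pair_sigma_finite.intro sigma_finite B fC)
  let ?s = "\<lambda>B f. \<Sum>b\<in>B. f b *\<^sub>R (b::'a)"
  fix A assume "A \<in> sets (lamE E)" then have A[measurable]: "A \<in> sets borel" by simp
  have pr: "proj E (?s B f + ?s C g) = ?s B f" for f g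
  proof (rule proj_eqI[OF E])
    show "?s B f \<in> E" unfolding B(4)[symmetric] by (intro span_sum span_scale span_base)
    fix w assume "w \<in> E"
    have "orthogonal c w" if "c \<in> C" for c
    proof (rule orthogonal_to_span)
      show "w \<in> span B" using \<open>w \<in> E\<close> B(4) by simp
      fix b assume "b \<in> B"
      then have "c \<noteq> b" "b \<in> B \<union> C" "c \<in> B \<union> C" using C(1) that by auto
      then show "orthogonal c b" using C(2) by (metis pairwiseD)
    qed
    then show "(?s B f + ?s C g - ?s B f) \<bullet> w = 0" by (simp add: inner_sum_left orthogonal_def)
  qed
  have nC: "norm (?s C g) = sqrt (\<Sum>b\<in>C. (g b)\<^sup>2)" for g
  proof -
    have "(norm (?s C g))\<^sup>2 = (\<Sum>b\<in>C. (norm (g b *\<^sub>R b))\<^sup>2)"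
      using C(2) by (intro norm_sum_Pythagorean[OF fC]) (auto simp: pairwise_def orthogonal_def)
    also have "\<dots> = (\<Sum>b\<in>C. (g b)\<^sup>2)" using C(3) by (intro sum.cong) auto
    finally show ?thesis using real_sqrt_unique[of "norm (?s C g)"] norm_ge_zero[of "?s C g"] by metis
  qed
  have "emeasure lborel (cyl E A) = emeasure (distr (\<Pi>\<^sub>M b\<in>B \<union> C. lborel) borel (?s (B \<union> C))) (cyl E A)"
    using lborel_eq_orthonormal[of "B \<union> C"] C by simp
  also have "(\<Pi>\<^sub>M b\<in>B \<union> C. (lborel::real measure)) = distr ((\<Pi>\<^sub>M b\<in>B. lborel) \<Otimes>\<^sub>M (\<Pi>\<^sub>M b\<in>C. lborel)) (\<Pi>\<^sub>M b\<in>B \<union> C. lborel) (merge B C)"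
    by (rule distr_merge[symmetric]) (use B C fC in auto)
  also have "distr \<dots> borel (?s (B \<union> C)) = distr ((\<Pi>\<^sub>M b\<in>B. lborel) \<Otimes>\<^sub>M (\<Pi>\<^sub>M b\<in>C. lborel)) borel (\<lambda>x. ?s (B \<union> C) (merge B C x))"
    by (subst distr_distr) (auto simp: comp_def)
  also have "\<dots> = distr ((\<Pi>\<^sub>M b\<in>B. lborel) \<Otimes>\<^sub>M (\<Pi>\<^sub>M b\<in>C. lborel)) borel (\<lambda>(f, g). ?s B f + ?s C g)"
  proof (intro distr_cong refl)
    fix x :: "('a \<Rightarrow> real) \<times> ('a \<Rightarrow> real)"
    have "?s (B \<union> C) (merge B C x) = ?s B (merge B C x) + ?s C (merge B C x)"
      using B(3) fC C(1) by (rule sum.union_disjoint)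
    also have "?s B (merge B C x) = ?s B (fst x)" by (intro sum.cong) (auto simp: merge_def split: prod.split)
    also have "?s C (merge B C x) = ?s C (snd x)" using C(1) by (intro sum.cong) (auto simp: merge_def split: prod.split)
    finally show "?s (B \<union> C) (merge B C x) = (case x of (f, g) \<Rightarrow> ?s B f + ?s C g)" by (simp add: case_prod_beta)
  qed
  also have "emeasure \<dots> (cyl E A) = emeasure ((\<Pi>\<^sub>M b\<in>B. lborel) \<Otimes>\<^sub>M (\<Pi>\<^sub>M b\<in>C. lborel))
      ((?s B -` A \<inter> space (\<Pi>\<^sub>M b\<in>B. lborel)) \<times> {g \<in> space (\<Pi>\<^sub>M b\<in>C. lborel). sqrt (\<Sum>b\<in>C. (g b)\<^sup>2) \<le> 1})"
    by (subst emeasure_distr) (auto simp: cyl_def pr nC space_pair_measure intro!: arg_cong2[where f=emeasure])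
  also have "\<dots> = emeasure (\<Pi>\<^sub>M b\<in>B. lborel) (?s B -` A \<inter> space (\<Pi>\<^sub>M b\<in>B. lborel))
     * emeasure (\<Pi>\<^sub>M b\<in>C. lborel) {g \<in> space (\<Pi>\<^sub>M b\<in>C. lborel). sqrt (\<Sum>b\<in>C. (g b)\<^sup>2) \<le> 1}"
    by (rule BC.M2.emeasure_pair_measure_Times) auto
  also have "emeasure (\<Pi>\<^sub>M b\<in>C. lborel) {g \<in> space (\<Pi>\<^sub>M b\<in>C. lborel). sqrt (\<Sum>b\<in>C. (g b)\<^sup>2) \<le> 1} = ennreal (kappa (card C))"
  proof -
    have "{g \<in> space (\<Pi>\<^sub>M b\<in>C. (lborel::real measure)). sqrt (\<Sum>b\<in>C. (g b)\<^sup>2) \<le> 1}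
        = {g. sqrt (\<Sum>b\<in>C. (g b)\<^sup>2) \<le> 1} \<inter> space (\<Pi>\<^sub>M b\<in>C. lborel)" by auto
    then show ?thesis using emeasure_cball_aux[OF fC, of 1] by (simp add: kappa_def unit_ball_vol_def)
  qed
  finally have "emeasure (lamE E) A = emeasure (\<Pi>\<^sub>M b\<in>B. lborel) (?s B -` A \<inter> space (\<Pi>\<^sub>M b\<in>B. lborel)) * ennreal (kappa (card C)) / ennreal (kappa (card C))"
    using emeasure_lamE[OF E A] by (simp only: cC)
  also have "\<dots> = emeasure (\<Pi>\<^sub>M b\<in>B. lborel) (?s B -` A \<inter> space (\<Pi>\<^sub>M b\<in>B. lborel))"
    using kappa_pos[of "card C"] by (simp add: ennreal_mult_divide_eq)
  also have "\<dots> = emeasure (distr (\<Pi>\<^sub>M b\<in>B. lborel) borel (?s B)) A"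
    by (subst emeasure_distr) auto
  finally show "emeasure (lamE E) A = emeasure (distr (\<Pi>\<^sub>M b\<in>B. lborel) borel (?s B)) A" .
qed simp

text \<open>Fubini in the direction \<open>u\<close>. It makes the shell around a body of lower
  dimension computable as a product.\<close>

lemma lamE_insert:
  assumes L: "subspace L" and u: "norm u = 1" "\<And>x. x \<in> L \<Longrightarrow> u \<bullet> x = 0"
  shows "lamE (span (insert u L)) = distr (lamE L \<Otimes>\<^sub>M lborel) borel (\<lambda>(y, t). y + t *\<^sub>R (u::'a::euclidean_space))"
proof -
  obtain B where B: "B \<subseteq> L" "pairwise orthogonal B" "\<And>b. b \<in> B \<Longrightarrow> norm b = 1" "finite B" "card B = dim L" "span B = L"
    using orthonormal_basis_subspace_obtain[OF L] by metis
  have uB: "u \<notin> B" using u B(1) by (metis norm_eq_1 subsetD zero_neq_one)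
  let ?s = "\<lambda>B f. \<Sum>b\<in>B. f b *\<^sub>R (b::'a)"
  interpret product_sigma_finite "\<lambda>_::'a. lborel :: real measure" ..
  have sp: "span (insert u B) = span (insert u L)"
    unfolding span_insert using B(6) L by (metis span_span)
  have "lamE (span (insert u L)) = distr (\<Pi>\<^sub>M b\<in>insert u B. lborel) borel (?s (insert u B))"
  proof (rule lamE_eq)
    show "pairwise orthogonal (insert u B)"
      using B(1,2) u(2) by (auto simp: pairwise_insert orthogonal_def inner_commute)
  qed (use B u sp in auto)
  also have "\<dots> = distr (distr (\<Pi>\<^sub>M b\<in>B. lborel) borel (?s B) \<Otimes>\<^sub>M lborel) borel (\<lambda>(y, t). y + t *\<^sub>R u)" (is "?l = ?r")
  proof (rule measure_eqI)
    fix A assume "A \<in> sets ?l" then have A[measurable]: "A \<in> sets borel" by simp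
    have m1[measurable]: "?s B \<in> (\<Pi>\<^sub>M b\<in>B. (lborel::real measure)) \<rightarrow>\<^sub>M borel" by measurable
    interpret sB: sigma_finite_measure "distr (\<Pi>\<^sub>M b\<in>B. lborel) borel (?s B)"
      using sigma_finite_lamE[OF L] lamE_eq[OF B(2,3,4,6)] by simp
    have "emeasure ?l A = (\<integral>\<^sup>+f. indicator A (?s (insert u B) f) \<partial>(\<Pi>\<^sub>M b\<in>insert u B. lborel))"
      by (subst nn_integral_indicator[symmetric], simp, subst nn_integral_distr)
         (use B(4) in \<open>auto intro!: borel_measurable_sum measurable_component_singleton borel_measurable_scaleR\<close>)
    also have "\<dots> = (\<integral>\<^sup>+f. (\<integral>\<^sup>+t. indicator A (?s (insert u B) (f(u := t))) \<partial>lborel) \<partial>(\<Pi>\<^sub>M b\<in>B. lborel))"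
      using B(4) uB by (intro product_nn_integral_insert) auto
    also have "\<dots> = (\<integral>\<^sup>+f. (\<integral>\<^sup>+t. indicator A (?s B f + t *\<^sub>R u) \<partial>lborel) \<partial>(\<Pi>\<^sub>M b\<in>B. lborel))"
    proof (intro nn_integral_cong)
      fix f :: "'a \<Rightarrow> real" and t :: real
      have "?s (insert u B) (f(u := t)) = t *\<^sub>R u + ?s B (f(u := t))" using B(4) uB by simp
      also have "?s B (f(u := t)) = ?s B f" using uB by (intro sum.cong) auto
      finally show "indicator A (?s (insert u B) (f(u := t))) = (indicator A (?s B f + t *\<^sub>R u) :: ennreal)" by (simp add: add.commute)
    qed
    also have "\<dots> = (\<integral>\<^sup>+y. (\<integral>\<^sup>+t. indicator A (y + t *\<^sub>R u) \<partial>lborel) \<partial>distr (\<Pi>\<^sub>M b\<in>B. lborel) borel (?s B))"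
      by (subst nn_integral_distr) auto
    also have "\<dots> = (\<integral>\<^sup>+x. indicator A (fst x + snd x *\<^sub>R u) \<partial>(distr (\<Pi>\<^sub>M b\<in>B. lborel) borel (?s B) \<Otimes>\<^sub>M lborel))"
      by (subst lborel.nn_integral_fst[symmetric]) (auto simp: case_prod_beta)
    also have "\<dots> = emeasure ?r A"
      by (subst nn_integral_indicator[symmetric], simp, subst nn_integral_distr) (auto simp: case_prod_beta)
    finally show "emeasure ?l A = emeasure ?r A" .
  qed simp
  also have "distr (\<Pi>\<^sub>M b\<in>B. lborel) borel (?s B) = lamE L" using lamE_eq[OF B(2,3,4,6)] by simp
  finally show ?thesis .
qed

lemma cyl_orthogonal:
  assumes T: "orthogonal_transformation T" and E: "subspace E"
  shows "T -` cyl (T ` E) A = cyl E (T -` A)"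
  using proj_orthogonal_transformation[OF T E] orthogonal_transformation_norm[OF T]
    linear_diff[OF orthogonal_transformation_linear[OF T], symmetric]
  by (auto simp: cyl_def)

lemma emeasure_lamE_orthogonal:
  fixes T :: "'a::euclidean_space \<Rightarrow> 'a"
  assumes T: "orthogonal_transformation T" and E: "subspace E" and A: "A \<in> sets borel"
  shows "emeasure (lamE (T ` E)) A = emeasure (lamE E) (T -` A)"
proof -
  have [measurable]: "T \<in> borel_measurable borel" using T by (intro borel_measurable_linear orthogonal_transformation_linear)
  have TE: "subspace (T ` E)" using T E by (simp add: linear_subspace_image orthogonal_transformation_linear)
  have TA: "T -` A \<in> sets borel" by (rule measurable_sets_borel[OF _ A]) simp
  have "emeasure lborel (cyl (T ` E) A) = emeasure (distr lborel borel T) (cyl (T ` E) A)"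
    using lborel_distr_orthogonal[OF T] by simp
  also have "\<dots> = emeasure lborel (cyl E (T -` A))"
    using TE A by (subst emeasure_distr) (auto simp: cyl_orthogonal[OF T E])
  finally show ?thesis using emeasure_lamE[OF TE A] emeasure_lamE[OF E TA] by (simp add: dim_orthogonal_image[OF T])
qed

lemma emeasure_lamE_translation:
  assumes E: "subspace E" and t: "t \<in> E" and A: "A \<in> sets borel"
  shows "emeasure (lamE E) ((\<lambda>x. t + x) -` A) = emeasure (lamE E) A"
proof -
  have TA: "(\<lambda>x. t + x) -` A \<in> sets borel" by (rule measurable_sets_borel[OF _ A]) simp
  have "(\<lambda>x. t + x) -` cyl E A = cyl E ((\<lambda>x. t + x) -` A)"
    using proj_id[OF E t] by (auto simp: cyl_def linear_add[OF linear_proj[OF E]])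
  moreover have "emeasure lborel (cyl E A) = emeasure (distr lborel borel (\<lambda>x. t + x)) (cyl E A)"
    by (simp add: lborel_distr_plus)
  moreover have "\<dots> = emeasure lborel ((\<lambda>x. t + x) -` cyl E A)" using E A by (subst emeasure_distr) auto
  ultimately show ?thesis using E A TA by (simp add: emeasure_lamE)
qed

text \<open>Reduces questions about a subspace to coordinate subspaces: the scaling law of
  \<open>lamE\<close> and the transitivity of rotations on the Grassmannian both use it.\<close>

lemma subspace_as_orthogonal_image:
  fixes E :: "'a::euclidean_space set"
  assumes E: "subspace E"
  obtains T :: "'a \<Rightarrow> 'a" and D where "orthogonal_transformation T" "D \<subseteq> Basis" "E = T ` span D" "card D = dim E"
proof -
  obtain B where B: "B \<subseteq> E" "pairwise orthogonal B" "\<And>b. b \<in> B \<Longrightarrow> norm b = 1" "finite B" "card B = dim E" "span B = E"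
    using orthonormal_basis_subspace_obtain[OF E] by metis
  obtain C where C: "B \<inter> C = {}" "pairwise orthogonal (B \<union> C)" "\<And>b. b \<in> B \<union> C \<Longrightarrow> norm b = 1"
    "span (B \<union> C) = UNIV" "finite (B \<union> C)" "card (B \<union> C) = DIM('a)"
    using orthonormal_basis_extend[OF B(2,3)] by metis
  obtain h where h: "bij_betw h (Basis::'a set) (B \<union> C)"
    using C(5,6) finite_same_card_bij[OF finite_Basis] by metis
  define T where "T = (\<lambda>x::'a. \<Sum>i\<in>Basis. (x \<bullet> i) *\<^sub>R h i)"
  have T: "orthogonal_transformation T"
    using orthogonal_transformation_extend(1)[OF C(2,3) h] by (simp add: T_def)
  have Ti: "i \<in> Basis \<Longrightarrow> T i = h i" for i
    unfolding T_def using orthogonal_transformation_extend(2)[OF C(2,3) h] by simp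
  define D where "D = {i\<in>Basis. h i \<in> B}"
  have hD: "h ` D = B" using h by (fastforce simp: D_def bij_betw_def)
  then have TD: "T ` D = B" using Ti by (force simp: D_def image_iff)
  have "inj_on h D" using h by (auto simp: D_def bij_betw_def inj_on_def)
  then have "card D = dim E" using hD B(5) card_image by metis
  moreover have "E = T ` span D"
    using TD B(6) linear_span_image[OF orthogonal_transformation_linear[OF T]] by metis
  moreover have "D \<subseteq> Basis" by (auto simp: D_def)
  ultimately show ?thesis using that[OF T, of D] by metis
qed

text \<open>A dilation of the whole space would also scale the cross-section of the cylinder. So
  \<open>E\<close> is rotated to a coordinate subspace \<open>span D\<close>, and only the
  coordinates in \<open>D\<close> are stretched: this map \<open>M\<close> has determinant
  \<open>s ^ dim E\<close> and leaves the cross-section alone.\<close>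

lemma emeasure_lamE_scale:
  assumes E: "subspace (E :: 'a::euclidean_space set)" and s: "s > 0" and A: "A \<in> sets borel"
  shows "emeasure (lamE E) A = ennreal (s ^ dim E) * emeasure (lamE E) ((\<lambda>x. s *\<^sub>R x) -` A)"
proof -
  obtain T :: "'a \<Rightarrow> 'a" and D where TD: "orthogonal_transformation T" "D \<subseteq> Basis" "E = T ` span D" "card D = dim E"
    using subspace_as_orthogonal_image[OF E] by metis
  have D: "subspace (span D)" by simp
  have finD: "finite D" by (rule finite_subset[OF TD(2) finite_Basis])
  have [measurable]: "T \<in> borel_measurable borel" using TD by (intro borel_measurable_linear orthogonal_transformation_linear)
  define A' where "A' = T -` A"
  have A': "A' \<in> sets borel" unfolding A'_def by (rule measurable_sets_borel[OF _ A]) simp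
  have sA': "(\<lambda>x. s *\<^sub>R x) -` A' \<in> sets borel" by (rule measurable_sets_borel[OF _ A']) simp
  have sA: "(\<lambda>x. s *\<^sub>R x) -` A \<in> sets borel" by (rule measurable_sets_borel[OF _ A]) simp
  have eq: "T -` ((\<lambda>x. s *\<^sub>R x) -` A) = (\<lambda>x. s *\<^sub>R x) -` A'"
    using TD(1) by (auto simp: A'_def orthogonal_transformation_scaleR)
  have pD: "proj (span D) x = (\<Sum>j\<in>D. (x \<bullet> j) *\<^sub>R j)" for x :: 'a
  proof (rule proj_eqI[OF D])
    show "(\<Sum>j\<in>D. (x \<bullet> j) *\<^sub>R j) \<in> span D" by (intro span_sum span_scale span_base)
    fix w assume "w \<in> span D"
    have "orthogonal (x - (\<Sum>j\<in>D. (x \<bullet> j) *\<^sub>R j)) w"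
    proof (rule orthogonal_to_span[OF \<open>w \<in> span D\<close>])
      fix i assume i: "i \<in> D"
      have "(\<Sum>j\<in>D. (x \<bullet> j) *\<^sub>R j) \<bullet> i = (\<Sum>j\<in>D. if j = i then x \<bullet> i else 0)"
        unfolding inner_sum_left using i TD(2) by (intro sum.cong) (auto simp: inner_Basis subset_iff)
      also have "\<dots> = x \<bullet> i" using i finD by simp
      finally show "orthogonal (x - (\<Sum>j\<in>D. (x \<bullet> j) *\<^sub>R j)) i" by (simp add: orthogonal_def inner_diff_left)
    qed
    then show "(x - (\<Sum>j\<in>D. (x \<bullet> j) *\<^sub>R j)) \<bullet> w = 0" by (simp add: orthogonal_def)
  qed
  define c where "c = (\<lambda>j::'a. if j \<in> D then s else 1)"
  define M where "M x = 0 + (\<Sum>j\<in>Basis. (c j * (x \<bullet> j)) *\<^sub>R j)" for x :: 'a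
  have M: "M x = x + (s - 1) *\<^sub>R proj (span D) x" for x
  proof -
    have "M x = (\<Sum>j\<in>Basis. (x \<bullet> j) *\<^sub>R j + (if j \<in> D then ((s - 1) * (x \<bullet> j)) *\<^sub>R j else 0))"
      unfolding M_def by (auto simp: c_def algebra_simps intro!: sum.cong)
    also have "\<dots> = x + (\<Sum>j\<in>Basis. (if j \<in> D then ((s - 1) * (x \<bullet> j)) *\<^sub>R j else 0))"
      by (simp add: sum.distrib euclidean_representation)
    also have "(\<Sum>j\<in>Basis. (if j \<in> D then ((s - 1) * (x \<bullet> j)) *\<^sub>R j else 0)) = (\<Sum>j\<in>D. ((s - 1) * (x \<bullet> j)) *\<^sub>R j)"
      using TD(2) by (subst sum.inter_restrict[symmetric]) (auto simp: Int_absorb1)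
    finally show ?thesis by (simp add: pD scaleR_sum_right)
  qed
  have pM: "proj (span D) (M x) = s *\<^sub>R proj (span D) x" for x
  proof -
    have "proj (span D) (M x) = proj (span D) x + (s - 1) *\<^sub>R proj (span D) x"
      unfolding M linear_add[OF linear_proj[OF D]] linear_scale[OF linear_proj[OF D]] proj_id[OF D proj_in[OF D]] ..
    then show ?thesis by (simp add: algebra_simps)
  qed
  have rM: "M x - proj (span D) (M x) = x - proj (span D) x" for x
    unfolding pM by (simp add: M algebra_simps)
  have [measurable]: "M \<in> borel_measurable borel" unfolding M_def by measurable
  have prc: "(\<Prod>j\<in>Basis. \<bar>c j\<bar>) = s ^ dim E"
  proof -
    have "(\<Prod>j\<in>Basis. \<bar>c j\<bar>) = (\<Prod>j\<in>Basis. if j \<in> D then s else 1)" using s by (intro prod.cong) (auto simp: c_def)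
    also have "\<dots> = (\<Prod>j\<in>D. s)" using TD(2) by (subst prod.inter_restrict[symmetric]) (auto simp: Int_absorb1)
    finally show ?thesis using TD(4) by simp
  qed
  have "lborel = density (distr lborel borel M) (\<lambda>_. (\<Prod>j\<in>Basis. \<bar>c j\<bar>))"
    unfolding M_def by (rule lborel_affine_euclidean) (use s in \<open>auto simp: c_def\<close>)
  then have "emeasure lborel (cyl (span D) A') = emeasure (density (distr lborel borel M) (\<lambda>_. ennreal (s ^ dim E))) (cyl (span D) A')"
    using prc by simp
  also have "\<dots> = ennreal (s ^ dim E) * emeasure lborel (M -` cyl (span D) A')"
    using A' D by (subst emeasure_density) (auto simp: nn_integral_cmult emeasure_distr)
  also have "M -` cyl (span D) A' = cyl (span D) ((\<lambda>x. s *\<^sub>R x) -` A')"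
    by (auto simp: cyl_def pM rM) (metis pM rM)+
  finally have "emeasure (lamE (span D)) A' = ennreal (s ^ dim E) * emeasure (lamE (span D)) ((\<lambda>x. s *\<^sub>R x) -` A')"
    using A' sA' D by (simp add: emeasure_lamE ennreal_times_divide)
  then show ?thesis
    using emeasure_lamE_orthogonal[OF TD(1) D A] emeasure_lamE_orthogonal[OF TD(1) D sA] TD(3) eq by (simp add: A'_def)
qed

lemma emeasure_lamE_pos:
  assumes E: "subspace E" and A: "A \<in> sets borel" and c: "c \<in> E" and r: "r > 0" and sub: "ball c r \<inter> E \<subseteq> A"
  shows "emeasure (lamE E) A > 0"
proof -
  \<comment> \<open>The radius is capped at 1 because the cylinder has a cross-section of radius
    1.\<close>
  have "ball c (min r 1) \<subseteq> cyl E A"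
  proof
    fix x assume x: "x \<in> ball c (min r 1)"
    have d: "proj E x - c = proj E (x - c)" using proj_id[OF E c] linear_diff[OF linear_proj[OF E]] by simp
    have "norm (proj E x - c) \<le> norm (x - c)" unfolding d by (rule norm_proj_le[OF E])
    moreover have "norm (x - proj E x) \<le> norm (x - c)"
      using norm_proj_compl_le[OF E, of "x - c"] by (simp add: d[symmetric])
    ultimately show "x \<in> cyl E A"
      using x sub proj_in[OF E, of x] by (auto simp: cyl_def dist_norm norm_minus_commute intro!: subsetD[OF sub])
  qed
  then have "emeasure lborel (ball c (min r 1)) \<le> emeasure lborel (cyl E A)"
    using E A by (intro emeasure_mono) auto
  moreover have "emeasure lborel (ball c (min r 1)) > 0" using r by (simp add: emeasure_ball)
  ultimately show ?thesis using kappa_pos E A by (auto simp: emeasure_lamE ennreal_zero_less_divide)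
qed

text \<open>Since \<open>a\<close> lies in \<open>E\<close>, projecting to \<open>E\<close> does not
  change \<open>a \<bullet> x\<close>, so the whole cylinder lies in a hyperplane of the ambient
  space.\<close>

lemma emeasure_lamE_hyperplane:
  assumes E: "subspace E" and A: "A \<in> sets borel" and a: "a \<in> E" "a \<noteq> 0" and sub: "A \<subseteq> {x. a \<bullet> x = b}"
  shows "emeasure (lamE E) A = 0"
proof -
  have "a \<bullet> proj E x = a \<bullet> x" for x
    using proj_orth[OF E a(1), of x] by (simp add: inner_diff_left inner_diff_right inner_commute)
  then have "cyl E A \<subseteq> {x. a \<bullet> x = b}" using sub by (auto simp: cyl_def)
  moreover have "{x. a \<bullet> x = b} \<in> null_sets lborel"
    using negligible_hyperplane[of a b] a(2) by (simp add: negligible_iff_null_sets null_sets_completion_iff closed_hyperplane)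
  ultimately have "cyl E A \<in> null_sets lborel"
    by (rule null_sets_subset[rotated -1]) (use E A in auto)
  then have "emeasure lborel (cyl E A) = 0" by auto
  then show ?thesis using E A by (simp add: emeasure_lamE)
qed

section \<open>Simple valuations on path simplices\<close>

lemma sum_PiE_insert:
  assumes "i \<notin> I"
  shows "(\<Sum>m\<in>PiE (insert i I) A. f m) = (\<Sum>m\<in>PiE I A. \<Sum>q\<in>A i. (f (m(i := q)) :: 'b::comm_monoid_add))"
proof -
  have "(\<Sum>m\<in>PiE (insert i I) A. f m) = (\<Sum>(q, m)\<in>A i \<times> PiE I A. f (m(i := q)))"
    unfolding PiE_insert_eq using inj_combinator[OF assms, of A]
    by (subst sum.reindex) (auto simp: case_prod_beta)
  also have "\<dots> = (\<Sum>q\<in>A i. \<Sum>m\<in>PiE I A. f (m(i := q)))" by (simp add: sum.cartesian_product)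
  also have "\<dots> = (\<Sum>m\<in>PiE I A. \<Sum>q\<in>A i. f (m(i := q)))" by (rule sum.swap)
  finally show ?thesis .
qed

text \<open>The dual basis of \<open>a\<close>, realised by vectors of \<open>E\<close> through the
  inner product, so that coordinates become the linear functionals \<open>w i \<bullet> x\<close>
  and coordinate inequalities become half-spaces.\<close>

lemma dual_family_exists:
  fixes a :: "nat \<Rightarrow> 'a::euclidean_space"
  assumes sp: "span (a ` {..<n}) = E" and dim: "dim E = n"
  obtains w where "\<And>i. i < n \<Longrightarrow> w i \<in> E" "\<And>i l. i < n \<Longrightarrow> l < n \<Longrightarrow> w i \<bullet> a l = (if i = l then 1 else 0)"
    "\<And>x. x \<in> E \<Longrightarrow> x = (\<Sum>i<n. (w i \<bullet> x) *\<^sub>R a i)"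
proof -
  have E: "subspace E" using sp by auto
  have cge: "n \<le> card (a ` {..<n})" using dim sp by (metis dim_le_card' dim_span finite_imageI finite_lessThan)
  then have card: "card (a ` {..<n}) = n" using card_image_le[of "{..<n}" a] by simp
  then have inj: "inj_on a {..<n}" by (simp add: eq_card_imp_inj_on)
  have ind: "independent (a ` {..<n})"
    using card dim sp by (intro card_le_dim_spanning[of _ E]) (auto intro: span_base)
  have aE: "a i \<in> E" if "i < n" for i using that sp by (metis imageI lessThan_iff span_base)
  have "\<exists>g. linear g \<and> (\<forall>l<n. g (a l) = (if i = l then 1 else (0::real)))" for i
  proof -
    obtain g where "linear g" "\<forall>x\<in>a ` {..<n}. g x = (if i < n \<and> x = a i then 1 else (0::real))"
      using linear_independent_extend[OF ind, of "\<lambda>x. if i < n \<and> x = a i then 1 else (0::real)"] by auto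
    then show ?thesis using inj by (intro exI[of _ g]) (auto simp: inj_on_def)
  qed
  then obtain g where g: "\<And>i. linear (g i)" "\<And>i l. l < n \<Longrightarrow> g i (a l) = (if i = l then 1 else (0::real))" by metis
  \<comment> \<open>The Riesz vector of the coordinate functional, projected to \<open>E\<close>;
    the projection does not change its values on \<open>E\<close>.\<close>
  define w where "w i = proj E (\<Sum>b\<in>Basis. g i b *\<^sub>R b)" for i
  have wx: "w i \<bullet> x = g i x" if "x \<in> E" for i x
  proof -
    have "w i \<bullet> x = (\<Sum>b\<in>Basis. g i b *\<^sub>R b) \<bullet> x"
      using proj_orth[OF E that, of "\<Sum>b\<in>Basis. g i b *\<^sub>R b"] by (simp add: w_def inner_diff_left)
    also have "\<dots> = (\<Sum>b\<in>Basis. (x \<bullet> b) * g i b)"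
      unfolding inner_sum_left by (intro sum.cong) (auto simp: inner_commute)
    also have "\<dots> = g i (\<Sum>b\<in>Basis. (x \<bullet> b) *\<^sub>R b)" by (simp add: linear_sum[OF g(1)] linear_scale[OF g(1)])
    finally show ?thesis by (simp add: euclidean_representation)
  qed
  have dual: "w i \<bullet> a l = (if i = l then 1 else 0)" if "i < n" "l < n" for i l
    using wx[OF aE] g that by simp
  have "x = (\<Sum>i<n. (w i \<bullet> x) *\<^sub>R a i)" if "x \<in> E" for x
  proof -
    have "x \<in> span (a ` {..<n})" using that sp by simp
    then obtain c where "x = (\<Sum>v\<in>a ` {..<n}. c v *\<^sub>R v)" by (auto simp: span_finite)
    then have x: "x = (\<Sum>i<n. c (a i) *\<^sub>R a i)" using inj by (simp add: sum.reindex)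
    have "w i \<bullet> x = c (a i)" if i: "i < n" for i
    proof -
      have "w i \<bullet> x = (\<Sum>l<n. if l = i then c (a i) else 0)"
        unfolding x inner_sum_right using i dual by (intro sum.cong) auto
      then show ?thesis using i by simp
    qed
    then show ?thesis using x by simp
  qed
  moreover have "w i \<in> E" for i by (simp add: w_def proj_in[OF E])
  ultimately show ?thesis using that dual by blast
qed

text \<open>Homogeneity is only assumed for integer dilations: these are the ones that dissections compute.\<close>
locale simple_val =
  fixes E :: "'a::euclidean_space set" and \<theta> :: "'a set \<Rightarrow> real" and r :: nat
  assumes subE: "subspace E"
    and empty: "\<theta> {} = 0"
    and cut0: "\<And>K a b. conv_body K \<Longrightarrow> K \<subseteq> E \<Longrightarrow> a \<in> E \<Longrightarrow> a \<noteq> 0 \<Longrightarrow>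
          \<theta> K = \<theta> (K \<inter> {x. a \<bullet> x \<le> b}) + \<theta> (K \<inter> {x. b \<le> a \<bullet> x})"
    and flat0: "\<And>K a b. conv_body K \<Longrightarrow> K \<subseteq> E \<Longrightarrow> a \<in> E \<Longrightarrow> a \<noteq> 0 \<Longrightarrow> K \<subseteq> {x. a \<bullet> x = b} \<Longrightarrow> \<theta> K = 0"
    and trans0: "\<And>K t. conv_body K \<Longrightarrow> K \<subseteq> E \<Longrightarrow> t \<in> E \<Longrightarrow> \<theta> ((\<lambda>x. t + x) ` K) = \<theta> K"
    and hom0: "\<And>K k. conv_body K \<Longrightarrow> K \<subseteq> E \<Longrightarrow> \<theta> ((\<lambda>x. real (Suc k) *\<^sub>R x) ` K) = real (Suc k) ^ r * \<theta> K"
begin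

definition body :: "'a set \<Rightarrow> bool" where "body K \<longleftrightarrow> compact K \<and> convex K \<and> K \<subseteq> E"

lemma body_cases: "body K \<Longrightarrow> K = {} \<or> conv_body K \<and> K \<subseteq> E"
  by (auto simp: body_def conv_body_def)

lemma cut: "body K \<Longrightarrow> a \<in> E \<Longrightarrow> a \<noteq> 0 \<Longrightarrow> \<theta> K = \<theta> (K \<inter> {x. a \<bullet> x \<le> b}) + \<theta> (K \<inter> {x. b \<le> a \<bullet> x})"
  using cut0 body_cases empty by (metis Int_empty_left add.right_neutral)

lemma flat: "body K \<Longrightarrow> a \<in> E \<Longrightarrow> a \<noteq> 0 \<Longrightarrow> K \<subseteq> {x. a \<bullet> x = b} \<Longrightarrow> \<theta> K = 0"
  using flat0 body_cases empty by metis

lemma trans: "body K \<Longrightarrow> t \<in> E \<Longrightarrow> \<theta> ((\<lambda>x. t + x) ` K) = \<theta> K"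
  using trans0 body_cases empty by (metis image_empty)

lemma hom: "body K \<Longrightarrow> k > 0 \<Longrightarrow> \<theta> ((\<lambda>x. real k *\<^sub>R x) ` K) = real k ^ r * \<theta> K"
  using hom0 body_cases empty by (metis gr0_implies_Suc image_empty mult_zero_right)

lemma body_Int: "body K \<Longrightarrow> closed C \<Longrightarrow> convex C \<Longrightarrow> body (K \<inter> C)"
  by (auto simp: body_def compact_Int_closed convex_Int)

lemma body_halfspaces:
  "body K \<Longrightarrow> body (K \<inter> {x. a \<bullet> x \<le> b})" "body K \<Longrightarrow> body (K \<inter> {x. b \<le> a \<bullet> x})"
  by (auto intro!: body_Int closed_halfspace_le convex_halfspace_le closed_halfspace_ge convex_halfspace_ge)

lemma slab_sum:
  assumes "body K" "a \<in> E" "a \<noteq> 0" "K \<subseteq> {x. 0 \<le> a \<bullet> x \<and> a \<bullet> x \<le> real k}"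
  shows "\<theta> K = (\<Sum>q<k. \<theta> (K \<inter> {x. real q \<le> a \<bullet> x \<and> a \<bullet> x \<le> real q + 1}))"
  using assms
proof (induction k arbitrary: K)
  case 0
  have "K \<subseteq> {x. a \<bullet> x = 0}" using 0(4) by (auto intro: antisym)
  then show ?case using flat[OF 0(1-3)] by simp
next
  case (Suc k)
  have "\<theta> K = \<theta> (K \<inter> {x. a \<bullet> x \<le> real k}) + \<theta> (K \<inter> {x. real k \<le> a \<bullet> x})"
    by (rule cut[OF Suc.prems(1-3)])
  also have "\<theta> (K \<inter> {x. a \<bullet> x \<le> real k}) = (\<Sum>q<k. \<theta> ((K \<inter> {x. a \<bullet> x \<le> real k}) \<inter> {x. real q \<le> a \<bullet> x \<and> a \<bullet> x \<le> real q + 1}))"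
    using Suc.prems by (intro Suc.IH body_halfspaces) auto
  also have "\<dots> = (\<Sum>q<k. \<theta> (K \<inter> {x. real q \<le> a \<bullet> x \<and> a \<bullet> x \<le> real q + 1}))"
  proof (intro sum.cong refl arg_cong[where f=\<theta>] set_eqI)
    fix q x assume "q \<in> {..<k}"
    then have "real q + 1 \<le> real k" by (simp add: nat_less_real_le)
    then show "x \<in> (K \<inter> {x. a \<bullet> x \<le> real k}) \<inter> {x. real q \<le> a \<bullet> x \<and> a \<bullet> x \<le> real q + 1}
       \<longleftrightarrow> x \<in> K \<inter> {x. real q \<le> a \<bullet> x \<and> a \<bullet> x \<le> real q + 1}" by auto
  qed
  also have "K \<inter> {x. real k \<le> a \<bullet> x} = K \<inter> {x. real k \<le> a \<bullet> x \<and> a \<bullet> x \<le> real k + 1}"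
    using Suc.prems(4) by auto
  finally show ?case by simp
qed

lemma closed_cell: "closed {x. \<forall>i<p. l i \<le> w i \<bullet> x \<and> w i \<bullet> (x::'a) \<le> (u i::real)}"
  and convex_cell: "convex {x. \<forall>i<p. l i \<le> w i \<bullet> x \<and> w i \<bullet> (x::'a) \<le> (u i::real)}" for p :: nat
proof -
  have eq: "{x. \<forall>i<p. l i \<le> w i \<bullet> x \<and> w i \<bullet> x \<le> u i} = (\<Inter>i\<in>{..<p}. {x. l i \<le> w i \<bullet> x} \<inter> {x. w i \<bullet> x \<le> u i})" by auto
  show "closed {x. \<forall>i<p. l i \<le> w i \<bullet> x \<and> w i \<bullet> x \<le> u i}" "convex {x. \<forall>i<p. l i \<le> w i \<bullet> x \<and> w i \<bullet> x \<le> u i}"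
    unfolding eq by (auto intro!: closed_INT closed_Int closed_halfspace_le closed_halfspace_ge convex_INT convex_Int convex_halfspace_le convex_halfspace_ge)
qed

lemma grid_sum:
  fixes w :: "nat \<Rightarrow> 'a"
  assumes "body K" "\<And>i. i < p \<Longrightarrow> w i \<in> E \<and> w i \<noteq> 0"
    "\<And>i x. i < p \<Longrightarrow> x \<in> K \<Longrightarrow> 0 \<le> w i \<bullet> x \<and> w i \<bullet> x \<le> real k"
  shows "\<theta> K = (\<Sum>m\<in>{..<p} \<rightarrow>\<^sub>E {..<k}. \<theta> (K \<inter> {x. \<forall>i<p. real (m i) \<le> w i \<bullet> x \<and> w i \<bullet> x \<le> real (m i) + 1}))"
  using assms
proof (induction p)
  case 0
  then show ?case by simp
next
  case (Suc p)
  let ?C = "\<lambda>p m. {x. \<forall>i<p. real (m i) \<le> w i \<bullet> x \<and> w i \<bullet> x \<le> real (m i :: nat) + 1}"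
  have "\<theta> K = (\<Sum>m\<in>{..<p} \<rightarrow>\<^sub>E {..<k}. \<theta> (K \<inter> ?C p m))" using Suc by auto
  also have "\<dots> = (\<Sum>m\<in>{..<p} \<rightarrow>\<^sub>E {..<k}. \<Sum>q<k. \<theta> (K \<inter> ?C (Suc p) (m(p := q))))"
  proof (intro sum.cong refl)
    fix m
    have b: "body (K \<inter> ?C p m)" by (rule body_Int[OF Suc.prems(1) closed_cell convex_cell])
    have "\<theta> (K \<inter> ?C p m) = (\<Sum>q<k. \<theta> ((K \<inter> ?C p m) \<inter> {x. real q \<le> w p \<bullet> x \<and> w p \<bullet> x \<le> real q + 1}))"
      using Suc.prems b by (intro slab_sum) auto
    also have "\<dots> = (\<Sum>q<k. \<theta> (K \<inter> ?C (Suc p) (m(p := q))))"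
      by (intro sum.cong refl arg_cong[where f=\<theta>]) (auto simp: less_Suc_eq)
    finally show "\<theta> (K \<inter> ?C p m) = (\<Sum>q<k. \<theta> (K \<inter> ?C (Suc p) (m(p := q))))" .
  qed
  also have "\<dots> = (\<Sum>m\<in>{..<Suc p} \<rightarrow>\<^sub>E {..<k}. \<theta> (K \<inter> ?C (Suc p) m))"
    using sum_PiE_insert[of p "{..<p}" "\<lambda>m. \<theta> (K \<inter> ?C (Suc p) m)" "\<lambda>_. {..<k}"] by (simp add: lessThan_Suc)
  finally show ?case .
qed

end

text \<open>\<open>S = {..<n - 1}\<close> gives a path simplex, \<open>S = {}\<close> the parallelotope dual to \<open>w\<close>, and the sets in
  between give products of path simplices.\<close>
definition orthoscheme :: "'a::euclidean_space set \<Rightarrow> nat \<Rightarrow> (nat \<Rightarrow> 'a) \<Rightarrow> nat set \<Rightarrow> 'a set" where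
  "orthoscheme E n w S = {x \<in> E. (\<forall>i<n. 0 \<le> w i \<bullet> x \<and> w i \<bullet> x \<le> 1) \<and> (\<forall>i\<in>S. w (Suc i) \<bullet> x \<le> w i \<bullet> x)}"

text \<open>Coordinates on \<open>E\<close>: the \<open>a i\<close> form a basis and the
  \<open>w i\<close> its dual basis, so \<open>n\<close> is the dimension of \<open>E\<close>. Grid
  cells are indexed by the integer parts of the coordinates \<open>w i \<bullet> x\<close>.\<close>

locale simple_val_dual = simple_val E \<theta> r for E :: "'a::euclidean_space set" and \<theta> r +
  fixes n :: nat and a w :: "nat \<Rightarrow> 'a"
  assumes n: "n \<ge> 1"
    and wE: "\<And>i. i < n \<Longrightarrow> w i \<in> E" and aE: "\<And>i. i < n \<Longrightarrow> a i \<in> E"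
    and dual: "\<And>i l. i < n \<Longrightarrow> l < n \<Longrightarrow> w i \<bullet> a l = (if i = l then 1 else 0)"
    and expand: "\<And>x. x \<in> E \<Longrightarrow> x = (\<Sum>i<n. (w i \<bullet> x) *\<^sub>R a i)"
begin

abbreviation "Z \<equiv> orthoscheme E n w"

lemma w_nz: "i < n \<Longrightarrow> w i \<noteq> 0" using dual[of i i] by auto

lemma w_sum: "i < n \<Longrightarrow> w i \<bullet> (\<Sum>l<n. c l *\<^sub>R a l) = c i"
proof -
  assume i: "i < n"
  have "w i \<bullet> (\<Sum>l<n. c l *\<^sub>R a l) = (\<Sum>l<n. if l = i then c i else 0)"
    unfolding inner_sum_right using i dual by (intro sum.cong) auto
  then show ?thesis using i by simp
qed

lemma sum_in_E: "(\<Sum>l<n. c l *\<^sub>R a l) \<in> E"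
  using aE by (intro subspace_sum[OF subE] subspace_scale[OF subE]) auto

lemma body_Z: assumes "S \<subseteq> {..<n - 1}" shows "body (Z S)"
proof -
  have eq: "Z S = E \<inter> (\<Inter>i\<in>{..<n}. {x. 0 \<le> w i \<bullet> x} \<inter> {x. w i \<bullet> x \<le> 1}) \<inter> (\<Inter>i\<in>S. {x. 0 \<le> (w i - w (Suc i)) \<bullet> x})"
    by (auto simp: orthoscheme_def inner_diff_left)
  have "closed (Z S)" "convex (Z S)" unfolding eq
    using closed_subspace[OF subE] subspace_imp_convex[OF subE]
    by (auto intro!: closed_INT closed_Int closed_halfspace_le closed_halfspace_ge convex_INT convex_Int
        convex_halfspace_le convex_halfspace_ge)
  moreover have "bounded (Z S)"
    unfolding bounded_iff
  proof (intro exI ballI)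
    fix x assume x: "x \<in> Z S"
    then have "x = (\<Sum>i<n. (w i \<bullet> x) *\<^sub>R a i)" using expand by (auto simp: orthoscheme_def)
    then have "norm x \<le> (\<Sum>i<n. norm ((w i \<bullet> x) *\<^sub>R a i))" by (metis norm_sum)
    also have "\<dots> \<le> (\<Sum>i<n. norm (a i))"
      using x by (intro sum_mono) (auto simp: orthoscheme_def intro!: mult_left_le_one_le)
    finally show "norm x \<le> (\<Sum>i<n. norm (a i))" .
  qed
  ultimately show ?thesis by (auto simp: body_def compact_eq_bounded_closed orthoscheme_def)
qed

lemma scaled_Z: "(\<lambda>x. real (Suc k) *\<^sub>R x) ` Z S =
   {x \<in> E. (\<forall>i<n. 0 \<le> w i \<bullet> x \<and> w i \<bullet> x \<le> real (Suc k)) \<and> (\<forall>i\<in>S. w (Suc i) \<bullet> x \<le> w i \<bullet> x)}" (is "?l = ?r")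
proof
  show "?l \<subseteq> ?r"
    by (auto simp: orthoscheme_def subspace_scale[OF subE] mult_left_le intro!: mult_nonneg_nonneg mult_left_mono
        simp del: of_nat_Suc)
  show "?r \<subseteq> ?l"
  proof
    fix x assume x: "x \<in> ?r"
    have "(1 / real (Suc k)) *\<^sub>R x \<in> Z S"
      using x by (auto simp: orthoscheme_def subspace_scale[OF subE] divide_simps simp del: of_nat_Suc)
    moreover have "x = real (Suc k) *\<^sub>R ((1 / real (Suc k)) *\<^sub>R x)" by (simp del: of_nat_Suc)
    ultimately show "x \<in> ?l" by blast
  qed
qed

text \<open>Where \<open>m\<close> strictly drops, the constraint between two neighbouring
  coordinates holds on the entire cell; where \<open>m\<close> stays equal, it becomes the same
  constraint on the fractional parts. Hence the cell is a translate of the product of path simplices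
  given by the equality pattern of \<open>m\<close>.\<close>

lemma cell_mono:
  assumes m: "\<And>i. Suc i < n \<Longrightarrow> m (Suc i) \<le> (m i :: nat)"
  shows "{x \<in> E. (\<forall>i\<in>{..<n-1}. w (Suc i) \<bullet> x \<le> w i \<bullet> x)} \<inter> {x. \<forall>i<n. real (m i) \<le> w i \<bullet> x \<and> w i \<bullet> x \<le> real (m i) + 1}
     = (\<lambda>x. (\<Sum>l<n. real (m l) *\<^sub>R a l) + x) ` Z {i. Suc i < n \<and> m i = m (Suc i)}" (is "?l = ?r")
proof
  let ?t = "\<Sum>l<n. real (m l) *\<^sub>R a l"
  have tE: "?t \<in> E" by (rule sum_in_E)
  have wt: "i < n \<Longrightarrow> w i \<bullet> ?t = real (m i)" for i by (rule w_sum)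
  show "?l \<subseteq> ?r"
  proof
    fix x assume x: "x \<in> ?l"
    have "x - ?t \<in> Z {i. Suc i < n \<and> m i = m (Suc i)}"
      using x wt by (auto simp: orthoscheme_def subspace_diff[OF subE _ tE] inner_diff_right)
    then show "x \<in> ?r" by (intro image_eqI[of _ _ "x - ?t"]) auto
  qed
  show "?r \<subseteq> ?l"
  proof
    fix y assume "y \<in> ?r"
    then obtain x where x: "y = ?t + x" "x \<in> Z {i. Suc i < n \<and> m i = m (Suc i)}" by auto
    have "w (Suc i) \<bullet> y \<le> w i \<bullet> y" if i: "Suc i < n" for i
    proof (cases "m i = m (Suc i)")
      case True then show ?thesis using x i wt[of i] wt[of "Suc i"] by (auto simp: orthoscheme_def inner_add_right)
    next
      case False
      then have "real (m (Suc i)) + 1 \<le> real (m i)" using m[OF i] by simp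
      moreover have "w (Suc i) \<bullet> x \<le> 1" "0 \<le> w i \<bullet> x" using x i by (auto simp: orthoscheme_def)
      ultimately show ?thesis using x i wt[of i] wt[of "Suc i"] by (auto simp: inner_add_right)
    qed
    then show "y \<in> ?l" using x tE wt by (auto simp: orthoscheme_def subspace_add[OF subE] inner_add_right)
  qed
qed

lemma card_pattern:
  assumes S: "S \<subseteq> {..<n - 1}"
  shows "card {m \<in> {..<n} \<rightarrow>\<^sub>E {..<k}. \<forall>i\<in>S. m i = m (Suc i)} \<le> k ^ (n - card S)" (is "card ?M \<le> _")
proof -
  let ?I = "{..<n} - Suc ` S"
  have "inj_on (\<lambda>m. restrict m ?I) ?M"
  proof (rule inj_onI)
    fix m m' assume mm: "m \<in> ?M" "m' \<in> ?M" "restrict m ?I = restrict m' ?I"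
    have "m i = m' i" for i
    proof (induction i)
      case 0
      have "0 \<in> ?I" using n by auto
      then show ?case using mm(3) by (metis restrict_apply')
    next
      case (Suc i)
      show ?case
      proof (cases "Suc i \<in> ?I")
        case True then show ?thesis using mm(3) by (metis restrict_apply')
      next
        case False
        then consider "Suc i \<ge> n" | "i \<in> S" by (auto simp: not_less)
        then show ?thesis
        proof cases
          case 1 then show ?thesis using mm by (auto simp: PiE_def extensional_def)
        next
          case 2 then show ?thesis using mm Suc by auto
        qed
      qed
    qed
    then show "m = m'" by auto
  qed
  moreover have "(\<lambda>m. restrict m ?I) ` ?M \<subseteq> ?I \<rightarrow>\<^sub>E {..<k}" by (auto simp: PiE_def)
  ultimately have "card ?M \<le> card (?I \<rightarrow>\<^sub>E {..<k})"
    by (intro card_inj_on_le) (auto intro: finite_PiE)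
  also have "\<dots> = k ^ card ?I" by (simp add: card_PiE)
  also have "card ?I = n - card S"
  proof -
    have "Suc ` S \<subseteq> {..<n}" "finite S" using S finite_subset by auto
    then show ?thesis by (simp add: card_Diff_subset card_image)
  qed
  finally show ?thesis .
qed

text \<open>Growth comparison: the dilate has value of order \<open>k ^ r\<close>, while the cells
  with at least \<open>s\<close> equalities number at most a constant times
  \<open>k ^ (n - s)\<close> and have bounded value. If the cells with fewer equalities contribute
  nothing and \<open>r\<close> exceeds \<open>n - s\<close>, the value must be 0.\<close>

lemma simplex_vanish:
  assumes van: "\<And>S. S \<subseteq> {..<n - 1} \<Longrightarrow> card S < s \<Longrightarrow> \<theta> (Z S) = 0" and s: "n < r + s" "s \<le> n"
  shows "\<theta> (Z {..<n - 1}) = 0"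
proof -
  let ?T = "Z {..<n - 1}"
  define S where "S m = {i. Suc i < n \<and> m i = m (Suc i)}" for m :: "nat \<Rightarrow> nat"
  \<comment> \<open>A bound, independent of the dilation factor, for the value of every cell type:
    there are only finitely many patterns.\<close>
  define D where "D = (\<Sum>U\<in>Pow {..<n - 1}. \<bar>\<theta> (Z U)\<bar>)"
  have D0: "D \<ge> 0" by (auto simp: D_def intro!: sum_nonneg)
  have bT: "body ?T" by (rule body_Z) simp
  have Sm: "S m \<subseteq> {..<n - 1}" for m by (auto simp: S_def)
  have key: "\<bar>\<theta> ?T\<bar> * real (Suc k) \<le> 2 ^ n * D" for k
  proof -
    let ?k = "Suc k"
    let ?K = "(\<lambda>x. real ?k *\<^sub>R x) ` ?T"
    let ?P = "{..<n} \<rightarrow>\<^sub>E {..<?k}"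
    let ?C = "\<lambda>m. {x. \<forall>i<n. real (m i) \<le> w i \<bullet> x \<and> w i \<bullet> x \<le> real (m i) + 1}"
    have bK: "body ?K"
      using bT subE by (auto simp: body_def subspace_scale intro!: compact_scaling convex_scaling)
    have cell: "\<theta> (?K \<inter> ?C m) = (if \<forall>i. Suc i < n \<longrightarrow> m (Suc i) \<le> m i then \<theta> (Z (S m)) else 0)"
      if m: "m \<in> ?P" for m
    proof (cases "\<forall>i. Suc i < n \<longrightarrow> m (Suc i) \<le> m i")
      case True
      have "?K \<inter> ?C m = {x \<in> E. (\<forall>i\<in>{..<n-1}. w (Suc i) \<bullet> x \<le> w i \<bullet> x)} \<inter> ?C m"
      proof -
        have "0 \<le> w i \<bullet> x \<and> w i \<bullet> x \<le> real ?k" if "x \<in> ?C m" "i < n" for i x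
        proof -
          have "m i < ?k" using m that by auto
          then have "real (m i) + 1 \<le> real ?k" by (simp add: nat_less_real_le)
          moreover have "real (m i) \<le> w i \<bullet> x" "w i \<bullet> x \<le> real (m i) + 1" using that by auto
          ultimately show ?thesis by linarith
        qed
        then show ?thesis unfolding scaled_Z by auto
      qed
      also have "\<dots> = (\<lambda>x. (\<Sum>l<n. real (m l) *\<^sub>R a l) + x) ` Z (S m)"
        unfolding S_def using True by (intro cell_mono) auto
      finally show ?thesis using True trans[OF body_Z[OF Sm] sum_in_E] by simp
    next
      case False
      then obtain i where i: "Suc i < n" "m i < m (Suc i)" by (auto simp: not_le)
      \<comment> \<open>An ascent of \<open>m\<close> is incompatible with decreasing coordinates
        except on the common face of the two slabs, so the piece is flat.\<close>
      have "?K \<inter> ?C m \<subseteq> {x. w i \<bullet> x = real (m i) + 1}"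
      proof
        fix x assume x: "x \<in> ?K \<inter> ?C m"
        then have "w (Suc i) \<bullet> x \<le> w i \<bullet> x" unfolding scaled_Z using i by auto
        moreover have "real (m (Suc i)) \<le> w (Suc i) \<bullet> x" "w i \<bullet> x \<le> real (m i) + 1" using x i by auto
        moreover have "real (m i) + 1 \<le> real (m (Suc i))" using i(2) by (simp add: nat_less_real_le)
        ultimately show "x \<in> {x. w i \<bullet> x = real (m i) + 1}" by simp
      qed
      moreover have "body (?K \<inter> ?C m)" by (rule body_Int[OF bK closed_cell convex_cell])
      ultimately have "\<theta> (?K \<inter> ?C m) = 0" using wE w_nz i flat[of _ "w i"] by auto
      then show ?thesis unfolding if_not_P[OF False] .
    qed
    have finP: "finite ?P" by (auto intro: finite_PiE)
    have "real ?k ^ r * \<theta> ?T = \<theta> ?K" using hom[OF bT, of ?k] by simp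
    also have "\<dots> = (\<Sum>m\<in>?P. \<theta> (?K \<inter> ?C m))"
      by (rule grid_sum[OF bK]) (use wE w_nz in \<open>auto simp: scaled_Z simp del: of_nat_Suc\<close>)
    finally have "real ?k ^ r * \<bar>\<theta> ?T\<bar> = \<bar>\<Sum>m\<in>?P. \<theta> (?K \<inter> ?C m)\<bar>" by (metis abs_mult abs_of_nonneg of_nat_0_le_iff zero_le_power)
    also have "\<dots> \<le> (\<Sum>m\<in>?P. \<bar>\<theta> (?K \<inter> ?C m)\<bar>)" by (rule sum_abs)
    also have "\<dots> \<le> (\<Sum>m\<in>?P. if card (S m) \<ge> s then D else 0)"
    proof (intro sum_mono)
      fix m assume m: "m \<in> ?P"
      have "\<bar>\<theta> (Z (S m))\<bar> \<le> D" unfolding D_def using Sm by (intro member_le_sum) auto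
      then show "\<bar>\<theta> (?K \<inter> ?C m)\<bar> \<le> (if card (S m) \<ge> s then D else 0)"
        using cell[OF m] van[OF Sm, of m] D0 by auto
    qed
    also have "\<dots> = real (card {m\<in>?P. card (S m) \<ge> s}) * D" using finP by (simp add: sum.If_cases Int_def)
    also have "\<dots> \<le> (2 ^ n * real ?k ^ (n - s)) * D"
    proof (intro mult_right_mono D0)
      \<comment> \<open>Union bound over the possible patterns; the factor \<open>2 ^ n\<close>
        counts subsets of \<open>{..<n - 1}\<close> generously.\<close>
      have "{m\<in>?P. card (S m) \<ge> s} \<subseteq> (\<Union>U\<in>{U\<in>Pow {..<n - 1}. card U \<ge> s}. {m\<in>?P. \<forall>i\<in>U. m i = m (Suc i)})"
        using Sm by (auto simp: S_def)
      then have "card {m\<in>?P. card (S m) \<ge> s} \<le> card (\<Union>U\<in>{U\<in>Pow {..<n - 1}. card U \<ge> s}. {m\<in>?P. \<forall>i\<in>U. m i = m (Suc i)})"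
        using finP by (intro card_mono) auto
      also have "\<dots> \<le> (\<Sum>U\<in>{U\<in>Pow {..<n - 1}. card U \<ge> s}. card {m\<in>?P. \<forall>i\<in>U. m i = m (Suc i)})"
        by (intro card_UN_le) auto
      also have "\<dots> \<le> (\<Sum>U\<in>{U\<in>Pow {..<n - 1}. card U \<ge> s}. ?k ^ (n - s))"
      proof (intro sum_mono)
        fix U assume U: "U \<in> {U\<in>Pow {..<n - 1}. card U \<ge> s}"
        have "card {m\<in>?P. \<forall>i\<in>U. m i = m (Suc i)} \<le> ?k ^ (n - card U)" using U by (intro card_pattern) auto
        also have "\<dots> \<le> ?k ^ (n - s)" using U by (intro power_increasing) auto
        finally show "card {m\<in>?P. \<forall>i\<in>U. m i = m (Suc i)} \<le> ?k ^ (n - s)" .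
      qed
      also have "\<dots> = card {U\<in>Pow {..<n - 1}. card U \<ge> s} * ?k ^ (n - s)" by simp
      also have "\<dots> \<le> 2 ^ n * ?k ^ (n - s)"
      proof (intro mult_right_mono)
        have "card {U\<in>Pow {..<n - 1}. card U \<ge> s} \<le> card (Pow {..<n - 1})" by (intro card_mono) auto
        also have "\<dots> = 2 ^ (n - 1)" by (simp add: card_Pow)
        also have "\<dots> \<le> 2 ^ n" by (intro power_increasing) auto
        finally show "card {U\<in>Pow {..<n - 1}. card U \<ge> s} \<le> 2 ^ n" .
      qed simp
      finally have c: "card {m\<in>?P. card (S m) \<ge> s} \<le> 2 ^ n * ?k ^ (n - s)" .
      show "real (card {m\<in>?P. card (S m) \<ge> s}) \<le> 2 ^ n * real ?k ^ (n - s)"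
        using of_nat_mono[OF c, where 'a=real] by (simp del: of_nat_Suc)
    qed
    finally have le: "real ?k ^ r * \<bar>\<theta> ?T\<bar> \<le> real ?k ^ (n - s) * (2 ^ n * D)" by (simp add: mult_ac)
    \<comment> \<open>The surplus of \<open>r\<close> over \<open>n - s\<close>, less one: one
      factor \<open>real (Suc k)\<close> is kept to force divergence and the remaining
      \<open>q\<close> factors are bounded below by 1.\<close>
    define q where "q = r - (n - s) - 1"
    have rq: "r = (n - s) + Suc q" using s by (simp add: q_def)
    have rr: "real ?k ^ r = real ?k ^ (n - s) * (real ?k * real ?k ^ q)"
      by (simp only: rq power_add power_Suc)
    have "real ?k ^ (n - s) * (real ?k * real ?k ^ q * \<bar>\<theta> ?T\<bar>) \<le> real ?k ^ (n - s) * (2 ^ n * D)"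
      using le unfolding rr by (simp only: mult_ac)
    then have "real ?k * real ?k ^ q * \<bar>\<theta> ?T\<bar> \<le> 2 ^ n * D"
      by (rule mult_left_le_imp_le) simp
    moreover have "real ?k * 1 * \<bar>\<theta> ?T\<bar> \<le> real ?k * real ?k ^ q * \<bar>\<theta> ?T\<bar>"
      by (intro mult_right_mono mult_left_mono one_le_power) auto
    ultimately have "real ?k * 1 * \<bar>\<theta> ?T\<bar> \<le> 2 ^ n * D" by linarith
    then show ?thesis by (simp only: mult.right_neutral mult.commute)
  qed
  show ?thesis
  proof (rule ccontr)
    assume "\<theta> ?T \<noteq> 0"
    then have pos: "\<bar>\<theta> ?T\<bar> > 0" by simp
    obtain k where "2 ^ n * D / \<bar>\<theta> ?T\<bar> < real k" using reals_Archimedean2 by blast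
    then have "2 ^ n * D < real k * \<bar>\<theta> ?T\<bar>" using pos by (simp add: pos_divide_less_eq)
    also have "\<dots> \<le> \<bar>\<theta> ?T\<bar> * real (Suc k)" using pos by (simp add: algebra_simps)
    also have "\<dots> \<le> 2 ^ n * D" by (rule key)
    finally show False by simp
  qed
qed

text \<open>The doubled parallelotope consists of \<open>2 ^ n\<close> translates of the original,
  but homogeneity gives it the factor \<open>2 ^ r\<close>.\<close>

lemma box_vanish: assumes "r \<noteq> n" shows "\<theta> (Z {}) = 0"
proof -
  let ?B = "Z {}"
  let ?K = "(\<lambda>x. real (Suc 1) *\<^sub>R x) ` ?B"
  let ?P = "{..<n} \<rightarrow>\<^sub>E {..<(2::nat)}"
  let ?C = "\<lambda>m. {x. \<forall>i<n. real (m i) \<le> w i \<bullet> x \<and> w i \<bullet> x \<le> real (m i) + 1}"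
  have bB: "body ?B" by (rule body_Z) simp
  have bK: "body ?K"
    using bB subE by (auto simp: body_def subspace_scale intro!: compact_scaling convex_scaling)
  have "\<theta> (?K \<inter> ?C m) = \<theta> ?B" if m: "m \<in> ?P" for m
  proof -
    let ?t = "\<Sum>l<n. real (m l) *\<^sub>R a l"
    have tE: "?t \<in> E" by (rule sum_in_E)
    have wt: "i < n \<Longrightarrow> w i \<bullet> ?t = real (m i)" for i by (rule w_sum)
    have m1: "real (m i) \<le> 1" if "i < n" for i
    proof -
      have "m i < 2" using m that by auto
      then show ?thesis by simp
    qed
    have "?K \<inter> ?C m = (\<lambda>x. ?t + x) ` ?B"
    proof (intro set_eqI iffI)
      fix x assume x: "x \<in> ?K \<inter> ?C m"
      have "x - ?t \<in> ?B"
        using x wt unfolding scaled_Z by (auto simp: orthoscheme_def subspace_diff[OF subE _ tE] inner_diff_right)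
      then show "x \<in> (\<lambda>x. ?t + x) ` ?B" by (intro image_eqI[of _ _ "x - ?t"]) auto
    next
      fix y assume "y \<in> (\<lambda>x. ?t + x) ` ?B"
      then obtain x where x: "y = ?t + x" "x \<in> ?B" by auto
      then show "y \<in> ?K \<inter> ?C m" unfolding scaled_Z using tE wt m1
        by (force simp: orthoscheme_def subspace_add[OF subE] inner_add_right)
    qed
    then show ?thesis using trans[OF bB tE] by simp
  qed
  moreover have "\<theta> ?K = (\<Sum>m\<in>?P. \<theta> (?K \<inter> ?C m))"
    by (rule grid_sum[OF bK]) (use wE w_nz in \<open>auto simp: scaled_Z simp del: of_nat_Suc\<close>)
  ultimately have "\<theta> ?K = 2 ^ n * \<theta> ?B" by (simp add: card_PiE)
  moreover have "\<theta> ?K = 2 ^ r * \<theta> ?B" using hom[OF bB, of "Suc 1"] by simp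
  ultimately have "(2 ^ n - 2 ^ r) * \<theta> ?B = 0" by (simp add: algebra_simps)
  moreover have "(2::real) ^ n \<noteq> 2 ^ r" using assms by simp
  ultimately show ?thesis by simp
qed

lemma prism_vanish:
  assumes even: "\<And>K. body K \<Longrightarrow> \<theta> (uminus ` K) = \<theta> K" and "r \<noteq> n" and i: "i \<in> {..<n - 1}"
  shows "\<theta> (Z {i}) = 0"
proof -
  \<comment> \<open>The vertex opposite to the origin: \<open>x \<mapsto> ?t - x\<close> is the
    central symmetry of the parallelotope and exchanges its two halves cut by
    \<open>w i \<bullet> x = w (Suc i) \<bullet> x\<close>.\<close>
  let ?t = "\<Sum>l<n. 1 *\<^sub>R a l"
  have tE: "?t \<in> E" by (rule sum_in_E)
  have wt: "i < n \<Longrightarrow> w i \<bullet> ?t = 1" for i by (rule w_sum)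
  have i': "i < n" "Suc i < n" using i by auto
  let ?d = "w i - w (Suc i)"
  have d: "?d \<in> E" "?d \<noteq> 0" using wE i' subE dual[of i i] dual[of "Suc i" i] by (auto simp: subspace_diff)
  have b: "body (Z {i})" using i by (intro body_Z) auto
  have bm: "body (uminus ` Z {i})"
    using b subE by (auto simp: body_def subspace_neg intro!: compact_negations convex_negations)
  have e1: "Z {} \<inter> {x. 0 \<le> ?d \<bullet> x} = Z {i}" by (auto simp: orthoscheme_def inner_diff_left)
  have e2: "Z {} \<inter> {x. ?d \<bullet> x \<le> 0} = (\<lambda>x. ?t + x) ` uminus ` Z {i}"
  proof (intro set_eqI iffI)
    fix x assume x: "x \<in> Z {} \<inter> {x. ?d \<bullet> x \<le> 0}"
    have "?t - x \<in> E" using x subspace_diff[OF subE tE] by (auto simp: orthoscheme_def)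
    then have "?t - x \<in> Z {i}" using x wt i'
      by (auto simp: orthoscheme_def inner_diff_right inner_diff_left)
    then show "x \<in> (\<lambda>x. ?t + x) ` uminus ` Z {i}" unfolding image_image by (intro image_eqI[of _ _ "?t - x"]) auto
  next
    fix y assume "y \<in> (\<lambda>x. ?t + x) ` uminus ` Z {i}"
    then obtain x where x: "y = ?t - x" "x \<in> Z {i}" by auto
    moreover have "y \<in> E" using x subspace_diff[OF subE tE] by (auto simp: orthoscheme_def)
    ultimately show "y \<in> Z {} \<inter> {x. ?d \<bullet> x \<le> 0}" using wt i'
      by (auto simp: orthoscheme_def inner_diff_right inner_diff_left)
  qed
  have "\<theta> (Z {}) = \<theta> (Z {} \<inter> {x. ?d \<bullet> x \<le> 0}) + \<theta> (Z {} \<inter> {x. 0 \<le> ?d \<bullet> x})"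
    by (rule cut[OF body_Z d]) simp
  also have "\<dots> = \<theta> (Z {i}) + \<theta> (Z {i})" unfolding e1 e2 using trans[OF bm tE] even[OF b] by simp
  finally show ?thesis using box_vanish[OF assms(2)] by simp
qed

text \<open>Above the dimension even the total number of cells grows too slowly, so no pattern has
  to vanish beforehand. This kills a valuation of degree \<open>j\<close> in dimensions below
  \<open>j\<close>.\<close>

lemma simplex_vanish_top: "n < r \<Longrightarrow> \<theta> (Z {..<n - 1}) = 0"
  by (rule simplex_vanish[of 0]) auto

text \<open>In degree equal to the dimension only the cells without equalities, the parallelotopes,
  are numerous enough to matter.\<close>

lemma simplex_vanish_box: "r = n \<Longrightarrow> \<theta> (Z {}) = 0 \<Longrightarrow> \<theta> (Z {..<n - 1}) = 0"
  using n by (intro simplex_vanish[of 1]) (auto dest: finite_subset)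

text \<open>One degree below the dimension, cells with at most one equality matter: parallelotopes
  are excluded by their degree and prisms by evenness.\<close>

lemma simplex_vanish_even:
  assumes "\<And>K. body K \<Longrightarrow> \<theta> (uminus ` K) = \<theta> K" "n \<ge> 2" "r = n - 1"
  shows "\<theta> (Z {..<n - 1}) = 0"
proof (rule simplex_vanish[of 2])
  fix S assume S: "S \<subseteq> {..<n - 1}" "card S < 2"
  have "finite S" using S(1) finite_subset by blast
  then have "S = {} \<or> (\<exists>i. S = {i})" using S(2) by (auto simp: less_2_cases_iff card_1_singleton_iff)
  then show "\<theta> (Z S) = 0" using box_vanish prism_vanish[OF assms(1)] S(1) assms(2,3) by auto
qed (use assms in auto)

end

section \<open>Simple valuations on polytopes\<close>

text \<open>Summation by parts, turning coordinates along a path of vertices into barycentric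
  weights. The last term is the boundary contribution, which disappears when
  \<open>t p = 0\<close>.\<close>

lemma abel_sum:
  fixes v :: "nat \<Rightarrow> 'a::real_vector" and t :: "nat \<Rightarrow> real"
  shows "(\<Sum>i\<le>p. (if i = 0 then 1 - t 0 else t (i - 1) - t i) *\<^sub>R v i) = v 0 + (\<Sum>i<p. t i *\<^sub>R (v (Suc i) - v i)) - t p *\<^sub>R v p"
  by (induction p) (simp_all add: algebra_simps)

text \<open>Enumerate the vertices and take the successive differences as basis. The coordinates of
  a point of the simplex are then tail sums of its barycentric weights, hence decreasing numbers
  between 0 and 1. So every simplex is a path simplex for a suitable basis.\<close>

lemma simplex_as_orthoscheme:
  fixes C :: "'a::euclidean_space set"
  assumes ind: "\<not> affine_dependent C" and card: "card C = Suc n" and CE: "C \<subseteq> E" and E: "subspace E" and dim: "dim E = n"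
    and n: "n \<ge> 1"
  obtains a w t where "\<And>i. i < n \<Longrightarrow> w i \<in> E" "\<And>i. i < n \<Longrightarrow> a i \<in> E"
    "\<And>i l. i < n \<Longrightarrow> l < n \<Longrightarrow> w i \<bullet> a l = (if i = l then 1 else 0)"
    "\<And>x. x \<in> E \<Longrightarrow> x = (\<Sum>i<n. (w i \<bullet> x) *\<^sub>R a i)"
    "t \<in> E" "convex hull C = (\<lambda>x. t + x) ` orthoscheme E n w {..<n - 1}"
proof -
  have finC: "finite C" using card card.infinite by fastforce
  obtain v where v: "bij_betw v {..n} C"
    using ex_bij_betw_nat_finite[OF finC] card by (metis atLeast0AtMost atLeastLessThanSuc_atLeastAtMost)
  have vC: "v i \<in> C" if "i \<le> n" for i using v that by (auto simp: bij_betw_def)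
  have vE: "v i \<in> E" if "i \<le> n" for i using vC[OF that] CE by auto
  define a where "a i = v (Suc i) - v i" for i
  have aE: "a i \<in> E" if "i < n" for i unfolding a_def using vE that by (intro subspace_diff[OF E]) auto
  have tel: "v i = v 0 + (\<Sum>l<i. a l)" for i by (simp add: a_def sum_lessThan_telescope)
  have spE: "span (a ` {..<n}) = E"
  proof (rule subspace_dim_equal)
    show "span (a ` {..<n}) \<subseteq> E" using aE E by (intro span_minimal) auto
    let ?D = "(\<lambda>x. - v 0 + x) ` (C - {v 0})"
    have "insert (v 0) (C - {v 0}) = C" using vC by auto
    then have indD: "independent ?D" using ind affine_dependent_iff_dependent[of "v 0" "C - {v 0}"] by simp
    have "?D \<subseteq> span (a ` {..<n})"
    proof
      fix y assume "y \<in> ?D"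
      then obtain i where i: "i \<le> n" "y = - v 0 + v i" using v by (auto simp: bij_betw_def)
      then have "y = (\<Sum>l<i. a l)" using tel[of i] by simp
      moreover have "(\<Sum>l<i. a l) \<in> span (a ` {..<n})"
        by (rule span_sum, rule span_base) (use i in auto)
      ultimately show "y \<in> span (a ` {..<n})" by simp
    qed
    then have "card ?D \<le> dim (span (a ` {..<n}))" using indD independent_card_le_dim by blast
    moreover have "card ?D = n" using vC[of 0] card finC by (subst card_image) (auto simp: inj_on_def)
    ultimately show "dim (span (a ` {..<n})) \<ge> dim E" using dim by simp
  qed (use E in auto)
  obtain w where w: "\<And>i. i < n \<Longrightarrow> w i \<in> E" "\<And>i l. i < n \<Longrightarrow> l < n \<Longrightarrow> w i \<bullet> a l = (if i = l then 1 else 0)"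
    "\<And>x. x \<in> E \<Longrightarrow> x = (\<Sum>i<n. (w i \<bullet> x) *\<^sub>R a i)"
    using dual_family_exists[OF spE dim] by metis
  let ?T = "orthoscheme E n w {..<n - 1}"
  have convT: "convex ?T"
  proof -
    have eq: "?T = E \<inter> (\<Inter>i\<in>{..<n}. {x. 0 \<le> w i \<bullet> x} \<inter> {x. w i \<bullet> x \<le> 1}) \<inter> (\<Inter>i\<in>{..<n-1}. {x. 0 \<le> (w i - w (Suc i)) \<bullet> x})"
      by (auto simp: orthoscheme_def inner_diff_left)
    show ?thesis unfolding eq using subspace_imp_convex[OF E]
      by (auto intro!: convex_INT convex_Int convex_halfspace_le convex_halfspace_ge)
  qed
  have "convex hull C = (\<lambda>x. v 0 + x) ` ?T"
  proof
    show "convex hull C \<subseteq> (\<lambda>x. v 0 + x) ` ?T"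
    proof (rule hull_minimal)
      show "C \<subseteq> (\<lambda>x. v 0 + x) ` ?T"
      proof
        fix c assume "c \<in> C"
        then obtain i where i: "i \<le> n" "c = v i" using v by (auto simp: bij_betw_def)
        have wv: "w m \<bullet> (\<Sum>l<i. a l) = (if m < i then 1 else 0)" if "m < n" for m
        proof -
          have "w m \<bullet> (\<Sum>l<i. a l) = (\<Sum>l<i. if l = m then 1 else 0)"
            unfolding inner_sum_right using that i w(2) by (intro sum.cong) auto
          then show ?thesis by simp
        qed
        have "(\<Sum>l<i. a l) \<in> ?T"
          using wv aE i by (auto simp: orthoscheme_def intro!: subspace_sum[OF E])
        then show "c \<in> (\<lambda>x. v 0 + x) ` ?T" using tel[of i] i by auto
      qed
      show "convex ((\<lambda>x. v 0 + x) ` ?T)" using convT by (rule convex_translation)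
    qed
    show "(\<lambda>x. v 0 + x) ` ?T \<subseteq> convex hull C"
    proof
      fix y assume "y \<in> (\<lambda>x. v 0 + x) ` ?T"
      then obtain x where x: "y = v 0 + x" "x \<in> ?T" by auto
      \<comment> \<open>Extended by 0 so that the last barycentric weight \<open>c n\<close> comes
        out as \<open>t (n - 1)\<close> and the boundary term in \<open>abel_sum\<close>
        vanishes.\<close>
      define t where "t i = (if i < n then w i \<bullet> x else 0)" for i
      define c where "c i = (if i = 0 then 1 - t 0 else t (i - 1) - t i)" for i
      have xs: "x = (\<Sum>i<n. t i *\<^sub>R a i)" using w(3)[of x] x by (simp add: orthoscheme_def t_def)
      have t1: "0 \<le> t i" "t i \<le> 1" for i using x by (auto simp: t_def orthoscheme_def)
      have t2: "t (Suc i) \<le> t i" for i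
      proof (cases "Suc i < n")
        case True
        then have "i \<in> {..<n - 1}" by auto
        then show ?thesis using x True by (auto simp: t_def orthoscheme_def)
      qed (use t1 in \<open>auto simp: t_def\<close>)
      have c0: "0 \<le> c i" for i
        using t1 t2[of "i - 1"] by (auto simp: c_def)
      have "(\<Sum>i\<le>n. c i *\<^sub>R v i) = v 0 + (\<Sum>i<n. t i *\<^sub>R a i) - t n *\<^sub>R v n"
        unfolding c_def a_def by (rule abel_sum)
      moreover have tn: "t n = 0" by (simp add: t_def)
      ultimately have "(\<Sum>i\<le>n. c i *\<^sub>R v i) = y" using x(1) xs by simp
      moreover have "(\<Sum>i\<le>n. c i) = 1"
      proof -
        have "(\<Sum>i\<le>n. c i) = (\<Sum>i\<le>n. c i *\<^sub>R (1::real))" by simp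
        also have "\<dots> = 1 - t n" unfolding c_def using abel_sum[of t "\<lambda>_. 1::real" n] by simp
        finally show ?thesis using tn by simp
      qed
      ultimately show "y \<in> convex hull C"
        using convex_sum[of "{..n}" "convex hull C" c v] c0 vC by (auto intro: hull_inc)
    qed
  qed
  then show ?thesis using that[of w a "v 0"] w aE vE by blast
qed

lemma lowdim_subset_hyperplane:
  fixes K :: "'a::euclidean_space set"
  assumes E: "subspace E" and K: "K \<subseteq> E" "K \<noteq> {}" "aff_dim K < int (dim E)"
  obtains a b where "a \<in> E" "a \<noteq> 0" "K \<subseteq> {x. a \<bullet> x = b}"
proof -
  obtain p where p: "p \<in> K" using K by auto
  let ?M = "(+) (- p) ` K"
  have "aff_dim K = int (dim ?M)" using p by (intro aff_dim_eq_dim hull_inc)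
  then have dM: "dim ?M < dim E" using K by simp
  have ME: "?M \<subseteq> E" using K p subspace_diff[OF E] by auto
  have "span ?M \<subset> span E"
  proof
    show "span ?M \<subseteq> span E" using ME by (rule span_mono)
    show "span ?M \<noteq> span E" using dM by (metis dim_span less_irrefl)
  qed
  then obtain a where a: "a \<noteq> 0" "a \<in> span E" "\<And>y. y \<in> span ?M \<Longrightarrow> orthogonal a y"
    using orthogonal_to_subspace_exists_gen by blast
  have "a \<bullet> x = a \<bullet> p" if "x \<in> K" for x
    using a(3)[of "- p + x"] that by (auto simp: orthogonal_def inner_diff_right inner_add_right intro!: span_base)
  moreover have "a \<in> E" using a(2) E by (metis span_eq_iff)
  ultimately show ?thesis using that[of a "a \<bullet> p"] a(1) by blast
qed

text \<open>A convex set whose affine hull is \<open>E\<close> has a relative interior point, and a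
  relative ball has positive measure.\<close>

lemma lamE_null_lowdim:
  fixes K :: "'a::euclidean_space set"
  assumes E: "subspace E" and K: "convex K" "K \<subseteq> E" "K \<noteq> {}" "K \<in> sets borel" and z: "emeasure (lamE E) K = 0"
  shows "aff_dim K < int (dim E)"
proof (rule ccontr)
  assume "\<not> aff_dim K < int (dim E)"
  moreover have "aff_dim K \<le> aff_dim E" using K by (intro aff_dim_subset)
  moreover have "aff_dim E = int (dim E)" using E by (rule aff_dim_subspace)
  ultimately have eq: "aff_dim K = aff_dim E" by simp
  have "affine hull K = affine hull E"
  proof (rule affine_dim_equal)
    show "affine hull K \<subseteq> affine hull E" using K by (intro hull_mono)
    show "affine hull K \<noteq> {}" using K by simp
  qed (use eq in \<open>auto simp: affine_affine_hull\<close>)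
  also have "affine hull E = E" using E by (simp add: affine_hull_eq subspace_imp_affine)
  finally have aff: "affine hull K = E" .
  obtain c where c: "c \<in> rel_interior K" using K rel_interior_eq_empty by blast
  then obtain e where e: "e > 0" "ball c e \<inter> affine hull K \<subseteq> K" "c \<in> K" by (auto simp: mem_rel_interior_ball)
  then have "emeasure (lamE E) K > 0"
    using K aff by (intro emeasure_lamE_pos[OF E, of K c e]) auto
  then show False using z by simp
qed

context simple_val
begin

lemma lowdim_zero: assumes "body K" "K \<noteq> {}" "aff_dim K < int (dim E)" shows "\<theta> K = 0"
proof -
  obtain a b where "a \<in> E" "a \<noteq> 0" "K \<subseteq> {x. a \<bullet> x = b}"
    using lowdim_subset_hyperplane[OF subE, of K] assms by (auto simp: body_def)
  then show ?thesis using flat assms by blast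
qed

text \<open>The closed cells of a hyperplane arrangement \<open>H\<close>, indexed by sign vectors:
  \<open>S\<close> holds the pairs taken with the sign \<open>\<le>\<close>.\<close>

definition hcell :: "('a \<times> real) set \<Rightarrow> ('a \<times> real) set \<Rightarrow> 'a set" where
  "hcell H S = {x. \<forall>(a, b)\<in>H. if (a, b) \<in> S then a \<bullet> x \<le> b else b \<le> a \<bullet> x}"

lemma closed_hcell: "closed (hcell H S)" and convex_hcell: "convex (hcell H S)"
proof -
  have eq: "hcell H S = (\<Inter>h\<in>H. if h \<in> S then {x. fst h \<bullet> x \<le> snd h} else {x. snd h \<le> fst h \<bullet> x})"
    unfolding hcell_def
  proof (rule set_eqI)
    fix x
    show "x \<in> {x. \<forall>(a, b)\<in>H. if (a, b) \<in> S then a \<bullet> x \<le> b else b \<le> a \<bullet> x} \<longleftrightarrow>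
      x \<in> (\<Inter>h\<in>H. if h \<in> S then {x. fst h \<bullet> x \<le> snd h} else {x. snd h \<le> fst h \<bullet> x})"
      unfolding mem_Collect_eq INT_iff by (intro ball_cong refl) (simp add: case_prod_beta)
  qed
  show "closed (hcell H S)" unfolding eq
    by (rule closed_INT) (auto simp: closed_halfspace_le closed_halfspace_ge)
  show "convex (hcell H S)" unfolding eq
    by (rule convex_INT) (auto simp: convex_halfspace_le convex_halfspace_ge)
qed

lemma arrangement_sum:
  assumes "finite H" "body K" "\<And>h. h \<in> H \<Longrightarrow> fst h \<in> E \<and> fst h \<noteq> 0"
  shows "\<theta> K = (\<Sum>S\<in>Pow H. \<theta> (K \<inter> hcell H S))"
  using assms
proof (induction H)
  case empty
  then show ?case by (simp add: hcell_def)
next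
  case (insert h H)
  obtain a b where h: "h = (a, b)" by force
  have "\<theta> K = (\<Sum>S\<in>Pow H. \<theta> (K \<inter> hcell H S))" using insert by auto
  also have "\<dots> = (\<Sum>S\<in>Pow H. \<theta> (K \<inter> hcell (insert h H) (insert h S)) + \<theta> (K \<inter> hcell (insert h H) S))"
  proof (intro sum.cong refl)
    fix S assume S: "S \<in> Pow H"
    have "body (K \<inter> hcell H S)" using insert.prems closed_hcell convex_hcell by (intro body_Int)
    then have "\<theta> (K \<inter> hcell H S) = \<theta> (K \<inter> hcell H S \<inter> {x. a \<bullet> x \<le> b}) + \<theta> (K \<inter> hcell H S \<inter> {x. b \<le> a \<bullet> x})"
      using insert.prems(2)[of h] h by (intro cut) simp_all
    moreover have "hcell (insert h H) (insert h S) = hcell H S \<inter> {x. a \<bullet> x \<le> b}"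
      using insert.hyps h by (auto simp: hcell_def)
    moreover have "hcell (insert h H) S = hcell H S \<inter> {x. b \<le> a \<bullet> x}"
      using insert.hyps h S by (auto simp: hcell_def)
    ultimately show "\<theta> (K \<inter> hcell H S) = \<theta> (K \<inter> hcell (insert h H) (insert h S)) + \<theta> (K \<inter> hcell (insert h H) S)"
      by (simp add: Int_assoc)
  qed
  also have "\<dots> = (\<Sum>S\<in>Pow H. \<theta> (K \<inter> hcell (insert h H) S)) + (\<Sum>S\<in>insert h ` Pow H. \<theta> (K \<inter> hcell (insert h H) S))"
  proof -
    have "inj_on (insert h) (Pow H)" using insert.hyps by (auto simp: inj_on_def)
    then show ?thesis by (simp add: sum.reindex sum.distrib)
  qed
  also have "\<dots> = (\<Sum>S\<in>Pow (insert h H). \<theta> (K \<inter> hcell (insert h H) S))"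
    unfolding Pow_insert using insert.hyps by (intro sum.union_disjoint[symmetric]) auto
  finally show ?case .
qed

text \<open>A triangulation cannot be summed directly, because \<open>cut\<close> only cuts along
  entire hyperplanes. Therefore \<open>Q\<close> and all simplices are refined by the arrangement
  \<open>HH\<close> of all facet hyperplanes, and the values are compared cell by cell before
  summing back.\<close>

lemma polytope_vanish:
  assumes n: "dim E \<ge> 1"
    and simp: "\<And>C. \<not> affine_dependent C \<Longrightarrow> card C = Suc (dim E) \<Longrightarrow> C \<subseteq> E \<Longrightarrow> \<theta> (convex hull C) = 0"
    and Q: "polytope Q" "Q \<subseteq> E" "Q \<noteq> {}"
  shows "\<theta> Q = 0"
proof (cases "aff_dim Q < int (dim E)")
  case True
  then show ?thesis using Q by (intro lowdim_zero) (auto simp: body_def polytope_imp_compact polytope_imp_convex)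
next
  case False
  have affE: "aff_dim E = int (dim E)" using subE by (rule aff_dim_subspace)
  have "aff_dim Q \<le> aff_dim E" using Q by (intro aff_dim_subset)
  then have dQ: "aff_dim Q = int (dim E)" using False affE by simp
  have bQ: "body Q" using Q by (auto simp: body_def polytope_imp_compact polytope_imp_convex)
  obtain \<T> where T: "triangulation \<T>" "\<And>k. k \<in> \<T> \<Longrightarrow> aff_dim k = int (dim E)" "\<Union>\<T> = Q"
  proof -
    have 1: "C1 \<inter> C2 face_of C1" if "C1 \<in> {Q}" "C2 \<in> {Q}" for C1 C2
      using that Q by (auto intro: face_of_refl polytope_imp_convex)
    have 2: "polytope C" "aff_dim C = int (dim E)" if "C \<in> {Q}" for C using that Q dQ by auto
    \<comment> \<open>The mesh bound 1 is arbitrary; what matters is a triangulation into simplices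
      of full dimension.\<close>
    show ?thesis
      by (rule fine_triangular_subdivision_of_cell_complex[of 1 "{Q}" "int (dim E)"])
         (use 1 2 that in auto)
  qed
  have finT: "finite \<T>" using T by (simp add: triangulation_def)
  have tsub: "t \<subseteq> E" if "t \<in> \<T>" for t using that T Q by auto
  have tC: "\<exists>C. \<not> affine_dependent C \<and> card C = Suc (dim E) \<and> C \<subseteq> E \<and> t = convex hull C" if t: "t \<in> \<T>" for t
  proof -
    obtain m where "m simplex t" using t T(1) by (auto simp: triangulation_def)
    then obtain C where C: "\<not> affine_dependent C" "int (card C) = m + 1" "t = convex hull C" by (auto simp: simplex_def)
    have "aff_dim t = m" using \<open>m simplex t\<close> by (simp add: aff_dim_simplex)
    then have "card C = Suc (dim E)" using C(2) T(2)[OF t] by simp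
    moreover have "C \<subseteq> E" using C(3) tsub[OF t] hull_subset[of C convex] by auto
    ultimately show ?thesis using C by auto
  qed
  have bt: "body t" if "t \<in> \<T>" for t
  proof -
    obtain C where C: "card C = Suc (dim E)" "t = convex hull C" using tC[OF \<open>t \<in> \<T>\<close>] by auto
    then have "finite C" using card.infinite by fastforce
    then show ?thesis using C tsub[OF that] by (auto simp: body_def finite_imp_compact_convex_hull)
  qed
  have t0: "\<theta> t = 0" if "t \<in> \<T>" for t using tC[OF that] simp by auto
  have "\<exists>H. finite H \<and> (\<forall>h\<in>H. fst h \<in> E \<and> fst h \<noteq> 0) \<and> t = E \<inter> {x. \<forall>(a, b)\<in>H. a \<bullet> x \<le> b}" if t: "t \<in> \<T>" for t
  proof -
    have tne: "t \<noteq> {}" using T(2)[OF t] by auto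
    have "affine hull t = affine hull E"
    proof (rule affine_dim_equal)
      show "affine hull t \<subseteq> affine hull E" using tsub[OF t] by (intro hull_mono)
      show "affine hull t \<noteq> {}" using tne by simp
    qed (use T(2)[OF t] affE in \<open>auto simp: affine_affine_hull\<close>)
    also have "affine hull E = E" using subE by (simp add: affine_hull_eq subspace_imp_affine)
    finally have aff: "affine hull t = E" .
    have "polyhedron t" using tC[OF t] card.infinite
      by (metis nat.distinct(1) polytope_imp_polyhedron polytope_convex_hull)
    then obtain F where F: "finite F" "t = E \<inter> \<Inter>F"
      "\<And>h. h \<in> F \<Longrightarrow> \<exists>a b. a \<noteq> 0 \<and> h = {x. a \<bullet> x \<le> b} \<and> (\<forall>x \<in> E. (x + a) \<in> E)"
      using polyhedron_Int_affine_parallel[of t] aff by auto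
    then obtain f g where fg: "\<And>h. h \<in> F \<Longrightarrow> f h \<noteq> 0 \<and> h = {x. f h \<bullet> x \<le> g h} \<and> (\<forall>x \<in> E. (x + f h) \<in> E)" by metis
    have fE: "f h \<in> E" if "h \<in> F" for h using fg[OF that] subspace_0[OF subE] by fastforce
    have eqI: "\<Inter>F = {x. \<forall>(a, b)\<in>(\<lambda>h. (f h, g h)) ` F. a \<bullet> x \<le> b}" using fg by auto
    show ?thesis
    proof (intro exI conjI)
      show "finite ((\<lambda>h. (f h, g h)) ` F)" using F by auto
      show "t = E \<inter> {x. \<forall>(a, b)\<in>(\<lambda>h. (f h, g h)) ` F. a \<bullet> x \<le> b}" using F(2) eqI by simp
      show "\<forall>h\<in>(\<lambda>h. (f h, g h)) ` F. fst h \<in> E \<and> fst h \<noteq> 0" using fg fE by auto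
    qed
  qed
  then have "\<exists>H. \<forall>t\<in>\<T>. finite (H t) \<and> (\<forall>h\<in>H t. fst h \<in> E \<and> fst h \<noteq> 0) \<and> t = E \<inter> {x. \<forall>(a, b)\<in>H t. a \<bullet> x \<le> b}"
    by (intro bchoice ballI)
  then obtain H where H0: "\<forall>t\<in>\<T>. finite (H t) \<and> (\<forall>h\<in>H t. fst h \<in> E \<and> fst h \<noteq> 0) \<and> t = E \<inter> {x. \<forall>(a, b)\<in>H t. a \<bullet> x \<le> b}"
    by (elim exE)
  have H: "finite (H t)" "h \<in> H t \<Longrightarrow> fst h \<in> E \<and> fst h \<noteq> 0" "t = E \<inter> {x. \<forall>(a, b)\<in>H t. a \<bullet> x \<le> b}"
    if "t \<in> \<T>" for t h using H0 that by blast+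
  define HH where "HH = (\<Union>t\<in>\<T>. H t)"
  have HH: "finite HH" "\<And>h. h \<in> HH \<Longrightarrow> fst h \<in> E \<and> fst h \<noteq> 0"
    unfolding HH_def using H(1) finT apply blast using H(2) by blast
  have match: "E \<inter> hcell HH S \<subseteq> t" if "t \<in> \<T>" "H t \<subseteq> S" for t S
  proof
    fix x assume x: "x \<in> E \<inter> hcell HH S"
    have "a \<bullet> x \<le> b" if ab: "(a, b) \<in> H t" for a b
    proof -
      have "(a, b) \<in> HH" "(a, b) \<in> S" using ab \<open>t \<in> \<T>\<close> \<open>H t \<subseteq> S\<close> by (auto simp: HH_def)
      then show ?thesis using x by (auto simp: hcell_def)
    qed
    then have "x \<in> E \<inter> {x. \<forall>(a, b)\<in>H t. a \<bullet> x \<le> b}" using x by auto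
    then show "x \<in> t" using H(3)[OF that(1)] by blast
  qed
  \<comment> \<open>A cell on the wrong side of some facet hyperplane of \<open>t\<close> can meet
    \<open>t\<close> only within that hyperplane.\<close>
  have nomatch: "\<exists>h\<in>HH. t \<inter> hcell HH S \<subseteq> {x. fst h \<bullet> x = snd h}" if t: "t \<in> \<T>" "\<not> H t \<subseteq> S" for t S
  proof -
    obtain a b where ab: "(a, b) \<in> H t" "(a, b) \<notin> S" using t by auto
    have "a \<bullet> x = b" if "x \<in> t \<inter> hcell HH S" for x
    proof -
      have "x \<in> E \<inter> {x. \<forall>(a, b)\<in>H t. a \<bullet> x \<le> b}" using that H(3)[OF t(1)] by blast
      then have "a \<bullet> x \<le> b" using ab(1) by auto
      moreover have "(a, b) \<in> HH" using ab(1) t(1) by (auto simp: HH_def)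
      then have "b \<le> a \<bullet> x" using that ab(2) by (auto simp: hcell_def)
      ultimately show ?thesis by simp
    qed
    then show ?thesis using ab t(1) by (intro bexI[of _ "(a, b)"]) (auto simp: HH_def)
  qed
  have bcell: "body (K \<inter> hcell HH S)" if "body K" for K S
    using that closed_hcell convex_hcell by (intro body_Int)
  have z: "\<theta> (t \<inter> hcell HH S) = 0" if t: "t \<in> \<T>" "\<not> H t \<subseteq> S" for t S
    using nomatch[OF t] HH(2) flat[OF bcell[OF bt[OF t(1)]]] by blast
  \<comment> \<open>On each cell at most one simplex contributes: either a simplex contains the cell
    within \<open>Q\<close>, and the others meet it in flat sets, or the cell itself meets
    \<open>Q\<close> in a flat set.\<close>
  have main: "\<theta> (Q \<inter> hcell HH S) = (\<Sum>t\<in>\<T>. \<theta> (t \<inter> hcell HH S))" for S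
  proof (cases "\<exists>t\<in>\<T>. H t \<subseteq> S")
    case False
    \<comment> \<open>The convex set is covered by finitely many hyperplanes, hence a null set,
      hence of lower dimension. Measure is used to pass from a finite cover by hyperplanes to a
      single hyperplane.\<close>
    have "\<theta> (Q \<inter> hcell HH S) = 0"
    proof (cases "Q \<inter> hcell HH S = {}")
      case True then show ?thesis using empty by simp
    next
      case ne: False
      have b: "body (Q \<inter> hcell HH S)" using bcell[OF bQ] .
      have sub: "Q \<inter> hcell HH S \<subseteq> (\<Union>h\<in>HH. E \<inter> {x. fst h \<bullet> x = snd h})"
      proof
        fix x assume x: "x \<in> Q \<inter> hcell HH S"
        then obtain t where "t \<in> \<T>" "x \<in> t" using T by auto
        then show "x \<in> (\<Union>h\<in>HH. E \<inter> {x. fst h \<bullet> x = snd h})" using nomatch[of t S] False x tsub by blast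
      qed
      have Eb: "E \<inter> {x. fst h \<bullet> x = snd h} \<in> sets borel" for h :: "'a \<times> real"
        using closed_subspace[OF subE] closed_hyperplane by (intro borel_closed closed_Int)
      have "emeasure (lamE E) (Q \<inter> hcell HH S) \<le> emeasure (lamE E) (\<Union>h\<in>HH. E \<inter> {x. fst h \<bullet> x = snd h})"
      proof (rule emeasure_mono[OF sub])
        have "(\<Union>h\<in>HH. E \<inter> {x. fst h \<bullet> x = snd h}) \<in> sets borel" by (rule sets.finite_UN[OF HH(1) Eb])
        then show "(\<Union>h\<in>HH. E \<inter> {x. fst h \<bullet> x = snd h}) \<in> sets (lamE E)" by (simp only: sets_lamE)
      qed
      also have "\<dots> \<le> (\<Sum>h\<in>HH. emeasure (lamE E) (E \<inter> {x. fst h \<bullet> x = snd h}))"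
        using HH(1) Eb by (intro emeasure_subadditive_finite) auto
      also have "\<dots> = 0" using HH Eb by (intro sum.neutral) (auto intro!: emeasure_lamE_hyperplane[OF subE])
      finally have "emeasure (lamE E) (Q \<inter> hcell HH S) = 0" by simp
      then have "aff_dim (Q \<inter> hcell HH S) < int (dim E)"
        using b ne by (intro lamE_null_lowdim[OF subE]) (auto simp: body_def compact_imp_closed)
      then show ?thesis using lowdim_zero[OF b ne] by simp
    qed
    moreover have "(\<Sum>t\<in>\<T>. \<theta> (t \<inter> hcell HH S)) = 0" using False z by (intro sum.neutral) auto
    ultimately show ?thesis by simp
  next
    case True
    then obtain t where t: "t \<in> \<T>" "H t \<subseteq> S" by auto
    have Qt: "Q \<inter> hcell HH S = t \<inter> hcell HH S" using match[OF t] T(3) t tsub Q by blast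
    \<comment> \<open>If both simplices contain the cell, the piece lies in
      \<open>t \<inter> t'\<close>, a common face that is proper for at least one of them and so has
      lower dimension.\<close>
    have "\<theta> (t' \<inter> hcell HH S) = 0" if t': "t' \<in> \<T>" "t' \<noteq> t" for t'
    proof (cases "H t' \<subseteq> S")
      case False then show ?thesis using z t' by auto
    next
      case True
      have sub: "t' \<inter> hcell HH S \<subseteq> t \<inter> t'" using match[OF t] tsub[OF t'(1)] by blast
      show ?thesis
      proof (cases "t' \<inter> hcell HH S = {}")
        case False
        have f1: "(t \<inter> t') face_of t" "(t' \<inter> t) face_of t'" using T(1) t t' by (auto simp: triangulation_def)
        have "t \<inter> t' \<noteq> t \<or> t' \<inter> t \<noteq> t'" using t'(2) by blast
        then have "aff_dim (t \<inter> t') < int (dim E)"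
          using f1 face_of_aff_dim_lt[of t "t \<inter> t'"] face_of_aff_dim_lt[of t' "t' \<inter> t"] T(2) t(1) t'(1) bt
          by (auto simp: body_def Int_commute)
        moreover have "aff_dim (t' \<inter> hcell HH S) \<le> aff_dim (t \<inter> t')" using sub by (rule aff_dim_subset)
        ultimately show ?thesis using lowdim_zero[OF bcell[OF bt[OF t'(1)]] False] by simp
      qed (use empty in simp)
    qed
    then have "(\<Sum>t'\<in>\<T> - {t}. \<theta> (t' \<inter> hcell HH S)) = 0" by (intro sum.neutral) auto
    then show ?thesis using Qt sum.remove[OF finT t(1), of "\<lambda>t. \<theta> (t \<inter> hcell HH S)"] by simp
  qed
  have "\<theta> Q = (\<Sum>S\<in>Pow HH. \<Sum>t\<in>\<T>. \<theta> (t \<inter> hcell HH S))"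
    using arrangement_sum[OF HH(1) bQ HH(2)] main by simp
  also have "\<dots> = (\<Sum>t\<in>\<T>. \<Sum>S\<in>Pow HH. \<theta> (t \<inter> hcell HH S))" by (rule sum.swap)
  also have "\<dots> = (\<Sum>t\<in>\<T>. \<theta> t)"
    by (intro sum.cong refl arrangement_sum[OF HH(1) bt HH(2), symmetric])
  also have "\<dots> = 0" using t0 by simp
  finally show ?thesis .
qed

end

text \<open>Around each point of a finite net with mesh \<open>s / N\<close>, where
  \<open>N = dim E\<close>, put the cross-polytope with vertices at distance \<open>s\<close>. It
  contains the ball of radius \<open>s / N\<close>, so the convex hull of all these vertices
  contains \<open>K\<close> and stays within distance \<open>s\<close>.\<close>

lemma outer_polytope:
  fixes K :: "'a::euclidean_space set"
  assumes E: "subspace E" and n: "dim E \<ge> 1" and K: "conv_body K" "K \<subseteq> E" and s: "s > 0"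
  obtains Q where "polytope Q" "K \<subseteq> Q" "Q \<subseteq> E" "\<And>x. x \<in> Q \<Longrightarrow> \<exists>k\<in>K. dist x k \<le> s"
proof -
  obtain B where B: "B \<subseteq> E" "pairwise orthogonal B" "\<And>b. b \<in> B \<Longrightarrow> norm b = 1" "finite B" "card B = dim E" "span B = E"
    using orthonormal_basis_subspace_obtain[OF E] by metis
  define N where "N = real (dim E)"
  have npos: "N > 0" using n by (simp add: N_def)
  have cB: "real (card B) = N" using B(5) by (simp add: N_def)
  have cK: "compact K" using K by (simp add: conv_body_def)
  obtain F where F: "finite F" "F \<subseteq> K" "K \<subseteq> (\<Union>p\<in>F. ball p (s / N))"
    using compactE_image[OF cK, of K "\<lambda>p. ball p (s / N)"] s npos
    by (metis (no_types, lifting) UN_I centre_in_ball divide_pos_pos open_ball subsetI)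
  define V where "V = (\<Union>p\<in>F. \<Union>b\<in>B. {p + s *\<^sub>R b, p - s *\<^sub>R b})"
  have finV: "finite V" using F B by (auto simp: V_def)
  have VE: "V \<subseteq> E" using F(2) K(2) B(1) by (auto simp: V_def intro!: subspace_add[OF E] subspace_diff[OF E] subspace_scale[OF E])
  show ?thesis
  proof
    show "polytope (convex hull V)" using finV by (rule polytope_convex_hull)
    show "convex hull V \<subseteq> E" using VE E by (intro hull_minimal) (auto simp: subspace_imp_convex)
    show "K \<subseteq> convex hull V"
    proof
      fix x assume x: "x \<in> K"
      then obtain p where p: "p \<in> F" "dist p x < s / N" using F(3) by auto
      define y where "y = x - p"
      have ny: "norm y \<le> s / N" using p by (simp add: y_def dist_norm norm_minus_commute)
      have yE: "y \<in> E" using x p F(2) K(2) by (auto simp: y_def intro!: subspace_diff[OF E])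
      have "y = (\<Sum>b\<in>B. (y \<bullet> b) *\<^sub>R b)"
      proof -
        have "y - (\<Sum>b\<in>B. (y \<bullet> b) *\<^sub>R b) \<in> span B"
          using yE B(6) by (intro span_diff span_sum span_scale) (auto intro: span_base)
        moreover have "orthogonal (y - (\<Sum>b\<in>B. (y \<bullet> b) *\<^sub>R b)) i" if i: "i \<in> B" for i
        proof -
          have "(\<Sum>j\<in>B. (y \<bullet> j) *\<^sub>R j) \<bullet> i = (\<Sum>j\<in>B. if j = i then y \<bullet> i else 0)"
            unfolding inner_sum_left using i B(2,3)
            by (intro sum.cong) (auto simp: pairwise_def orthogonal_def norm_eq_1)
          also have "\<dots> = y \<bullet> i" using i B(4) by simp
          finally show ?thesis by (simp add: orthogonal_def inner_diff_left)
        qed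
        ultimately have "orthogonal (y - (\<Sum>b\<in>B. (y \<bullet> b) *\<^sub>R b)) (y - (\<Sum>b\<in>B. (y \<bullet> b) *\<^sub>R b))"
          by (rule orthogonal_to_span)
        then show ?thesis by (simp add: orthogonal_def)
      qed
      \<comment> \<open>\<open>x\<close> is the average over \<open>b\<close> of the points
        \<open>p + (N * (y \<bullet> b)) *\<^sub>R b\<close>, each of which lies on an axis of the
        cross-polytope at \<open>p\<close>.\<close>
      then have "x = (\<Sum>b\<in>B. (1 / N) *\<^sub>R (p + (N * (y \<bullet> b)) *\<^sub>R b))"
      proof -
        assume yB: "y = (\<Sum>b\<in>B. (y \<bullet> b) *\<^sub>R b)"
        have "(\<Sum>b\<in>B. (1 / N) *\<^sub>R (p + (N * (y \<bullet> b)) *\<^sub>R b)) = (\<Sum>b\<in>B. (1 / N) *\<^sub>R p) + (\<Sum>b\<in>B. (y \<bullet> b) *\<^sub>R b)"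
          using npos by (simp add: scaleR_add_right sum.distrib)
        also have "(\<Sum>b\<in>B. (1 / N) *\<^sub>R p) = p" using npos cB by (simp add: sum_constant_scaleR)
        finally show ?thesis using yB by (simp add: y_def)
      qed
      moreover have "(\<Sum>b\<in>B. (1 / N) *\<^sub>R (p + (N * (y \<bullet> b)) *\<^sub>R b)) \<in> convex hull V"
      proof (rule convex_sum[OF B(4) convex_convex_hull])
        show "(\<Sum>b\<in>B. 1 / N) = 1" using npos cB by simp
        fix b assume b: "b \<in> B"
        have "\<bar>y \<bullet> b\<bar> \<le> norm y * norm b" by (rule Cauchy_Schwarz_ineq2)
        also have "\<dots> \<le> s / N" using ny B(3)[OF b] by simp
        finally have yb: "\<bar>N * (y \<bullet> b)\<bar> \<le> s" using npos by (simp add: abs_mult pos_le_divide_eq mult.commute)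
        \<comment> \<open>The position on the segment from \<open>p - s *\<^sub>R b\<close> to
          \<open>p + s *\<^sub>R b\<close>.\<close>
        define l where "l = (1 + N * (y \<bullet> b) / s) / 2"
        have l: "0 \<le> l" "l \<le> 1" using yb s by (auto simp: l_def field_simps abs_le_iff)
        have ls: "s * (2 * l - 1) = N * (y \<bullet> b)" using s by (simp add: l_def field_simps)
        have "l *\<^sub>R (p + s *\<^sub>R b) + (1 - l) *\<^sub>R (p - s *\<^sub>R b) = p + (s * (2 * l - 1)) *\<^sub>R b"
          by (simp add: algebra_simps, subst scaleR_add_left[symmetric], simp)
        moreover have "l *\<^sub>R (p + s *\<^sub>R b) + (1 - l) *\<^sub>R (p - s *\<^sub>R b) \<in> convex hull V"
          using l p b by (intro convexD[OF convex_convex_hull]) (auto intro!: hull_inc simp: V_def)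
        ultimately show "p + (N * (y \<bullet> b)) *\<^sub>R b \<in> convex hull V" using ls by simp
      qed (use npos in auto)
      ultimately show "x \<in> convex hull V" by simp
    qed
    have "convex hull V \<subseteq> {x. \<exists>k\<in>K. dist x k \<le> s}"
    proof (rule hull_minimal)
      show "V \<subseteq> {x. \<exists>k\<in>K. dist x k \<le> s}"
        using F(2) B(3) s by (force simp: V_def dist_norm)
      show "convex {x. \<exists>k\<in>K. dist x k \<le> s}"
      proof (rule convexI)
        fix x y :: 'a and u v :: real
        assume xy: "x \<in> {x. \<exists>k\<in>K. dist x k \<le> s}" "y \<in> {x. \<exists>k\<in>K. dist x k \<le> s}" and uv: "0 \<le> u" "0 \<le> v" "u + v = 1"
        then obtain k l where kl: "k \<in> K" "dist x k \<le> s" "l \<in> K" "dist y l \<le> s" by auto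
        have "u *\<^sub>R k + v *\<^sub>R l \<in> K" using K(1) kl uv by (auto simp: conv_body_def convexD)
        moreover have "dist (u *\<^sub>R x + v *\<^sub>R y) (u *\<^sub>R k + v *\<^sub>R l) \<le> s"
        proof -
          have "(u *\<^sub>R x + v *\<^sub>R y) - (u *\<^sub>R k + v *\<^sub>R l) = u *\<^sub>R (x - k) + v *\<^sub>R (y - l)" by (simp add: algebra_simps)
          then have "dist (u *\<^sub>R x + v *\<^sub>R y) (u *\<^sub>R k + v *\<^sub>R l) \<le> norm (u *\<^sub>R (x - k)) + norm (v *\<^sub>R (y - l))"
            unfolding dist_norm by (metis norm_triangle_ineq)
          also have "\<dots> \<le> u * s + v * s" using kl uv by (auto simp: dist_norm intro!: add_mono mult_left_mono)
          also have "\<dots> = s" using uv by (metis distrib_right mult_1)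
          finally show ?thesis .
        qed
        ultimately show "u *\<^sub>R x + v *\<^sub>R y \<in> {x. \<exists>k\<in>K. dist x k \<le> s}" by blast
      qed
    qed
    then show "\<exists>k\<in>K. dist x k \<le> s" if "x \<in> convex hull V" for x using that by auto
  qed
qed

text \<open>Continuity is demanded only for sequences that contain \<open>K\<close> and approach it
  at a fixed rate, since these are what \<open>outer_polytope\<close> supplies. It is weak enough to
  be verified for integrals against the area measure.\<close>

lemma (in simple_val) vanish:
  assumes n: "dim E \<ge> 1"
    and simp: "\<And>a w. simple_val_dual E \<theta> r (dim E) a w \<Longrightarrow> \<theta> (orthoscheme E (dim E) w {..<dim E - 1}) = 0"
    and cont: "\<And>K Q. conv_body K \<Longrightarrow> K \<subseteq> E \<Longrightarrow> (\<And>m. conv_body (Q m)) \<Longrightarrow> (\<And>m. Q m \<subseteq> E) \<Longrightarrow> (\<And>m. K \<subseteq> Q m) \<Longrightarrow>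
        (\<And>m x. x \<in> Q m \<Longrightarrow> \<exists>k\<in>K. dist x k \<le> 1 / real (Suc m)) \<Longrightarrow> (\<lambda>m. \<theta> (Q m)) \<longlonglongrightarrow> \<theta> K"
    and K: "conv_body K" "K \<subseteq> E"
  shows "\<theta> K = 0"
proof -
  have simplex: "\<theta> (convex hull C) = 0" if C: "\<not> affine_dependent C" "card C = Suc (dim E)" "C \<subseteq> E" for C
  proof -
    show ?thesis
    proof (rule simplex_as_orthoscheme[OF C(1,2,3) subE refl n])
      fix a w :: "nat \<Rightarrow> 'a" and t :: 'a
      assume aw: "\<And>i. i < dim E \<Longrightarrow> w i \<in> E" "\<And>i. i < dim E \<Longrightarrow> a i \<in> E"
        "\<And>i l. i < dim E \<Longrightarrow> l < dim E \<Longrightarrow> w i \<bullet> a l = (if i = l then 1 else 0)"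
        "\<And>x. x \<in> E \<Longrightarrow> x = (\<Sum>i<dim E. (w i \<bullet> x) *\<^sub>R a i)"
        "t \<in> E" "convex hull C = (\<lambda>x. t + x) ` orthoscheme E (dim E) w {..<dim E - 1}"
      interpret D: simple_val_dual E \<theta> r "dim E" a w
      proof
        fix x assume "x \<in> E" then show "x = (\<Sum>i<dim E. (w i \<bullet> x) *\<^sub>R a i)" by (rule aw(4))
      qed (use n aw(1-3) in auto)
      have "\<theta> (convex hull C) = \<theta> (orthoscheme E (dim E) w {..<dim E - 1})"
        unfolding aw(6) by (rule trans[OF D.body_Z aw(5)]) simp
      then show ?thesis using simp[OF D.simple_val_dual_axioms] by simp
    qed
  qed
  have "\<forall>m. \<exists>Q. polytope Q \<and> K \<subseteq> Q \<and> Q \<subseteq> E \<and> (\<forall>x\<in>Q. \<exists>k\<in>K. dist x k \<le> 1 / real (Suc m))"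
  proof
    show "\<exists>Q. polytope Q \<and> K \<subseteq> Q \<and> Q \<subseteq> E \<and> (\<forall>x\<in>Q. \<exists>k\<in>K. dist x k \<le> 1 / real (Suc m))" for m
      by (rule outer_polytope[OF subE n K, of "1 / real (Suc m)"]) (simp, blast)
  qed
  then have "\<exists>Q. \<forall>m. polytope (Q m) \<and> K \<subseteq> Q m \<and> Q m \<subseteq> E \<and> (\<forall>x\<in>Q m. \<exists>k\<in>K. dist x k \<le> 1 / real (Suc m))"
    by (rule choice)
  then obtain Q where QQ: "\<forall>m. polytope (Q m) \<and> K \<subseteq> Q m \<and> Q m \<subseteq> E \<and> (\<forall>x\<in>Q m. \<exists>k\<in>K. dist x k \<le> 1 / real (Suc m))"
    by (elim exE)
  have Q: "polytope (Q m)" "K \<subseteq> Q m" "Q m \<subseteq> E" and Qd: "\<forall>x\<in>Q m. \<exists>k\<in>K. dist x k \<le> 1 / real (Suc m)" for m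
    using spec[OF QQ, of m] by simp_all
  have ne: "Q m \<noteq> {}" for m using Q(2)[of m] K by (auto simp: conv_body_def)
  have "(\<lambda>m. \<theta> (Q m)) \<longlonglongrightarrow> \<theta> K"
  proof (rule cont[OF K])
    show "conv_body (Q m)" for m using Q(1)[of m] ne by (simp add: conv_body_def polytope_imp_compact polytope_imp_convex)
    show "\<exists>k\<in>K. dist x k \<le> 1 / real (Suc m)" if "x \<in> Q m" for m x using Qd that by (rule bspec)
  qed (use Q in auto)
  moreover have "\<theta> (Q m) = 0" for m using polytope_vanish[OF n simplex Q(1) Q(3) ne] .
  ultimately have "(\<lambda>m. 0) \<longlonglongrightarrow> \<theta> K" by simp
  then show ?thesis by (simp add: LIMSEQ_const_iff)
qed

section \<open>Simple valuations of top degree\<close>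

lemma simple_val_lincomb:
  assumes "simple_val E \<theta>1 r" "simple_val E \<theta>2 r"
  shows "simple_val E (\<lambda>K. \<theta>1 K - c * \<theta>2 K) r"
proof -
  interpret A: simple_val E \<theta>1 r by fact
  interpret B: simple_val E \<theta>2 r by fact
  show ?thesis
  proof
    fix K a b assume K: "conv_body K" "K \<subseteq> E" "a \<in> E" "a \<noteq> 0"
    show "\<theta>1 K - c * \<theta>2 K = \<theta>1 (K \<inter> {x. a \<bullet> x \<le> b}) - c * \<theta>2 (K \<inter> {x. a \<bullet> x \<le> b})
       + (\<theta>1 (K \<inter> {x. b \<le> a \<bullet> x}) - c * \<theta>2 (K \<inter> {x. b \<le> a \<bullet> x}))"
      unfolding A.cut0[OF K, of b] B.cut0[OF K, of b] by (simp add: algebra_simps)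
  next
    fix K a b assume K: "conv_body K" "K \<subseteq> E" "a \<in> E" "a \<noteq> 0" "K \<subseteq> {x. a \<bullet> x = b}"
    show "\<theta>1 K - c * \<theta>2 K = 0" using A.flat0[OF K] B.flat0[OF K] by simp
  next
    fix K k assume K: "conv_body K" "K \<subseteq> E"
    show "\<theta>1 ((\<lambda>x. real (Suc k) *\<^sub>R x) ` K) - c * \<theta>2 ((\<lambda>x. real (Suc k) *\<^sub>R x) ` K) = real (Suc k) ^ r * (\<theta>1 K - c * \<theta>2 K)"
      unfolding A.hom0[OF K] B.hom0[OF K] by (simp add: algebra_simps)
  qed (simp_all add: A.subE A.empty B.empty A.trans0 B.trans0)
qed

lemma conv_body_borel: "conv_body K \<Longrightarrow> K \<in> sets borel"
  by (auto simp: conv_body_def compact_imp_closed)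

lemma emeasure_lamE_conv_body:
  assumes "subspace E" "conv_body K" shows "emeasure (lamE E) K < \<infinity>"
  using assms by (intro emeasure_lamE_bounded conv_body_borel) (auto simp: conv_body_def compact_imp_bounded)

lemma image_translation_vimage: "(\<lambda>x. t + x) ` K = (\<lambda>x. - t + x) -` K" for K :: "'a::real_vector set"
  by (auto simp: image_iff intro!: bexI[of _ "- t + _"])

lemma image_scale_vimage: "s \<noteq> 0 \<Longrightarrow> (\<lambda>x. s *\<^sub>R x) ` K = (\<lambda>x. (1 / s) *\<^sub>R x) -` K" for K :: "'a::real_vector set"
  by (auto simp: image_iff intro!: bexI[of _ "(1 / s) *\<^sub>R _"])

lemma measure_lamE_translation:
  assumes "subspace E" "t \<in> E" "K \<in> sets borel"
  shows "measure (lamE E) ((\<lambda>x. t + x) ` K) = measure (lamE E) K"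
  unfolding measure_def image_translation_vimage
  using emeasure_lamE_translation[of E "- t" K] assms subspace_neg by metis

lemma measure_lamE_scale:
  assumes E: "subspace E" and s: "s > 0" and K: "K \<in> sets borel"
  shows "measure (lamE E) ((\<lambda>x. s *\<^sub>R x) ` K) = s ^ dim E * measure (lamE E) K"
proof -
  let ?A = "(\<lambda>x. s *\<^sub>R x) ` K"
  have eq: "?A = (\<lambda>x. (1 / s) *\<^sub>R x) -` K" using s by (intro image_scale_vimage) simp
  have "(\<lambda>x. (1 / s) *\<^sub>R x) -` K \<in> sets borel" by (rule measurable_sets_borel[OF _ K]) simp
  then have A: "?A \<in> sets borel" using eq by simp
  have "(\<lambda>x. s *\<^sub>R x) -` ?A = K" using s by auto
  then have "emeasure (lamE E) ?A = ennreal (s ^ dim E) * emeasure (lamE E) K"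
    using emeasure_lamE_scale[OF E s A] by simp
  then show ?thesis using s by (simp add: measure_def enn2real_mult)
qed

lemma measure_lamE_hyperplane:
  "subspace E \<Longrightarrow> A \<in> sets borel \<Longrightarrow> a \<in> E \<Longrightarrow> a \<noteq> 0 \<Longrightarrow> A \<subseteq> {x. a \<bullet> x = b} \<Longrightarrow> measure (lamE E) A = 0"
  by (simp add: measure_def emeasure_lamE_hyperplane)

lemma simple_val_volume:
  fixes E :: "'a::euclidean_space set"
  assumes E: "subspace E"
  shows "simple_val E (\<lambda>K. measure (lamE E) K) (dim E)"
proof
  fix K a b assume K: "conv_body K" "K \<subseteq> E" "a \<in> E" "a \<noteq> (0::'a)"
  let ?A = "K \<inter> {x. a \<bullet> x \<le> b}" and ?B = "K \<inter> {x. b \<le> a \<bullet> x}"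
  have Kb: "K \<in> sets borel" using K(1) by (rule conv_body_borel)
  have fin: "emeasure (lamE E) K \<noteq> \<infinity>" using emeasure_lamE_conv_body[OF E K(1)] by auto
  have m: "?A \<in> sets (lamE E)" "?B \<in> sets (lamE E)" "K \<inter> {x. a \<bullet> x = b} \<in> sets borel"
    using Kb by (auto intro!: borel_closed closed_halfspace_le closed_halfspace_ge closed_hyperplane)
  have fm: "X \<in> fmeasurable (lamE E)" if "X \<in> sets (lamE E)" "X \<subseteq> K" for X
    using that fin Kb emeasure_mono[of X K "lamE E"] by (intro fmeasurableI) (auto simp: less_top[symmetric] top_unique)
  have "measure (lamE E) (?A \<union> ?B) = measure (lamE E) ?A + measure (lamE E) ?B - measure (lamE E) (?A \<inter> ?B)"
    by (rule measure_Un3; rule fm; use m in auto)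
  moreover have "?A \<union> ?B = K" by auto
  moreover have "?A \<inter> ?B = K \<inter> {x. a \<bullet> x = b}" by auto
  moreover have "measure (lamE E) (K \<inter> {x. a \<bullet> x = b}) = 0"
    using m K by (intro measure_lamE_hyperplane[OF E, of _ a b]) auto
  ultimately show "measure (lamE E) K = measure (lamE E) ?A + measure (lamE E) ?B" by simp
qed (use E in \<open>auto simp: conv_body_borel measure_lamE_translation measure_lamE_scale measure_lamE_hyperplane simp del: of_nat_Suc\<close>)

text \<open>Fixing the rate \<open>1 / real (Suc m)\<close> keeps the Hausdorff limit out of the
  hypothesis and matches the approximating polytopes used in \<open>vanish\<close>.\<close>

definition outer_continuous :: "'a::euclidean_space set \<Rightarrow> ('a set \<Rightarrow> real) \<Rightarrow> bool" where
  "outer_continuous E \<theta> \<longleftrightarrow> (\<forall>K Q. conv_body K \<and> K \<subseteq> E \<and> (\<forall>m. conv_body (Q m) \<and> Q m \<subseteq> E \<and> K \<subseteq> Q m \<and>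
     (\<forall>x\<in>Q m. \<exists>k\<in>K. dist x k \<le> 1 / real (Suc m))) \<longrightarrow> (\<lambda>m. \<theta> (Q m)) \<longlonglongrightarrow> \<theta> K)"

lemma infdist_attained_le: "k \<in> K \<Longrightarrow> dist x k \<le> s \<Longrightarrow> infdist x K \<le> s"
  using infdist_le2 by (metis)

lemma closed_infdist_le: "closed {x. infdist x K \<le> s}"
  by (intro closed_Collect_le continuous_intros)

text \<open>The approximating bodies lie between \<open>K\<close> and its closed parallel sets
  \<open>D m\<close>, which decrease to \<open>K\<close> because \<open>K\<close> is closed.\<close>

lemma outer_continuous_volume:
  fixes E :: "'a::euclidean_space set"
  assumes E: "subspace E" shows "outer_continuous E (\<lambda>K. measure (lamE E) K)"
  unfolding outer_continuous_def
proof (intro allI impI)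
  fix K :: "'a set" and Q
  assume KQ: "conv_body K \<and> K \<subseteq> E \<and> (\<forall>m. conv_body (Q m) \<and> Q m \<subseteq> E \<and> K \<subseteq> Q m \<and>
     (\<forall>x\<in>Q m. \<exists>k\<in>K. dist x k \<le> 1 / real (Suc m)))"
  define D where "D m = {x. infdist x K \<le> 1 / real (Suc m)}" for m
  have cK: "compact K" "K \<noteq> {}" using KQ by (auto simp: conv_body_def)
  have bD: "bounded (D m)" for m
  proof -
    obtain r where r: "\<And>k. k \<in> K \<Longrightarrow> norm k \<le> r" using compact_imp_bounded[OF cK(1)] by (auto simp: bounded_iff)
    have "norm x \<le> r + 1 / real (Suc m)" if "x \<in> D m" for x
    proof -
      obtain k where "k \<in> K" "infdist x K = dist x k" using infdist_attains_inf[OF compact_imp_closed[OF cK(1)] cK(2)] by metis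
      then show ?thesis using that r[of k] norm_triangle_sub[of x k] by (auto simp: D_def dist_norm)
    qed
    then show ?thesis by (auto simp: bounded_iff)
  qed
  have Db: "D m \<in> sets borel" for m unfolding D_def by (intro borel_closed closed_infdist_le)
  have fin: "emeasure (lamE E) (D m) \<noteq> \<infinity>" for m using emeasure_lamE_bounded[OF E Db bD] by (simp add: less_top)
  have decD: "decseq D"
    unfolding decseq_def D_def
  proof (intro allI impI subsetI)
    fix m n :: nat and x assume "m \<le> n" "x \<in> {x. infdist x K \<le> 1 / real (Suc n)}"
    moreover have "1 / real (Suc n) \<le> 1 / real (Suc m)" using \<open>m \<le> n\<close> by (intro divide_left_mono) auto
    ultimately show "x \<in> {x. infdist x K \<le> 1 / real (Suc m)}" by auto
  qed
  have "(\<Inter>m. D m) = K"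
  proof (intro equalityI subsetI)
    fix x assume "x \<in> (\<Inter>m. D m)"
    then have "infdist x K \<le> 1 / real (Suc m)" for m by (auto simp: D_def)
    moreover have "(\<lambda>m. 1 / real (Suc m)) \<longlonglongrightarrow> 0" by (rule LIMSEQ_Suc[OF lim_1_over_n])
    ultimately have "infdist x K \<le> 0" by (intro LIMSEQ_le_const) auto
    then have "infdist x K = 0" using infdist_nonneg[of x K] by linarith
    then show "x \<in> K" using in_closed_iff_infdist_zero[OF compact_imp_closed[OF cK(1)] cK(2)] by simp
  qed (auto simp: D_def)
  then have lim: "(\<lambda>m. measure (lamE E) (D m)) \<longlonglongrightarrow> measure (lamE E) K"
    using Lim_measure_decseq[of D "lamE E"] Db fin decD by auto
  have QD: "Q m \<subseteq> D m" for m
  proof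
    fix x assume "x \<in> Q m"
    then obtain k where "k \<in> K" "dist x k \<le> 1 / real (Suc m)" using KQ by blast
    then show "x \<in> D m" unfolding D_def using infdist_attained_le by blast
  qed
  have KQ': "conv_body K" "conv_body (Q m)" "K \<subseteq> Q m" for m using KQ by auto
  have m1: "measure (lamE E) (Q m) \<le> measure (lamE E) (D m)" for m
    using Db[of m] fin[of m] conv_body_borel[OF KQ'(2), of m]
    by (intro measure_mono_fmeasurable[OF QD]) (auto simp: fmeasurable_def less_top)
  have m2: "measure (lamE E) K \<le> measure (lamE E) (Q m)" for m
    using conv_body_borel[OF KQ'(2), of m] conv_body_borel[OF KQ'(1)] emeasure_lamE_conv_body[OF E KQ'(2), of m]
    by (intro measure_mono_fmeasurable[OF KQ'(3)]) (auto simp: fmeasurable_def)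
  show "(\<lambda>m. measure (lamE E) (Q m)) \<longlonglongrightarrow> measure (lamE E) K"
    by (rule tendsto_sandwich[OF _ _ tendsto_const lim]) (use m1 m2 in auto)
qed

lemma outer_continuous_lincomb:
  fixes E :: "'a::euclidean_space set"
  assumes "outer_continuous E \<theta>1" "outer_continuous E \<theta>2"
  shows "outer_continuous E (\<lambda>K. \<theta>1 K - c * \<theta>2 K)"
  unfolding outer_continuous_def
proof (intro allI impI)
  fix K :: "'a set" and Q
  assume KQ: "conv_body K \<and> K \<subseteq> E \<and> (\<forall>m. conv_body (Q m) \<and> Q m \<subseteq> E \<and> K \<subseteq> Q m \<and>
     (\<forall>x\<in>Q m. \<exists>k\<in>K. dist x k \<le> 1 / real (Suc m)))"
  have "(\<lambda>m. \<theta>1 (Q m)) \<longlonglongrightarrow> \<theta>1 K" "(\<lambda>m. \<theta>2 (Q m)) \<longlonglongrightarrow> \<theta>2 K"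
    by (rule assms(1)[unfolded outer_continuous_def, rule_format, OF KQ],
        rule assms(2)[unfolded outer_continuous_def, rule_format, OF KQ])
  then show "(\<lambda>m. \<theta>1 (Q m) - c * \<theta>2 (Q m)) \<longlonglongrightarrow> \<theta>1 K - c * \<theta>2 K"
    by (intro tendsto_intros)
qed

text \<open>A description by the basis \<open>a\<close> alone. It shows that the set does not depend
  on the choice of \<open>w\<close>, and allows path simplices over different bases to be compared
  by substitution in the coefficients.\<close>

lemma orthoscheme_sum:
  assumes "simple_val_dual E \<theta> r n a w" "S \<subseteq> {..<n - 1}"
  shows "orthoscheme E n w S = {\<Sum>i<n. t i *\<^sub>R a i | t. (\<forall>i<n. 0 \<le> t i \<and> t i \<le> 1) \<and> (\<forall>i\<in>S. t (Suc i) \<le> t i)}" (is "_ = ?R")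
proof -
  interpret simple_val_dual E \<theta> r n a w by fact
  have ws: "w i \<bullet> (\<Sum>l<n. t l *\<^sub>R a l) = t i" if "i < n" for t i using that by (rule w_sum)
  have Sn: "i < n" "Suc i < n" if "i \<in> S" for i using that assms(2) by auto
  show ?thesis
  proof (intro equalityI subsetI)
    fix x assume x: "x \<in> Z S"
    show "x \<in> ?R"
      by (intro CollectI exI[of _ "\<lambda>i. w i \<bullet> x"]) (use x expand in \<open>auto simp: orthoscheme_def\<close>)
  next
    fix x assume "x \<in> ?R"
    then obtain t where t: "x = (\<Sum>i<n. t i *\<^sub>R a i)" "\<forall>i<n. 0 \<le> t i \<and> t i \<le> 1" "\<forall>i\<in>S. t (Suc i) \<le> t i" by auto
    show "x \<in> Z S" unfolding t(1) orthoscheme_def using t(2,3) sum_in_E ws Sn by auto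
  qed
qed

section \<open>Parallelotopes over different bases\<close>

lemma sum_first_two: "2 \<le> n \<Longrightarrow> (\<Sum>i<n. f i) = f 0 + f 1 + (\<Sum>i\<in>{2..<n}. f i)" for f :: "nat \<Rightarrow> 'b::comm_monoid_add"
proof -
  assume n: "2 \<le> n"
  have "{..<n} = {0, 1} \<union> {2..<n}" using n by auto
  then have "(\<Sum>i<n. f i) = (\<Sum>i\<in>{0, 1}. f i) + (\<Sum>i\<in>{2..<n}. f i)"
    by (simp only:) (rule sum.union_disjoint, auto)
  then show ?thesis by simp
qed

text \<open>The parallelotope depends on the unordered set of its edges, whereas a path simplex
  depends on their order. Basis exchange is therefore carried out on sets.\<close>

definition boxset :: "'a::real_vector set \<Rightarrow> 'a set" where
  "boxset S = {\<Sum>v\<in>S. t v *\<^sub>R v | t. \<forall>v\<in>S. 0 \<le> t v \<and> t v \<le> 1}"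

locale top_val = simple_val E \<theta> "dim E" for E :: "'a::euclidean_space set" and \<theta> +
  assumes dimE: "dim E \<ge> 1" and cont: "outer_continuous E \<theta>"
begin

definition bas :: "'a set \<Rightarrow> bool" where "bas S \<longleftrightarrow> finite S \<and> independent S \<and> span S = E"

lemma bas_card: "bas S \<Longrightarrow> card S = dim E"
  by (metis bas_def dim_eq_card dim_span)

lemma is_basisI: assumes "finite S" "S \<subseteq> E" "E \<subseteq> span S" "card S \<le> dim E" shows "bas S"
proof -
  have "span S = E" using assms subE by (metis span_minimal subset_antisym)
  moreover have "independent S" using assms by (intro card_le_dim_spanning[of S E]) auto
  ultimately show ?thesis using assms by (simp add: bas_def)
qed

lemma bas_dual:
  assumes S: "bas S" and a: "bij_betw a {..<dim E} S"
  obtains w where "simple_val_dual E \<theta> (dim E) (dim E) a w" "boxset S = orthoscheme E (dim E) w {}"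
proof -
  have im: "a ` {..<dim E} = S" using a by (simp add: bij_betw_def)
  have sp: "span (a ` {..<dim E}) = E" using S im by (simp add: bas_def)
  show ?thesis
  proof (rule dual_family_exists[OF sp refl])
    fix w assume w: "\<And>i. i < dim E \<Longrightarrow> w i \<in> E" "\<And>i l. i < dim E \<Longrightarrow> l < dim E \<Longrightarrow> w i \<bullet> a l = (if i = l then 1 else 0)"
      "\<And>x. x \<in> E \<Longrightarrow> x = (\<Sum>i<dim E. (w i \<bullet> x) *\<^sub>R a i)"
    have aE: "a i \<in> E" if "i < dim E" for i using that sp by (metis imageI lessThan_iff span_base)
    have D: "simple_val_dual E \<theta> (dim E) (dim E) a w"
    proof
      fix x assume "x \<in> E" then show "x = (\<Sum>i<dim E. (w i \<bullet> x) *\<^sub>R a i)" by (rule w(3))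
    qed (use dimE aE w(1,2) in auto)
    have "boxset S = {\<Sum>i<dim E. t i *\<^sub>R a i | t. (\<forall>i<dim E. 0 \<le> t i \<and> t i \<le> 1)}" (is "_ = ?R")
    proof (intro equalityI subsetI)
      fix x assume "x \<in> boxset S"
      then obtain t where t: "x = (\<Sum>v\<in>S. t v *\<^sub>R v)" "\<forall>v\<in>S. 0 \<le> t v \<and> t v \<le> 1" by (auto simp: boxset_def)
      have "x = (\<Sum>i<dim E. t (a i) *\<^sub>R a i)" unfolding t(1) by (rule sum.reindex_bij_betw[OF a, symmetric])
      then show "x \<in> ?R" using t(2) im by (intro CollectI exI[of _ "\<lambda>i. t (a i)"]) auto
    next
      fix x assume "x \<in> ?R"
      then obtain t where t: "x = (\<Sum>i<dim E. t i *\<^sub>R a i)" "\<forall>i<dim E. 0 \<le> t i \<and> t i \<le> 1" by auto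
      let ?b = "the_inv_into {..<dim E} a"
      have b: "?b (a i) = i" if "i < dim E" for i using that a by (simp add: bij_betw_def the_inv_into_f_f)
      have "(\<Sum>v\<in>S. t (?b v) *\<^sub>R v) = (\<Sum>i<dim E. t (?b (a i)) *\<^sub>R a i)" by (rule sum.reindex_bij_betw[OF a, symmetric])
      also have "\<dots> = x" unfolding t(1) using b by (intro sum.cong) auto
      finally show "x \<in> boxset S" unfolding boxset_def using t(2) im b by (intro CollectI exI[of _ "\<lambda>v. t (?b v)"]) auto
    qed
    also have "\<dots> = orthoscheme E (dim E) w {}" using orthoscheme_sum[OF D, of "{}"] by simp
    finally show ?thesis using that D by blast
  qed
qed

lemma body_boxset: assumes "bas S" shows "body (boxset S)"
proof -
  have "finite S" "card S = dim E" using assms bas_card by (auto simp: bas_def)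
  then obtain a where a: "bij_betw a {..<dim E} S"
    using ex_bij_betw_nat_finite[of S] by (metis atLeast0LessThan)
  show ?thesis
  proof (rule bas_dual[OF assms a])
    fix w assume "simple_val_dual E \<theta> (dim E) (dim E) a w" and eq: "boxset S = orthoscheme E (dim E) w {}"
    then interpret simple_val_dual E \<theta> "dim E" "dim E" a w by simp
    show ?thesis unfolding eq by (rule body_Z) simp
  qed
qed

lemma orthoscheme_volume_pos:
  assumes "simple_val_dual E \<theta> r (dim E) a w"
  shows "measure (lamE E) (orthoscheme E (dim E) w {}) > 0"
proof -
  interpret D: simple_val_dual E \<theta> r "dim E" a w by fact
  let ?c = "\<Sum>l<dim E. (1 / 2) *\<^sub>R a l" and ?Z = "orthoscheme E (dim E) w {}"
  \<comment> \<open>Bounds all \<open>norm (w i)\<close> at once, so that a displacement of at most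
    \<open>1 / (2 * M)\<close> from the centre changes each coordinate by at most one half.\<close>
  define M where "M = (\<Sum>i<dim E. norm (w i)) + 1"
  have M: "norm (w i) \<le> M" if "i < dim E" for i
    unfolding M_def using that member_le_sum[of i "{..<dim E}" "\<lambda>i. norm (w i)"] by simp
  have M0: "M > 0" unfolding M_def by (intro add_nonneg_pos sum_nonneg) auto
  have b: "D.body ?Z" by (rule D.body_Z) simp
  then have Zb: "?Z \<in> sets borel" "bounded ?Z" by (auto simp: D.body_def compact_imp_closed compact_imp_bounded)
  have "ball ?c (1 / (2 * M)) \<inter> E \<subseteq> ?Z"
  proof
    fix x assume x: "x \<in> ball ?c (1 / (2 * M)) \<inter> E"
    have "0 \<le> w i \<bullet> x \<and> w i \<bullet> x \<le> 1" if i: "i < dim E" for i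
    proof -
      have "w i \<bullet> x - 1 / 2 = w i \<bullet> (x - ?c)" using D.w_sum[OF i] by (simp add: inner_diff_right)
      then have "\<bar>w i \<bullet> x - 1 / 2\<bar> \<le> norm (w i) * norm (x - ?c)" using Cauchy_Schwarz_ineq2 by metis
      also have "\<dots> \<le> M * (1 / (2 * M))" using M[OF i] x M0 by (intro mult_mono) (auto simp: dist_norm norm_minus_commute)
      also have "\<dots> = 1 / 2" using M0 by simp
      finally show ?thesis unfolding abs_le_iff by linarith
    qed
    then show "x \<in> ?Z" using x by (auto simp: orthoscheme_def)
  qed
  then have "emeasure (lamE E) ?Z > 0"
    using Zb M0 by (intro emeasure_lamE_pos[OF subE _ D.sum_in_E]) auto
  then show ?thesis using emeasure_lamE_bounded[OF subE Zb] by (simp add: measure_def enn2real_positive_iff)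
qed

text \<open>Apply \<open>simplex_vanish_box\<close> to \<open>\<theta> - c vol\<close>, where \<open>c\<close> makes this vanish on the parallelotope or
  on its path simplex.\<close>
lemma box_iff_simplex:
  assumes D: "simple_val_dual E \<theta> (dim E) (dim E) a w"
  shows "\<theta> (orthoscheme E (dim E) w {}) = 0 \<longleftrightarrow> \<theta> (orthoscheme E (dim E) w {..<dim E - 1}) = 0"
proof -
  interpret D: simple_val_dual E \<theta> "dim E" "dim E" a w by fact
  let ?Z = "orthoscheme E (dim E) w {}" and ?T = "orthoscheme E (dim E) w {..<dim E - 1}"
  let ?v = "\<lambda>K. measure (lamE E) K"
  have vpos: "?v ?Z > 0" by (rule orthoscheme_volume_pos[OF D])
  define c where "c = \<theta> ?Z / ?v ?Z"
  have S: "simple_val E (\<lambda>K. \<theta> K - c * ?v K) (dim E)"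
    by (rule simple_val_lincomb[OF simple_val_axioms simple_val_volume[OF subE]])
  interpret C: simple_val E "\<lambda>K. \<theta> K - c * ?v K" "dim E" by (rule S)
  interpret C: simple_val_dual E "\<lambda>K. \<theta> K - c * ?v K" "dim E" "dim E" a w
  proof
    fix x assume "x \<in> E" then show "x = (\<Sum>i<dim E. (w i \<bullet> x) *\<^sub>R a i)" by (rule D.expand)
  qed (use D.n D.wE D.aE D.dual in auto)
  have "\<theta> ?Z - c * ?v ?Z = 0" using vpos by (simp add: c_def)
  then have "\<theta> ?T - c * ?v ?T = 0" by (rule C.simplex_vanish_box[OF refl])
  \<comment> \<open>The path simplex is not flat: its vertices are partial sums of the
    \<open>a l\<close>, so a vector \<open>p\<close> constant on it is orthogonal to all
    \<open>a k\<close> and hence 0. With nonzero volumes, each of the two values of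
    \<open>\<theta>\<close> vanishes exactly when \<open>c\<close> does.\<close>
  moreover have "?v ?T \<noteq> 0"
  proof
    assume z: "?v ?T = 0"
    interpret V: simple_val E ?v "dim E" by (rule simple_val_volume[OF subE])
    interpret V: simple_val_dual E ?v "dim E" "dim E" a w
    proof
      fix x assume "x \<in> E" then show "x = (\<Sum>i<dim E. (w i \<bullet> x) *\<^sub>R a i)" by (rule D.expand)
    qed (use D.n D.wE D.aE D.dual in auto)
    have bT: "body ?T" by (rule D.body_Z) simp
    have ne: "?T \<noteq> {}" using subspace_0[OF subE] by (auto simp: orthoscheme_def)
    have "emeasure (lamE E) ?T = 0"
      using z emeasure_lamE_bounded[OF subE, of ?T] bT
      by (auto simp: body_def compact_imp_closed compact_imp_bounded measure_def enn2real_eq_0_iff)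
    then have "aff_dim ?T < int (dim E)"
      using bT ne by (intro lamE_null_lowdim[OF subE]) (auto simp: body_def compact_imp_closed)
    then obtain p b where pb: "p \<in> E" "p \<noteq> 0" "?T \<subseteq> {x. p \<bullet> x = b}"
      using lowdim_subset_hyperplane[OF subE, of ?T] bT ne by (metis body_def)
    have mem: "(\<Sum>l<dim E. (if l < k then 1 else 0) *\<^sub>R a l) \<in> ?T" for k
      using D.sum_in_E D.w_sum by (auto simp: orthoscheme_def)
    have "p \<bullet> a k = 0" if k: "k < dim E" for k
    proof -
      have "(\<Sum>l<dim E. (if l < Suc k then 1 else 0) *\<^sub>R a l) = (\<Sum>l<dim E. (if l < k then 1 else 0) *\<^sub>R a l + (if l = k then 1 else 0) *\<^sub>R a l)"
        by (intro sum.cong) auto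
      also have "\<dots> = (\<Sum>l<dim E. (if l < k then 1 else 0) *\<^sub>R a l) + a k"
        using k by (simp add: sum.distrib if_distrib[of "\<lambda>c. c *\<^sub>R _"] cong: if_cong)
      finally have eq: "(\<Sum>l<dim E. (if l < Suc k then 1 else 0) *\<^sub>R a l) = (\<Sum>l<dim E. (if l < k then 1 else 0) *\<^sub>R a l) + a k" .
      have "p \<bullet> (\<Sum>l<dim E. (if l < m then 1 else 0) *\<^sub>R a l) = b" for m
        using mem[of m] pb(3) by blast
      from this[of k] this[of "Suc k"] show ?thesis unfolding eq inner_add_right by simp
    qed
    then have "p \<bullet> p = 0" using D.expand[OF pb(1)] by (metis (no_types, lifting) inner_scaleR_right inner_sum_right lessThan_iff mult_zero_right sum.neutral)
    then show False using pb by simp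
  qed
  ultimately show ?thesis using vpos by (auto simp: c_def)
qed

text \<open>Reversing an edge replaces its coefficient by one minus itself, which amounts to a
  translation by that edge.\<close>

lemma boxset_uminus:
  assumes S: "finite S" "x \<notin> S" "- x \<notin> S"
  shows "boxset (insert (- x) S) = (\<lambda>y. - x + y) ` boxset (insert x S)"
proof (intro equalityI subsetI)
  fix y assume "y \<in> boxset (insert (- x) S)"
  then obtain t where t: "y = t (- x) *\<^sub>R (- x) + (\<Sum>v\<in>S. t v *\<^sub>R v)" "\<forall>v\<in>insert (- x) S. 0 \<le> t v \<and> t v \<le> 1"
    using S by (auto simp: boxset_def)
  let ?u = "t(x := 1 - t (- x))"
  have "(\<Sum>v\<in>S. ?u v *\<^sub>R v) = (\<Sum>v\<in>S. t v *\<^sub>R v)" using S by (intro sum.cong) auto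
  then have "y = - x + (\<Sum>v\<in>insert x S. ?u v *\<^sub>R v)" using S t by (simp add: algebra_simps)
  moreover have "(\<Sum>v\<in>insert x S. ?u v *\<^sub>R v) \<in> boxset (insert x S)"
    unfolding boxset_def using t(2) by (intro CollectI exI[of _ ?u]) auto
  ultimately show "y \<in> (\<lambda>y. - x + y) ` boxset (insert x S)" by blast
next
  fix y assume "y \<in> (\<lambda>y. - x + y) ` boxset (insert x S)"
  then obtain t where t: "y = - x + (t x *\<^sub>R x + (\<Sum>v\<in>S. t v *\<^sub>R v))" "\<forall>v\<in>insert x S. 0 \<le> t v \<and> t v \<le> 1"
    using S by (auto simp: boxset_def)
  let ?u = "t(- x := 1 - t x)"
  have "(\<Sum>v\<in>S. ?u v *\<^sub>R v) = (\<Sum>v\<in>S. t v *\<^sub>R v)" using S by (intro sum.cong) auto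
  then have "y = (\<Sum>v\<in>insert (- x) S. ?u v *\<^sub>R v)" using S t by (simp add: algebra_simps)
  then show "y \<in> boxset (insert (- x) S)" unfolding boxset_def using t(2) by (intro CollectI exI[of _ ?u]) auto
qed

lemma bas_insert_notin:
  assumes "bas (insert x R)" "x \<notin> R" and z: "z = c *\<^sub>R x + u" "c \<noteq> 0" "u \<in> span R"
  shows "bas (insert z R)" "z \<notin> R" "z \<notin> span R"
proof -
  have ind: "x \<notin> span R" using assms(1,2) by (simp add: bas_def independent_insert)
  have fR: "finite R" using assms(1) by (simp add: bas_def)
  show zn: "z \<notin> span R"
  proof
    assume "z \<in> span R"
    then have "z - u \<in> span R" using z by (intro span_diff)
    then have "(1 / c) *\<^sub>R (z - u) \<in> span R" by (rule span_scale)
    then show False using ind z by simp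
  qed
  then show znR: "z \<notin> R" using span_base by blast
  have R: "R \<subseteq> E" "x \<in> E" "span (insert x R) = E"
    using assms(1) span_superset[of "insert x R"] by (auto simp: bas_def)
  have uE: "u \<in> E" using z(3) R subE span_minimal by blast
  have zE: "z \<in> E" using z R uE by (simp add: subspace_add[OF subE] subspace_scale[OF subE])
  show "bas (insert z R)"
  proof (rule is_basisI)
    show "E \<subseteq> span (insert z R)"
    proof -
      have "u \<in> span (insert z R)" using z(3) span_mono[of R "insert z R"] by blast
      moreover have "z \<in> span (insert z R)" by (rule span_base) simp
      ultimately have "(1 / c) *\<^sub>R (z - u) \<in> span (insert z R)" by (intro span_scale span_diff)
      then have "x \<in> span (insert z R)" using z by simp
      then have "span (insert x R) \<subseteq> span (insert z R)" by (intro span_minimal) (auto intro: span_base)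
      then show ?thesis using R by simp
    qed
    show "card (insert z R) \<le> dim E" using bas_card[OF assms(1)] fR znR assms(2) by simp
  qed (use fR zE R in auto)
qed

text \<open>The path \<open>0\<close>, \<open>x\<close>, \<open>x + y\<close>, and so on, visits the
  same vertices as the path that starts at \<open>x\<close> with the steps \<open>- x\<close>,
  \<open>x + y\<close> and continues as before. So the two parallelotopes share a path simplex up to
  translation, and \<open>box_iff_simplex\<close> carries the zero from one to the other.\<close>

lemma shear_zero:
  assumes S: "bas (insert x (insert y R))" "x \<noteq> y" "x \<notin> R" "y \<notin> R" and z: "\<theta> (boxset (insert x (insert y R))) = 0"
  shows "\<theta> (boxset (insert x (insert (x + y) R))) = 0"
proof -
  let ?n = "dim E"
  let ?S = "insert x (insert y R)" and ?S' = "insert (- x) (insert (x + y) R)" and ?S'' = "insert x (insert (x + y) R)"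
  have fR: "finite R" using S by (simp add: bas_def)
  have n2: "2 \<le> ?n" using bas_card[OF S(1)] S fR by simp
  have cR: "card R = ?n - 2" using bas_card[OF S(1)] S fR by simp
  obtain g where g: "bij_betw g {..<?n - 2} R" using ex_bij_betw_nat_finite[OF fR] cR by (metis atLeast0LessThan)
  define a where "a i = (if i = 0 then x else if i = 1 then y else g (i - 2))" for i
  define a' where "a' i = (if i = 0 then - x else if i = 1 then x + y else g (i - 2))" for i
  have h: "bij_betw (\<lambda>i. g (i - 2)) {2..<?n} R"
  proof -
    have "bij_betw (\<lambda>i. i - 2) {2..<?n} {..<?n - 2}" by (rule bij_betwI[where g="\<lambda>i. i + 2"]) auto
    then show ?thesis using bij_betw_trans[OF _ g] by (simp add: comp_def)
  qed
  have un: "{..<?n} = {0, 1} \<union> {2..<?n}" using n2 by auto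
  have bij: "bij_betw (\<lambda>i. if i = 0 then p else if i = 1 then q else g (i - 2)) {..<?n} (insert p (insert q R))"
    if "p \<noteq> q" "p \<notin> R" "q \<notin> R" for p q
  proof -
    have 1: "bij_betw (\<lambda>i. if i = 0 then p else if i = 1 then q else g (i - 2)) {0, 1} {p, q}"
      using that by (auto simp: bij_betw_def inj_on_def)
    have 2: "bij_betw (\<lambda>i. if i = 0 then p else if i = 1 then q else g (i - 2)) {2..<?n} R"
      using h by (rule bij_betw_cong[THEN iffD1, rotated]) auto
    have "bij_betw (\<lambda>i. if i = 0 then p else if i = 1 then q else g (i - 2)) ({0, 1} \<union> {2..<?n}) ({p, q} \<union> R)"
      using 1 2 by (rule bij_betw_combine) (use that in auto)
    then show ?thesis unfolding un by simp
  qed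
  have bij_a: "bij_betw a {..<?n} ?S" unfolding a_def[abs_def] using S by (intro bij) auto
  have b1: "bas (insert (x + y) (insert x R))" "x + y \<notin> insert x R" "x + y \<notin> span (insert x R)"
    by (rule bas_insert_notin[of y "insert x R" "x + y" 1 x]; use S in \<open>auto simp: insert_commute intro: span_base\<close>)+
  have xn: "x \<notin> insert (x + y) R" using b1(2) S(3) by auto
  have b2: "bas ?S'" "- x \<notin> insert (x + y) R"
    by (rule bas_insert_notin[of x "insert (x + y) R" "- x" "- 1" 0]; use b1 xn in \<open>auto simp: insert_commute span_zero\<close>)+
  have b3: "bas ?S''" using b1(1) by (simp add: insert_commute)
  have bij_a': "bij_betw a' {..<?n} ?S'" unfolding a'_def[abs_def] using b1 b2 by (intro bij) auto
  show ?thesis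
  proof (rule bas_dual[OF S(1) bij_a], rule bas_dual[OF b2(1) bij_a'])
    fix w w' assume D: "simple_val_dual E \<theta> ?n ?n a w" "boxset ?S = orthoscheme E ?n w {}"
      and D': "simple_val_dual E \<theta> ?n ?n a' w'" "boxset ?S' = orthoscheme E ?n w' {}"
    interpret D: simple_val_dual E \<theta> ?n ?n a w by (rule D(1))
    interpret D': simple_val_dual E \<theta> ?n ?n a' w' by (rule D'(1))
    let ?T = "orthoscheme E ?n w {..<?n - 1}" and ?T' = "orthoscheme E ?n w' {..<?n - 1}"
    have T0: "\<theta> ?T = 0" using box_iff_simplex[OF D(1)] z D(2) by simp
    \<comment> \<open>The change of coefficients under swapping the first two vertices: comparing
      the coefficients of \<open>x\<close> in \<open>t 0 *\<^sub>R x + t 1 *\<^sub>R y\<close> and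
      the new sum gives \<open>1 - t 0 + t 1\<close>. It is an involution preserving the order
      constraints.\<close>
    define \<tau> where "\<tau> t = t(0 := 1 - t 0 + t 1)" for t :: "nat \<Rightarrow> real"
    have \<tau>1: "(\<Sum>i<?n. t i *\<^sub>R a i) = x + (\<Sum>i<?n. \<tau> t i *\<^sub>R a' i)" for t
    proof -
      have "(\<Sum>i\<in>{2..<?n}. \<tau> t i *\<^sub>R a' i) = (\<Sum>i\<in>{2..<?n}. t i *\<^sub>R a i)"
        by (intro sum.cong) (auto simp: \<tau>_def a_def a'_def)
      then show ?thesis unfolding sum_first_two[OF n2] by (simp add: \<tau>_def a_def a'_def algebra_simps)
    qed
    have \<tau>2: "\<tau> (\<tau> t) = t" for t by (auto simp: \<tau>_def)
    have \<tau>3: "(\<forall>i<?n. 0 \<le> \<tau> t i \<and> \<tau> t i \<le> 1) \<and> (\<forall>i\<in>{..<?n - 1}. \<tau> t (Suc i) \<le> \<tau> t i)"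
      if t: "\<forall>i<?n. 0 \<le> t i \<and> t i \<le> 1" "\<forall>i\<in>{..<?n - 1}. t (Suc i) \<le> t i" for t
    proof -
      have "t 1 \<le> t 0" using t(2) n2 by auto
      moreover have "0 \<le> t 1" "t 0 \<le> 1" using t(1) n2 by auto
      ultimately show ?thesis using t by (auto simp: \<tau>_def)
    qed
    have "?T = (\<lambda>v. x + v) ` ?T'"
    proof (intro equalityI subsetI)
      fix p assume "p \<in> ?T"
      then obtain t where t: "p = (\<Sum>i<?n. t i *\<^sub>R a i)" "\<forall>i<?n. 0 \<le> t i \<and> t i \<le> 1" "\<forall>i\<in>{..<?n - 1}. t (Suc i) \<le> t i"
        unfolding orthoscheme_sum[OF D(1) order_refl] by blast
      have "(\<Sum>i<?n. \<tau> t i *\<^sub>R a' i) \<in> ?T'"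
        unfolding orthoscheme_sum[OF D'(1) order_refl] using \<tau>3[OF t(2,3)] by blast
      then show "p \<in> (\<lambda>v. x + v) ` ?T'" using t(1) \<tau>1 by auto
    next
      fix p assume "p \<in> (\<lambda>v. x + v) ` ?T'"
      then obtain t where t: "p = x + (\<Sum>i<?n. t i *\<^sub>R a' i)" "\<forall>i<?n. 0 \<le> t i \<and> t i \<le> 1" "\<forall>i\<in>{..<?n - 1}. t (Suc i) \<le> t i"
        unfolding orthoscheme_sum[OF D'(1) order_refl] by blast
      have "p = (\<Sum>i<?n. \<tau> t i *\<^sub>R a i)" using t(1) \<tau>1[of "\<tau> t"] \<tau>2 by simp
      then show "p \<in> ?T" unfolding orthoscheme_sum[OF D(1) order_refl] using \<tau>3[OF t(2,3)] by blast
    qed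
    moreover have xE: "x \<in> E" using S(1) span_superset[of ?S] by (auto simp: bas_def)
    moreover have "body ?T'" by (rule D'.body_Z) simp
    ultimately have "\<theta> ?T' = 0" using T0 trans by metis
    then have "\<theta> (boxset ?S') = 0" using box_iff_simplex[OF D'(1)] D'(2) by simp
    moreover have "boxset ?S' = (\<lambda>y. - x + y) ` boxset ?S''"
      using fR xn b2(2) by (intro boxset_uminus) auto
    ultimately show "\<theta> (boxset ?S'') = 0" using trans[OF body_boxset[OF b3], of "- x"] xE subspace_neg[OF subE] by simp
  qed
qed

lemma bas_dual_set:
  assumes S: "bas S"
  obtains W where "\<And>v. v \<in> S \<Longrightarrow> W v \<in> E" "\<And>u v. u \<in> S \<Longrightarrow> v \<in> S \<Longrightarrow> W u \<bullet> v = (if u = v then 1 else 0)"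
    "\<And>y. y \<in> E \<Longrightarrow> y = (\<Sum>v\<in>S. (W v \<bullet> y) *\<^sub>R v)"
proof -
  have "finite S" "card S = dim E" using S bas_card by (auto simp: bas_def)
  then obtain a where a: "bij_betw a {..<dim E} S"
    using ex_bij_betw_nat_finite[of S] by (metis atLeast0LessThan)
  have im: "a ` {..<dim E} = S" using a by (simp add: bij_betw_def)
  have sp: "span (a ` {..<dim E}) = E" using S im by (simp add: bas_def)
  let ?b = "the_inv_into {..<dim E} a"
  have b: "bij_betw ?b S {..<dim E}" by (rule bij_betw_the_inv_into[OF a])
  have ab: "a (?b v) = v" if "v \<in> S" for v using that f_the_inv_into_f_bij_betw[OF a] by simp
  have bS: "?b v < dim E" if "v \<in> S" for v using bij_betwE[OF b] that by auto
  show ?thesis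
  proof (rule dual_family_exists[OF sp refl])
    fix w assume w: "\<And>i. i < dim E \<Longrightarrow> w i \<in> E" "\<And>i l. i < dim E \<Longrightarrow> l < dim E \<Longrightarrow> w i \<bullet> a l = (if i = l then 1 else 0)"
      "\<And>x. x \<in> E \<Longrightarrow> x = (\<Sum>i<dim E. (w i \<bullet> x) *\<^sub>R a i)"
    have "W \<in> E \<and> W = w (?b v)" if "v \<in> S" "W = w (?b v)" for v W using w(1) bS that by auto
    moreover have "w (?b u) \<bullet> v = (if u = v then 1 else 0)" if "u \<in> S" "v \<in> S" for u v
    proof -
      have "w (?b u) \<bullet> a (?b v) = (if ?b u = ?b v then 1 else 0)" using w(2) bS that by auto
      moreover have "?b u = ?b v \<longleftrightarrow> u = v" using ab that by metis
      ultimately show ?thesis using ab that by simp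
    qed
    moreover have "y = (\<Sum>v\<in>S. (w (?b v) \<bullet> y) *\<^sub>R v)" if "y \<in> E" for y
    proof -
      have "(\<Sum>v\<in>S. (w (?b v) \<bullet> y) *\<^sub>R v) = (\<Sum>v\<in>S. (w (?b v) \<bullet> y) *\<^sub>R a (?b v))" using ab by (intro sum.cong) auto
      also have "\<dots> = (\<Sum>i<dim E. (w i \<bullet> y) *\<^sub>R a i)" by (rule sum.reindex_bij_betw[OF b])
      finally show ?thesis using w(3)[OF that] by simp
    qed
    ultimately show ?thesis using that[of "\<lambda>v. w (?b v)"] by blast
  qed
qed

text \<open>As a function of the edge length the value satisfies the Cauchy equation, by cutting
  across the edge. It vanishes at 1, hence at all positive rationals, and outer continuity along
  rationals above \<open>s\<close> extends this to every \<open>s\<close>.\<close>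

lemma scale_zero_pos:
  assumes S: "bas (insert x R)" "x \<notin> R" and s: "s > 0" and z: "\<theta> (boxset (insert x R)) = 0"
  shows "\<theta> (boxset (insert (s *\<^sub>R x) R)) = 0"
proof (rule bas_dual_set[OF S(1)])
  fix W assume W: "\<And>v. v \<in> insert x R \<Longrightarrow> W v \<in> E"
    "\<And>u v. u \<in> insert x R \<Longrightarrow> v \<in> insert x R \<Longrightarrow> W u \<bullet> v = (if u = v then 1 else 0)"
    "\<And>y. y \<in> E \<Longrightarrow> y = (\<Sum>v\<in>insert x R. (W v \<bullet> y) *\<^sub>R v)"
  have fR: "finite R" using S by (simp add: bas_def)
  have xE: "x \<in> E" and RE: "R \<subseteq> E" using S(1) span_superset[of "insert x R"] by (auto simp: bas_def)
  have Wx: "W x \<in> E" "W x \<bullet> x = 1" "W x \<noteq> 0" using W(1)[of x] W(2)[of x x] by auto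
  have Wxv: "W x \<bullet> v = 0" "W v \<bullet> x = 0" if "v \<in> R" for v using W(2)[of x v] W(2)[of v x] that S(2) by auto
  define B where "B s = {y \<in> E. 0 \<le> W x \<bullet> y \<and> W x \<bullet> y \<le> s \<and> (\<forall>v\<in>R. 0 \<le> W v \<bullet> y \<and> W v \<bullet> y \<le> 1)}" for s
  have bs: "bas (insert (s *\<^sub>R x) R)" "s *\<^sub>R x \<notin> R" if "s > 0" for s
    by (rule bas_insert_notin[OF S, of "s *\<^sub>R x" s 0]; use that in \<open>auto simp: span_zero\<close>)+
  have Beq: "boxset (insert (s *\<^sub>R x) R) = B s" if s: "s > 0" for s
  proof (intro equalityI subsetI)
    fix y assume "y \<in> boxset (insert (s *\<^sub>R x) R)"
    then obtain t where t: "y = t (s *\<^sub>R x) *\<^sub>R s *\<^sub>R x + (\<Sum>v\<in>R. t v *\<^sub>R v)" "\<forall>v\<in>insert (s *\<^sub>R x) R. 0 \<le> t v \<and> t v \<le> 1"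
      using bs(2)[OF s] fR by (auto simp: boxset_def)
    have sR: "W u \<bullet> (\<Sum>v\<in>R. t v *\<^sub>R v) = (if u = x then 0 else t u)" if "u \<in> insert x R" for u
    proof -
      have "W u \<bullet> (\<Sum>v\<in>R. t v *\<^sub>R v) = (\<Sum>v\<in>R. if v = u then t u else 0)"
        unfolding inner_sum_right using W(2) that by (intro sum.cong) auto
      then show ?thesis using fR S(2) that by auto
    qed
    have "y \<in> E" unfolding t(1) using xE RE
      by (intro subspace_add[OF subE] subspace_scale[OF subE] subspace_sum[OF subE]) auto
    moreover have "W x \<bullet> y = t (s *\<^sub>R x) * s" using sR[of x] Wx by (simp add: t(1) inner_add_right)
    moreover have "W v \<bullet> y = t v" if "v \<in> R" for v
      using sR[of v] Wxv[OF that] that S(2) by (auto simp: t(1) inner_add_right)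
    ultimately show "y \<in> B s" using t(2) s by (auto simp: B_def mult_left_le_one_le)
  next
    fix y assume y: "y \<in> B s"
    let ?t = "\<lambda>v. if v = s *\<^sub>R x then (W x \<bullet> y) / s else W v \<bullet> y"
    have "y = (W x \<bullet> y) *\<^sub>R x + (\<Sum>v\<in>R. (W v \<bullet> y) *\<^sub>R v)" using W(3)[of y] y fR S(2) by (auto simp: B_def)
    also have "(\<Sum>v\<in>R. (W v \<bullet> y) *\<^sub>R v) = (\<Sum>v\<in>R. ?t v *\<^sub>R v)" using bs(2)[OF s] by (intro sum.cong) auto
    also have "(W x \<bullet> y) *\<^sub>R x = ?t (s *\<^sub>R x) *\<^sub>R (s *\<^sub>R x)" using s by simp
    finally have "y = (\<Sum>v\<in>insert (s *\<^sub>R x) R. ?t v *\<^sub>R v)" using fR bs(2)[OF s] by simp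
    then show "y \<in> boxset (insert (s *\<^sub>R x) R)" unfolding boxset_def using y s
      by (intro CollectI exI[of _ ?t]) (auto simp: B_def)
  qed
  have bB: "body (B s)" if "s > 0" for s using body_boxset[OF bs(1)[OF that]] Beq[OF that] by simp
  define g where "g s = \<theta> (B s)" for s
  have add: "g (s + t) = g s + g t" if st: "s > 0" "t > 0" for s t
  proof -
    have "\<theta> (B (s + t)) = \<theta> (B (s + t) \<inter> {y. W x \<bullet> y \<le> s}) + \<theta> (B (s + t) \<inter> {y. s \<le> W x \<bullet> y})"
      using st by (intro cut bB Wx) auto
    also have "B (s + t) \<inter> {y. W x \<bullet> y \<le> s} = B s" using st by (auto simp: B_def)
    also have "B (s + t) \<inter> {y. s \<le> W x \<bullet> y} = (\<lambda>y. s *\<^sub>R x + y) ` B t"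
    proof (intro equalityI subsetI)
      fix y assume y: "y \<in> B (s + t) \<inter> {y. s \<le> W x \<bullet> y}"
      have "y - s *\<^sub>R x \<in> B t" using y Wx Wxv xE
        by (auto simp: B_def inner_diff_right subspace_diff[OF subE] subspace_scale[OF subE])
      then show "y \<in> (\<lambda>y. s *\<^sub>R x + y) ` B t" by (intro image_eqI[of _ _ "y - s *\<^sub>R x"]) auto
    next
      fix y assume "y \<in> (\<lambda>y. s *\<^sub>R x + y) ` B t"
      then obtain y' where "y = s *\<^sub>R x + y'" "y' \<in> B t" by auto
      then show "y \<in> B (s + t) \<inter> {y. s \<le> W x \<bullet> y}" using Wx Wxv xE st
        by (auto simp: B_def inner_add_right subspace_add[OF subE] subspace_scale[OF subE])
    qed
    also have "\<theta> \<dots> = \<theta> (B t)" using st xE by (intro trans bB subspace_scale[OF subE]) auto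
    finally show ?thesis by (simp add: g_def)
  qed
  have mult: "g (real (Suc k) * s) = real (Suc k) * g s" if "s > 0" for k s
  proof (induction k)
    case (Suc k)
    have "real (Suc (Suc k)) * s = real (Suc k) * s + s" by (simp add: algebra_simps)
    then have "g (real (Suc (Suc k)) * s) = g (real (Suc k) * s) + g s" using that by (simp only: add mult_pos_pos of_nat_0_less_iff zero_less_Suc)
    then show ?case using Suc by (simp add: algebra_simps)
  qed simp
  have g1: "g 1 = 0" using z Beq[of 1] by (simp add: g_def)
  have ginv: "g (1 / real (Suc k)) = 0" for k
  proof -
    have "g (real (Suc k) * (1 / real (Suc k))) = real (Suc k) * g (1 / real (Suc k))" by (rule mult) simp
    moreover have "real (Suc k) * (1 / real (Suc k)) = 1" by simp
    ultimately show ?thesis using g1 by (metis mult_eq_0_iff of_nat_eq_0_iff nat.distinct(1))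
  qed
  have grat: "g q = 0" if qh: "q > 0" "q \<in> \<rat>" for q
  proof -
    obtain m n where mn: "q = real m / real n" "n \<noteq> 0" "m \<noteq> 0"
    proof (rule Rats_abs_nat_div_natE[OF qh(2)])
      fix m n :: nat assume "n \<noteq> 0" "\<bar>q\<bar> = real m / real n"
      moreover from this have "m \<noteq> 0" using qh(1) by (cases "m = 0") auto
      ultimately show ?thesis using qh(1) by (intro that[of m n]) auto
    qed
    then obtain m' n' where "m = Suc m'" "n = Suc n'" by (meson not0_implies_Suc)
    then have "q = real (Suc m') * (1 / real (Suc n'))" using mn by simp
    then show ?thesis using mult[of "1 / real (Suc n')" m'] ginv by simp
  qed
  \<comment> \<open>The overshoot allowed in the edge length so that the longer parallelotope stays
    within \<open>1 / real (Suc m)\<close> of the shorter one; adding 1 to the norm keeps the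
    denominator positive.\<close>
  define d where "d m = 1 / (real (Suc m) * (norm x + 1))" for m
  have dpos: "d m > 0" for m unfolding d_def by (intro divide_pos_pos mult_pos_pos add_nonneg_pos) auto
  have "\<forall>m. \<exists>q\<in>\<rat>. s < q \<and> q < s + d m" using dpos by (auto intro!: Rats_dense_in_real)
  then obtain q where q: "\<And>m. q m \<in> \<rat>" "\<And>m. s < q m" "\<And>m. q m < s + d m" by metis
  have qpos: "q m > 0" for m using q(2)[of m] s by simp
  have B0: "0 \<in> B t" if "t > 0" for t using that subspace_0[OF subE] by (auto simp: B_def)
  have cb: "conv_body (B t)" "B t \<subseteq> E" if "t > 0" for t
    using bB[OF that] B0[OF that] by (auto simp: body_def conv_body_def)
  have near: "\<exists>k\<in>B s. dist y k \<le> 1 / real (Suc m)" if y: "y \<in> B (q m)" for m y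
  proof (cases "W x \<bullet> y \<le> s")
    case True
    then have "y \<in> B s" using y by (auto simp: B_def)
    then show ?thesis by (intro bexI[of _ y]) auto
  next
    case False
    let ?k = "y - (W x \<bullet> y - s) *\<^sub>R x"
    have "?k \<in> B s" using y False Wx Wxv xE s
      by (auto simp: B_def inner_diff_right subspace_diff[OF subE] subspace_scale[OF subE])
    moreover have "dist y ?k \<le> 1 / real (Suc m)"
    proof -
      have "dist y ?k = (W x \<bullet> y - s) * norm x" using False by (simp add: dist_norm)
      also have "\<dots> \<le> d m * (norm x + 1)" using y q(3)[of m] False
        by (intro mult_mono) (auto simp: B_def less_imp_le[OF dpos])
      also have "\<dots> = 1 / real (Suc m)"
      proof -
        have "norm x + 1 \<noteq> 0" using norm_ge_zero[of x] by linarith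
        then show ?thesis by (simp add: d_def del: of_nat_Suc)
      qed
      finally show ?thesis .
    qed
    ultimately show ?thesis by blast
  qed
  have "conv_body (B s) \<and> B s \<subseteq> E \<and> (\<forall>m. conv_body (B (q m)) \<and> B (q m) \<subseteq> E \<and> B s \<subseteq> B (q m) \<and>
     (\<forall>x\<in>B (q m). \<exists>k\<in>B s. dist x k \<le> 1 / real (Suc m)))"
  proof (intro conjI allI ballI)
    show "B s \<subseteq> B (q m)" for m using q(2)[of m] by (auto simp: B_def)
  qed (use cb s qpos near in blast)+
  from cont[unfolded outer_continuous_def, rule_format, OF this]
  have "(\<lambda>m. g (q m)) \<longlonglongrightarrow> g s" by (simp add: g_def)
  moreover have "g (q m) = 0" for m using grat qpos q(1) by simp
  ultimately have "g s = 0" by (simp add: LIMSEQ_const_iff)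
  then show ?thesis using Beq[OF s] by (simp add: g_def)
qed

lemma scale_zero:
  assumes S: "bas (insert x R)" "x \<notin> R" and s: "s \<noteq> 0" and z: "\<theta> (boxset (insert x R)) = 0"
  shows "\<theta> (boxset (insert (s *\<^sub>R x) R)) = 0"
proof (cases "s > 0")
  case True then show ?thesis using scale_zero_pos[OF S _ z] by simp
next
  case False
  then have s: "- s > 0" using s by simp
  let ?y = "(- s) *\<^sub>R x"
  have z': "\<theta> (boxset (insert ?y R)) = 0" by (rule scale_zero_pos[OF S s z])
  have b: "bas (insert ?y R)" "?y \<notin> R"
    by (rule bas_insert_notin[OF S, of "?y" "- s" 0]; use s in \<open>auto simp: span_zero\<close>)+
  have b': "- ?y \<notin> R"
    by (rule bas_insert_notin(2)[OF b, of _ "- 1" 0]) (auto simp: span_zero)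
  have fR: "finite R" using S by (simp add: bas_def)
  have "?y \<in> E" using b(1) span_superset[of "insert ?y R"] unfolding bas_def by blast
  then have yE: "- ?y \<in> E" by (rule subspace_neg[OF subE])
  have "boxset (insert (- ?y) R) = (\<lambda>p. - ?y + p) ` boxset (insert ?y R)"
    by (rule boxset_uminus[OF fR b(2) b'])
  then have "\<theta> (boxset (insert (- ?y) R)) = 0" using trans[OF body_boxset[OF b(1)] yE] z' by simp
  then show ?thesis by simp
qed

text \<open>To add a multiple of \<open>v\<close>: rescale the edge \<open>v\<close> to
  \<open>c v *\<^sub>R v\<close>, shear by it, and rescale back.\<close>

lemma add_zero:
  assumes S: "bas (insert z R)" "z \<notin> R" and 0: "\<theta> (boxset (insert z R)) = 0" and F: "F \<subseteq> R"
  shows "\<theta> (boxset (insert (z + (\<Sum>v\<in>F. c v *\<^sub>R v)) R)) = 0"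
proof -
  have fR: "finite R" using S by (simp add: bas_def)
  have "finite F" using F fR finite_subset by auto
  then show ?thesis using F
  proof (induction F)
    case empty then show ?case using 0 by simp
  next
    case (insert v F)
    define z' where "z' = z + (\<Sum>v\<in>F. c v *\<^sub>R v)"
    have IH: "\<theta> (boxset (insert z' R)) = 0" using insert by (simp add: z'_def)
    have "(\<Sum>v\<in>F. c v *\<^sub>R v) \<in> span R"
      using insert.prems by (intro span_sum span_scale) (auto intro: span_base)
    then have b1: "bas (insert z' R)" "z' \<notin> R" "z' \<notin> span R"
      using bas_insert_notin[OF S, of z' 1 "\<Sum>v\<in>F. c v *\<^sub>R v"] by (auto simp: z'_def)
    have goal: "z + (\<Sum>v\<in>insert v F. c v *\<^sub>R v) = c v *\<^sub>R v + z'"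
      using insert.hyps by (simp add: z'_def algebra_simps)
    show ?case
    proof (cases "c v = 0")
      case True then show ?thesis using IH goal by simp
    next
      case False
      define R0 where "R0 = R - {v}"
      have R: "R = insert v R0" "v \<notin> R0" using insert.prems by (auto simp: R0_def)
      let ?x = "c v *\<^sub>R v"
      have e1: "insert z' R = insert v (insert z' R0)" using R by auto
      have vn: "v \<notin> insert z' R0" using b1(2) R by auto
      have b2: "bas (insert ?x (insert z' R0))" "?x \<notin> insert z' R0"
        by (rule bas_insert_notin[of v "insert z' R0" "?x" "c v" 0]; use b1(1) e1 vn False in \<open>auto simp: span_zero\<close>)+
      have s1: "\<theta> (boxset (insert ?x (insert z' R0))) = 0"
        using scale_zero[of v "insert z' R0" "c v"] b1(1) e1 vn False IH by simp
      have zR0: "z' \<notin> R0" using b1(2) R by auto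
      have s2: "\<theta> (boxset (insert ?x (insert (?x + z') R0))) = 0"
        by (rule shear_zero) (use b2 s1 zR0 in auto)
      have xs: "?x \<in> span R" using R by (intro span_scale span_base) auto
      have b3: "bas (insert (?x + z') R)" "?x + z' \<notin> R"
        by (rule bas_insert_notin[OF b1(1,2), of _ 1 ?x]; use xs in \<open>auto simp: add.commute\<close>)+
      have e3: "insert (?x + z') R = insert v (insert (?x + z') R0)" using R by auto
      have vn3: "v \<notin> insert (?x + z') R0" using b3(2) R by auto
      have b4: "bas (insert ?x (insert (?x + z') R0))" "?x \<notin> insert (?x + z') R0"
        by (rule bas_insert_notin[of v "insert (?x + z') R0" "?x" "c v" 0]; use b3(1) e3 vn3 False in \<open>auto simp: span_zero\<close>)+
      have "\<theta> (boxset (insert ((1 / c v) *\<^sub>R ?x) (insert (?x + z') R0))) = 0"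
        using scale_zero[OF b4, of "1 / c v"] s2 False by simp
      then show ?thesis using False e3 goal by simp
    qed
  qed
qed

text \<open>Steinitz exchange, one vector at a time: rescaling and adding combinations of the other
  edges turns an edge of \<open>S\<close> into a missing vector of \<open>S'\<close>.\<close>

lemma bas_zero_transfer:
  assumes "bas S" "bas S'" "\<theta> (boxset S) = 0"
  shows "\<theta> (boxset S') = 0"
  using assms(1,3)
proof (induction "card (S' - S)" arbitrary: S)
  case 0
  have fS': "finite S'" "finite S" using assms(2) 0 by (auto simp: bas_def)
  then have "S' \<subseteq> S" using 0 by auto
  then have "S' = S" using bas_card[OF assms(2)] bas_card[OF 0(2)] fS' by (metis card_subset_eq)
  then show ?case using 0 by simp
next
  case (Suc k)
  have fS: "finite S'" "finite S" using assms(2) Suc by (auto simp: bas_def)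
  obtain y where y: "y \<in> S'" "y \<notin> S" using Suc(2) by (metis Diff_iff card.empty equals0I nat.distinct(1))
  have "y \<in> span S" using y Suc(3) assms(2) span_base by (auto simp: bas_def)
  then obtain c where c: "y = (\<Sum>v\<in>S. c v *\<^sub>R v)" using fS by (auto simp: span_finite)
  \<comment> \<open>The removed vector must lie outside \<open>S'\<close>, so that the number of
    missing vectors drops. If all such coefficients were 0, \<open>y\<close> would depend on the
    remaining vectors of \<open>S'\<close>.\<close>
  have "\<exists>x\<in>S - S'. c x \<noteq> 0"
  proof (rule ccontr)
    assume "\<not> ?thesis"
    then have "y = (\<Sum>v\<in>S \<inter> S'. c v *\<^sub>R v)" unfolding c using fS by (intro sum.mono_neutral_right) auto
    also have "\<dots> \<in> span (S' - {y})" using y by (intro span_sum span_scale span_base) auto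
    finally have "dependent S'" using y unfolding dependent_def by blast
    then show False using assms(2) by (simp add: bas_def)
  qed
  then obtain x where x: "x \<in> S" "x \<notin> S'" "c x \<noteq> 0" by auto
  define R where "R = S - {x}"
  have SR: "S = insert x R" "x \<notin> R" using x by (auto simp: R_def)
  have yx: "y = c x *\<^sub>R x + (\<Sum>v\<in>R. c v *\<^sub>R v)" unfolding c R_def using fS x by (simp add: sum.remove)
  have bS: "bas (insert x R)" using Suc(3) SR by simp
  have sR: "(\<Sum>v\<in>R. c v *\<^sub>R v) \<in> span R" by (intro span_sum span_scale) (rule span_base)
  have by1: "bas (insert y R)" by (rule bas_insert_notin(1)[OF bS SR(2) yx x(3) sR])
  have bx: "bas (insert (c x *\<^sub>R x) R)" "c x *\<^sub>R x \<notin> R"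
    by (rule bas_insert_notin[OF bS SR(2), of "c x *\<^sub>R x" "c x" 0]; use x in \<open>auto simp: span_zero\<close>)+
  have "\<theta> (boxset (insert (c x *\<^sub>R x) R)) = 0" using scale_zero[OF bS SR(2) x(3)] Suc(4) SR by simp
  then have "\<theta> (boxset (insert y R)) = 0" unfolding yx by (intro add_zero[OF bx]) auto
  moreover have "k = card (S' - insert y R)"
  proof -
    have "S' - insert y R = (S' - S) - {y}" using x y by (auto simp: R_def)
    moreover have "y \<in> S' - S" using y by simp
    ultimately show ?thesis using Suc(2) fS by (simp add: card_Diff_singleton)
  qed
  ultimately show ?case using Suc(1)[of "insert y R"] by1 by simp
qed

text \<open>A zero on one parallelotope spreads to all parallelotopes, from each to its path
  simplex, and from path simplices to all bodies.\<close>

lemma vanish_of_box: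
  assumes S: "bas S" "\<theta> (boxset S) = 0" and K: "conv_body K" "K \<subseteq> E"
  shows "\<theta> K = 0"
proof (rule vanish[OF dimE _ _ K])
  fix a w assume D: "simple_val_dual E \<theta> (dim E) (dim E) a w"
  then interpret D: simple_val_dual E \<theta> "dim E" "dim E" a w .
  let ?S = "a ` {..<dim E}"
  have inj: "inj_on a {..<dim E}"
    using D.dual by (intro inj_onI) (metis lessThan_iff zero_neq_one)
  have "bas ?S"
  proof (rule is_basisI)
    show "E \<subseteq> span ?S"
    proof
      fix x assume "x \<in> E"
      then have "x = (\<Sum>i<dim E. (w i \<bullet> x) *\<^sub>R a i)" by (rule D.expand)
      moreover have "\<dots> \<in> span ?S" by (intro span_sum span_scale) (auto intro: span_base)
      ultimately show "x \<in> span ?S" by simp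
    qed
    show "card ?S \<le> dim E" using card_image_le[of "{..<dim E}" a] by simp
  qed (use D.aE in auto)
  then have z: "\<theta> (boxset ?S) = 0" using bas_zero_transfer[OF S(1) _ S(2)] by simp
  have "bij_betw a {..<dim E} ?S" using inj by (simp add: bij_betw_def)
  then show "\<theta> (orthoscheme E (dim E) w {..<dim E - 1}) = 0"
  proof (rule bas_dual[OF \<open>bas ?S\<close>])
    fix w2 assume D2: "simple_val_dual E \<theta> (dim E) (dim E) a w2" "boxset ?S = orthoscheme E (dim E) w2 {}"
    have "orthoscheme E (dim E) w2 {} = orthoscheme E (dim E) w {}"
      using orthoscheme_sum[OF D2(1), of "{}"] orthoscheme_sum[OF D, of "{}"] by simp
    then show ?thesis using box_iff_simplex[OF D] z D2(2) by simp
  qed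
next
  fix K Q
  assume "conv_body K" "K \<subseteq> E" "\<And>m. conv_body (Q m)" "\<And>m. Q m \<subseteq> E" "\<And>m. K \<subseteq> Q m"
    "\<And>m x. x \<in> Q m \<Longrightarrow> \<exists>k\<in>K. dist x k \<le> 1 / real (Suc m)"
  then have "conv_body K \<and> K \<subseteq> E \<and> (\<forall>m. conv_body (Q m) \<and> Q m \<subseteq> E \<and> K \<subseteq> Q m \<and>
     (\<forall>x\<in>Q m. \<exists>k\<in>K. dist x k \<le> 1 / real (Suc m)))" by blast
  then show "(\<lambda>m. \<theta> (Q m)) \<longlonglongrightarrow> \<theta> K" by (rule cont[unfolded outer_continuous_def, rule_format])
qed

end

text \<open>The constant is read off from a single parallelotope; the difference to that multiple of
  the volume then vanishes there and hence everywhere.\<close>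

theorem top_degree_multiple_of_volume:
  fixes E :: "'a::euclidean_space set"
  assumes S: "simple_val E \<theta> (dim E)" and c: "outer_continuous E \<theta>" and d: "dim E \<ge> 1"
  obtains c where "\<And>K. conv_body K \<Longrightarrow> K \<subseteq> E \<Longrightarrow> \<theta> K = c * measure (lamE E) K"
proof -
  interpret T: top_val E \<theta> using S c d by (intro top_val.intro top_val_axioms.intro)
  let ?v = "\<lambda>K. measure (lamE E) K"
  obtain B where B: "B \<subseteq> E" "independent B" "E \<subseteq> span B" "card B = dim E" using basis_exists by metis
  have bB: "T.bas B" using B independent_imp_finite by (intro T.is_basisI) auto
  then obtain a where a: "bij_betw a {..<dim E} B"
    using ex_bij_betw_nat_finite[of B] B(4) by (metis T.bas_def atLeast0LessThan)
  show ?thesis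
  proof (rule T.bas_dual[OF bB a])
    fix w assume w: "simple_val_dual E \<theta> (dim E) (dim E) a w" "boxset B = orthoscheme E (dim E) w {}"
    have pos: "?v (boxset B) > 0" using T.orthoscheme_volume_pos[OF w(1)] w(2) by simp
    define c0 where "c0 = \<theta> (boxset B) / ?v (boxset B)"
    have S': "simple_val E (\<lambda>K. \<theta> K - c0 * ?v K) (dim E)"
      by (rule simple_val_lincomb[OF S simple_val_volume[OF T.subE]])
    have c': "outer_continuous E (\<lambda>K. \<theta> K - c0 * ?v K)"
      by (rule outer_continuous_lincomb[OF c outer_continuous_volume[OF T.subE]])
    interpret C: top_val E "\<lambda>K. \<theta> K - c0 * ?v K" using S' c' d by (intro top_val.intro top_val_axioms.intro)
    have "C.bas B" using bB by (simp add: T.bas_def C.bas_def)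
    moreover have "\<theta> (boxset B) - c0 * ?v (boxset B) = 0" using pos by (simp add: c0_def)
    ultimately have "\<theta> K - c0 * ?v K = 0" if "conv_body K" "K \<subseteq> E" for K
      using C.vanish_of_box[of B K] that by simp
    then show ?thesis using that[of c0] by simp
  qed
qed

text \<open>Operators with rational matrix entries are dense, and balls around them with rational
  radii form a base. This makes distances and sums of operator-valued maps measurable and gives
  countable covers of the Grassmannian.\<close>

instance blinfun :: (euclidean_space, euclidean_space) second_countable_topology
proof
  let ?I = "(Basis :: 'b set) \<times> (Basis :: 'a set)"
  define M where "M q = (blinfun_of_matrix (\<lambda>i j. q (i, j)) :: 'a \<Rightarrow>\<^sub>L 'b)" for q :: "'b \<times> 'a \<Rightarrow> real"
  define D where "D = M ` (?I \<rightarrow>\<^sub>E \<rat>)"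
  define B where "B = (\<lambda>(c, r). ball c r) ` (D \<times> (\<rat> :: real set))"
  have cD: "countable D" unfolding D_def by (intro countable_image countable_PiE) (auto simp: countable_rat)
  have dense: "\<exists>d\<in>D. dist f d < e" if e: "e > 0" for f :: "'a \<Rightarrow>\<^sub>L 'b" and e
  proof -
    define k where "k = real (card ?I)"
    have k: "k > 0" unfolding k_def by (simp add: card_gt_0_iff)
    have "\<exists>r\<in>\<rat>. \<bar>blinfun_apply f (snd p) \<bullet> fst p - r\<bar> < e / k" for p :: "'b \<times> 'a"
    proof -
      have "blinfun_apply f (snd p) \<bullet> fst p - e / k < blinfun_apply f (snd p) \<bullet> fst p" using e k by simp
      then obtain r where "r \<in> \<rat>" "blinfun_apply f (snd p) \<bullet> fst p - e / k < r" "r < blinfun_apply f (snd p) \<bullet> fst p"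
        using Rats_dense_in_real by blast
      then show ?thesis by (intro bexI[of _ r]) auto
    qed
    then obtain r where r: "\<And>p. r p \<in> \<rat>" "\<And>p. \<bar>blinfun_apply f (snd p) \<bullet> fst p - r p\<bar> < e / k" by metis
    let ?q = "restrict r ?I"
    have "f - M ?q = blinfun_of_matrix ((\<lambda>i j. blinfun_apply f j \<bullet> i) - (\<lambda>i j. ?q (i, j)))"
      unfolding M_def blinfun_of_matrix_minus[symmetric] blinfun_of_matrix_works ..
    then have "norm (f - M ?q) \<le> (\<Sum>i\<in>Basis. \<Sum>j\<in>Basis. \<bar>blinfun_apply f j \<bullet> i - ?q (i, j)\<bar>)"
      using norm_blinfun_of_matrix[of "(\<lambda>i j. blinfun_apply f j \<bullet> i) - (\<lambda>i j. ?q (i, j))"] by simp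
    also have "\<dots> = (\<Sum>p\<in>?I. \<bar>blinfun_apply f (snd p) \<bullet> fst p - r p\<bar>)"
      by (simp add: sum.cartesian_product case_prod_beta)
    also have "\<dots> < (\<Sum>p\<in>?I. e / k)"
      using r(2) by (intro sum_strict_mono) auto
    also have "\<dots> = e" using k by (simp add: k_def)
    finally show ?thesis using r(1) by (intro bexI[of _ "M ?q"]) (auto simp: D_def dist_norm)
  qed
  have "Ball B open" by (auto simp: B_def)
  moreover have "\<exists>B'\<subseteq>B. \<Union>B' = A" if A: "open A" for A :: "('a \<Rightarrow>\<^sub>L 'b) set"
  proof (intro exI conjI)
    show "{b\<in>B. b \<subseteq> A} \<subseteq> B" by auto
    show "\<Union>{b\<in>B. b \<subseteq> A} = A"
    proof (intro equalityI subsetI)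
      fix f assume "f \<in> A"
      then obtain e where e: "e > 0" "ball f e \<subseteq> A" using A open_contains_ball by blast
      obtain q where q: "q \<in> \<rat>" "e / 3 < q" "q < e / 2" using Rats_dense_in_real[of "e/3" "e/2"] e(1) by auto
      obtain d where d: "d \<in> D" "dist f d < e / 3" using dense[of "e/3" f] e(1) by auto
      have "ball d q \<subseteq> ball f e"
      proof
        fix g assume "g \<in> ball d q"
        then have "dist f g < e / 3 + e / 2" using dist_triangle[of f g d] d(2) q(3) by (auto simp: dist_commute)
        then show "g \<in> ball f e" using e(1) by simp
      qed
      moreover have "ball d q \<in> B" using d q by (auto simp: B_def)
      moreover have "f \<in> ball d q" using d q by (simp add: dist_commute)
      ultimately show "f \<in> \<Union>{b\<in>B. b \<subseteq> A}" using e(2) by blast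
    qed auto
  qed
  ultimately have "topological_basis B" unfolding topological_basis_def by blast
  moreover have "countable B"
    unfolding B_def using cD by (intro countable_image countable_SIGMA) (auto simp: countable_rat)
  ultimately show "\<exists>B::('a \<Rightarrow>\<^sub>L 'b) set set. countable B \<and> open = generate_topology B"
    by (blast intro: topological_basis_imp_subbasis)
qed

section \<open>The Klain function\<close>

lemma subspace_hyperplane_section:
  fixes E :: "'a::euclidean_space set"
  assumes E: "subspace E" and a: "a \<in> E" "a \<noteq> 0"
  shows "subspace (E \<inter> {x. a \<bullet> x = 0})" "span (insert a (E \<inter> {x. a \<bullet> x = 0})) = E" "dim E = Suc (dim (E \<inter> {x. a \<bullet> x = 0}))"
proof -
  let ?M = "E \<inter> {x. a \<bullet> x = 0}"
  show M: "subspace ?M" using E by (intro subspace_inter subspace_hyperplane)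
  show sp: "span (insert a ?M) = E"
  proof
    show "span (insert a ?M) \<subseteq> E" using a E by (intro span_minimal) auto
    show "E \<subseteq> span (insert a ?M)"
    proof
      fix x assume x: "x \<in> E"
      let ?c = "(a \<bullet> x) / (a \<bullet> a)"
      have "x - ?c *\<^sub>R a \<in> ?M" using x a by (simp add: subspace_diff[OF E] subspace_scale[OF E] inner_diff_right)
      then have "x - ?c *\<^sub>R a \<in> span ?M" by (rule span_base)
      then show "x \<in> span (insert a ?M)" unfolding span_insert by blast
    qed
  qed
  have "a \<notin> span ?M" using M a by (metis (mono_tags, lifting) IntE inner_eq_zero_iff mem_Collect_eq span_eq_iff)
  then have "dim (insert a ?M) = Suc (dim ?M)" by (simp add: dim_insert)
  moreover have "dim (insert a ?M) = dim E" using sp by (metis dim_span)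
  ultimately show "dim E = Suc (dim ?M)" by simp
qed

lemma conv_body_translation: "conv_body K \<Longrightarrow> conv_body ((\<lambda>x. t + x) ` K)"
  by (auto simp: conv_body_def compact_translation convex_translation)

lemma conv_body_scale: "conv_body K \<Longrightarrow> conv_body ((\<lambda>x. s *\<^sub>R x) ` K)"
  by (auto simp: conv_body_def compact_scaling convex_scaling)

lemma flat_translate_section:
  fixes E :: "'a::euclidean_space set"
  assumes E: "subspace E" and K: "conv_body K" "K \<subseteq> E" "a \<in> E" "K \<subseteq> {x. a \<bullet> x = b}"
  obtains t where "t \<in> E" "conv_body ((\<lambda>x. t + x) ` K)" "(\<lambda>x. t + x) ` K \<subseteq> E \<inter> {x. a \<bullet> x = 0}"
proof -
  obtain p where p: "p \<in> K" using K by (auto simp: conv_body_def)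
  show ?thesis
  proof
    show "- p \<in> E" using p K subspace_neg[OF E] by auto
    show "conv_body ((\<lambda>x. - p + x) ` K)" using K(1) by (rule conv_body_translation)
    show "(\<lambda>x. - p + x) ` K \<subseteq> E \<inter> {x. a \<bullet> x = 0}"
    proof
      fix y assume "y \<in> (\<lambda>x. - p + x) ` K"
      then obtain x where x: "x \<in> K" "y = x - p" by auto
      have "a \<bullet> x = b" "a \<bullet> p = b" using x p K(4) by auto
      then show "y \<in> E \<inter> {x. a \<bullet> x = 0}" using x p K(2) subspace_diff[OF E] by (auto simp: inner_diff_right)
    qed
  qed
qed

text \<open>Cuts may produce the empty set, where \<open>simple_val\<close> needs the value 0, while
  the valuation property does not determine \<open>\<phi> {}\<close>.\<close>

definition ext0 :: "('a set \<Rightarrow> real) \<Rightarrow> 'a set \<Rightarrow> real" where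
  "ext0 \<phi> K = (if K = {} then 0 else \<phi> K)"

lemma ext0_conv_body: "conv_body K \<Longrightarrow> ext0 \<phi> K = \<phi> K"
  by (simp add: ext0_def conv_body_def)

lemma conv_body_halfspaces:
  assumes "conv_body K" "K \<inter> {x. a \<bullet> x \<le> b} \<noteq> {}" shows "conv_body (K \<inter> {x. a \<bullet> x \<le> b})"
  using assms by (auto simp: conv_body_def intro!: compact_Int_closed closed_halfspace_le convex_Int convex_halfspace_le)

lemma conv_body_halfspaces':
  assumes "conv_body K" "K \<inter> {x. b \<le> a \<bullet> x} \<noteq> {}" shows "conv_body (K \<inter> {x. b \<le> a \<bullet> x})"
  using assms by (auto simp: conv_body_def intro!: compact_Int_closed closed_halfspace_ge convex_Int convex_halfspace_ge)

lemma conv_body_hyperplane: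
  assumes "conv_body K" "K \<inter> {x. a \<bullet> x = b} \<noteq> {}" shows "conv_body (K \<inter> {x. a \<bullet> x = b})"
  using assms by (auto simp: conv_body_def intro!: compact_Int_closed closed_hyperplane convex_Int convex_hyperplane)

text \<open>The cut property needs the valuation property only for bodies in \<open>E\<close>; it is stated this way
  so that it also applies to functionals that are only defined relative to \<open>E\<close>.\<close>
lemma simple_val_ext0:
  fixes E :: "'a::euclidean_space set"
  assumes E: "subspace E"
    and val: "\<And>K M. conv_body K \<Longrightarrow> K \<subseteq> E \<Longrightarrow> conv_body M \<Longrightarrow> M \<subseteq> E \<Longrightarrow> conv_body (K \<union> M) \<Longrightarrow> K \<inter> M \<noteq> {} \<Longrightarrow>
       \<phi> (K \<union> M) + \<phi> (K \<inter> M) = \<phi> K + \<phi> M"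
    and flat: "\<And>K a. conv_body K \<Longrightarrow> a \<in> E \<Longrightarrow> a \<noteq> 0 \<Longrightarrow> K \<subseteq> E \<inter> {x. a \<bullet> x = 0} \<Longrightarrow> \<phi> K = 0"
    and tr: "\<And>K t. conv_body K \<Longrightarrow> K \<subseteq> E \<Longrightarrow> t \<in> E \<Longrightarrow> \<phi> ((\<lambda>x. t + x) ` K) = \<phi> K"
    and hom: "\<And>K k. conv_body K \<Longrightarrow> K \<subseteq> E \<Longrightarrow> \<phi> ((\<lambda>x. real (Suc k) *\<^sub>R x) ` K) = real (Suc k) ^ r * \<phi> K"
  shows "simple_val E (ext0 \<phi>) r"
proof
  show fl: "ext0 \<phi> K = 0" if K: "conv_body K" "K \<subseteq> E" "a \<in> E" "a \<noteq> 0" "K \<subseteq> {x. a \<bullet> x = b}" for K a b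
  proof (rule flat_translate_section[OF E K(1,2,3,5)])
    fix t assume t: "t \<in> E" "conv_body ((\<lambda>x. t + x) ` K)" "(\<lambda>x. t + x) ` K \<subseteq> E \<inter> {x. a \<bullet> x = 0}"
    have "\<phi> K = \<phi> ((\<lambda>x. t + x) ` K)" using tr[OF K(1,2) t(1)] by simp
    also have "\<dots> = 0" using flat[OF t(2) K(3,4) t(3)] .
    finally show ?thesis using K(1) by (simp add: ext0_conv_body)
  qed
  fix K a b assume K: "conv_body K" "K \<subseteq> E" "a \<in> E" "a \<noteq> (0::'a)"
  let ?A = "K \<inter> {x. a \<bullet> x \<le> b}" and ?B = "K \<inter> {x. b \<le> a \<bullet> x}"
  show "ext0 \<phi> K = ext0 \<phi> ?A + ext0 \<phi> ?B"
  proof (cases "?A = {} \<or> ?B = {}")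
    case True
    then have "(?A = {} \<and> ?B = K) \<or> (?B = {} \<and> ?A = K)" by (auto intro: less_imp_le simp: not_le)
    then show ?thesis by (auto simp: ext0_def)
  next
    case False
    \<comment> \<open>Both sides are nonempty, so by connectedness the body meets the cutting
      hyperplane. Thus \<open>val\<close> applies, and its intersection term is flat and contributes
      0.\<close>
    have "connected K" using K(1) by (auto simp: conv_body_def convex_connected)
    then have ne: "?A \<inter> ?B \<noteq> {}" using False connected_ivt_hyperplane[of K _ _ a b] by fastforce
    have AB: "?A \<union> ?B = K" "?A \<inter> ?B = K \<inter> {x. a \<bullet> x = b}" by auto
    have cA: "conv_body ?A" "conv_body ?B" using False K(1) by (auto intro: conv_body_halfspaces conv_body_halfspaces')
    have cI: "conv_body (?A \<inter> ?B)" using ne K(1) conv_body_hyperplane unfolding AB(2) by blast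
    have "\<phi> (?A \<union> ?B) + \<phi> (?A \<inter> ?B) = \<phi> ?A + \<phi> ?B"
      by (rule val) (use cA K ne AB(1) in auto)
    moreover have "\<phi> (?A \<inter> ?B) = 0"
      using fl[OF cI _ K(3,4), of b] K(2) ext0_conv_body[OF cI] by (auto simp: AB(2))
    ultimately show ?thesis using cA K(1) AB(1) by (simp add: ext0_conv_body)
  qed
qed (use E tr hom conv_body_translation conv_body_scale in \<open>auto simp: ext0_conv_body ext0_def conv_body_def\<close>)

lemma hausdist_outer:
  assumes K: "conv_body K" "conv_body Q" "K \<subseteq> Q" and s: "\<And>x. x \<in> Q \<Longrightarrow> \<exists>k\<in>K. dist x k \<le> s"
  shows "0 \<le> hausdist Q K" "hausdist Q K \<le> s"
proof -
  have ne: "K \<noteq> {}" "Q \<noteq> {}" using K by (auto simp: conv_body_def)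
  have "(SUP x\<in>Q. infdist x K) \<le> s"
    using s ne by (intro cSUP_least) (auto intro: infdist_attained_le)
  moreover have "(SUP y\<in>K. infdist y Q) = 0" using ne K(3) by (simp add: subset_iff)
  moreover have "0 \<le> s" using s ne by (meson dist_not_less_zero ex_in_conv linorder_not_le order_le_less_trans)
  ultimately show "0 \<le> hausdist Q K" "hausdist Q K \<le> s" by (auto simp: hausdist_def)
qed

lemma outer_continuous_hausdorff:
  assumes "hausdorff_continuous \<phi>" shows "outer_continuous E (ext0 \<phi>)"
  unfolding outer_continuous_def
proof (intro allI impI)
  fix K :: "'a set" and Q
  assume KQ: "conv_body K \<and> K \<subseteq> E \<and> (\<forall>m. conv_body (Q m) \<and> Q m \<subseteq> E \<and> K \<subseteq> Q m \<and>
     (\<forall>x\<in>Q m. \<exists>k\<in>K. dist x k \<le> 1 / real (Suc m)))"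
  then have b: "0 \<le> hausdist (Q m) K \<and> hausdist (Q m) K \<le> 1 / real (Suc m)" for m
    using hausdist_outer[of K "Q m" "1 / real (Suc m)"] by blast
  have lim: "(\<lambda>m. 1 / real (Suc m)) \<longlonglongrightarrow> 0" by (rule LIMSEQ_Suc[OF lim_1_over_n])
  have "(\<lambda>m. hausdist (Q m) K) \<longlonglongrightarrow> 0"
    by (rule tendsto_sandwich[OF _ _ tendsto_const lim]) (use b in auto)
  then have "(\<lambda>m. \<phi> (Q m)) \<longlonglongrightarrow> \<phi> K" using assms KQ unfolding hausdorff_continuous_def by blast
  then show "(\<lambda>m. ext0 \<phi> (Q m)) \<longlonglongrightarrow> ext0 \<phi> K" using KQ by (simp add: ext0_conv_body)
qed

locale hom_valuation =
  fixes \<phi> :: "'a::euclidean_space set \<Rightarrow> real" and j :: nat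
  assumes j: "1 \<le> j" and val: "valuation \<phi>" and hom: "homogeneous_val j \<phi>"
    and tr: "translation_invariant \<phi>" and cont: "hausdorff_continuous \<phi>"
begin

lemma simple_val_phi:
  assumes E: "subspace E"
    and flat: "\<And>K a. conv_body K \<Longrightarrow> a \<in> E \<Longrightarrow> a \<noteq> 0 \<Longrightarrow> K \<subseteq> E \<inter> {x. a \<bullet> x = 0} \<Longrightarrow> \<phi> K = 0"
  shows "simple_val E (ext0 \<phi>) j"
  using E
proof (rule simple_val_ext0)
  show "\<phi> (K \<union> M) + \<phi> (K \<inter> M) = \<phi> K + \<phi> M" if "conv_body K" "conv_body M" "conv_body (K \<union> M)" for K M
    using val that by (auto simp: valuation_def)
  show "\<phi> ((\<lambda>x. t + x) ` K) = \<phi> K" if "conv_body K" for K t using tr that by (auto simp: translation_invariant_def)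
  show "\<phi> ((\<lambda>x. real (Suc k) *\<^sub>R x) ` K) = real (Suc k) ^ j * \<phi> K" if "conv_body K" for K k
    using hom that unfolding homogeneous_val_def by (metis of_nat_0_le_iff)
qed (use flat in auto)

text \<open>By induction the valuation vanishes on hyperplane sections of \<open>E\<close>, so it is
  simple in \<open>E\<close>, and a degree above the dimension forces a simple valuation to
  vanish.\<close>

lemma low_dimension_zero:
  assumes "subspace E" "dim E < j" "conv_body K" "K \<subseteq> E"
  shows "\<phi> K = 0"
  using assms
proof (induction "dim E" arbitrary: E K)
  case 0
  then have "E = {0}" by (simp add: dim_eq_0 subspace_0 subset_singleton_iff) (metis empty_iff subspace_0)
  then have K: "K = {0}" using 0 by (auto simp: conv_body_def)
  \<comment> \<open>A point is its own dilate by 0, and \<open>0 ^ j\<close> is 0 because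
    \<open>j\<close> is at least 1.\<close>
  have "\<phi> ((\<lambda>x. 0 *\<^sub>R x) ` K) = 0 ^ j * \<phi> K" using hom 0 unfolding homogeneous_val_def by (metis order_refl)
  moreover have "(0::real) ^ j = 0" using j by simp
  ultimately show ?case using K by simp
next
  case (Suc n)
  have flat: "\<phi> K = 0" if "conv_body K" "a \<in> E" "a \<noteq> 0" "K \<subseteq> E \<inter> {x. a \<bullet> x = 0}" for K a
    using subspace_hyperplane_section[OF Suc(3) that(2,3)] Suc that by auto
  interpret S: simple_val E "ext0 \<phi>" j by (rule simple_val_phi[OF Suc(3) flat])
  have "ext0 \<phi> K = 0"
  proof (rule S.vanish)
    show "1 \<le> dim E" using Suc by simp
    show "ext0 \<phi> (orthoscheme E (dim E) w {..<dim E - 1}) = 0" if "simple_val_dual E (ext0 \<phi>) j (dim E) a w" for a w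
    proof -
      interpret D: simple_val_dual E "ext0 \<phi>" j "dim E" a w by (rule that)
      show ?thesis by (rule D.simplex_vanish_top[OF Suc(4)])
    qed
    show "(\<lambda>m. ext0 \<phi> (Q m)) \<longlonglongrightarrow> ext0 \<phi> K"
      if "conv_body K" "K \<subseteq> E" "\<And>m. conv_body (Q m)" "\<And>m. Q m \<subseteq> E" "\<And>m. K \<subseteq> Q m"
        "\<And>m x. x \<in> Q m \<Longrightarrow> \<exists>k\<in>K. dist x k \<le> 1 / real (Suc m)" for K Q
      by (rule outer_continuous_hausdorff[OF cont, of E, unfolded outer_continuous_def, rule_format]) (use that in blast)
  qed (use Suc in auto)
  then show ?case using Suc by (simp add: ext0_conv_body)
qed

text \<open>Bodies in hyperplanes of \<open>L\<close> have dimension below \<open>j\<close>, so the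
  restriction to \<open>L\<close> is simple of top degree, hence a multiple of the volume.\<close>

lemma klain_exists:
  assumes L: "L \<in> grass j"
  obtains c where "\<And>K. conv_body K \<Longrightarrow> K \<subseteq> L \<Longrightarrow> \<phi> K = c * volE L K"
proof -
  have sL: "subspace L" and dL: "dim L = j" using L by (auto simp: grass_def)
  have flat: "\<phi> K = 0" if "conv_body K" "a \<in> L" "a \<noteq> 0" "K \<subseteq> L \<inter> {x. a \<bullet> x = 0}" for K a
    using subspace_hyperplane_section[OF sL that(2,3)] dL that by (intro low_dimension_zero[of "L \<inter> {x. a \<bullet> x = 0}"]) auto
  have S: "simple_val L (ext0 \<phi>) (dim L)" unfolding dL by (rule simple_val_phi[OF sL flat])
  show ?thesis
  proof (rule top_degree_multiple_of_volume[OF S outer_continuous_hausdorff[OF cont]])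
    show "1 \<le> dim L" using dL j by simp
    fix c assume c: "\<And>K. conv_body K \<Longrightarrow> K \<subseteq> L \<Longrightarrow> ext0 \<phi> K = c * measure (lamE L) K"
    have "\<phi> K = c * volE L K" if "conv_body K" "K \<subseteq> L" for K
      using c[OF that] that by (simp add: ext0_conv_body volE_eq_measure_lamE[OF sL conv_body_borel])
    then show ?thesis by (rule that)
  qed
qed

end

lemma zero_in_ball_section: "subspace L \<Longrightarrow> 0 \<in> cball 0 1 \<inter> L"
  by (simp add: subspace_0)

lemma conv_body_ball_section: "subspace L \<Longrightarrow> conv_body (cball 0 1 \<inter> L)"
  unfolding conv_body_def using zero_in_ball_section[of L]
  by (intro conjI compact_Int_closed convex_Int compact_cball convex_cball closed_subspace subspace_imp_convex) blast+

lemma volE_ball_section: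
  assumes L: "subspace (L::'a::euclidean_space set)" shows "volE L (cball 0 1 \<inter> L) = kappa (dim L)"
proof -
  obtain B where B: "B \<subseteq> L" "pairwise orthogonal B" "\<And>b. b \<in> B \<Longrightarrow> norm b = 1" "finite B" "card B = dim L" "span B = L"
    using orthonormal_basis_subspace_obtain[OF L] by metis
  let ?s = "\<lambda>f. \<Sum>b\<in>B. f b *\<^sub>R (b::'a)"
  have nC: "norm (?s g) = sqrt (\<Sum>b\<in>B. (g b)\<^sup>2)" for g
  proof -
    have "(norm (?s g))\<^sup>2 = (\<Sum>b\<in>B. (norm (g b *\<^sub>R b))\<^sup>2)"
      using B(2) by (intro norm_sum_Pythagorean[OF B(4)]) (auto simp: pairwise_def orthogonal_def)
    also have "\<dots> = (\<Sum>b\<in>B. (g b)\<^sup>2)" using B(3) by (intro sum.cong) auto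
    finally show ?thesis using real_sqrt_unique[of "norm (?s g)"] norm_ge_zero[of "?s g"] by metis
  qed
  have sL: "?s f \<in> L" for f unfolding B(6)[symmetric] by (intro span_sum span_scale span_base)
  have Lb: "cball 0 1 \<inter> L \<in> sets borel" using L by (intro borel_closed closed_Int closed_cball closed_subspace)
  have "emeasure (lamE L) (cball 0 1 \<inter> L) = emeasure (\<Pi>\<^sub>M b\<in>B. lborel) ({f. sqrt (\<Sum>b\<in>B. (f b)\<^sup>2) \<le> 1} \<inter> space (\<Pi>\<^sub>M b\<in>B. lborel))"
  proof -
    have eq: "lamE L = distr (\<Pi>\<^sub>M b\<in>B. lborel) borel ?s" by (rule lamE_eq[OF B(2,3,4,6)])
    have "?s -` (cball 0 1 \<inter> L) \<inter> space (\<Pi>\<^sub>M b\<in>B. (lborel::real measure)) = {f. sqrt (\<Sum>b\<in>B. (f b)\<^sup>2) \<le> 1} \<inter> space (\<Pi>\<^sub>M b\<in>B. lborel)"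
      using sL by (auto simp: nC)
    moreover have "?s \<in> (\<Pi>\<^sub>M b\<in>B. (lborel::real measure)) \<rightarrow>\<^sub>M borel" by measurable
    ultimately show ?thesis unfolding eq using Lb by (simp add: emeasure_distr)
  qed
  also have "\<dots> = ennreal (kappa (dim L))"
    using emeasure_cball_aux[OF B(4), of 1] B(5) by (simp add: kappa_def unit_ball_vol_def)
  finally have "measure (lamE L) (cball 0 1 \<inter> L) = kappa (dim L)"
    using kappa_pos[of "dim L"] by (simp add: measure_def)
  then show ?thesis using volE_eq_measure_lamE[OF L Lb] by simp
qed

context hom_valuation
begin

text \<open>The unit ball of \<open>L\<close> serves as a test body. It turns the definite
  description into a formula whose dependence on \<open>L\<close> is controlled by Hausdorff
  continuity of \<open>\<phi>\<close>.\<close>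

lemma klain_eq:
  assumes L: "L \<in> grass j" shows "klain \<phi> L = \<phi> (cball 0 1 \<inter> L) / kappa j"
proof (rule klain_exists[OF L])
  fix c assume c: "\<And>K. conv_body K \<Longrightarrow> K \<subseteq> L \<Longrightarrow> \<phi> K = c * volE L K"
  have sL: "subspace L" and dL: "dim L = j" using L by (auto simp: grass_def)
  have v: "volE L (cball 0 1 \<inter> L) = kappa j" using volE_ball_section[OF sL] dL by simp
  have cb: "conv_body (cball 0 1 \<inter> L)" by (rule conv_body_ball_section[OF sL])
  have kp: "kappa j > 0" by (rule kappa_pos)
  have "klain \<phi> L = c" unfolding klain_def
  proof (rule the_equality)
    show "\<forall>K. conv_body K \<and> K \<subseteq> L \<longrightarrow> \<phi> K = c * volE L K" using c by auto
    fix c' assume "\<forall>K. conv_body K \<and> K \<subseteq> L \<longrightarrow> \<phi> K = c' * volE L K"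
    then have "c' * kappa j = c * kappa j" using cb c[OF cb] v by auto
    then show "c' = c" using kp by simp
  qed
  then show ?thesis using c[OF cb] v kp by simp
qed

lemma klain_works:
  assumes L: "L \<in> grass j" and K: "conv_body K" "K \<subseteq> L" shows "\<phi> K = klain \<phi> L * volE L K"
proof (rule klain_exists[OF L])
  fix c assume c: "\<And>K. conv_body K \<Longrightarrow> K \<subseteq> L \<Longrightarrow> \<phi> K = c * volE L K"
  have sL: "subspace L" and dL: "dim L = j" using L by (auto simp: grass_def)
  have "klain \<phi> L = c"
    using klain_eq[OF L] c[OF conv_body_ball_section[OF sL]] volE_ball_section[OF sL] dL kappa_pos[of j] by simp
  then show ?thesis using c K by simp
qed

end

section \<open>Subspaces as orthogonal projections: topology and measurability on the
  Grassmannian\<close>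

definition projB :: "'a::euclidean_space set \<Rightarrow> 'a \<Rightarrow>\<^sub>L 'a" where "projB L = Blinfun (proj L)"

lemma projB_apply: "subspace L \<Longrightarrow> blinfun_apply (projB L) x = proj L x"
  by (simp add: projB_def bounded_linear_Blinfun_apply bounded_linear_proj)

lemma norm_projB_le: "subspace L \<Longrightarrow> norm (projB L) \<le> 1"
  by (rule norm_blinfun_bound) (auto simp: projB_apply norm_proj_le)

text \<open>Projecting a point of one unit ball section to the other subspace moves it by at most
  the operator norm of the difference of the projections.\<close>

lemma hausdist_ball_sections:
  assumes L: "subspace L" "subspace M"
  shows "0 \<le> hausdist (cball 0 1 \<inter> L) (cball 0 1 \<inter> M)"
    "hausdist (cball 0 1 \<inter> L) (cball 0 1 \<inter> M) \<le> dist (projB L) (projB M)"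
proof -
  have half: "(SUP x\<in>cball 0 1 \<inter> L. infdist x (cball 0 1 \<inter> M)) \<le> dist (projB L) (projB M)"
    and half0: "0 \<le> (SUP x\<in>cball 0 1 \<inter> L. infdist x (cball 0 1 \<inter> M))"
    if L: "subspace L" "subspace M" for L M :: "'a set"
  proof -
    have ne: "cball 0 1 \<inter> L \<noteq> {}" using zero_in_ball_section[OF L(1)] by blast
    have le: "infdist x (cball 0 1 \<inter> M) \<le> dist (projB L) (projB M)" if x: "x \<in> cball 0 1 \<inter> L" for x
    proof -
      have "proj M x \<in> cball 0 1 \<inter> M" using x norm_proj_le[OF L(2), of x] proj_in[OF L(2)] by auto
      then have "infdist x (cball 0 1 \<inter> M) \<le> dist x (proj M x)" by (rule infdist_le)
      also have "dist x (proj M x) = norm (blinfun_apply (projB L - projB M) x)"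
        using x L proj_id[OF L(1)] by (simp add: dist_norm projB_apply blinfun.diff_left)
      also have "\<dots> \<le> norm (projB L - projB M) * norm x" by (rule norm_blinfun)
      also have "\<dots> \<le> norm (projB L - projB M)" using x by (intro mult_left_le) auto
      finally show ?thesis by (simp add: dist_norm)
    qed
    show "(SUP x\<in>cball 0 1 \<inter> L. infdist x (cball 0 1 \<inter> M)) \<le> dist (projB L) (projB M)"
      using ne le by (rule cSUP_least)
    obtain x where x: "x \<in> cball 0 1 \<inter> L" using zero_in_ball_section[OF L(1)] by blast
    have "bdd_above ((\<lambda>x. infdist x (cball 0 1 \<inter> M)) ` (cball 0 1 \<inter> L))" using le by (intro bdd_aboveI2)
    then have "infdist x (cball 0 1 \<inter> M) \<le> (SUP x\<in>cball 0 1 \<inter> L. infdist x (cball 0 1 \<inter> M))" using x by (rule cSUP_upper2) simp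
    then show "0 \<le> (SUP x\<in>cball 0 1 \<inter> L. infdist x (cball 0 1 \<inter> M))" using infdist_nonneg order_trans by blast
  qed
  show "0 \<le> hausdist (cball 0 1 \<inter> L) (cball 0 1 \<inter> M)"
    unfolding hausdist_def using half0[OF L] by (simp add: le_max_iff_disj)
  show "hausdist (cball 0 1 \<inter> L) (cball 0 1 \<inter> M) \<le> dist (projB L) (projB M)"
    unfolding hausdist_def using half[OF L] half[OF L(2,1)] by (simp add: dist_commute)
qed

lemma hausdorff_continuous_ball_section:
  assumes c: "hausdorff_continuous \<phi>" and L: "subspace L" "\<And>m. subspace (Ls m)" and lim: "(\<lambda>m. projB (Ls m)) \<longlonglongrightarrow> projB L"
  shows "(\<lambda>m. \<phi> (cball 0 1 \<inter> Ls m)) \<longlonglongrightarrow> \<phi> (cball 0 1 \<inter> L)"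
proof -
  have "(\<lambda>m. dist (projB (Ls m)) (projB L)) \<longlonglongrightarrow> 0" using lim by (rule tendsto_dist_iff[THEN iffD1])
  note lim' = this
  have "(\<lambda>m. hausdist (cball 0 1 \<inter> Ls m) (cball 0 1 \<inter> L)) \<longlonglongrightarrow> 0"
    by (rule tendsto_sandwich[OF _ _ tendsto_const lim']) (use hausdist_ball_sections[OF L(2) L(1)] in auto)
  then show ?thesis
    using c[unfolded hausdorff_continuous_def, rule_format, of "cball 0 1 \<inter> L" "\<lambda>m. cball 0 1 \<inter> Ls m"] L
    by (simp add: conv_body_ball_section)
qed

text \<open>Compactness of the Grassmannians: a limit of orthogonal projections is an orthogonal projection.\<close>
lemma ball_section_bounded:
  fixes \<phi> :: "'a::euclidean_space set \<Rightarrow> real"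
  assumes c: "hausdorff_continuous \<phi>"
  obtains C where "C > 0" "\<And>L. subspace L \<Longrightarrow> \<bar>\<phi> (cball 0 1 \<inter> L)\<bar> \<le> C"
proof -
  have "\<exists>C. \<forall>L. subspace L \<longrightarrow> \<bar>\<phi> (cball 0 1 \<inter> L)\<bar> \<le> C"
  proof (rule ccontr)
    assume "\<not> ?thesis"
    then have "\<forall>m. \<exists>L. subspace L \<and> \<not> \<bar>\<phi> (cball 0 1 \<inter> L)\<bar> \<le> real m" by blast
    then obtain Ls where Ls: "\<And>m. subspace (Ls m)" "\<And>m. \<not> \<bar>\<phi> (cball 0 1 \<inter> Ls m)\<bar> \<le> real m" by metis
    have "bounded (range (\<lambda>m. projB (Ls m)))" unfolding bounded_iff using norm_projB_le[OF Ls(1)] by auto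
    then obtain f and r :: "nat \<Rightarrow> nat" where r: "strict_mono r" "((\<lambda>m. projB (Ls m)) \<circ> r) \<longlonglongrightarrow> f"
      using bounded_imp_convergent_subsequence by blast
    have lim: "(\<lambda>m. proj (Ls (r m)) x) \<longlonglongrightarrow> blinfun_apply f x" for x
      using blinfun.tendsto[OF r(2) tendsto_const[of x]] by (simp add: comp_def projB_apply Ls)
    define L where "L = range (blinfun_apply f)"
    have sL: "subspace L" unfolding L_def
      using blinfun.bounded_linear_right[of f] by (intro linear_subspace_image subspace_UNIV) (auto simp: bounded_linear.linear)
    have "proj L x = blinfun_apply f x" for x
    proof (rule proj_eqI[OF sL])
      show "blinfun_apply f x \<in> L" by (simp add: L_def)
      fix w assume "w \<in> L"
      then obtain y where y: "w = blinfun_apply f y" by (auto simp: L_def)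
      have "(\<lambda>m. (x - proj (Ls (r m)) x) \<bullet> proj (Ls (r m)) y) \<longlonglongrightarrow> (x - blinfun_apply f x) \<bullet> blinfun_apply f y"
        by (intro tendsto_intros lim)
      moreover have "(x - proj (Ls (r m)) x) \<bullet> proj (Ls (r m)) y = 0" for m
        by (rule proj_orth[OF Ls(1) proj_in[OF Ls(1)]])
      ultimately show "(x - blinfun_apply f x) \<bullet> w = 0" unfolding y by (simp add: LIMSEQ_const_iff)
    qed
    then have "projB L = f" by (intro blinfun_eqI) (simp add: projB_apply sL)
    then have "(\<lambda>m. projB (Ls (r m))) \<longlonglongrightarrow> projB L" using r(2) by (simp add: comp_def)
    then have "(\<lambda>m. \<phi> (cball 0 1 \<inter> Ls (r m))) \<longlonglongrightarrow> \<phi> (cball 0 1 \<inter> L)"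
      by (intro hausdorff_continuous_ball_section[OF c sL Ls(1)])
    then have "Bseq (\<lambda>m. \<phi> (cball 0 1 \<inter> Ls (r m)))" by (intro convergent_imp_Bseq convergentI)
    then obtain C where C: "\<And>m. \<bar>\<phi> (cball 0 1 \<inter> Ls (r m))\<bar> \<le> C" by (auto simp: Bseq_def)
    obtain m where "C < real m" using reals_Archimedean2 by blast
    also have "real m \<le> real (r m)" using seq_suble[OF r(1)] by simp
    finally show False using C[of m] Ls(2)[of "r m"] by linarith
  qed
  then obtain C where C: "\<And>L. subspace L \<Longrightarrow> \<bar>\<phi> (cball 0 1 \<inter> L)\<bar> \<le> C" by blast
  show ?thesis by (rule that[of "\<bar>C\<bar> + 1"]) (use C in fastforce)+
qed

lemma space_grass_space[simp]: "space (grass_space k) = grass k"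
  by (simp add: grass_space_def)

lemma measurable_projB[measurable]: "projB \<in> borel_measurable (grass_space k)"
  unfolding grass_space_def projB_def[abs_def] by (rule measurable_vimage_algebra1) auto

lemma measurable_grass_spaceI:
  assumes "\<And>x. x \<in> space M \<Longrightarrow> f x \<in> grass k" "(\<lambda>x. projB (f x)) \<in> borel_measurable M"
  shows "f \<in> M \<rightarrow>\<^sub>M grass_space k"
  unfolding grass_space_def using assms by (intro measurable_vimage_algebra2) (auto simp: projB_def)

text \<open>An operator is a finite sum of its matrix entries times matrix units, so measurability
  can be tested on basis vectors.\<close>

lemma measurable_blinfunI:
  fixes F :: "'x \<Rightarrow> 'a::euclidean_space \<Rightarrow>\<^sub>L 'b::euclidean_space"
  assumes [measurable]: "\<And>b. b \<in> Basis \<Longrightarrow> (\<lambda>x. blinfun_apply (F x) b) \<in> borel_measurable M"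
  shows "F \<in> borel_measurable M"
proof -
  have "F x = (\<Sum>i\<in>Basis. \<Sum>j\<in>Basis. (blinfun_apply (F x) j \<bullet> i) *\<^sub>R blinfun_of_matrix (\<lambda>i' j'. if i' = i \<and> j' = j then 1 else 0))" for x
  proof (rule blinfun_euclidean_eqI)
    fix b :: 'a assume b: "b \<in> Basis"
    have m: "blinfun_apply (blinfun_of_matrix (\<lambda>i' j'. if i' = i \<and> j' = j then 1 else 0)) b = (if j = b then i else 0)"
      if "i \<in> Basis" "j \<in> Basis" for i :: 'b and j :: 'a
    proof -
      have "blinfun_apply (blinfun_of_matrix (\<lambda>i' j'. if i' = i \<and> j' = j then 1 else 0)) b
        = (\<Sum>i'\<in>Basis. if i' = i then (\<Sum>j'\<in>Basis. if j' = j then (b \<bullet> j) *\<^sub>R i else 0) else 0)"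
      proof (unfold blinfun_of_matrix_apply, intro sum.cong refl)
        fix i' :: 'b
        show "(\<Sum>j'\<in>Basis. ((b \<bullet> j') * (if i' = i \<and> j' = j then 1 else 0)) *\<^sub>R i') =
          (if i' = i then (\<Sum>j'\<in>Basis. if j' = j then (b \<bullet> j) *\<^sub>R i else 0) else 0)"
        proof (cases "i' = i")
          case True
          then have "(\<Sum>j'\<in>Basis. ((b \<bullet> j') * (if i' = i \<and> j' = j then 1 else 0)) *\<^sub>R i') = (\<Sum>j'\<in>Basis. if j' = j then (b \<bullet> j) *\<^sub>R i else 0)"
            by (intro sum.cong refl) auto
          then show ?thesis using True by simp
        qed simp
      qed
      also have "\<dots> = (b \<bullet> j) *\<^sub>R i" using that by simp
      finally show ?thesis using b that by (auto simp: inner_Basis)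
    qed
    have "blinfun_apply (\<Sum>i\<in>Basis. \<Sum>j\<in>Basis. (blinfun_apply (F x) j \<bullet> i) *\<^sub>R blinfun_of_matrix (\<lambda>i' j'. if i' = i \<and> j' = j then 1 else 0)) b
      = (\<Sum>i\<in>Basis. \<Sum>j\<in>Basis. if j = b then (blinfun_apply (F x) b \<bullet> i) *\<^sub>R i else 0)"
      unfolding blinfun.sum_left blinfun.scaleR_left by (intro sum.cong refl) (auto simp: m)
    also have "\<dots> = blinfun_apply (F x) b" using b by (simp add: euclidean_representation)
    finally show "blinfun_apply (F x) b = blinfun_apply (\<Sum>i\<in>Basis. \<Sum>j\<in>Basis. (blinfun_apply (F x) j \<bullet> i) *\<^sub>R blinfun_of_matrix (\<lambda>i' j'. if i' = i \<and> j' = j then 1 else 0)) b" by simp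
  qed
  then have "F = (\<lambda>x. (\<Sum>i\<in>Basis. \<Sum>j\<in>Basis. (blinfun_apply (F x) j \<bullet> i) *\<^sub>R blinfun_of_matrix (\<lambda>i' j'. if i' = i \<and> j' = j then 1 else 0)))" by (rule ext)
  moreover have "\<dots> \<in> borel_measurable M"
    by (intro borel_measurable_sum borel_measurable_scaleR borel_measurable_inner borel_measurable_const assms) auto
  ultimately show ?thesis by simp
qed

text \<open>Sequential continuity suffices: the preimage of an open set \<open>S\<close> is cut out
  by the complement of the closure of all projections with value outside \<open>S\<close>. No
  closedness of the Grassmannian among the operators is involved.\<close>

lemma grass_seq_measurable:
  fixes h :: "'a::euclidean_space set \<Rightarrow> 'b::metric_space"
  assumes "\<And>L Ls. L \<in> grass k \<Longrightarrow> (\<And>m. Ls m \<in> grass k) \<Longrightarrow> (\<lambda>m. projB (Ls m)) \<longlonglongrightarrow> projB L \<Longrightarrow> (\<lambda>m. h (Ls m)) \<longlonglongrightarrow> h L"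
  shows "h \<in> borel_measurable (grass_space k)"
proof (rule borel_measurableI)
  fix S :: "'b set" assume S: "open S"
  define Z where "Z = projB ` {L \<in> grass k. h L \<notin> S}"
  have "h -` S \<inter> space (grass_space k) = projB -` (- closure Z) \<inter> space (grass_space k)"
  proof (intro set_eqI iffI)
    fix L assume L: "L \<in> h -` S \<inter> space (grass_space k)"
    have "projB L \<notin> closure Z"
    proof
      assume "projB L \<in> closure Z"
      then obtain z where z: "\<And>m. z m \<in> Z" "z \<longlonglongrightarrow> projB L" by (auto simp: closure_sequential)
      have "\<forall>m. \<exists>L. L \<in> grass k \<and> h L \<notin> S \<and> z m = projB L" using z(1) by (auto simp: Z_def)
      then obtain Ls where "\<forall>m. Ls m \<in> grass k \<and> h (Ls m) \<notin> S \<and> z m = projB (Ls m)"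
        using choice[of "\<lambda>m L. L \<in> grass k \<and> h L \<notin> S \<and> z m = projB L"] by auto
      then have Ls: "\<And>m. Ls m \<in> grass k" "\<And>m. h (Ls m) \<notin> S" "\<And>m. z m = projB (Ls m)" by auto
      have "z = (\<lambda>m. projB (Ls m))" using Ls(3) by (rule ext)
      then have "(\<lambda>m. projB (Ls m)) \<longlonglongrightarrow> projB L" using z(2) by simp
      then have "(\<lambda>m. h (Ls m)) \<longlonglongrightarrow> h L" using L Ls(1) by (intro assms) auto
      then have "eventually (\<lambda>m. h (Ls m) \<in> S) sequentially" using S L by (auto dest: topological_tendstoD)
      then show False using Ls(2) by simp
    qed
    then show "L \<in> projB -` (- closure Z) \<inter> space (grass_space k)" using L by simp
  next
    fix L assume "L \<in> projB -` (- closure Z) \<inter> space (grass_space k)"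
    then show "L \<in> h -` S \<inter> space (grass_space k)" using closure_subset[of Z] by (auto simp: Z_def)
  qed
  also have "\<dots> \<in> sets (grass_space k)" by (rule measurable_sets[OF measurable_projB]) auto
  finally show "h -` S \<inter> space (grass_space k) \<in> sets (grass_space k)" .
qed

text \<open>Expanding the point in \<open>Basis\<close> separates the two variables: coefficients
  depend on the point and projected basis vectors on the subspace.\<close>

lemma measurable_proj_pair[measurable]:
  assumes [measurable]: "f \<in> borel_measurable M" "g \<in> M \<rightarrow>\<^sub>M grass_space k"
  shows "(\<lambda>x. proj (g x) (f x)) \<in> borel_measurable M"
proof -
  have gE: "subspace (g x)" if "x \<in> space M" for x
    using measurable_space[OF assms(2) that] by (simp add: grass_def)
  have ev: "(\<lambda>L. blinfun_apply (projB L) b) \<in> borel_measurable (grass_space k)" for b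
    by (rule measurable_compose[OF measurable_projB]) (intro borel_measurable_continuous_onI continuous_intros)
  have "(\<lambda>x. \<Sum>b\<in>Basis. (f x \<bullet> b) *\<^sub>R blinfun_apply (projB (g x)) b) \<in> borel_measurable M"
    by (intro borel_measurable_sum borel_measurable_scaleR borel_measurable_inner borel_measurable_const assms(1) measurable_compose[OF assms(2) ev])
  moreover have "(\<Sum>b\<in>Basis. (f x \<bullet> b) *\<^sub>R blinfun_apply (projB (g x)) b) = proj (g x) (f x)" if "x \<in> space M" for x
  proof -
    have "proj (g x) (f x) = proj (g x) (\<Sum>b\<in>Basis. (f x \<bullet> b) *\<^sub>R b)" by (simp add: euclidean_representation)
    also have "\<dots> = (\<Sum>b\<in>Basis. (f x \<bullet> b) *\<^sub>R proj (g x) b)"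
      by (simp add: linear_sum[OF linear_proj[OF gE[OF that]]] linear_scale[OF linear_proj[OF gE[OF that]]])
    finally show ?thesis by (simp add: projB_apply gE[OF that])
  qed
  ultimately show ?thesis by (simp cong: measurable_cong)
qed

lemma (in hom_valuation) klain_continuous:
  assumes "L \<in> grass j" "\<And>m. Ls m \<in> grass j" "(\<lambda>m. projB (Ls m)) \<longlonglongrightarrow> projB L"
  shows "(\<lambda>m. klain \<phi> (Ls m)) \<longlonglongrightarrow> klain \<phi> L"
  unfolding klain_eq[OF assms(1)] klain_eq[OF assms(2)]
  using kappa_pos[of j] assms by (intro tendsto_divide tendsto_const hausdorff_continuous_ball_section[OF cont]) (auto simp: grass_def)

lemma (in hom_valuation) klain_measurable: "klain \<phi> \<in> borel_measurable (grass_space j)"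
  by (rule grass_seq_measurable) (rule klain_continuous)

lemma (in hom_valuation) klain_bounded:
  obtains C where "C > 0" "\<And>L. L \<in> grass j \<Longrightarrow> \<bar>klain \<phi> L\<bar> \<le> C"
proof (rule ball_section_bounded[OF cont])
  fix C assume C: "C > 0" "\<And>L. subspace L \<Longrightarrow> \<bar>\<phi> (cball 0 1 \<inter> L)\<bar> \<le> C"
  show ?thesis
  proof (rule that)
    show "C / kappa j > 0" using C kappa_pos by simp
    show "\<bar>klain \<phi> L\<bar> \<le> C / kappa j" if "L \<in> grass j" for L
      using C(2)[of L] that kappa_pos[of j] by (auto simp: klain_eq grass_def abs_divide intro!: divide_right_mono)
  qed
qed

section \<open>The area measure of codimension one\<close>

definition unit_nrm :: "'a::euclidean_space set \<Rightarrow> 'a \<Rightarrow> 'a" where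
  "unit_nrm P x = (1 / infdist x P) *\<^sub>R (x - closest_point P x)"

text \<open>Compared with \<open>local_par\<close> there is an inner radius, so that shells can be
  slid outwards, and the foot point is recorded with the normal. The foot point is needed to sort
  normal rays by where they leave a larger body.\<close>

definition shell :: "'a::euclidean_space set \<Rightarrow> 'a set \<Rightarrow> real \<Rightarrow> real \<Rightarrow> ('a \<times> 'a) set \<Rightarrow> 'a set" where
  "shell E P s t X = {x \<in> E. s < infdist x P \<and> infdist x P \<le> t \<and> (closest_point P x, unit_nrm P x) \<in> X}"

lemma local_par_eq_shell: "local_par E P \<epsilon> \<omega> = shell E P 0 \<epsilon> (UNIV \<times> \<omega>)"
  by (auto simp: local_par_def shell_def unit_nrm_def)

lemma subspace_borel: "subspace E \<Longrightarrow> E \<in> sets borel" for E :: "'a::euclidean_space set"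
  by (simp add: borel_closed closed_subspace)

locale body_in =
  fixes E P :: "'a::euclidean_space set"
  assumes E: "subspace E" and P: "conv_body P" and PE: "P \<subseteq> E"
begin

lemma P': "compact P" "closed P" "convex P" "P \<noteq> {}"
  using P by (auto simp: conv_body_def compact_imp_closed)

lemma cp_in: "closest_point P x \<in> P"
  using P' by (intro closest_point_in_set)

lemma infdist_cp: "infdist x P = norm (x - closest_point P x)"
  using setdist_closest_point[OF P'(2,4), of x] by (simp add: infdist_eq_setdist dist_norm)

lemma cp_dot: "z \<in> P \<Longrightarrow> (x - closest_point P x) \<bullet> (z - closest_point P x) \<le> 0"
  using P' by (intro closest_point_dot)

lemma decomp:
  assumes "0 < infdist x P"
  shows "x = closest_point P x + infdist x P *\<^sub>R unit_nrm P x" "norm (unit_nrm P x) = 1"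
  using assms by (auto simp: unit_nrm_def infdist_cp)

lemma unit_nrm_E: "x \<in> E \<Longrightarrow> unit_nrm P x \<in> E"
  unfolding unit_nrm_def using cp_in PE by (intro subspace_scale[OF E] subspace_diff[OF E]) auto

text \<open>\<open>P\<close> lies in the half-space bounded by the hyperplane through the foot point
  orthogonal to the normal, so all points of the normal ray share the foot point. Sliding along rays
  thus matches shells of different radii.\<close>

lemma ray:
  assumes x: "0 < infdist x P" and \<rho>: "0 \<le> \<rho>"
  defines "y \<equiv> closest_point P x + \<rho> *\<^sub>R unit_nrm P x"
  shows "closest_point P y = closest_point P x" "infdist y P = \<rho>" "0 < \<rho> \<Longrightarrow> unit_nrm P y = unit_nrm P x"
proof -
  let ?q = "closest_point P x" and ?u = "unit_nrm P x"
  have u: "norm ?u = 1" using decomp(2)[OF x] .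
  show cp: "closest_point P y = ?q"
  proof (rule closest_point_unique[symmetric, OF P'(3,2) cp_in], rule ballI)
    fix z assume z: "z \<in> P"
    have "?u \<bullet> (z - ?q) \<le> 0" using cp_dot[OF z, of x] x by (simp add: unit_nrm_def divide_nonpos_pos)
    then have "0 \<le> 2 * \<rho> * (?u \<bullet> (?q - z))" using \<rho> by (simp add: inner_diff_right)
    moreover have "(norm (y - z))\<^sup>2 = (norm (\<rho> *\<^sub>R ?u))\<^sup>2 + 2 * \<rho> * (?u \<bullet> (?q - z)) + (norm (?q - z))\<^sup>2"
    proof -
      have gen: "(norm (v + w))\<^sup>2 = (norm v)\<^sup>2 + 2 * (v \<bullet> w) + (norm w)\<^sup>2" for v w :: 'a
        by (simp add: power2_norm_eq_inner inner_add_left inner_add_right inner_commute)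
      have "y - z = \<rho> *\<^sub>R ?u + (?q - z)" by (simp add: y_def)
      then show ?thesis using gen[of "\<rho> *\<^sub>R ?u" "?q - z"] by (simp only: inner_scaleR_left mult.assoc)
    qed
    ultimately have "(norm (\<rho> *\<^sub>R ?u))\<^sup>2 \<le> (norm (y - z))\<^sup>2" by simp
    then have "norm (\<rho> *\<^sub>R ?u) \<le> norm (y - z)" by (rule power2_le_imp_le) simp
    then show "dist y ?q \<le> dist y z" by (simp add: dist_norm y_def)
  qed
  show d: "infdist y P = \<rho>" unfolding infdist_cp cp using u \<rho> by (simp add: y_def)
  show "0 < \<rho> \<Longrightarrow> unit_nrm P y = ?u" unfolding unit_nrm_def[of P y] d cp by (simp add: y_def)
qed

lemma cp_measurable[measurable]: "closest_point P \<in> borel_measurable borel"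
  using P' by (intro borel_measurable_continuous_onI continuous_on_closest_point)

lemma infdist_measurable[measurable]: "(\<lambda>x. infdist x P) \<in> borel_measurable borel"
  by (intro borel_measurable_continuous_onI continuous_on_infdist continuous_on_id)

lemma unit_nrm_measurable[measurable]: "unit_nrm P \<in> borel_measurable borel"
  unfolding unit_nrm_def[abs_def] by measurable

lemma shell_borel[measurable]:
  assumes [measurable]: "X \<in> sets borel" shows "shell E P s t X \<in> sets borel"
proof -
  note [measurable] = subspace_borel[OF E]
  have [measurable]: "(\<lambda>x. (closest_point P x, unit_nrm P x)) \<in> borel_measurable borel" by measurable
  have "shell E P s t X = {x \<in> space borel. x \<in> E \<and> s < infdist x P \<and> infdist x P \<le> t \<and> (closest_point P x, unit_nrm P x) \<in> X}"
    by (auto simp: shell_def)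
  also have "\<dots> \<in> sets borel" by measurable
  finally show ?thesis .
qed

lemma shell_bounded: "bounded (shell E P s t X)"
proof -
  obtain r where r: "\<And>k. k \<in> P \<Longrightarrow> norm k \<le> r" using compact_imp_bounded[OF P'(1)] by (auto simp: bounded_iff)
  have "norm x \<le> r + t" if "x \<in> shell E P s t X" for x
  proof -
    have "norm (x - closest_point P x) \<le> t" using that by (auto simp: shell_def infdist_cp)
    then show ?thesis using r[OF cp_in, of x] norm_triangle_sub[of x "closest_point P x"] by linarith
  qed
  then show ?thesis by (auto simp: bounded_iff)
qed

lemma shell_finite: "X \<in> sets borel \<Longrightarrow> emeasure (lamE E) (shell E P s t X) < \<infinity>"
  using emeasure_lamE_bounded[OF E shell_borel shell_bounded] .

lemma shell_fmeasurable: "X \<in> sets borel \<Longrightarrow> shell E P s t X \<in> fmeasurable (lamE E)"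
  using shell_finite by (intro fmeasurableI) auto

text \<open>Normal cones are monotone.\<close>
lemma pull_back_contraction:
  assumes x: "\<delta> \<le> infdist x P" "0 < infdist x P" and y: "\<delta> \<le> infdist y P" "0 < infdist y P" and \<delta>: "0 \<le> \<delta>"
  shows "norm ((x - y) - \<delta> *\<^sub>R (unit_nrm P x - unit_nrm P y)) \<le> norm (x - y)"
proof -
  let ?p = "closest_point P x" and ?q = "closest_point P y" and ?u = "unit_nrm P x" and ?v = "unit_nrm P y"
  let ?r = "infdist x P" and ?s = "infdist y P"
  have u: "?u \<bullet> ?u = 1" "?v \<bullet> ?v = 1" using decomp(2)[OF x(2)] decomp(2)[OF y(2)] by (auto simp: norm_eq_1)
  have "?u \<bullet> (?q - ?p) \<le> 0" using cp_dot[OF cp_in[of y], of x] x(2) by (simp add: unit_nrm_def divide_nonpos_pos)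
  moreover have "?v \<bullet> (?p - ?q) \<le> 0" using cp_dot[OF cp_in[of x], of y] y(2) by (simp add: unit_nrm_def divide_nonpos_pos)
  ultimately have mono: "0 \<le> (?p - ?q) \<bullet> (?u - ?v)" by (simp add: inner_diff_left inner_diff_right inner_commute)
  have c: "?u \<bullet> ?v \<le> 1" using Cauchy_Schwarz_ineq2[of ?u ?v] decomp(2)[OF x(2)] decomp(2)[OF y(2)] by simp
  have "x - y = (?p - ?q) + (?r *\<^sub>R ?u - ?s *\<^sub>R ?v)" using decomp(1)[OF x(2)] decomp(1)[OF y(2)] by (simp add: algebra_simps)
  then have "(x - y) \<bullet> (?u - ?v) = (?p - ?q) \<bullet> (?u - ?v) + (?r *\<^sub>R ?u - ?s *\<^sub>R ?v) \<bullet> (?u - ?v)" by (metis inner_add_left)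
  also have "(?r *\<^sub>R ?u - ?s *\<^sub>R ?v) \<bullet> (?u - ?v) = (?r + ?s) * (1 - ?u \<bullet> ?v)"
    using u by (simp add: inner_diff_left inner_diff_right inner_commute algebra_simps)
  finally have ge: "(x - y) \<bullet> (?u - ?v) \<ge> (?r + ?s) * (1 - ?u \<bullet> ?v)" using mono by simp
  \<comment> \<open>Both distances are at least \<open>\<delta>\<close>, so the cross term
    \<open>2 * \<delta> * ((x - y) \<bullet> (?u - ?v))\<close> is at least twice the quadratic term
    \<open>\<delta> * \<delta> * ((?u - ?v) \<bullet> (?u - ?v))\<close> in the expansion of the
    square.\<close>
  have "(2 * \<delta>) * (1 - ?u \<bullet> ?v) \<le> (?r + ?s) * (1 - ?u \<bullet> ?v)" using x y c by (intro mult_right_mono) auto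
  then have ge': "2 * ((x - y) \<bullet> (?u - ?v)) \<ge> 4 * \<delta> * (1 - ?u \<bullet> ?v)" using ge by linarith
  have sq: "(?u - ?v) \<bullet> (?u - ?v) = 2 * (1 - ?u \<bullet> ?v)" using u by (simp add: inner_diff_left inner_diff_right inner_commute)
  have gen: "(norm (v - \<delta> *\<^sub>R w))\<^sup>2 = (norm v)\<^sup>2 - \<delta> * (2 * (v \<bullet> w)) + \<delta> * \<delta> * (w \<bullet> w)" for v w :: 'a
    by (simp add: power2_norm_eq_inner inner_diff_left inner_diff_right inner_commute algebra_simps)
  have "(norm ((x - y) - \<delta> *\<^sub>R (?u - ?v)))\<^sup>2 = (norm (x - y))\<^sup>2 - \<delta> * (2 * ((x - y) \<bullet> (?u - ?v))) + \<delta> * \<delta> * (2 * (1 - ?u \<bullet> ?v))"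
    unfolding gen sq ..
  also have "\<dots> \<le> (norm (x - y))\<^sup>2"
  proof -
    have "\<delta> * (4 * \<delta> * (1 - ?u \<bullet> ?v)) \<le> \<delta> * (2 * ((x - y) \<bullet> (?u - ?v)))" using ge' \<delta> by (intro mult_left_mono)
    moreover have "0 \<le> \<delta> * \<delta> * (1 - ?u \<bullet> ?v)" using \<delta> c by (intro mult_nonneg_nonneg) auto
    ultimately show ?thesis by (simp add: algebra_simps)
  qed
  finally show ?thesis by (rule power2_le_imp_le) simp
qed

text \<open>Pulling the outer shell inwards by \<open>s' - s\<close> along the normals is a
  contraction that covers the inner shell. It is carried out on the cylinders, because the volume in
  \<open>E\<close> is defined through them.\<close>

lemma shell_expand:
  assumes X: "X \<in> sets borel" and s: "0 \<le> s" "s \<le> s'"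
  shows "emeasure (lamE E) (shell E P s (s + h) X) \<le> emeasure (lamE E) (shell E P s' (s' + h) X)"
proof -
  define \<delta> where "\<delta> = s' - s"
  have \<delta>: "0 \<le> \<delta>" using s by (simp add: \<delta>_def)
  let ?A = "shell E P s (s + h) X" and ?B = "shell E P s' (s' + h) X"
  \<comment> \<open>Only the component in \<open>E\<close> is moved; the component orthogonal to
    \<open>E\<close>, hence the cross-section of the cylinder, is untouched.\<close>
  define F where "F y = y - \<delta> *\<^sub>R unit_nrm P (proj E y)" for y
  have pF: "proj E (F y) = proj E y - \<delta> *\<^sub>R unit_nrm P (proj E y)" for y
    unfolding F_def linear_diff[OF linear_proj[OF E]] linear_scale[OF linear_proj[OF E]]
    using proj_id[OF E unit_nrm_E[OF proj_in[OF E]]] by simp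
  have "emeasure lborel (cyl E ?A) \<le> emeasure lborel (cyl E ?B)"
  proof (rule emeasure_Lipschitz_image_le[where f=F])
    show "cyl E ?B \<in> sets borel" "cyl E ?A \<in> sets borel" using E X shell_borel by auto
    show "cyl E ?A \<subseteq> F ` cyl E ?B"
    proof
      fix x assume x: "x \<in> cyl E ?A"
      define e where "e = proj E x"
      have e: "e \<in> E" "s < infdist e P" "infdist e P \<le> s + h" "(closest_point P e, unit_nrm P e) \<in> X" "norm (x - e) \<le> 1"
        using x by (auto simp: cyl_def shell_def e_def)
      have d0: "0 < infdist e P" using e s by simp
      define e' where "e' = closest_point P e + (infdist e P + \<delta>) *\<^sub>R unit_nrm P e"
      have e'e: "e' = e + \<delta> *\<^sub>R unit_nrm P e"
        using decomp(1)[OF d0] by (simp add: e'_def scaleR_add_left)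
      have r: "closest_point P e' = closest_point P e" "infdist e' P = infdist e P + \<delta>" "unit_nrm P e' = unit_nrm P e"
        using ray[OF d0, of "infdist e P + \<delta>"] \<delta> d0 by (auto simp: e'_def)
      have e'E: "e' \<in> E" unfolding e'e using e unit_nrm_E by (intro subspace_add[OF E] subspace_scale[OF E])
      define y where "y = x + \<delta> *\<^sub>R unit_nrm P e"
      have py: "proj E y = e'"
        unfolding y_def linear_add[OF linear_proj[OF E]] linear_scale[OF linear_proj[OF E]]
        using proj_id[OF E unit_nrm_E[OF e(1)]] by (simp add: e_def[symmetric] e'e)
      have "y \<in> cyl E ?B"
        using e r e'E py by (auto simp: cyl_def shell_def \<delta>_def y_def e'e)
      moreover have "F y = x" unfolding F_def py r by (simp add: y_def)
      ultimately show "x \<in> F ` cyl E ?B" by blast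
    qed
    fix x y assume xy: "x \<in> cyl E ?B" "y \<in> cyl E ?B"
    have d: "\<delta> \<le> infdist (proj E x) P" "0 < infdist (proj E x) P" "\<delta> \<le> infdist (proj E y) P" "0 < infdist (proj E y) P"
      using xy s by (auto simp: cyl_def shell_def \<delta>_def)
    have "norm (proj E (F x - F y)) \<le> norm (proj E (x - y))"
      using pull_back_contraction[OF d \<delta>] by (simp add: linear_diff[OF linear_proj[OF E]] pF algebra_simps)
    moreover have "(F x - F y) - proj E (F x - F y) = (x - y) - proj E (x - y)"
      by (simp add: linear_diff[OF linear_proj[OF E]] pF) (simp add: F_def)
    ultimately have "(norm (F x - F y))\<^sup>2 \<le> (norm (x - y))\<^sup>2"
      using norm_proj_sq[OF E, of "F x - F y"] norm_proj_sq[OF E, of "x - y"] by (simp add: power_mono)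
    then show "dist (F x) (F y) \<le> dist x y" unfolding dist_norm by (rule power2_le_imp_le) simp
  qed
  then show ?thesis using E X shell_borel by (simp add: emeasure_lamE divide_right_mono_ennreal)
qed

lemma shell_expand_measure:
  assumes X: "X \<in> sets borel" and s: "0 \<le> s" "s \<le> s'"
  shows "measure (lamE E) (shell E P s (s + h) X) \<le> measure (lamE E) (shell E P s' (s' + h) X)"
  unfolding measure_def using shell_expand[OF assms] shell_finite[OF X] by (intro enn2real_mono) auto

lemma shell_split:
  assumes X: "X \<in> sets borel" and "s \<le> t" "t \<le> r"
  shows "measure (lamE E) (shell E P s r X) = measure (lamE E) (shell E P s t X) + measure (lamE E) (shell E P t r X)"
proof -
  have "shell E P s r X = shell E P s t X \<union> shell E P t r X" using assms by (auto simp: shell_def)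
  moreover have "shell E P s t X \<inter> shell E P t r X = {}" by (auto simp: shell_def)
  ultimately show ?thesis using shell_fmeasurable[OF X] by (simp add: measure_Un3)
qed

end

text \<open>The first \<open>k\<close> terms are at most \<open>G k\<close> and the later ones at
  least that, so the mean of an initial part of an increasing sequence does not exceed the full
  mean.\<close>

lemma incseq_partial_sum_le:
  fixes G :: "nat \<Rightarrow> real"
  assumes G: "\<And>i j. i \<le> j \<Longrightarrow> G i \<le> G j" and k: "k \<le> N"
  shows "real N * (\<Sum>i<k. G i) \<le> real k * (\<Sum>i<N. G i)"
proof -
  have "(\<Sum>i<N. G i) = (\<Sum>i<k. G i) + (\<Sum>i\<in>{k..<N}. G i)"
    using k by (metis atLeast0LessThan le0 sum.atLeastLessThan_concat)
  moreover have "(\<Sum>i\<in>{k..<N}. G i) \<ge> real (N - k) * G k"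
    using sum_bounded_below[of "{k..<N}" "G k" G] G by simp
  moreover have "(\<Sum>i<k. G i) \<le> real k * G k" using sum_bounded_above[of "{..<k}" G "G k"] G by simp
  then have "real (N - k) * (\<Sum>i<k. G i) \<le> real (N - k) * (real k * G k)" by (rule mult_left_mono) simp
  moreover have Nk: "real N = real k + real (N - k)" using k by simp
  have "real N * (\<Sum>i<k. G i) = real k * (\<Sum>i<k. G i) + real (N - k) * (\<Sum>i<k. G i)"
    by (subst Nk) (rule distrib_right)
  ultimately have "real N * (\<Sum>i<k. G i) \<le> real k * (\<Sum>i<k. G i) + real (N - k) * (real k * G k)"
    by linarith
  also have "\<dots> \<le> real k * (\<Sum>i<k. G i) + real k * (\<Sum>i\<in>{k..<N}. G i)"
    using \<open>(\<Sum>i\<in>{k..<N}. G i) \<ge> real (N - k) * G k\<close> by (simp add: mult.left_commute mult_left_mono)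
  finally show ?thesis using \<open>(\<Sum>i<N. G i) = (\<Sum>i<k. G i) + (\<Sum>i\<in>{k..<N}. G i)\<close> by (simp add: distrib_left)
qed

lemma at_right_0_mono_limit:
  fixes f :: "real \<Rightarrow> real"
  assumes mono: "\<And>a b. 0 < a \<Longrightarrow> a \<le> b \<Longrightarrow> f a \<le> f b" and nn: "\<And>a. 0 < a \<Longrightarrow> 0 \<le> f a"
  obtains l where "(f \<longlongrightarrow> l) (at_right 0)" "0 \<le> l" "\<And>a. 0 < a \<Longrightarrow> l \<le> f a"
proof -
  define l where "l = (INF a\<in>{0<..}. f a)"
  have bdd: "bdd_below (f ` {0<..})" using nn by (intro bdd_belowI2[of _ 0]) auto
  have le: "l \<le> f a" if "0 < a" for a unfolding l_def using that by (intro cINF_lower[OF bdd]) auto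
  have "(f \<longlongrightarrow> l) (at_right 0)"
  proof (rule order_tendstoI)
    fix y assume "y < l"
    then show "eventually (\<lambda>x. y < f x) (at_right 0)"
      using le by (auto simp: eventually_at_right_field intro!: exI[of _ 1] intro: less_le_trans)
  next
    fix y assume "l < y"
    then obtain a where a: "0 < a" "f a < y" unfolding l_def using cINF_less_iff[OF _ bdd, of y] by auto
    have "f x < y" if "0 < x" "x < a" for x using mono[of x a] that a by simp
    then show "eventually (\<lambda>x. f x < y) (at_right 0)" using a by (auto simp: eventually_at_right_field)
  qed
  moreover have "0 \<le> l" unfolding l_def using nn by (intro cINF_greatest) auto
  ultimately show ?thesis using that le by blast
qed

definition shell_fun :: "'a::euclidean_space set \<Rightarrow> 'a set \<Rightarrow> real \<Rightarrow> ('a \<Rightarrow> real) \<Rightarrow> 'a \<Rightarrow> real" where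
  "shell_fun E P \<epsilon> g x = indicator (shell E P 0 \<epsilon> UNIV) x * g (unit_nrm P x)"

definition area_int :: "'a::euclidean_space set \<Rightarrow> 'a set \<Rightarrow> ('a \<Rightarrow> real) \<Rightarrow> real" where
  "area_int E P g = (\<integral>u. g u \<partial>area_codim1 E P)"

text \<open>The integral form of the quotient in \<open>area_codim1\<close>, where the factor 2 is
  the volume of the unit ball of the line.\<close>

definition shell_avg :: "'a::euclidean_space set \<Rightarrow> 'a set \<Rightarrow> real \<Rightarrow> ('a \<Rightarrow> real) \<Rightarrow> real" where
  "shell_avg E P \<epsilon> g = (1 / (2 * \<epsilon>)) * (\<integral>x. shell_fun E P \<epsilon> g x \<partial>lamE E)"

context body_in
begin

text \<open>Cut the shell of width \<open>b\<close> into layers of equal width. Their volumes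
  increase outwards by \<open>shell_expand\<close>, so the mean over the inner layers is at most the
  mean over all: parallel volume is convex in the width. This takes the place of the local Steiner
  formula.\<close>

lemma shell_quotient_mono:
  assumes X: "X \<in> sets borel" and ab: "0 < a" "a \<le> b"
  shows "measure (lamE E) (shell E P 0 a X) / (2 * a) \<le> measure (lamE E) (shell E P 0 b X) / (2 * b)"
proof -
  let ?F = "\<lambda>t. measure (lamE E) (shell E P 0 t X)"
  have mono: "?F s \<le> ?F t" if "s \<le> t" for s t
  proof (rule measure_mono_fmeasurable)
    show "shell E P 0 s X \<subseteq> shell E P 0 t X" using that by (auto simp: shell_def)
  qed (use shell_fmeasurable[OF X] shell_borel[OF X] in simp_all)
  have le: "?F a \<le> (a / b + 1 / real (Suc m)) * ?F b" for m
  proof -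
    let ?N = "Suc m"
    define h where "h = b / real ?N"
    have h: "h > 0" "real ?N * h = b" using ab by (auto simp: h_def)
    define G where "G i = measure (lamE E) (shell E P (real i * h) (real (Suc i) * h) X)" for i :: nat
    have G: "G i \<le> G j" if "i \<le> j" for i j
      unfolding G_def using shell_expand_measure[OF X, of "real i * h" "real j * h" h] that h(1)
      by (simp add: algebra_simps)
    have FG: "?F (real k * h) = (\<Sum>i<k. G i)" for k
    proof (induction k)
      case 0
      have "shell E P 0 (real 0 * h) X = {}" by (auto simp: shell_def)
      then show ?case by simp
    next
      case (Suc k)
      have "?F (real (Suc k) * h) = ?F (real k * h) + G k"
        unfolding G_def using h(1) by (intro shell_split[OF X]) (auto intro!: mult_right_mono)
      then show ?case using Suc by simp
    qed
    \<comment> \<open>Enough layers to reach \<open>a\<close>, but no more than exist. Rounding up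
      costs one layer, which is the error \<open>1 / real (Suc m)\<close> that disappears in the
      limit.\<close>
    define k where "k = min ?N (nat \<lceil>a / h\<rceil>)"
    have "a / h \<le> real (nat \<lceil>a / h\<rceil>)" by linarith
    moreover have "a / h \<le> real ?N" using ab h by (simp add: pos_divide_le_eq)
    ultimately have k1: "a \<le> real k * h" using h(1) by (simp add: k_def pos_divide_le_eq min_def)
    have "0 \<le> a / h" using ab h by simp
    then have "real (nat \<lceil>a / h\<rceil>) \<le> a / h + 1" by linarith
    then have k2: "real k \<le> a / h + 1" by (simp add: k_def)
    have "k \<le> ?N" by (simp add: k_def)
    then have "real ?N * (\<Sum>i<k. G i) \<le> real k * (\<Sum>i<?N. G i)" using G by (intro incseq_partial_sum_le)
    then have "real ?N * ?F (real k * h) \<le> real k * ?F b" using FG[of k] FG[of ?N] h(2) by simp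
    also have "\<dots> \<le> (a / h + 1) * ?F b" using k2 by (intro mult_right_mono) auto
    finally have "?F (real k * h) \<le> (a / h + 1) * ?F b / real ?N" by (simp add: pos_le_divide_eq mult.commute)
    also have "(a / h + 1) * ?F b / real ?N = (a / (real ?N * h) + 1 / real ?N) * ?F b"
    proof -
      have e: "a / (real ?N * h) + 1 / real ?N = (a / h + 1) / real ?N"
        by (simp add: add_divide_distrib mult.commute del: of_nat_Suc)
      show ?thesis unfolding e by (simp only: times_divide_eq_left)
    qed
    finally show ?thesis using mono[OF k1] h(2) by simp
  qed
  have "(\<lambda>m. (a / b + 1 / real (Suc m)) * ?F b) \<longlonglongrightarrow> (a / b + 0) * ?F b"
    by (intro tendsto_intros LIMSEQ_Suc[OF lim_1_over_n])
  then have "?F a \<le> (a / b + 0) * ?F b" by (rule LIMSEQ_le_const) (use le in auto)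
  then show ?thesis using ab by (simp add: field_simps)
qed

definition quot :: "real \<Rightarrow> ('a \<times> 'a) set \<Rightarrow> real" where
  "quot \<epsilon> X = measure (lamE E) (shell E P 0 \<epsilon> X) / (2 * \<epsilon>)"

lemma quot_mono: "X \<in> sets borel \<Longrightarrow> 0 < a \<Longrightarrow> a \<le> b \<Longrightarrow> quot a X \<le> quot b X"
  unfolding quot_def by (rule shell_quotient_mono)

lemma quot_limit:
  assumes X: "X \<in> sets borel"
  obtains l where "((\<lambda>\<epsilon>. quot \<epsilon> X) \<longlongrightarrow> l) (at_right 0)" "0 \<le> l" "\<And>a. 0 < a \<Longrightarrow> l \<le> quot a X"
  using at_right_0_mono_limit[of "\<lambda>\<epsilon>. quot \<epsilon> X"] quot_mono[OF X] by (metis (no_types, lifting) divide_nonneg_nonneg less_imp_le measure_nonneg mult_nonneg_nonneg quot_def zero_le_numeral)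

definition alim :: "'a set \<Rightarrow> real" where "alim \<omega> = Lim (at_right 0) (\<lambda>\<epsilon>. quot \<epsilon> (UNIV \<times> \<omega>))"

lemma UNIV_Times_borel[measurable]: "\<omega> \<in> sets borel \<Longrightarrow> (UNIV::'a set) \<times> (\<omega> :: 'a set) \<in> sets borel"
  unfolding borel_prod[symmetric] by (intro pair_measureI) auto

text \<open>The \<open>Lim\<close> in the definition of the area measure is attained as a genuine
  limit, from above, since the quotients are monotone in the width.\<close>

lemma alim:
  assumes "\<omega> \<in> sets borel"
  shows "((\<lambda>\<epsilon>. quot \<epsilon> (UNIV \<times> \<omega>)) \<longlongrightarrow> alim \<omega>) (at_right 0)" "0 \<le> alim \<omega>" "\<And>a. 0 < a \<Longrightarrow> alim \<omega> \<le> quot a (UNIV \<times> \<omega>)"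
proof -
  obtain l where l: "((\<lambda>\<epsilon>. quot \<epsilon> (UNIV \<times> \<omega>)) \<longlongrightarrow> l) (at_right 0)" "0 \<le> l" "\<And>a. 0 < a \<Longrightarrow> l \<le> quot a (UNIV \<times> \<omega>)"
    using quot_limit[OF UNIV_Times_borel[OF assms]] by metis
  have "alim \<omega> = l" unfolding alim_def using l(1) by (intro tendsto_Lim) auto
  then show "((\<lambda>\<epsilon>. quot \<epsilon> (UNIV \<times> \<omega>)) \<longlongrightarrow> alim \<omega>) (at_right 0)" "0 \<le> alim \<omega>" "\<And>a. 0 < a \<Longrightarrow> alim \<omega> \<le> quot a (UNIV \<times> \<omega>)"
    using l by auto
qed

lemma alim_empty: "alim {} = 0"
proof -
  have "quot \<epsilon> (UNIV \<times> {}) = 0" for \<epsilon> by (simp add: quot_def shell_def)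
  then have "((\<lambda>\<epsilon>. 0) \<longlongrightarrow> alim {}) (at_right (0::real))" using alim(1)[of "{}"] by simp
  then show ?thesis using tendsto_unique[OF trivial_limit_at_right_real _ tendsto_const] by blast
qed

lemma quot_Un:
  assumes "X \<in> sets borel" "Y \<in> sets borel" "X \<inter> Y = {}"
  shows "quot \<epsilon> (X \<union> Y) = quot \<epsilon> X + quot \<epsilon> Y"
proof -
  have "shell E P 0 \<epsilon> (X \<union> Y) = shell E P 0 \<epsilon> X \<union> shell E P 0 \<epsilon> Y" by (auto simp: shell_def)
  moreover have "shell E P 0 \<epsilon> X \<inter> shell E P 0 \<epsilon> Y = {}" using assms(3) by (auto simp: shell_def)
  ultimately show ?thesis using shell_fmeasurable assms(1,2) by (simp add: quot_def measure_Un3 add_divide_distrib)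
qed

abbreviation "\<Omega> \<equiv> sphere 0 1 \<inter> E"

lemma Omega_borel[measurable]: "\<Omega> \<in> sets borel"
  using subspace_borel[OF E] by (intro sets.Int) auto

lemma sets_Omega: "sets (restrict_space borel \<Omega>) = {\<omega> \<in> sets borel. \<omega> \<subseteq> \<Omega>}"
  using sets_restrict_space_iff[of \<Omega> borel] Omega_borel sets.sets_into_space[of _ "restrict_space borel \<Omega>"]
  by (auto simp: space_restrict_space)

lemma area_codim1_eq: "area_codim1 E P = measure_of \<Omega> (sets (restrict_space borel \<Omega>)) (\<lambda>\<omega>. ennreal (alim \<omega>))"
  unfolding area_codim1_def
proof (rule measure_of_eq)
  show "sets (restrict_space borel \<Omega>) \<subseteq> Pow \<Omega>" by (auto simp: sets_Omega)
  fix \<omega> assume "\<omega> \<in> sigma_sets \<Omega> (sets (restrict_space borel \<Omega>))"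
  then have "\<omega> \<in> sets (restrict_space borel \<Omega>)"
    by (metis Int_UNIV_right sets.sigma_sets_eq space_borel space_restrict_space)
  then have w: "\<omega> \<in> sets borel" by (simp add: sets_Omega)
  have "volE E (local_par E P \<epsilon> \<omega>) / (2 * \<epsilon>) = quot \<epsilon> (UNIV \<times> \<omega>)" for \<epsilon>
    unfolding local_par_eq_shell quot_def using w by (subst volE_eq_measure_lamE[OF E shell_borel]) auto
  then show "ennreal (Lim (at_right 0) (\<lambda>\<epsilon>. volE E (local_par E P \<epsilon> \<omega>) / (2 * \<epsilon>))) = ennreal (alim \<omega>)"
    by (simp add: alim_def)
qed

lemma sets_area[measurable_cong]: "sets (area_codim1 E P) = sets (restrict_space borel \<Omega>)"
  unfolding area_codim1_eq
  by (metis (no_types, lifting) Int_UNIV_right sets.sets_measure_of_eq space_borel space_restrict_space)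

lemma space_area: "space (area_codim1 E P) = \<Omega>"
  using sets_eq_imp_space_eq[OF sets_area] by (simp add: space_restrict_space)

text \<open>Finite additivity passes to the limit, but countable additivity needs a bound:
  \<open>alim\<close> is dominated by \<open>quot 1\<close>, which is continuous at the empty set as
  a normalised volume. Continuity at the empty set then yields countable additivity.\<close>

lemma emeasure_area:
  assumes w: "\<omega> \<in> sets borel" "\<omega> \<subseteq> \<Omega>"
  shows "emeasure (area_codim1 E P) \<omega> = ennreal (alim \<omega>)"
proof (rule emeasure_measure_of[OF area_codim1_eq])
  let ?M = "sets (restrict_space borel \<Omega>)"
  show "?M \<subseteq> Pow \<Omega>" by (auto simp: sets_Omega)
  show "\<omega> \<in> sets (area_codim1 E P)" using w by (simp add: sets_area sets_Omega)
  show "positive (sets (area_codim1 E P)) (\<lambda>\<omega>. ennreal (alim \<omega>))" by (simp add: positive_def alim_empty)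
  interpret R: ring_of_sets \<Omega> ?M using sets.ring_of_sets_axioms[of "restrict_space borel \<Omega>"] by (simp add: space_restrict_space)
  have "countably_additive ?M (\<lambda>\<omega>. ennreal (alim \<omega>))"
  proof (rule R.empty_continuous_imp_countably_additive)
    show "positive ?M (\<lambda>\<omega>. ennreal (alim \<omega>))" by (simp add: positive_def alim_empty)
    show "additive ?M (\<lambda>\<omega>. ennreal (alim \<omega>))"
      unfolding additive_def
    proof (intro ballI impI)
      fix x y assume xy: "x \<in> ?M" "y \<in> ?M" "x \<inter> y = {}"
      then have b: "x \<in> sets borel" "y \<in> sets borel" "x \<union> y \<in> sets borel" by (auto simp: sets_Omega)
      have "quot \<epsilon> (UNIV \<times> (x \<union> y)) = quot \<epsilon> (UNIV \<times> x) + quot \<epsilon> (UNIV \<times> y)" for \<epsilon>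
        using quot_Un[of "UNIV \<times> x" "UNIV \<times> y" \<epsilon>] b xy(3) by (simp add: Sigma_Un_distrib2 Times_Int_Times)
      then have "((\<lambda>\<epsilon>. quot \<epsilon> (UNIV \<times> (x \<union> y))) \<longlongrightarrow> alim x + alim y) (at_right 0)"
        using tendsto_add[OF alim(1)[OF b(1)] alim(1)[OF b(2)]] by simp
      then have "alim (x \<union> y) = alim x + alim y" using alim(1)[OF b(3)] tendsto_unique trivial_limit_at_right_real by blast
      then show "ennreal (alim (x \<union> y)) = ennreal (alim x) + ennreal (alim y)" using alim(2) b by (simp add: ennreal_plus)
    qed
    fix A :: "nat \<Rightarrow> 'a set" assume A: "range A \<subseteq> ?M" "decseq A" "(\<Inter>i. A i) = {}"
    then have b: "A i \<in> sets borel" for i by (auto simp: sets_Omega)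
    have "(\<lambda>i. measure (lamE E) (shell E P 0 1 (UNIV \<times> A i))) \<longlonglongrightarrow> measure (lamE E) (\<Inter>i. shell E P 0 1 (UNIV \<times> A i))"
    proof (rule Lim_measure_decseq)
      show "range (\<lambda>i. shell E P 0 1 (UNIV \<times> A i)) \<subseteq> sets (lamE E)" using b by auto
      show "decseq (\<lambda>i. shell E P 0 1 (UNIV \<times> A i))" using A(2) by (fastforce simp: decseq_def shell_def)
      show "emeasure (lamE E) (shell E P 0 1 (UNIV \<times> A i)) \<noteq> \<infinity>" for i using shell_finite[OF UNIV_Times_borel[OF b], of 0 1 i] by auto
    qed
    moreover have "(\<Inter>i. shell E P 0 1 (UNIV \<times> A i)) = {}" using A(3) by (auto simp: shell_def)
    ultimately have "(\<lambda>i. quot 1 (UNIV \<times> A i)) \<longlonglongrightarrow> 0 / 2"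
      unfolding quot_def by (intro tendsto_divide) auto
    then have "(\<lambda>i. quot 1 (UNIV \<times> A i)) \<longlonglongrightarrow> 0" by simp
    then have "(\<lambda>i. alim (A i)) \<longlonglongrightarrow> 0"
      by (rule tendsto_sandwich[OF _ _ tendsto_const, rotated 2]) (use alim b in auto)
    then show "(\<lambda>i. ennreal (alim (A i))) \<longlonglongrightarrow> 0" using tendsto_ennrealI by fastforce
  qed auto
  then show "countably_additive (sets (area_codim1 E P)) (\<lambda>\<omega>. ennreal (alim \<omega>))" by (simp add: sets_area)
qed

lemma finite_area: "finite_measure (area_codim1 E P)"
  by (rule finite_measureI) (simp add: space_area emeasure_area)

text \<open>The distribution of the normals over the shell of width \<open>\<epsilon>\<close>,
  normalised as in the area measure. It dominates the area measure setwise, which turns set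
  estimates into estimates of integrals.\<close>

definition shell_meas :: "real \<Rightarrow> 'a measure" where
  "shell_meas \<epsilon> = scale_measure (ennreal (1 / (2 * \<epsilon>))) (distr (restrict_space (lamE E) (shell E P 0 \<epsilon> UNIV)) (restrict_space borel \<Omega>) (unit_nrm P))"

lemma unit_nrm_shell_measurable: "unit_nrm P \<in> restrict_space (lamE E) (shell E P 0 \<epsilon> UNIV) \<rightarrow>\<^sub>M restrict_space borel \<Omega>"
  using decomp(2) unit_nrm_E
  by (intro measurable_restrict_space2 measurable_restrict_space1) (auto simp: space_restrict_space shell_def)

lemma sets_shell_meas[measurable_cong]: "sets (shell_meas \<epsilon>) = sets (restrict_space borel \<Omega>)"
  by (simp add: shell_meas_def)

lemma space_shell_meas: "space (shell_meas \<epsilon>) = \<Omega>"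
  using sets_eq_imp_space_eq[OF sets_shell_meas] by (simp add: space_restrict_space)

lemma emeasure_shell_meas:
  assumes e: "0 < \<epsilon>" and w: "\<omega> \<in> sets borel" "\<omega> \<subseteq> \<Omega>"
  shows "emeasure (shell_meas \<epsilon>) \<omega> = ennreal (quot \<epsilon> (UNIV \<times> \<omega>))"
proof -
  have S: "shell E P 0 \<epsilon> UNIV \<in> sets borel" by simp
  have "emeasure (distr (restrict_space (lamE E) (shell E P 0 \<epsilon> UNIV)) (restrict_space borel \<Omega>) (unit_nrm P)) \<omega>
    = emeasure (restrict_space (lamE E) (shell E P 0 \<epsilon> UNIV)) (unit_nrm P -` \<omega> \<inter> shell E P 0 \<epsilon> UNIV)"
    using w by (subst emeasure_distr[OF unit_nrm_shell_measurable]) (auto simp: sets_Omega space_restrict_space)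
  also have "\<dots> = emeasure (lamE E) (unit_nrm P -` \<omega> \<inter> shell E P 0 \<epsilon> UNIV)"
    using S by (intro emeasure_restrict_space) auto
  also have "unit_nrm P -` \<omega> \<inter> shell E P 0 \<epsilon> UNIV = shell E P 0 \<epsilon> (UNIV \<times> \<omega>)" by (auto simp: shell_def)
  finally show ?thesis
    using shell_fmeasurable[OF UNIV_Times_borel[OF w(1)], of 0 \<epsilon>] e
    by (simp add: shell_meas_def quot_def emeasure_eq_measure2 ennreal_mult' [symmetric] field_simps)
qed

lemma finite_shell_meas: "0 < \<epsilon> \<Longrightarrow> finite_measure (shell_meas \<epsilon>)"
  by (rule finite_measureI) (simp add: space_shell_meas emeasure_shell_meas)

lemma area_le_shell_meas: "0 < \<epsilon> \<Longrightarrow> area_codim1 E P \<le> shell_meas \<epsilon>"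
  by (subst le_measure) (auto simp: sets_area sets_shell_meas sets_Omega emeasure_area emeasure_shell_meas alim intro!: ennreal_leI)

lemma g_measurable_Omega: "g \<in> borel_measurable borel \<Longrightarrow> g \<in> borel_measurable (restrict_space borel \<Omega>)"
  by (rule measurable_restrict_space1)

lemma integral_shell_meas:
  fixes g :: "'a \<Rightarrow> real"
  assumes e: "0 < \<epsilon>" and g: "g \<in> borel_measurable borel"
  shows "(\<integral>u. g u \<partial>shell_meas \<epsilon>) = shell_avg E P \<epsilon> g"
proof -
  let ?D = "distr (restrict_space (lamE E) (shell E P 0 \<epsilon> UNIV)) (restrict_space borel \<Omega>) (unit_nrm P)"
  have "shell_meas \<epsilon> = density ?D (\<lambda>_. ennreal (1 / (2 * \<epsilon>)))"
  proof (rule measure_eqI)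
    fix A assume "A \<in> sets (shell_meas \<epsilon>)"
    then show "emeasure (shell_meas \<epsilon>) A = emeasure (density ?D (\<lambda>_. ennreal (1 / (2 * \<epsilon>)))) A"
      by (simp add: shell_meas_def emeasure_density nn_integral_cmult)
  qed (simp add: shell_meas_def)
  then have "(\<integral>u. g u \<partial>shell_meas \<epsilon>) = (\<integral>u. (1 / (2 * \<epsilon>)) *\<^sub>R g u \<partial>?D)"
    using e g_measurable_Omega[OF g] by (simp only:) (subst integral_density, auto)
  also have "\<dots> = (1 / (2 * \<epsilon>)) * (\<integral>u. g u \<partial>?D)" by simp
  also have "(\<integral>u. g u \<partial>?D) = (\<integral>x. g (unit_nrm P x) \<partial>restrict_space (lamE E) (shell E P 0 \<epsilon> UNIV))"
    by (rule integral_distr[OF unit_nrm_shell_measurable g_measurable_Omega[OF g]])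
  also have "\<dots> = (\<integral>x. indicator (shell E P 0 \<epsilon> UNIV) x * g (unit_nrm P x) \<partial>lamE E)"
    by (subst integral_restrict_space) auto
  finally show ?thesis by (simp add: shell_avg_def shell_fun_def)
qed

lemma integral_area_le_shell_meas:
  fixes g :: "'a \<Rightarrow> real"
  assumes e: "0 < \<epsilon>" and g: "g \<in> borel_measurable borel" "\<And>u. 0 \<le> g u" "\<And>u. g u \<le> C"
  shows "(\<integral>u. g u \<partial>area_codim1 E P) \<le> (\<integral>u. g u \<partial>shell_meas \<epsilon>)"
proof -
  interpret A: finite_measure "area_codim1 E P" by (rule finite_area)
  interpret S: finite_measure "shell_meas \<epsilon>" by (rule finite_shell_meas[OF e])
  have gA[measurable]: "g \<in> borel_measurable (area_codim1 E P)" "g \<in> borel_measurable (shell_meas \<epsilon>)"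
    using g_measurable_Omega[OF g(1)] by (auto cong: measurable_cong_sets simp: sets_area sets_shell_meas)
  have "(\<integral>\<^sup>+u. ennreal (g u) \<partial>area_codim1 E P) \<le> (\<integral>\<^sup>+u. ennreal (g u) \<partial>shell_meas \<epsilon>)"
    by (rule nn_integral_mono_measure) (simp_all add: sets_area sets_shell_meas area_le_shell_meas[OF e])
  moreover have "integrable (shell_meas \<epsilon>) g" using g gA by (intro S.integrable_const_bound[where B=C]) auto
  then have "(\<integral>\<^sup>+u. ennreal (g u) \<partial>shell_meas \<epsilon>) < \<infinity>"
    using g by (subst nn_integral_eq_integral) auto
  ultimately show ?thesis using g gA by (simp add: integral_eq_nn_integral enn2real_mono)
qed

text \<open>The domination by \<open>shell_meas\<close> is applied to the nonnegative functions
  \<open>g + C\<close> and \<open>C - g\<close>; together they bound the error by \<open>C\<close>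
  times the difference of the total masses, which tends to 0.\<close>

lemma shell_avg_at_right:
  fixes g :: "'a \<Rightarrow> real"
  assumes g: "g \<in> borel_measurable borel" "\<And>u. \<bar>g u\<bar> \<le> C"
  shows "((\<lambda>\<epsilon>. shell_avg E P \<epsilon> g) \<longlongrightarrow> area_int E P g) (at_right 0)"
proof -
  interpret A: finite_measure "area_codim1 E P" by (rule finite_area)
  let ?a = "alim \<Omega>" and ?q = "\<lambda>\<epsilon>. quot \<epsilon> (UNIV \<times> \<Omega>)"
  have mA: "measure (area_codim1 E P) \<Omega> = ?a" using alim(2)[of \<Omega>] by (simp add: measure_def emeasure_area)
  have gA: "g \<in> borel_measurable (area_codim1 E P)"
    using g_measurable_Omega[OF g(1)] by (auto cong: measurable_cong_sets simp: sets_area)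
  have iA: "integrable (area_codim1 E P) g" using g gA by (intro A.integrable_const_bound[where B=C]) auto
  have b: "\<bar>shell_avg E P \<epsilon> g - (\<integral>u. g u \<partial>area_codim1 E P)\<bar> \<le> C * (?q \<epsilon> - ?a)" if e: "0 < \<epsilon>" for \<epsilon>
  proof -
    interpret S: finite_measure "shell_meas \<epsilon>" by (rule finite_shell_meas[OF e])
    have mS: "measure (shell_meas \<epsilon>) \<Omega> = ?q \<epsilon>" using e by (simp add: measure_def emeasure_shell_meas quot_def)
    have gS: "g \<in> borel_measurable (shell_meas \<epsilon>)"
      using g_measurable_Omega[OF g(1)] by (auto cong: measurable_cong_sets simp: sets_shell_meas)
    have iS: "integrable (shell_meas \<epsilon>) g" using g gS by (intro S.integrable_const_bound[where B=C]) auto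
    have m: "(\<lambda>u. g u + C) \<in> borel_measurable borel" "(\<lambda>u. C - g u) \<in> borel_measurable borel" using g(1) by auto
    have gb: "- C \<le> g u" "g u \<le> C" for u using g(2)[of u] by (auto simp: abs_le_iff)
    have gb2: "0 \<le> g u + C" "g u + C \<le> 2 * C" "0 \<le> C - g u" "C - g u \<le> 2 * C" for u
      using gb[of u] by linarith+
    have "(\<integral>u. g u + C \<partial>area_codim1 E P) \<le> (\<integral>u. g u + C \<partial>shell_meas \<epsilon>)"
      by (rule integral_area_le_shell_meas[OF e m(1) gb2(1,2)])
    moreover have "(\<integral>u. C - g u \<partial>area_codim1 E P) \<le> (\<integral>u. C - g u \<partial>shell_meas \<epsilon>)"
      by (rule integral_area_le_shell_meas[OF e m(2) gb2(3,4)])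
    ultimately show ?thesis
      using iA iS mA mS by (simp add: space_area space_shell_meas integral_shell_meas[OF e g(1)] algebra_simps abs_le_iff)
  qed
  have "((\<lambda>\<epsilon>. C * (?q \<epsilon> - ?a)) \<longlongrightarrow> C * (?a - ?a)) (at_right 0)"
    by (intro tendsto_intros alim(1)) simp
  then have lim0: "((\<lambda>\<epsilon>. C * (?q \<epsilon> - ?a)) \<longlongrightarrow> 0) (at_right 0)" by simp
  have "((\<lambda>\<epsilon>. shell_avg E P \<epsilon> g - (\<integral>u. g u \<partial>area_codim1 E P)) \<longlongrightarrow> 0) (at_right 0)"
    by (rule Lim_null_comparison[OF _ lim0]) (use b in \<open>auto simp: eventually_at_right_field intro!: exI[of _ 1]\<close>)
  then show ?thesis unfolding area_int_def by (rule LIM_zero_cancel)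
qed

end

section \<open>The area measure as a valuation\<close>

lemma at_right_0_seq:
  fixes f :: "real \<Rightarrow> real"
  assumes "(f \<longlongrightarrow> l) (at_right 0)" "\<And>m. 0 < e m" "e \<longlonglongrightarrow> 0"
  shows "(\<lambda>m. f (e m)) \<longlonglongrightarrow> l"
proof -
  have "filterlim e (at_right 0) sequentially"
    using assms(2,3) by (intro tendsto_imp_filterlim_at_right) auto
  then show ?thesis using assms(1) by (rule filterlim_compose[rotated])
qed

context body_in
begin

lemma shell_fun_measurable[measurable]:
  assumes "g \<in> borel_measurable borel" shows "shell_fun E P \<epsilon> g \<in> borel_measurable borel"
proof -
  have [measurable]: "(\<lambda>x. g (unit_nrm P x)) \<in> borel_measurable borel"
    by (rule measurable_compose[OF unit_nrm_measurable assms])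
  show ?thesis unfolding shell_fun_def[abs_def] by measurable
qed

lemma shell_fun_integrable:
  assumes g: "g \<in> borel_measurable borel" "\<And>u. \<bar>g u\<bar> \<le> C"
  shows "integrable (lamE E) (shell_fun E P \<epsilon> g)"
proof (rule Bochner_Integration.integrable_bound)
  have "emeasure (lamE E) (shell E P 0 \<epsilon> UNIV) < \<infinity>" by (intro shell_finite) simp
  then show "integrable (lamE E) (\<lambda>x. C * indicator (shell E P 0 \<epsilon> UNIV) x :: real)" by simp
  show "shell_fun E P \<epsilon> g \<in> borel_measurable (lamE E)" using shell_fun_measurable[OF g(1)] by simp
  have "0 \<le> C" using g(2)[of 0] by simp
  then show "AE x in lamE E. norm (shell_fun E P \<epsilon> g x) \<le> norm (C * indicator (shell E P 0 \<epsilon> UNIV) x :: real)"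
    using g(2) by (auto simp: shell_fun_def indicator_def)
qed

lemma shell_avg_tendsto:
  assumes g: "g \<in> borel_measurable borel" "\<And>u. \<bar>g u\<bar> \<le> C" and e: "\<And>m. 0 < e m" "e \<longlonglongrightarrow> 0"
  shows "(\<lambda>m. shell_avg E P (e m) g) \<longlonglongrightarrow> area_int E P g"
  by (rule at_right_0_seq[OF shell_avg_at_right[OF g] e])

text \<open>At a given \<open>x\<close> the body enters only through its nearest point and its
  distance, so identities between bodies can be checked pointwise.\<close>

lemma shell_fun_cp_cong:
  assumes "closest_point P x = closest_point Q x" "infdist x P = infdist x Q"
  shows "shell_fun E P \<epsilon> g x = shell_fun E Q \<epsilon> g x"
  using assms by (simp add: shell_fun_def shell_def unit_nrm_def indicator_def)

lemma area_int_add_const: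
  assumes g: "g \<in> borel_measurable borel" "\<And>u. \<bar>g u\<bar> \<le> C"
  shows "area_int E P (\<lambda>u. c - g u) = c * area_int E P (\<lambda>_. 1) - area_int E P g"
proof -
  interpret A: finite_measure "area_codim1 E P" by (rule finite_area)
  have gA: "g \<in> borel_measurable (area_codim1 E P)"
    using g_measurable_Omega[OF g(1)] by (auto cong: measurable_cong_sets simp: sets_area)
  have iA: "integrable (area_codim1 E P) g" using g gA by (intro A.integrable_const_bound[where B=C]) auto
  then show ?thesis by (simp add: area_int_def mult.commute)
qed

lemma area_int_le_shell_avg:
  assumes "0 < \<epsilon>" "g \<in> borel_measurable borel" "\<And>u. 0 \<le> g u" "\<And>u. g u \<le> C"
  shows "area_int E P g \<le> shell_avg E P \<epsilon> g"
  using integral_area_le_shell_meas[OF assms] integral_shell_meas[OF assms(1,2)] by (simp add: area_int_def)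

lemma shell_avg_one: "0 < \<epsilon> \<Longrightarrow> shell_avg E P \<epsilon> (\<lambda>_. 1) = measure (lamE E) (shell E P 0 \<epsilon> UNIV) / (2 * \<epsilon>)"
  by (simp add: shell_avg_def shell_fun_def)

end

text \<open>For the union, the closer of the two nearest points wins. For the intersection, the
  segment between the nearest points lies in the convex union, so by connectedness it meets
  \<open>P \<inter> Q\<close>; that point is no farther from \<open>x\<close> than the nearest point
  of \<open>Q\<close> and so equals it.\<close>

lemma closest_point_union:
  assumes P: "conv_body P" and Q: "conv_body Q" and U: "conv_body (P \<union> Q)" and I: "P \<inter> Q \<noteq> {}"
    and le: "infdist x P \<le> infdist x Q"
  shows "closest_point (P \<union> Q) x = closest_point P x" "closest_point (P \<inter> Q) x = closest_point Q x"
    "infdist x (P \<union> Q) = infdist x P" "infdist x (P \<inter> Q) = infdist x Q"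
proof -
  interpret P: body_in UNIV P by unfold_locales (use P in auto)
  interpret Q: body_in UNIV Q by unfold_locales (use Q in auto)
  interpret U: body_in UNIV "P \<union> Q" by unfold_locales (use U in auto)
  have I': "conv_body (P \<inter> Q)"
    using I P.P' Q.P' by (auto simp: conv_body_def compact_Int convex_Int)
  interpret I: body_in UNIV "P \<inter> Q" by unfold_locales (use I' in auto)
  let ?p = "closest_point P x" and ?q = "closest_point Q x"
  show "closest_point (P \<union> Q) x = ?p"
  proof (rule closest_point_unique[symmetric, OF U.P'(3,2)], use P.cp_in in blast, rule ballI)
    fix z assume "z \<in> P \<union> Q"
    then have "infdist x P \<le> dist x z" using le infdist_le[of z P x] infdist_le[of z Q x] by auto
    then show "dist x ?p \<le> dist x z" by (simp add: P.infdist_cp dist_norm)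
  qed
  then show "infdist x (P \<union> Q) = infdist x P" by (simp add: U.infdist_cp P.infdist_cp)
  have qP: "?q \<in> P"
  proof -
    have seg: "closed_segment ?p ?q \<subseteq> P \<union> Q"
      using U.P'(3) P.cp_in Q.cp_in by (intro closed_segment_subset) auto
    have "closed_segment ?p ?q \<inter> P \<inter> Q \<noteq> {}"
    proof (rule ccontr)
      assume "\<not> ?thesis"
      then have "P \<inter> Q \<inter> closed_segment ?p ?q = {}" by auto
      then have "P \<inter> closed_segment ?p ?q = {} \<or> Q \<inter> closed_segment ?p ?q = {}"
        using connected_closedD[OF connected_segment(1) _ seg P.P'(2) Q.P'(2)] by auto
      then show False using P.cp_in[of x] Q.cp_in[of x] ends_in_segment[of ?p ?q] by blast
    qed
    then obtain z where z: "z \<in> closed_segment ?p ?q" "z \<in> P" "z \<in> Q" by auto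
    have "dist x z \<le> dist x ?q"
    proof -
      have "convex (cball x (dist x ?q))" by simp
      moreover have "?p \<in> cball x (dist x ?q)" using le by (simp add: P.infdist_cp Q.infdist_cp dist_norm)
      ultimately have "closed_segment ?p ?q \<subseteq> cball x (dist x ?q)" by (intro closed_segment_subset) auto
      then show ?thesis using z by auto
    qed
    moreover have "dist x ?q \<le> dist x w" if "w \<in> Q" for w using closest_point_le[OF Q.P'(2) that] .
    ultimately have "z = ?q" by (intro closest_point_unique[OF Q.P'(3,2) z(3)]) (auto intro: order_trans)
    then show ?thesis using z by simp
  qed
  show "closest_point (P \<inter> Q) x = ?q"
  proof (rule closest_point_unique[symmetric, OF I.P'(3,2)], use qP Q.cp_in in blast, rule ballI)
    fix z assume "z \<in> P \<inter> Q"
    then show "dist x ?q \<le> dist x z" using closest_point_le[OF Q.P'(2)] by auto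
  qed
  then show "infdist x (P \<inter> Q) = infdist x Q" by (simp add: I.infdist_cp Q.infdist_cp)
qed

text \<open>At every point the pair union and intersection has the same nearest points and distances
  as the pair \<open>P\<close> and \<open>Q\<close>, in some order. The valuation identity thus
  holds for the shell functions and survives integration and the limit.\<close>

lemma area_int_valuation:
  assumes E: "subspace E" and P: "conv_body P" "P \<subseteq> E" and Q: "conv_body Q" "Q \<subseteq> E"
    and U: "conv_body (P \<union> Q)" and I: "P \<inter> Q \<noteq> {}"
    and g: "g \<in> borel_measurable borel" "\<And>u. \<bar>g u\<bar> \<le> C"
  shows "area_int E (P \<union> Q) g + area_int E (P \<inter> Q) g = area_int E P g + area_int E Q g"
proof -
  interpret P: body_in E P by unfold_locales (use E P in auto)
  interpret Q: body_in E Q by unfold_locales (use E Q in auto)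
  interpret U: body_in E "P \<union> Q" by unfold_locales (use E P Q U in auto)
  have I': "conv_body (P \<inter> Q)"
    using I P.P' Q.P' by (auto simp: conv_body_def compact_Int convex_Int)
  interpret I: body_in E "P \<inter> Q" by unfold_locales (use E P I' in auto)
  have pw: "shell_fun E (P \<union> Q) \<epsilon> g x + shell_fun E (P \<inter> Q) \<epsilon> g x = shell_fun E P \<epsilon> g x + shell_fun E Q \<epsilon> g x" for \<epsilon> x
  proof (cases "infdist x P \<le> infdist x Q")
    case True
    note c = closest_point_union[OF P(1) Q(1) U I True]
    show ?thesis using U.shell_fun_cp_cong[OF c(1,3)] I.shell_fun_cp_cong[OF c(2,4)] by simp
  next
    case False
    then have le: "infdist x Q \<le> infdist x P" by simp
    have U': "conv_body (Q \<union> P)" "Q \<inter> P \<noteq> {}" using U I by (auto simp: Un_commute)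
    note c = closest_point_union[OF Q(1) P(1) U' le]
    show ?thesis using U.shell_fun_cp_cong[of x Q] I.shell_fun_cp_cong[of x P] c by (simp add: Un_commute Int_commute)
  qed
  have "shell_avg E (P \<union> Q) \<epsilon> g + shell_avg E (P \<inter> Q) \<epsilon> g = shell_avg E P \<epsilon> g + shell_avg E Q \<epsilon> g" for \<epsilon>
  proof -
    have "(\<integral>x. shell_fun E (P \<union> Q) \<epsilon> g x \<partial>lamE E) + (\<integral>x. shell_fun E (P \<inter> Q) \<epsilon> g x \<partial>lamE E)
      = (\<integral>x. shell_fun E (P \<union> Q) \<epsilon> g x + shell_fun E (P \<inter> Q) \<epsilon> g x \<partial>lamE E)"
      by (rule Bochner_Integration.integral_add[symmetric]; rule U.shell_fun_integrable[OF g] I.shell_fun_integrable[OF g])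
    also have "\<dots> = (\<integral>x. shell_fun E P \<epsilon> g x + shell_fun E Q \<epsilon> g x \<partial>lamE E)" by (simp add: pw)
    also have "\<dots> = (\<integral>x. shell_fun E P \<epsilon> g x \<partial>lamE E) + (\<integral>x. shell_fun E Q \<epsilon> g x \<partial>lamE E)"
      by (rule Bochner_Integration.integral_add; rule P.shell_fun_integrable[OF g] Q.shell_fun_integrable[OF g])
    finally show ?thesis unfolding shell_avg_def distrib_left[symmetric] by (rule arg_cong)
  qed
  then have eq: "(\<lambda>m. shell_avg E (P \<union> Q) (1 / real (Suc m)) g + shell_avg E (P \<inter> Q) (1 / real (Suc m)) g)
     = (\<lambda>m. shell_avg E P (1 / real (Suc m)) g + shell_avg E Q (1 / real (Suc m)) g)" by (rule ext)
  have e: "0 < 1 / real (Suc m)" for m by simp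
  note lim = LIMSEQ_Suc[OF lim_1_over_n]
  have "(\<lambda>m. shell_avg E (P \<union> Q) (1 / real (Suc m)) g + shell_avg E (P \<inter> Q) (1 / real (Suc m)) g) \<longlonglongrightarrow> area_int E (P \<union> Q) g + area_int E (P \<inter> Q) g"
    by (intro tendsto_add U.shell_avg_tendsto[OF g e lim] I.shell_avg_tendsto[OF g e lim])
  moreover have "(\<lambda>m. shell_avg E (P \<union> Q) (1 / real (Suc m)) g + shell_avg E (P \<inter> Q) (1 / real (Suc m)) g) \<longlonglongrightarrow> area_int E P g + area_int E Q g"
    unfolding eq by (intro tendsto_add P.shell_avg_tendsto[OF g e lim] Q.shell_avg_tendsto[OF g e lim])
  ultimately show ?thesis by (rule LIMSEQ_unique)
qed

text \<open>A factor \<open>s\<close> of either sign is split into \<open>\<bar>s\<bar>\<close> and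
  \<open>sgn s\<close>; the sign acts as a reflection, which is orthogonal and preserves
  \<open>E\<close>.\<close>

lemma lamE_affine:
  fixes E :: "'a::euclidean_space set"
  assumes E: "subspace E" and t: "t \<in> E" and s: "s \<noteq> 0"
  shows "lamE E = density (distr (lamE E) borel (\<lambda>x. t + s *\<^sub>R x)) (\<lambda>_. ennreal (\<bar>s\<bar> ^ dim E))"
proof (rule measure_eqI)
  fix A assume "A \<in> sets (lamE E)" then have A: "A \<in> sets borel" by simp
  define B where "B = (\<lambda>x. t + x) -` A"
  have B: "B \<in> sets borel" unfolding B_def by (rule measurable_sets_borel[OF _ A]) simp
  define C where "C = (\<lambda>x. sgn s *\<^sub>R x) -` B"
  have C: "C \<in> sets borel" unfolding C_def by (rule measurable_sets_borel[OF _ B]) simp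
  have CB: "emeasure (lamE E) C = emeasure (lamE E) B"
  proof (cases "s > 0")
    case False
    then have CC: "C = uminus -` B" using s by (auto simp: C_def)
    have "uminus ` E = E" using E by (force simp: subspace_neg image_iff intro: bexI[of _ "- _"])
    moreover have "orthogonal_transformation (uminus :: 'a \<Rightarrow> 'a)" by (simp add: orthogonal_transformation_def linear_uminus)
    ultimately show ?thesis using emeasure_lamE_orthogonal[of uminus E B] E B CC by simp
  qed (simp add: C_def)
  have D: "(\<lambda>x. \<bar>s\<bar> *\<^sub>R x) -` C = (\<lambda>x. t + s *\<^sub>R x) -` A"
    by (auto simp: C_def B_def abs_mult_sgn mult.commute)
  have "emeasure (density (distr (lamE E) borel (\<lambda>x. t + s *\<^sub>R x)) (\<lambda>_. ennreal (\<bar>s\<bar> ^ dim E))) A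
    = ennreal (\<bar>s\<bar> ^ dim E) * emeasure (lamE E) ((\<lambda>x. t + s *\<^sub>R x) -` A)"
    using A by (subst emeasure_density) (auto simp: nn_integral_cmult emeasure_distr)
  also have "\<dots> = emeasure (lamE E) C" using emeasure_lamE_scale[OF E _ C, of "\<bar>s\<bar>"] s D by simp
  also have "\<dots> = emeasure (lamE E) A" unfolding CB B_def by (rule emeasure_lamE_translation[OF E t A])
  finally show "emeasure (lamE E) A = emeasure (density (distr (lamE E) borel (\<lambda>x. t + s *\<^sub>R x)) (\<lambda>_. ennreal (\<bar>s\<bar> ^ dim E))) A" by simp
qed simp

lemma integral_lamE_affine:
  fixes F :: "'a::euclidean_space \<Rightarrow> real"
  assumes E: "subspace E" and t: "t \<in> E" and s: "s \<noteq> 0" and F[measurable]: "F \<in> borel_measurable borel"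
  shows "(\<integral>x. F x \<partial>lamE E) = \<bar>s\<bar> ^ dim E * (\<integral>x. F (t + s *\<^sub>R x) \<partial>lamE E)"
proof -
  have "(\<integral>x. F x \<partial>lamE E) = (\<integral>x. F x \<partial>density (distr (lamE E) borel (\<lambda>x. t + s *\<^sub>R x)) (\<lambda>_. ennreal (\<bar>s\<bar> ^ dim E)))"
    using lamE_affine[OF E t s] by simp
  also have "\<dots> = (\<integral>x. (\<bar>s\<bar> ^ dim E) *\<^sub>R F x \<partial>distr (lamE E) borel (\<lambda>x. t + s *\<^sub>R x))"
    by (subst integral_density) auto
  also have "\<dots> = (\<integral>x. (\<bar>s\<bar> ^ dim E) *\<^sub>R F (t + s *\<^sub>R x) \<partial>lamE E)" by (subst integral_distr) auto
  finally show ?thesis by simp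
qed

text \<open>The map carries the shell of width \<open>\<epsilon>\<close> to that of width
  \<open>\<bar>s\<bar> * \<epsilon>\<close> and scales volume by
  \<open>\<bar>s\<bar> ^ Suc j\<close>; division by the new width leaves
  \<open>\<bar>s\<bar> ^ j\<close>. A negative \<open>s\<close> reverses the normals.\<close>

lemma area_int_affine:
  fixes E :: "'a::euclidean_space set"
  assumes E: "subspace E" and P: "conv_body P" "P \<subseteq> E" and t: "t \<in> E" and s: "s \<noteq> 0" and dim: "dim E = Suc j"
    and g: "g \<in> borel_measurable borel" "\<And>u. \<bar>g u\<bar> \<le> C"
  shows "area_int E ((\<lambda>x. t + s *\<^sub>R x) ` P) g = \<bar>s\<bar> ^ j * area_int E P (\<lambda>u. g (sgn s *\<^sub>R u))"
proof -
  let ?T = "\<lambda>x. t + s *\<^sub>R x"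
  let ?Q = "?T ` P" and ?g = "\<lambda>u. g (sgn s *\<^sub>R u)"
  interpret P: body_in E P by unfold_locales (use E P in auto)
  have Q: "conv_body ?Q"
  proof -
    have "?Q = (\<lambda>x. t + x) ` (\<lambda>x. s *\<^sub>R x) ` P" by (simp add: image_image)
    then show ?thesis using P by (simp add: conv_body_scale conv_body_translation)
  qed
  have QE: "?Q \<subseteq> E" using P t by (auto intro!: subspace_add[OF E] subspace_scale[OF E])
  interpret Q: body_in E ?Q by unfold_locales (use E Q QE in auto)
  have cp: "closest_point ?Q (?T x) = ?T (closest_point P x)" for x
  proof (rule closest_point_unique[symmetric, OF Q.P'(3,2)], use P.cp_in in blast, rule ballI)
    fix z assume "z \<in> ?Q"
    then obtain y where y: "y \<in> P" "z = ?T y" by auto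
    have "dist x (closest_point P x) \<le> dist x y" using closest_point_le[OF P.P'(2) y(1)] .
    then show "dist (?T x) (?T (closest_point P x)) \<le> dist (?T x) z"
      unfolding y(2) by (simp add: dist_norm scaleR_diff_right[symmetric] mult_left_mono)
  qed
  have id: "infdist (?T x) ?Q = \<bar>s\<bar> * infdist x P" for x
    unfolding Q.infdist_cp P.infdist_cp cp by (simp add: scaleR_diff_right[symmetric])
  have un: "unit_nrm ?Q (?T x) = sgn s *\<^sub>R unit_nrm P x" for x
    unfolding unit_nrm_def id cp using s by (simp add: scaleR_diff_right[symmetric] real_sgn_eq)
  have TE: "?T x \<in> E \<longleftrightarrow> x \<in> E" for x
  proof
    assume "?T x \<in> E"
    then have "(1 / s) *\<^sub>R (?T x - t) \<in> E" using t by (intro subspace_scale[OF E] subspace_diff[OF E])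
    then show "x \<in> E" using s by simp
  qed (use t in \<open>auto intro!: subspace_add[OF E] subspace_scale[OF E]\<close>)
  have sh: "?T x \<in> shell E ?Q 0 (\<bar>s\<bar> * \<epsilon>) UNIV \<longleftrightarrow> x \<in> shell E P 0 \<epsilon> UNIV" for x \<epsilon>
    using s unfolding shell_def mem_Collect_eq id TE by (simp add: zero_less_mult_iff)
  have f: "shell_fun E ?Q (\<bar>s\<bar> * \<epsilon>) g (?T x) = shell_fun E P \<epsilon> ?g x" for x \<epsilon>
    unfolding shell_fun_def un indicator_def sh ..
  have eq: "shell_avg E ?Q (\<bar>s\<bar> * \<epsilon>) g = \<bar>s\<bar> ^ j * shell_avg E P \<epsilon> ?g" if "\<epsilon> > 0" for \<epsilon>
  proof -
    have "(\<integral>x. shell_fun E ?Q (\<bar>s\<bar> * \<epsilon>) g x \<partial>lamE E) = \<bar>s\<bar> ^ dim E * (\<integral>x. shell_fun E P \<epsilon> ?g x \<partial>lamE E)"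
      using integral_lamE_affine[OF E t s Q.shell_fun_measurable[OF g(1)], of "\<bar>s\<bar> * \<epsilon>"] unfolding f .
    then show ?thesis using s that by (simp add: shell_avg_def dim field_simps)
  qed
  have g': "?g \<in> borel_measurable borel" "\<And>u. \<bar>?g u\<bar> \<le> C" using g by auto
  have e: "0 < 1 / real (Suc m)" for m by simp
  note lim = LIMSEQ_Suc[OF lim_1_over_n]
  have e': "0 < \<bar>s\<bar> * (1 / real (Suc m))" for m using s by simp
  have lim': "(\<lambda>m. \<bar>s\<bar> * (1 / real (Suc m))) \<longlonglongrightarrow> 0"
    using tendsto_mult[OF tendsto_const lim, of "\<bar>s\<bar>"] by simp
  have "(\<lambda>m. shell_avg E ?Q (\<bar>s\<bar> * (1 / real (Suc m))) g) \<longlonglongrightarrow> area_int E ?Q g" by (rule Q.shell_avg_tendsto[OF g e' lim'])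
  moreover have "(\<lambda>m. shell_avg E ?Q (\<bar>s\<bar> * (1 / real (Suc m))) g) \<longlonglongrightarrow> \<bar>s\<bar> ^ j * area_int E P ?g"
    unfolding eq[OF e] by (intro tendsto_mult tendsto_const P.shell_avg_tendsto[OF g' e lim])
  ultimately show ?thesis by (rule LIMSEQ_unique)
qed

text \<open>Fubini along \<open>u\<close>: almost every point for \<open>lamE M\<close> lies in
  \<open>M\<close>, and over such points the set is a product.\<close>

lemma prism_measure:
  fixes M :: "'a::euclidean_space set"
  assumes M: "subspace M" and u: "norm u = 1" "\<And>x. x \<in> M \<Longrightarrow> u \<bullet> x = 0"
    and Y[measurable]: "Y \<in> sets borel" and I[measurable]: "I \<in> sets borel"
  defines "E \<equiv> span (insert u M)"
  shows "emeasure (lamE E) {x \<in> E. proj M x \<in> Y \<and> u \<bullet> x \<in> I} = emeasure (lamE M) Y * emeasure lborel I"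
    "{x \<in> E. proj M x \<in> Y \<and> u \<bullet> x \<in> I} \<in> sets borel"
proof -
  let ?A = "{x \<in> E. proj M x \<in> Y \<and> u \<bullet> x \<in> I}"
  have sE: "subspace E" by (simp add: E_def)
  note [measurable] = subspace_borel[OF sE] borel_measurable_proj[OF M]
  have "?A = {x \<in> space borel. x \<in> E \<and> proj M x \<in> Y \<and> u \<bullet> x \<in> I}" by auto
  also have "\<dots> \<in> sets borel" by measurable
  finally show A[measurable]: "?A \<in> sets borel" .
  interpret sM: sigma_finite_measure "lamE M" by (rule sigma_finite_lamE[OF M])
  have mem: "y + \<tau> *\<^sub>R u \<in> ?A \<longleftrightarrow> y \<in> Y \<and> \<tau> \<in> I" if y: "y \<in> M" for y \<tau>
  proof -
    have "y + \<tau> *\<^sub>R u \<in> E" using y unfolding E_def by (intro span_add span_scale) (auto intro: span_base)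
    moreover have "proj M (y + \<tau> *\<^sub>R u) = y" by (rule proj_eqI[OF M y]) (use u in auto)
    moreover have "u \<bullet> (y + \<tau> *\<^sub>R u) = \<tau>" using u y by (simp add: inner_add_right norm_eq_1)
    ultimately show ?thesis by simp
  qed
  have lam: "lamE E = distr (lamE M \<Otimes>\<^sub>M lborel) borel (\<lambda>(y, t). y + t *\<^sub>R u)"
    unfolding E_def by (rule lamE_insert[OF M u])
  have "emeasure (lamE E) ?A = (\<integral>\<^sup>+x. indicator ?A x \<partial>lamE E)"
    by (rule nn_integral_indicator[symmetric]) (simp only: sets_lamE A)
  also have "\<dots> = (\<integral>\<^sup>+x. indicator ?A (fst x + snd x *\<^sub>R u) \<partial>(lamE M \<Otimes>\<^sub>M lborel))"
    unfolding lam by (subst nn_integral_distr) (simp_all add: case_prod_beta)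
  also have "\<dots> = (\<integral>\<^sup>+y. (\<integral>\<^sup>+\<tau>. indicator ?A (y + \<tau> *\<^sub>R u) \<partial>lborel) \<partial>lamE M)"
    by (subst lborel.nn_integral_fst[symmetric]) auto
  also have "\<dots> = (\<integral>\<^sup>+y. indicator Y y * emeasure lborel I \<partial>lamE M)"
  proof (rule nn_integral_cong_AE, rule AE_mp[OF lamE_not_in[OF M]], intro AE_I2 impI)
    fix y assume y: "y \<in> M"
    have "(\<integral>\<^sup>+\<tau>. indicator ?A (y + \<tau> *\<^sub>R u) \<partial>lborel) = (\<integral>\<^sup>+\<tau>. indicator Y y * indicator I \<tau> \<partial>lborel)"
      by (intro nn_integral_cong) (simp only: indicator_def mem[OF y], simp)
    then show "(\<integral>\<^sup>+\<tau>. indicator ?A (y + \<tau> *\<^sub>R u) \<partial>lborel) = indicator Y y * emeasure lborel I"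
      by (simp add: nn_integral_cmult)
  qed
  also have "\<dots> = emeasure (lamE M) Y * emeasure lborel I" by (subst nn_integral_multc) auto
  finally show "emeasure (lamE E) ?A = emeasure (lamE M) Y * emeasure lborel I" .
qed

text \<open>The shell of a body in the hyperplane \<open>M\<close> consists of two slabs over the
  body, with normals \<open>u\<close> and \<open>- u\<close>, and a part over the rim
  \<open>D \<epsilon>\<close>. Divided by \<open>2 * \<epsilon>\<close>, the rim contributes at most
  \<open>C\<close> times the measure of \<open>D \<epsilon>\<close>, and these sets shrink to the
  empty set.\<close>

lemma area_int_flat:
  fixes M :: "'a::euclidean_space set"
  assumes M: "subspace M" and u: "norm u = 1" "\<And>x. x \<in> M \<Longrightarrow> u \<bullet> x = 0" and P: "conv_body P" "P \<subseteq> M"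
    and g: "g \<in> borel_measurable borel" "\<And>u. \<bar>g u\<bar> \<le> C"
  defines "E \<equiv> span (insert u M)"
  shows "area_int E P g = (g u + g (- u)) / 2 * measure (lamE M) P"
proof -
  have sE: "subspace E" by (simp add: E_def)
  have ME: "M \<subseteq> E" unfolding E_def using span_superset[of "insert u M"] by auto
  interpret P: body_in E P by unfold_locales (use sE P ME in auto)
  have uu: "u \<bullet> u = 1" using u by (simp add: norm_eq_1)
  have C0: "0 \<le> C" using g(2)[of 0] by simp
  have xE: "x = proj M x + (u \<bullet> x) *\<^sub>R u" if "x \<in> E" for x
  proof -
    obtain k y where y: "x - k *\<^sub>R u = y" "y \<in> span M" using \<open>x \<in> E\<close> unfolding E_def span_insert by auto
    have yM: "y \<in> M" using y(2) M by (metis span_eq_iff)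
    have x: "x = y + k *\<^sub>R u" using y(1) by (simp add: algebra_simps)
    have "proj M x = y" by (rule proj_eqI[OF M yM]) (use u x in auto)
    moreover have "u \<bullet> x = k" using u uu yM by (simp add: x inner_add_right)
    ultimately show ?thesis using x by simp
  qed
  have pyth: "(dist x z)\<^sup>2 = (dist (proj M x) z)\<^sup>2 + (u \<bullet> x)\<^sup>2" if "x \<in> E" "z \<in> M" for x z
  proof -
    have "orthogonal (proj M x - z) ((u \<bullet> x) *\<^sub>R u)"
      using u(2)[of "proj M x - z"] that proj_in[OF M] subspace_diff[OF M] by (simp add: orthogonal_def inner_commute)
    then have "(norm ((proj M x - z) + (u \<bullet> x) *\<^sub>R u))\<^sup>2 = (norm (proj M x - z))\<^sup>2 + (u \<bullet> x)\<^sup>2"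
      using norm_add_Pythagorean[of "proj M x - z" "(u \<bullet> x) *\<^sub>R u"] u(1) by simp
    moreover have "(proj M x - z) + (u \<bullet> x) *\<^sub>R u = x - z" using xE[OF that(1)] by (simp add: algebra_simps)
    ultimately show ?thesis by (simp only: dist_norm)
  qed
  have inP: "closest_point P x = proj M x" "infdist x P = \<bar>u \<bullet> x\<bar>" if x: "x \<in> E" "proj M x \<in> P" for x
  proof -
    show cp: "closest_point P x = proj M x"
    proof (rule closest_point_unique[symmetric, OF P.P'(3,2) x(2)], rule ballI)
      fix z assume z: "z \<in> P"
      have "(dist x (proj M x))\<^sup>2 \<le> (dist x z)\<^sup>2" using pyth[OF x(1), of z] pyth[OF x(1), of "proj M x"] z P(2) proj_in[OF M] by auto
      then show "dist x (proj M x) \<le> dist x z" by (rule power2_le_imp_le) simp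
    qed
    have "x - proj M x = (u \<bullet> x) *\<^sub>R u" using xE[OF x(1)] by (metis add_diff_cancel_left')
    then show "infdist x P = \<bar>u \<bullet> x\<bar>" using u(1) by (simp add: P.infdist_cp cp)
  qed
  have ge: "infdist (proj M x) P \<le> infdist x P" "\<bar>u \<bullet> x\<bar> \<le> infdist x P" if x: "x \<in> E" for x
  proof -
    let ?z = "closest_point P x"
    have z: "?z \<in> P" "?z \<in> M" using P.cp_in P(2) by auto
    have d: "infdist x P = dist x ?z" by (simp add: P.infdist_cp dist_norm)
    have "(dist (proj M x) ?z)\<^sup>2 \<le> (dist x ?z)\<^sup>2" using pyth[OF x z(2)] by simp
    then have "dist (proj M x) ?z \<le> dist x ?z" by (rule power2_le_imp_le) simp
    then show "infdist (proj M x) P \<le> infdist x P" using infdist_le[OF z(1), of "proj M x"] d by simp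
    have "\<bar>u \<bullet> x\<bar>\<^sup>2 \<le> (dist x ?z)\<^sup>2" using pyth[OF x z(2)] by simp
    then show "\<bar>u \<bullet> x\<bar> \<le> infdist x P" unfolding d by (rule power2_le_imp_le) simp
  qed
  let ?v = "measure (lamE M) P"
  have Pb: "P \<in> sets borel" using P(1) by (rule conv_body_borel)
  define D where "D \<epsilon> = {y. y \<notin> P \<and> infdist y P \<le> \<epsilon>}" for \<epsilon>
  have Dm[measurable]: "D \<epsilon> \<in> sets borel" for \<epsilon>
  proof -
    have "D \<epsilon> = {y. infdist y P \<le> \<epsilon>} - P" by (auto simp: D_def)
    then show ?thesis using Pb closed_infdist_le[of P \<epsilon>] by auto
  qed
  have Dbd: "bounded (D \<epsilon>)" for \<epsilon>
  proof -
    obtain r where r: "\<And>k. k \<in> P \<Longrightarrow> norm k \<le> r" using compact_imp_bounded[OF P.P'(1)] by (auto simp: bounded_iff)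
    have "norm x \<le> r + \<epsilon>" if "x \<in> D \<epsilon>" for x
      using that r[OF P.cp_in, of x] norm_triangle_sub[of x "closest_point P x"] by (auto simp: D_def P.infdist_cp)
    then show ?thesis by (auto simp: bounded_iff)
  qed
  have Dfin: "emeasure (lamE M) (D \<epsilon>) < \<infinity>" for \<epsilon> by (rule emeasure_lamE_bounded[OF M Dm Dbd])
  have Pfin: "emeasure (lamE M) P < \<infinity>" using emeasure_lamE_conv_body[OF M P(1)] .
  define R where "R Y I = {x \<in> E. proj M x \<in> Y \<and> u \<bullet> x \<in> I}" for Y and I :: "real set"
  have Rm: "R Y I \<in> sets borel" and Re: "emeasure (lamE E) (R Y I) = emeasure (lamE M) Y * emeasure lborel I"
    if "Y \<in> sets borel" "I \<in> sets borel" for Y I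
    using prism_measure[OF M u that] by (auto simp: R_def E_def)
  have err: "\<bar>shell_avg E P \<epsilon> g - (g u + g (- u)) / 2 * ?v\<bar> \<le> C * measure (lamE M) (D \<epsilon>)" if e: "\<epsilon> > 0" for \<epsilon>
  proof -
    \<comment> \<open>\<open>S1\<close> and \<open>S2\<close> are the slabs on the two sides of the
      body and \<open>S3\<close> contains the rim part; outside \<open>S3\<close> the shell function
      agrees exactly with its constant values on the slabs.\<close>
    define S1 S2 S3 where "S1 = R P {0<..\<epsilon>}" and "S2 = R P {-\<epsilon>..<0}" and "S3 = R (D \<epsilon>) {-\<epsilon>..\<epsilon>}"
    have S: "S1 \<in> sets borel" "S2 \<in> sets borel" "S3 \<in> sets borel" using Rm Pb Dm by (auto simp: S1_def S2_def S3_def)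
    have eS: "emeasure (lamE E) S1 = ennreal (\<epsilon> * ?v)" "emeasure (lamE E) S2 = ennreal (\<epsilon> * ?v)"
      "emeasure (lamE E) S3 = ennreal (2 * \<epsilon> * measure (lamE M) (D \<epsilon>))"
    proof -
      have vP: "emeasure (lamE M) P = ennreal ?v" using Pfin by (intro emeasure_eq_ennreal_measure) (simp add: less_top)
      have vD: "emeasure (lamE M) (D \<epsilon>) = ennreal (measure (lamE M) (D \<epsilon>))"
        using Dfin[of \<epsilon>] by (intro emeasure_eq_ennreal_measure) (simp add: less_top)
      show "emeasure (lamE E) S1 = ennreal (\<epsilon> * ?v)" "emeasure (lamE E) S2 = ennreal (\<epsilon> * ?v)"
        "emeasure (lamE E) S3 = ennreal (2 * \<epsilon> * measure (lamE M) (D \<epsilon>))"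
        using e Pb Dm unfolding S1_def S2_def S3_def
        by (simp_all add: Re vP vD ennreal_mult[symmetric] mult.commute)
    qed
    have mS: "measure (lamE E) S1 = \<epsilon> * ?v" "measure (lamE E) S2 = \<epsilon> * ?v" "measure (lamE E) S3 = 2 * \<epsilon> * measure (lamE M) (D \<epsilon>)"
      using eS e by (simp_all add: measure_def)
    let ?f = "shell_fun E P \<epsilon> g"
    define h where "h x = ?f x - g u * indicator S1 x - g (- u) * indicator S2 x" for x
    have hb: "\<bar>h x\<bar> \<le> C * indicator S3 x" for x
    proof (cases "x \<in> E")
      case False
      then show ?thesis using C0 by (simp add: h_def shell_fun_def shell_def S1_def S2_def R_def)
    next
      case x: True
      show ?thesis
      proof (cases "proj M x \<in> P")
        case True
        note c = inP[OF x True]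
        have un: "unit_nrm P x = sgn (u \<bullet> x) *\<^sub>R u"
        proof -
          have "x - proj M x = (u \<bullet> x) *\<^sub>R u" using xE[OF x] by (metis add_diff_cancel_left')
          then show ?thesis unfolding unit_nrm_def c by (simp add: real_sgn_eq)
        qed
        have "h x = 0"
          unfolding h_def shell_fun_def un using x True e
          by (auto simp: indicator_def S1_def S2_def R_def shell_def c sgn_real_def abs_le_iff split: if_splits)
        then show ?thesis using C0 by simp
      next
        case False
        then have hx: "h x = ?f x" by (simp add: h_def S1_def S2_def R_def)
        show ?thesis
        proof (cases "x \<in> shell E P 0 \<epsilon> UNIV")
          case True
          then have "infdist x P \<le> \<epsilon>" by (simp add: shell_def)
          then have "x \<in> S3" using ge[OF x] x False by (auto simp: S3_def R_def D_def)
          then show ?thesis using hx True g(2) by (simp add: shell_fun_def)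
        next
          case False
          then show ?thesis using hx C0 by (simp add: shell_fun_def)
        qed
      qed
    qed
    have if_: "integrable (lamE E) ?f" by (rule P.shell_fun_integrable[OF g])
    have i1: "integrable (lamE E) (indicator S1 :: 'a \<Rightarrow> real)" "integrable (lamE E) (indicator S2 :: 'a \<Rightarrow> real)" "integrable (lamE E) (indicator S3 :: 'a \<Rightarrow> real)"
      using eS S by (simp_all add: integrable_indicator_iff)
    have "integrable (lamE E) h" unfolding h_def[abs_def] using if_ i1 by simp
    then have "\<bar>\<integral>x. h x \<partial>lamE E\<bar> \<le> (\<integral>x. C * indicator S3 x \<partial>lamE E)"
      using hb i1 by (intro integral_abs_bound[THEN order_trans] integral_mono integrable_abs) auto
    also have "\<dots> = C * (2 * \<epsilon> * measure (lamE M) (D \<epsilon>))" using mS(3) by simp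
    finally have hi: "\<bar>\<integral>x. h x \<partial>lamE E\<bar> \<le> C * (2 * \<epsilon> * measure (lamE M) (D \<epsilon>))" .
    have "(\<integral>x. h x \<partial>lamE E) = (\<integral>x. ?f x \<partial>lamE E) - g u * (\<epsilon> * ?v) - g (- u) * (\<epsilon> * ?v)"
      unfolding h_def[abs_def] using if_ i1 mS by simp
    then have "(1 / (2 * \<epsilon>)) * (\<integral>x. h x \<partial>lamE E) = shell_avg E P \<epsilon> g - (g u + g (- u)) / 2 * ?v"
      using e by (simp add: shell_avg_def field_simps)
    then have "\<bar>shell_avg E P \<epsilon> g - (g u + g (- u)) / 2 * ?v\<bar> = (1 / (2 * \<epsilon>)) * \<bar>\<integral>x. h x \<partial>lamE E\<bar>"
      using e by (metis abs_mult abs_of_pos divide_pos_pos mult_pos_pos zero_less_numeral zero_less_one)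
    also have "\<dots> \<le> (1 / (2 * \<epsilon>)) * (C * (2 * \<epsilon> * measure (lamE M) (D \<epsilon>)))" using hi e by (intro mult_left_mono) auto
    also have "\<dots> = C * measure (lamE M) (D \<epsilon>)" using e by simp
    finally show ?thesis .
  qed
  let ?e = "\<lambda>m. 1 / real (Suc m)"
  have e: "0 < ?e m" for m by simp
  note lim = LIMSEQ_Suc[OF lim_1_over_n]
  have "(\<lambda>m. measure (lamE M) (D (?e m))) \<longlonglongrightarrow> measure (lamE M) (\<Inter>m. D (?e m))"
  proof (rule Lim_measure_decseq)
    show "range (\<lambda>m. D (?e m)) \<subseteq> sets (lamE M)" by auto
    show "decseq (\<lambda>m. D (?e m))"
    proof (unfold decseq_def, intro allI impI subsetI)
      fix m n :: nat and x assume "m \<le> n" "x \<in> D (?e n)"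
      moreover have "?e n \<le> ?e m" using \<open>m \<le> n\<close> by (intro divide_left_mono) auto
      ultimately show "x \<in> D (?e m)" unfolding D_def by auto
    qed
    show "emeasure (lamE M) (D (?e m)) \<noteq> \<infinity>" for m using Dfin[of "?e m"] by auto
  qed
  moreover have "(\<Inter>m. D (?e m)) = {}"
  proof (rule ccontr)
    assume "(\<Inter>m. D (?e m)) \<noteq> {}"
    then obtain x where x: "\<And>m. x \<in> D (?e m)" by auto
    then have "infdist x P \<le> ?e m" for m unfolding D_def by blast
    then have "infdist x P \<le> 0" by (intro LIMSEQ_le_const[OF lim]) auto
    then have "infdist x P = 0" using infdist_nonneg[of x P] by linarith
    then have "x \<in> P" using in_closed_iff_infdist_zero[OF P.P'(2,4)] by simp
    then show False using x[of 0] by (simp add: D_def)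
  qed
  ultimately have "(\<lambda>m. C * measure (lamE M) (D (?e m))) \<longlonglongrightarrow> C * 0" by (intro tendsto_intros) simp
  then have lim0: "(\<lambda>m. C * measure (lamE M) (D (?e m))) \<longlonglongrightarrow> 0" by simp
  have "(\<lambda>m. shell_avg E P (?e m) g - (g u + g (- u)) / 2 * ?v) \<longlonglongrightarrow> 0"
    by (rule Lim_null_comparison[OF _ lim0]) (use err e in auto)
  then have "(\<lambda>m. shell_avg E P (?e m) g) \<longlonglongrightarrow> (g u + g (- u)) / 2 * ?v" by (rule LIM_zero_cancel)
  moreover have "(\<lambda>m. shell_avg E P (?e m) g) \<longlonglongrightarrow> area_int E P g" by (rule P.shell_avg_tendsto[OF g e lim])
  ultimately show ?thesis using LIMSEQ_unique by blast
qed

section \<open>Reconstruction of an even valuation from its Klain function\<close>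

text \<open>Each normal ray of \<open>P\<close> leaves the larger body \<open>Q\<close> at some parameter; pushing the shell of \<open>P\<close>
  outwards to that exit point (up to a mesh \<open>\<eta>\<close>) does not decrease its volume.\<close>
lemma shell_volume_mono:
  fixes E :: "'a::euclidean_space set"
  assumes E: "subspace E" and P: "conv_body P" "P \<subseteq> Q" and Q: "conv_body Q" "Q \<subseteq> E" and e: "0 < \<eta>" "\<eta> < \<epsilon>"
  shows "measure (lamE E) (shell E P 0 (\<epsilon> - \<eta>) UNIV) \<le> measure (lamE E) (shell E Q 0 \<epsilon> UNIV)"
proof -
  interpret P: body_in E P by unfold_locales (use E P Q in auto)
  interpret Q: body_in E Q by unfold_locales (use E Q in auto)
  \<comment> \<open>The normal rays that leave \<open>Q\<close> between the parameters
    \<open>real m * \<eta>\<close> and \<open>real (Suc m) * \<eta>\<close>, sorted by foot point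
    and direction.\<close>
  define X where "X m = {(p, u). p \<in> Q \<and> p + (real m * \<eta>) *\<^sub>R u \<in> Q \<and> p + (real (Suc m) * \<eta>) *\<^sub>R u \<notin> Q}" for m
  have Xb[measurable]: "X m \<in> sets borel" for m
  proof -
    have [measurable]: "Q \<in> sets borel" using Q(1) by (rule conv_body_borel)
    have "X m = {z \<in> space (borel \<Otimes>\<^sub>M borel). fst z \<in> Q \<and> fst z + (real m * \<eta>) *\<^sub>R snd z \<in> Q \<and> \<not> fst z + (real (Suc m) * \<eta>) *\<^sub>R snd z \<in> Q}"
      by (auto simp: X_def space_pair_measure)
    also have "\<dots> \<in> sets (borel \<Otimes>\<^sub>M borel)" by measurable
    finally show ?thesis by (simp only: borel_prod)
  qed
  have between: "p + s *\<^sub>R u \<in> Q" if "p \<in> Q" "p + t *\<^sub>R u \<in> Q" "0 \<le> s" "s \<le> t" for p u s t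
  proof (cases "t = 0")
    case False
    then have t: "t > 0" using that by simp
    have "(1 - s / t) *\<^sub>R p + (s / t) *\<^sub>R (p + t *\<^sub>R u) \<in> Q"
      using that t by (intro convexD[OF Q.P'(3)]) auto
    moreover have "(1 - s / t) *\<^sub>R p + (s / t) *\<^sub>R (p + t *\<^sub>R u) = p + s *\<^sub>R u" using t by (simp add: algebra_simps)
    ultimately show ?thesis by simp
  qed (use that in auto)
  have disjX: "X m \<inter> X n = {}" if "m < n" for m n
  proof -
    have "p + (real (Suc m) * \<eta>) *\<^sub>R u \<in> Q" if "p \<in> Q" "p + (real n * \<eta>) *\<^sub>R u \<in> Q" for p u
      using between[OF that, of "real (Suc m) * \<eta>"] \<open>m < n\<close> e by (simp add: mult_right_mono)
    then show ?thesis by (auto simp: X_def)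
  qed
  obtain r where r: "\<And>k. k \<in> Q \<Longrightarrow> norm k \<le> r" using compact_imp_bounded[OF Q.P'(1)] by (auto simp: bounded_iff)
  \<comment> \<open>Norms in \<open>Q\<close> are at most \<open>r\<close>, so a ray with unit
    direction starting in \<open>Q\<close> has left it after length \<open>2 * r\<close>.\<close>
  obtain N :: nat where N: "2 * r < real N * \<eta>" using reals_Archimedean3[OF e(1)] by metis
  have cover: "(p, u) \<in> (\<Union>m<N. X m)" if p: "p \<in> Q" and u: "norm u = 1" for p u
  proof -
    have "p + (real N * \<eta>) *\<^sub>R u \<notin> Q"
    proof
      assume "p + (real N * \<eta>) *\<^sub>R u \<in> Q"
      then have "norm (p + (real N * \<eta>) *\<^sub>R u) \<le> r" by (rule r)
      moreover have "norm ((real N * \<eta>) *\<^sub>R u) \<le> norm (p + (real N * \<eta>) *\<^sub>R u) + norm p"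
        using norm_triangle_ineq4[of "p + (real N * \<eta>) *\<^sub>R u" p] by simp
      ultimately show False using r[OF p] u N e by simp
    qed
    then have ex: "\<exists>m. p + (real m * \<eta>) *\<^sub>R u \<notin> Q" by blast
    define k where "k = (LEAST m. p + (real m * \<eta>) *\<^sub>R u \<notin> Q)"
    have k1: "p + (real k * \<eta>) *\<^sub>R u \<notin> Q" unfolding k_def using LeastI_ex[OF ex] .
    have k2: "k \<le> N" unfolding k_def using \<open>p + (real N * \<eta>) *\<^sub>R u \<notin> Q\<close> by (rule Least_le)
    have "k \<noteq> 0" using k1 p by (metis add.right_neutral mult_zero_left of_nat_0 scale_zero_left)
    then obtain m where m: "k = Suc m" by (metis not0_implies_Suc)
    have "p + (real m * \<eta>) *\<^sub>R u \<in> Q" using not_less_Least[of m "\<lambda>m. p + (real m * \<eta>) *\<^sub>R u \<notin> Q"] m by (auto simp: k_def)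
    then show ?thesis using k1 k2 m p by (auto simp: X_def)
  qed
  let ?\<mu> = "measure (lamE E)"
  \<comment> \<open>The shell of rays of class \<open>m\<close>, pushed outwards with its width
    \<open>\<epsilon> - \<eta>\<close> kept. Starting at \<open>real (Suc m) * \<eta>\<close> puts
    it outside \<open>Q\<close>, and ending at \<open>real m * \<eta> + \<epsilon>\<close> keeps it
    within \<open>\<epsilon>\<close> of a point of \<open>Q\<close> on the same ray.\<close>
  let ?A = "\<lambda>m. shell E P (real (Suc m) * \<eta>) (real m * \<eta> + \<epsilon>) (X m)"
  have A_sub: "?A m \<subseteq> shell E Q 0 \<epsilon> UNIV" for m
  proof
    fix x assume x: "x \<in> ?A m"
    let ?p = "closest_point P x" and ?u = "unit_nrm P x" and ?d = "infdist x P"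
    have x': "x \<in> E" "real (Suc m) * \<eta> < ?d" "?d \<le> real m * \<eta> + \<epsilon>" "?p \<in> Q" "?p + (real m * \<eta>) *\<^sub>R ?u \<in> Q" "?p + (real (Suc m) * \<eta>) *\<^sub>R ?u \<notin> Q"
      using x by (auto simp: shell_def X_def)
    have "0 \<le> real (Suc m) * \<eta>" using e by simp
    then have d0: "0 < ?d" using x'(2) by linarith
    note dec = P.decomp[OF d0]
    have "x \<notin> Q"
    proof
      assume "x \<in> Q"
      then have "?p + ?d *\<^sub>R ?u \<in> Q" using dec(1) by simp
      then show False using between[OF x'(4), of ?d ?u "real (Suc m) * \<eta>"] x' \<open>0 \<le> real (Suc m) * \<eta>\<close> by simp
    qed
    then have "0 < infdist x Q" using infdist_pos_not_in_closed[OF Q.P'(2,4)] by simp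
    moreover have "infdist x Q \<le> \<epsilon>"
    proof -
      have "infdist x Q \<le> dist x (?p + (real m * \<eta>) *\<^sub>R ?u)" by (rule infdist_le[OF x'(5)])
      also have "x - (?p + (real m * \<eta>) *\<^sub>R ?u) = (?d - real m * \<eta>) *\<^sub>R ?u"
        using dec(1) by (simp add: algebra_simps)
      then have "dist x (?p + (real m * \<eta>) *\<^sub>R ?u) = \<bar>?d - real m * \<eta>\<bar>" using dec(2) by (simp add: dist_norm)
      also have "\<dots> \<le> \<epsilon>" using x'(2,3) e by (simp add: algebra_simps abs_le_iff)
      finally show ?thesis .
    qed
    ultimately show "x \<in> shell E Q 0 \<epsilon> UNIV" using x'(1) by (simp add: shell_def)
  qed
  have disjA: "disjoint_family_on ?A {..<N}"
  proof (unfold disjoint_family_on_def, intro ballI impI)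
    fix m n :: nat assume "m \<noteq> n"
    then have "X m \<inter> X n = {}" using disjX[of m n] disjX[of n m] by (cases "m < n") auto
    then show "?A m \<inter> ?A n = {}" by (auto simp: shell_def)
  qed
  have "?\<mu> (shell E P 0 (\<epsilon> - \<eta>) UNIV) \<le> ?\<mu> (\<Union>m<N. shell E P 0 (\<epsilon> - \<eta>) (X m))"
  proof (rule measure_mono_fmeasurable)
    show "shell E P 0 (\<epsilon> - \<eta>) UNIV \<subseteq> (\<Union>m<N. shell E P 0 (\<epsilon> - \<eta>) (X m))"
    proof
      fix x assume x: "x \<in> shell E P 0 (\<epsilon> - \<eta>) UNIV"
      then have "0 < infdist x P" by (simp add: shell_def)
      then have "(closest_point P x, unit_nrm P x) \<in> (\<Union>m<N. X m)"
        using P.decomp(2)[of x] P.cp_in P(2) by (intro cover) auto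
      then show "x \<in> (\<Union>m<N. shell E P 0 (\<epsilon> - \<eta>) (X m))" using x by (auto simp: shell_def)
    qed
    show "(\<Union>m<N. shell E P 0 (\<epsilon> - \<eta>) (X m)) \<in> fmeasurable (lamE E)"
      by (rule fmeasurable.finite_UN) (auto intro: P.shell_fmeasurable)
  qed simp
  also have "\<dots> \<le> (\<Sum>m<N. ?\<mu> (shell E P 0 (\<epsilon> - \<eta>) (X m)))"
    by (rule measure_UNION_le) (auto intro: P.shell_borel)
  also have "\<dots> \<le> (\<Sum>m<N. ?\<mu> (?A m))"
  proof (rule sum_mono)
    fix m
    have "?\<mu> (shell E P 0 (0 + (\<epsilon> - \<eta>)) (X m)) \<le> ?\<mu> (shell E P (real (Suc m) * \<eta>) (real (Suc m) * \<eta> + (\<epsilon> - \<eta>)) (X m))"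
      using e by (intro P.shell_expand_measure) auto
    then show "?\<mu> (shell E P 0 (\<epsilon> - \<eta>) (X m)) \<le> ?\<mu> (?A m)" by (simp add: algebra_simps)
  qed
  also have "\<dots> = ?\<mu> (\<Union>m<N. ?A m)"
  proof (rule measure_finite_Union[symmetric])
    show "?A ` {..<N} \<subseteq> sets (lamE E)" by (auto intro: P.shell_borel)
    show "emeasure (lamE E) (?A m) \<noteq> \<infinity>" for m using P.shell_finite[OF Xb[of m], of "real (Suc m) * \<eta>" "real m * \<eta> + \<epsilon>"] by auto
  qed (use disjA in auto)
  also have "\<dots> \<le> ?\<mu> (shell E Q 0 \<epsilon> UNIV)"
  proof (rule measure_mono_fmeasurable)
    show "(\<Union>m<N. ?A m) \<subseteq> shell E Q 0 \<epsilon> UNIV" using A_sub by blast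
    show "(\<Union>m<N. ?A m) \<in> sets (lamE E)" by (auto intro: P.shell_borel)
    show "shell E Q 0 \<epsilon> UNIV \<in> fmeasurable (lamE E)" by (rule Q.shell_fmeasurable) simp
  qed
  finally show ?thesis .
qed

text \<open>The mesh in \<open>shell_volume_mono\<close> costs a factor tending to 1; then the width
  of the shell around \<open>Q\<close> tends to 0. Monotonicity of the total mass supplies the lower
  semicontinuity that the decreasing limits alone do not give.\<close>

lemma area_int_one_mono:
  fixes E :: "'a::euclidean_space set"
  assumes E: "subspace E" and P: "conv_body P" "P \<subseteq> Q" and Q: "conv_body Q" "Q \<subseteq> E"
  shows "area_int E P (\<lambda>_. 1) \<le> area_int E Q (\<lambda>_. 1)"
proof -
  interpret P: body_in E P by unfold_locales (use E P Q in auto)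
  interpret Q: body_in E Q by unfold_locales (use E Q in auto)
  let ?e = "\<lambda>m. 1 / real (Suc m)"
  have e0: "0 < ?e m" for m by simp
  note lim = LIMSEQ_Suc[OF lim_1_over_n]
  have g: "(\<lambda>_. 1::real) \<in> borel_measurable (borel :: 'a measure)" by simp
  have "area_int E P (\<lambda>_. 1) \<le> shell_avg E Q \<epsilon> (\<lambda>_. 1)" if \<epsilon>: "0 < \<epsilon>" for \<epsilon>
  proof -
    have le: "area_int E P (\<lambda>_. 1) * ((\<epsilon> - \<epsilon> * (?e (Suc m))) / \<epsilon>) \<le> shell_avg E Q \<epsilon> (\<lambda>_. 1)" for m
    proof -
      \<comment> \<open>The shift to \<open>Suc m\<close> keeps \<open>\<eta>\<close> strictly below
        \<open>\<epsilon>\<close>, also for \<open>m = 0\<close>.\<close>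
      define \<eta> where "\<eta> = \<epsilon> * ?e (Suc m)"
      have \<eta>: "0 < \<eta>" "\<eta> < \<epsilon>" using \<epsilon> by (auto simp: \<eta>_def mult_less_cancel_left2 divide_less_eq)
      have "area_int E P (\<lambda>_. 1) \<le> shell_avg E P (\<epsilon> - \<eta>) (\<lambda>_. 1)" using \<eta> by (intro P.area_int_le_shell_avg[where C=1]) auto
      also have "\<dots> = measure (lamE E) (shell E P 0 (\<epsilon> - \<eta>) UNIV) / (2 * (\<epsilon> - \<eta>))" using \<eta> by (intro P.shell_avg_one) simp
      also have "\<dots> \<le> measure (lamE E) (shell E Q 0 \<epsilon> UNIV) / (2 * (\<epsilon> - \<eta>))"
        using shell_volume_mono[OF E P Q \<eta>] \<eta> by (intro divide_right_mono) auto
      also have "\<dots> = shell_avg E Q \<epsilon> (\<lambda>_. 1) * (\<epsilon> / (\<epsilon> - \<eta>))"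
        unfolding Q.shell_avg_one[OF \<epsilon>] using \<epsilon> \<eta> by (simp add: field_simps)
      finally have "area_int E P (\<lambda>_. 1) * ((\<epsilon> - \<eta>) / \<epsilon>) \<le> shell_avg E Q \<epsilon> (\<lambda>_. 1) * (\<epsilon> / (\<epsilon> - \<eta>)) * ((\<epsilon> - \<eta>) / \<epsilon>)"
        using \<epsilon> \<eta> by (intro mult_right_mono) auto
      also have "\<dots> = shell_avg E Q \<epsilon> (\<lambda>_. 1)" using \<epsilon> \<eta> by simp
      finally show ?thesis by (simp only: \<eta>_def)
    qed
    have "(\<lambda>m. area_int E P (\<lambda>_. 1) * ((\<epsilon> - \<epsilon> * (?e (Suc m))) / \<epsilon>)) \<longlonglongrightarrow> area_int E P (\<lambda>_. 1) * ((\<epsilon> - \<epsilon> * 0) / \<epsilon>)"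
      using \<epsilon> by (intro tendsto_intros LIMSEQ_Suc[OF lim]) auto
    then have "area_int E P (\<lambda>_. 1) * ((\<epsilon> - \<epsilon> * 0) / \<epsilon>) \<le> shell_avg E Q \<epsilon> (\<lambda>_. 1)"
      by (rule LIMSEQ_le_const2) (use le in auto)
    then show ?thesis using \<epsilon> by simp
  qed
  then show ?thesis using Q.shell_avg_tendsto[OF g _ e0 lim, of 1] by (intro LIMSEQ_le_const) auto
qed

text \<open>The angle at the nearest point is not acute. Quantitatively, almost nearest points of
  \<open>P\<close> are close to the nearest one.\<close>

lemma (in body_in) dist_closest_point_sq:
  assumes "z \<in> P" shows "(dist z (closest_point P x))\<^sup>2 \<le> (dist x z)\<^sup>2 - (infdist x P)\<^sup>2"
proof -
  let ?p = "closest_point P x"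
  have "(x - ?p) \<bullet> (z - ?p) \<le> 0" by (rule cp_dot[OF assms])
  moreover have "(norm (x - z))\<^sup>2 = (norm (x - ?p))\<^sup>2 + (norm (z - ?p))\<^sup>2 - 2 * ((x - ?p) \<bullet> (z - ?p))"
  proof -
    have gen: "(norm (v - w))\<^sup>2 = (norm v)\<^sup>2 + (norm w)\<^sup>2 - 2 * (v \<bullet> w)" for v w :: 'a
      by (simp add: power2_norm_eq_inner inner_diff_left inner_diff_right inner_commute)
    show ?thesis using gen[of "x - ?p" "z - ?p"] by simp
  qed
  ultimately show ?thesis by (simp add: infdist_cp dist_norm)
qed

text \<open>The nearest point of \<open>Q m\<close> has a neighbour \<open>k m\<close> in
  \<open>P\<close> that is almost nearest to \<open>x\<close>, so
  \<open>dist_closest_point_sq\<close> bounds its distance to the nearest point of \<open>P\<close>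
  by a square root of a null sequence.\<close>

lemma closest_point_outer:
  assumes P: "conv_body P" and Q: "\<And>m. conv_body (Q m)" "\<And>m. P \<subseteq> Q m"
    and near: "\<And>m. \<forall>x\<in>Q m. \<exists>k\<in>P. dist x k \<le> 1 / real (Suc m)"
  shows "(\<lambda>m. infdist x (Q m)) \<longlonglongrightarrow> infdist x P" "(\<lambda>m. closest_point (Q m) x) \<longlonglongrightarrow> closest_point P x"
    "\<And>m. infdist x (Q m) \<le> infdist x P"
proof -
  interpret P: body_in UNIV P by unfold_locales (use P in auto)
  have Qb: "body_in UNIV (Q m)" for m by unfold_locales (use Q in auto)
  let ?e = "\<lambda>m. 1 / real (Suc m)" and ?d = "infdist x P" and ?p = "closest_point P x"
  note lim = LIMSEQ_Suc[OF lim_1_over_n]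
  let ?q = "\<lambda>m. closest_point (Q m) x"
  have le: "infdist x (Q m) \<le> ?d" for m using Q(2) P.P'(4) by (rule infdist_mono)
  then show "\<And>m. infdist x (Q m) \<le> ?d" .
  have "\<forall>m. \<exists>k\<in>P. dist (?q m) k \<le> ?e m" using near body_in.cp_in[OF Qb] by blast
  then obtain k where k: "\<And>m. k m \<in> P" "\<And>m. dist (?q m) (k m) \<le> ?e m" by metis
  have xk: "dist x (k m) \<le> infdist x (Q m) + ?e m" for m
    using dist_triangle[of x "k m" "?q m"] k(2)[of m] body_in.infdist_cp[OF Qb[of m], of x] by (simp add: dist_norm)
  have ge: "?d - ?e m \<le> infdist x (Q m)" for m using xk[of m] infdist_le[OF k(1), of x m] by linarith
  have "(\<lambda>m. ?d - ?e m) \<longlonglongrightarrow> ?d - 0" by (intro tendsto_intros lim)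
  then have l1: "(\<lambda>m. ?d - ?e m) \<longlonglongrightarrow> ?d" by simp
  show "(\<lambda>m. infdist x (Q m)) \<longlonglongrightarrow> ?d"
    by (rule tendsto_sandwich[OF _ _ l1 tendsto_const]) (use le ge in auto)
  have kp: "(dist (k m) ?p)\<^sup>2 \<le> (?d + ?e m)\<^sup>2 - ?d\<^sup>2" for m
  proof -
    have "(dist (k m) ?p)\<^sup>2 \<le> (dist x (k m))\<^sup>2 - ?d\<^sup>2" by (rule P.dist_closest_point_sq[OF k(1)])
    also have "(dist x (k m))\<^sup>2 \<le> (?d + ?e m)\<^sup>2" using xk[of m] le[of m] by (intro power_mono) auto
    finally show ?thesis by simp
  qed
  have "(\<lambda>m. sqrt ((?d + ?e m)\<^sup>2 - ?d\<^sup>2) + ?e m) \<longlonglongrightarrow> sqrt ((?d + 0)\<^sup>2 - ?d\<^sup>2) + 0"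
    by (intro tendsto_intros lim)
  then have l2: "(\<lambda>m. sqrt ((?d + ?e m)\<^sup>2 - ?d\<^sup>2) + ?e m) \<longlonglongrightarrow> 0" by simp
  have "dist (?q m) ?p \<le> sqrt ((?d + ?e m)\<^sup>2 - ?d\<^sup>2) + ?e m" for m
    using dist_triangle[of "?q m" ?p "k m"] k(2)[of m] real_le_rsqrt[OF kp[of m]] by linarith
  then have "(\<lambda>m. dist (?q m) ?p) \<longlonglongrightarrow> 0"
    by (intro tendsto_sandwich[OF _ _ tendsto_const l2]) auto
  then show "?q \<longlonglongrightarrow> ?p" by (rule tendsto_dist_iff[THEN iffD2])
qed

text \<open>At fixed width, dominated convergence applies with convergence at every point: the
  closed condition \<open>infdist x P \<le> \<epsilon>\<close> persists because distances to the
  larger bodies are smaller, and strict inequalities persist eventually.\<close>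

lemma shell_avg_outer:
  fixes E :: "'a::euclidean_space set"
  assumes E: "subspace E" and P: "conv_body P" "P \<subseteq> E" and Q: "\<And>m. conv_body (Q m)" "\<And>m. Q m \<subseteq> E" "\<And>m. P \<subseteq> Q m"
    and near: "\<And>m. \<forall>x\<in>Q m. \<exists>k\<in>P. dist x k \<le> 1 / real (Suc m)"
    and g: "g \<in> borel_measurable borel" "\<And>u. \<bar>g u\<bar> \<le> C" "continuous_on (sphere 0 1 \<inter> E) g" and \<epsilon>: "0 < \<epsilon>"
  shows "(\<lambda>m. shell_avg E (Q m) \<epsilon> g) \<longlonglongrightarrow> shell_avg E P \<epsilon> g"
proof -
  interpret P: body_in E P by unfold_locales (use E P in auto)
  have Qb: "body_in E (Q m)" for m by unfold_locales (use E Q in auto)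
  note co = closest_point_outer[OF P(1) Q(1,3) near]
  have pw: "(\<lambda>m. shell_fun E (Q m) \<epsilon> g x) \<longlonglongrightarrow> shell_fun E P \<epsilon> g x" for x
  proof (cases "x \<in> E \<and> 0 < infdist x P \<and> infdist x P \<le> \<epsilon>")
    case True
    then have x: "x \<in> E" "0 < infdist x P" "infdist x P \<le> \<epsilon>" by auto
    have ev: "eventually (\<lambda>m. 0 < infdist x (Q m)) sequentially" using order_tendstoD(1)[OF co(1)[of x] x(2)] .
    have un: "(\<lambda>m. unit_nrm (Q m) x) \<longlonglongrightarrow> unit_nrm P x"
      unfolding unit_nrm_def using x(2) by (intro tendsto_intros co) auto
    have inO: "eventually (\<lambda>m. unit_nrm (Q m) x \<in> sphere 0 1 \<inter> E) sequentially"
      using ev by eventually_elim (use body_in.decomp(2)[OF Qb] body_in.unit_nrm_E[OF Qb x(1)] in auto)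
    have "unit_nrm P x \<in> sphere 0 1 \<inter> E" using P.decomp(2)[OF x(2)] P.unit_nrm_E[OF x(1)] by simp
    then have A: "(\<lambda>m. g (unit_nrm (Q m) x)) \<longlonglongrightarrow> g (unit_nrm P x)"
      using continuous_on_tendsto_compose[OF g(3) un _ inO] by simp
    have B: "eventually (\<lambda>m. g (unit_nrm (Q m) x) = shell_fun E (Q m) \<epsilon> g x) sequentially"
      using ev by eventually_elim (use x co(3)[of x] order_trans[OF co(3)[of x] x(3)] in \<open>simp add: shell_fun_def shell_def\<close>)
    have "shell_fun E P \<epsilon> g x = g (unit_nrm P x)" using x by (simp add: shell_fun_def shell_def)
    then show ?thesis using Lim_transform_eventually[OF A B] by simp
  next
    case False
    then consider "x \<notin> E" | "x \<in> E" "infdist x P = 0" | "infdist x P > \<epsilon>"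
      using infdist_nonneg[of x P] by fastforce
    then have "eventually (\<lambda>m. shell_fun E (Q m) \<epsilon> g x = 0) sequentially"
    proof cases
      case 2
      then have "infdist x (Q m) = 0" for m using co(3)[where x=x] infdist_nonneg[of x "Q m"] by (metis antisym)
      then show ?thesis by (simp add: shell_fun_def shell_def)
    next
      case 3
      show ?thesis using order_tendstoD(1)[OF co(1)[of x] 3] by eventually_elim (simp add: shell_fun_def shell_def)
    qed (simp add: shell_fun_def shell_def)
    moreover have "shell_fun E P \<epsilon> g x = 0" using False by (auto simp: shell_fun_def shell_def)
    ultimately show ?thesis by (simp add: tendsto_eventually)
  qed
  obtain r where r: "\<And>k. k \<in> P \<Longrightarrow> norm k \<le> r" using compact_imp_bounded[OF P.P'(1)] by (auto simp: bounded_iff)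
  let ?B = "cball (0::'a) (r + 1 + \<epsilon>)"
  have sub: "shell E (Q m) 0 \<epsilon> UNIV \<subseteq> ?B" for m
  proof
    fix x assume x: "x \<in> shell E (Q m) 0 \<epsilon> UNIV"
    let ?q = "closest_point (Q m) x"
    obtain k where k: "k \<in> P" "dist ?q k \<le> 1 / real (Suc m)" using near body_in.cp_in[OF Qb] by blast
    have "1 / real (Suc m) \<le> 1" by simp
    then have "norm ?q \<le> r + 1" using k r[OF k(1)] norm_triangle_sub[of ?q k] unfolding dist_norm by linarith
    moreover have "norm (x - ?q) \<le> \<epsilon>" using x body_in.infdist_cp[OF Qb[of m], of x] by (simp add: shell_def)
    ultimately show "x \<in> ?B" using norm_triangle_sub[of x ?q] by simp
  qed
  have "(\<lambda>m. \<integral>x. shell_fun E (Q m) \<epsilon> g x \<partial>lamE E) \<longlonglongrightarrow> (\<integral>x. shell_fun E P \<epsilon> g x \<partial>lamE E)"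
  proof (rule integral_dominated_convergence[where w="\<lambda>x. C * indicator ?B x"])
    have "emeasure (lamE E) ?B < \<infinity>" by (rule emeasure_lamE_bounded[OF E]) auto
    then show "integrable (lamE E) (\<lambda>x. C * indicator ?B x :: real)" by simp
    show "shell_fun E P \<epsilon> g \<in> borel_measurable (lamE E)" using P.shell_fun_measurable[OF g(1)] by simp
    show "shell_fun E (Q m) \<epsilon> g \<in> borel_measurable (lamE E)" for m using body_in.shell_fun_measurable[OF Qb g(1)] by simp
    have C0: "0 \<le> C" using g(2)[of 0] by simp
    show "AE x in lamE E. norm (shell_fun E (Q m) \<epsilon> g x) \<le> C * indicator ?B x" for m
      using sub[of m] g(2) C0 by (intro AE_I2) (auto simp: shell_fun_def indicator_def simp del: mem_cball_0)
  qed (use pw in auto)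
  then show ?thesis unfolding shell_avg_def by (intro tendsto_mult tendsto_const)
qed

text \<open>Upper semicontinuity: choose a width at which the shell average of \<open>P\<close> is
  close to its limit, let the bodies converge at that width, and use that shell averages bound area
  integrals from above.\<close>

lemma area_int_outer_nonneg:
  fixes E :: "'a::euclidean_space set"
  assumes E: "subspace E" and P: "conv_body P" "P \<subseteq> E" and Q: "\<And>m. conv_body (Q m)" "\<And>m. Q m \<subseteq> E" "\<And>m. P \<subseteq> Q m"
    and near: "\<And>m. \<forall>x\<in>Q m. \<exists>k\<in>P. dist x k \<le> 1 / real (Suc m)"
    and g: "g \<in> borel_measurable borel" "\<And>u. 0 \<le> g u" "\<And>u. g u \<le> C" "continuous_on (sphere 0 1 \<inter> E) g" and \<delta>: "0 < \<delta>"
  shows "eventually (\<lambda>m. area_int E (Q m) g < area_int E P g + \<delta>) sequentially"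
proof -
  interpret P: body_in E P by unfold_locales (use E P in auto)
  have Qb: "body_in E (Q m)" for m by unfold_locales (use E Q in auto)
  have gb: "\<bar>g u\<bar> \<le> C" for u using g(2,3)[of u] by simp
  have e0: "0 < 1 / real (Suc m)" for m by simp
  have "eventually (\<lambda>m. shell_avg E P (1 / real (Suc m)) g < area_int E P g + \<delta>) sequentially"
    using \<delta> by (intro order_tendstoD(2)[OF P.shell_avg_tendsto[OF g(1) gb e0 LIMSEQ_Suc[OF lim_1_over_n]]]) simp
  then obtain m where m: "shell_avg E P (1 / real (Suc m)) g < area_int E P g + \<delta>" by (auto simp: eventually_sequentially)
  have "eventually (\<lambda>i. shell_avg E (Q i) (1 / real (Suc m)) g < area_int E P g + \<delta>) sequentially"
    by (rule order_tendstoD(2)[OF shell_avg_outer[OF E P Q near g(1) gb g(4) e0] m])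
  then show ?thesis
    by eventually_elim (use body_in.area_int_le_shell_avg[OF Qb e0 g(1-3)] in \<open>auto intro: le_less_trans\<close>)
qed

text \<open>Upper semicontinuity holds for \<open>g\<close> and for \<open>C - g\<close>; together with monotonicity of the
  total mass this gives continuity.\<close>
lemma area_int_outer_continuous:
  fixes E :: "'a::euclidean_space set"
  assumes E: "subspace E"
    and g: "g \<in> borel_measurable borel" "\<And>u. \<bar>g u\<bar> \<le> C" "continuous_on (sphere 0 1 \<inter> E) g"
  shows "outer_continuous E (ext0 (\<lambda>P. area_int E P g))"
  unfolding outer_continuous_def
proof (intro allI impI)
  fix P :: "'a set" and Q
  assume "conv_body P \<and> P \<subseteq> E \<and> (\<forall>m. conv_body (Q m) \<and> Q m \<subseteq> E \<and> P \<subseteq> Q m \<and>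
     (\<forall>x\<in>Q m. \<exists>k\<in>P. dist x k \<le> 1 / real (Suc m)))"
  then have P: "conv_body P" "P \<subseteq> E" and Q: "\<And>m. conv_body (Q m)" "\<And>m. Q m \<subseteq> E" "\<And>m. P \<subseteq> Q m"
    and near: "\<And>m. \<forall>x\<in>Q m. \<exists>k\<in>P. dist x k \<le> 1 / real (Suc m)" by blast+
  interpret P: body_in E P by unfold_locales (use E P in auto)
  have Qb: "body_in E (Q m)" for m by unfold_locales (use E Q in auto)
  have gb: "- C \<le> g u" "g u \<le> C" for u using g(2)[of u] by (auto simp: abs_le_iff)
  let ?S = "\<lambda>P. area_int E P (\<lambda>_. 1)" and ?\<psi> = "\<lambda>P. area_int E P g"
  have one: "(\<lambda>_. 1::real) \<in> borel_measurable (borel :: 'a measure)" by simp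
  have S_lim: "(\<lambda>m. ?S (Q m)) \<longlonglongrightarrow> ?S P"
  proof (rule order_tendstoI)
    fix y assume "y < ?S P"
    then show "eventually (\<lambda>m. y < ?S (Q m)) sequentially"
      using area_int_one_mono[OF E P(1) Q(3) Q(1,2)] by (intro always_eventually) (auto intro: less_le_trans)
  next
    fix y assume "?S P < y"
    then show "eventually (\<lambda>m. ?S (Q m) < y) sequentially"
      using area_int_outer_nonneg[OF E P Q near one _ _ continuous_on_const, of 1 "y - ?S P"] by simp
  qed
  have m: "(\<lambda>u. C - g u) \<in> borel_measurable borel" "(\<lambda>u. C - (- g u)) \<in> borel_measurable borel"
    "(\<lambda>u. - g u) \<in> borel_measurable borel" using g(1) by auto
  have c: "continuous_on (sphere 0 1 \<inter> E) (\<lambda>u. C - g u)" "continuous_on (sphere 0 1 \<inter> E) (\<lambda>u. C - (- g u))"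
    using g(3) by (auto intro!: continuous_intros)
  have b: "0 \<le> C - g u" "C - g u \<le> 2 * C" "0 \<le> C - (- g u)" "C - (- g u) \<le> 2 * C" for u using gb[of u] by linarith+
  have gn: "\<bar>- g u\<bar> \<le> C" for u using g(2)[of u] by simp
  have neg: "area_int E K (\<lambda>u. - g u) = - area_int E K g" for K by (simp add: area_int_def)
  have A: "eventually (\<lambda>m. C * ?S (Q m) - ?\<psi> (Q m) < C * ?S P - ?\<psi> P + \<delta>) sequentially" if "\<delta> > 0" for \<delta>
    using area_int_outer_nonneg[OF E P Q near m(1) b(1,2) c(1) that]
    unfolding P.area_int_add_const[OF g(1,2)] body_in.area_int_add_const[OF Qb g(1,2)] .
  have B: "eventually (\<lambda>m. C * ?S (Q m) + ?\<psi> (Q m) < C * ?S P + ?\<psi> P + \<delta>) sequentially" if "\<delta> > 0" for \<delta>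
    using area_int_outer_nonneg[OF E P Q near m(2) b(3,4) c(2) that]
    unfolding P.area_int_add_const[OF m(3) gn] body_in.area_int_add_const[OF Qb m(3) gn] neg by simp
  have CS: "(\<lambda>m. C * ?S (Q m)) \<longlonglongrightarrow> C * ?S P" by (intro tendsto_intros S_lim)
  have "(\<lambda>m. ?\<psi> (Q m)) \<longlonglongrightarrow> ?\<psi> P"
  proof (rule order_tendstoI)
    fix y assume y: "y < ?\<psi> P"
    define \<delta> where "\<delta> = (?\<psi> P - y) / 2"
    have \<delta>: "\<delta> > 0" using y by (simp add: \<delta>_def)
    have "eventually (\<lambda>m. C * ?S P - \<delta> < C * ?S (Q m)) sequentially" using \<delta> by (intro order_tendstoD(1)[OF CS]) simp
    with A[OF \<delta>] show "eventually (\<lambda>m. y < ?\<psi> (Q m)) sequentially"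
      by eventually_elim (simp add: \<delta>_def field_simps)
  next
    fix y assume y: "?\<psi> P < y"
    define \<delta> where "\<delta> = (y - ?\<psi> P) / 2"
    have \<delta>: "\<delta> > 0" using y by (simp add: \<delta>_def)
    have "eventually (\<lambda>m. C * ?S P - \<delta> < C * ?S (Q m)) sequentially" using \<delta> by (intro order_tendstoD(1)[OF CS]) simp
    with B[OF \<delta>] show "eventually (\<lambda>m. ?\<psi> (Q m) < y) sequentially"
      by eventually_elim (simp add: \<delta>_def field_simps)
  qed
  then show "(\<lambda>m. ext0 ?\<psi> (Q m)) \<longlonglongrightarrow> ext0 ?\<psi> P" using Q(1) P(1) by (simp add: ext0_conv_body)
qed

section \<open>The Klain function on hyperplane sections of a subspace\<close>

lemma proj_hyperplane_section:
  assumes E: "subspace E" and u: "u \<in> sphere 0 1 \<inter> E"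
  shows "proj ({v. u \<bullet> v = 0} \<inter> E) x = proj E x - (u \<bullet> x) *\<^sub>R u"
proof (rule proj_eqI)
  have uu: "u \<bullet> u = 1" "u \<in> E" using u by (auto simp: norm_eq_1)
  have ux: "u \<bullet> proj E x = u \<bullet> x" using proj_orth[OF E uu(2), of x] by (simp add: inner_diff_left inner_commute[of u])
  show "subspace ({v. u \<bullet> v = 0} \<inter> E)" using E by (intro subspace_inter subspace_hyperplane)
  show "proj E x - (u \<bullet> x) *\<^sub>R u \<in> {v. u \<bullet> v = 0} \<inter> E"
    using uu ux proj_in[OF E] by (simp add: inner_diff_right subspace_diff[OF E] subspace_scale[OF E])
  fix w assume w: "w \<in> {v. u \<bullet> v = 0} \<inter> E"
  then have "(x - proj E x) \<bullet> w = 0" using proj_orth[OF E] by auto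
  then show "(x - (proj E x - (u \<bullet> x) *\<^sub>R u)) \<bullet> w = 0" using w by (simp add: inner_diff_left inner_add_left)
qed

lemma grass_hyperplane_section:
  assumes E: "E \<in> grass (Suc j)" and u: "u \<in> sphere 0 1 \<inter> E"
  shows "{v. u \<bullet> v = 0} \<inter> E \<in> grass j"
proof -
  have "subspace E" "dim E = Suc j" "u \<in> E" "u \<noteq> 0" using E u by (auto simp: grass_def)
  then show ?thesis using subspace_hyperplane_section[of E u] by (simp add: grass_def Int_commute)
qed

text \<open>The two projections differ by the difference of the rank-one projections onto the lines
  of \<open>u\<close> and \<open>v\<close>, so the section depends on its normal in a Lipschitz
  way.\<close>

lemma projB_hyperplane_section_dist:
  assumes E: "subspace E" and u: "u \<in> sphere 0 1 \<inter> E" and v: "v \<in> sphere 0 1 \<inter> E"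
  shows "dist (projB ({x. u \<bullet> x = 0} \<inter> E)) (projB ({x. v \<bullet> x = 0} \<inter> E)) \<le> 2 * dist u v"
  unfolding dist_norm
proof (rule norm_blinfun_bound)
  fix x
  have s: "subspace ({x. w \<bullet> x = 0} \<inter> E)" for w using E by (intro subspace_inter subspace_hyperplane)
  have "blinfun_apply (projB ({x. u \<bullet> x = 0} \<inter> E) - projB ({x. v \<bullet> x = 0} \<inter> E)) x = (v \<bullet> x) *\<^sub>R v - (u \<bullet> x) *\<^sub>R u"
    unfolding blinfun.diff_left projB_apply[OF s] proj_hyperplane_section[OF E u] proj_hyperplane_section[OF E v] by simp
  also have "\<dots> = (v \<bullet> x) *\<^sub>R (v - u) + ((v - u) \<bullet> x) *\<^sub>R u" by (simp add: algebra_simps inner_diff_left)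
  also have "norm \<dots> \<le> norm ((v \<bullet> x) *\<^sub>R (v - u)) + norm (((v - u) \<bullet> x) *\<^sub>R u)" by (rule norm_triangle_ineq)
  also have "\<dots> \<le> norm x * norm (v - u) + norm (v - u) * norm x"
    using u v Cauchy_Schwarz_ineq2[of v x] Cauchy_Schwarz_ineq2[of "v - u" x] by (intro add_mono) (auto intro!: mult_right_mono)
  finally show "norm (blinfun_apply (projB ({x. u \<bullet> x = 0} \<inter> E) - projB ({x. v \<bullet> x = 0} \<inter> E)) x) \<le> 2 * norm (u - v) * norm x"
    by (simp add: norm_minus_commute mult.commute)
qed simp

context hom_valuation
begin

text \<open>The integrand as a total function: the value 0 off the sphere of \<open>E\<close> makes
  it Borel measurable and bounded on the whole space, as the lemmas on \<open>area_int\<close>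
  require. Continuity is used only on the sphere.\<close>

definition klain_sec :: "'a set \<Rightarrow> 'a \<Rightarrow> real" where
  "klain_sec E u = (if u \<in> sphere 0 1 \<inter> E then klain \<phi> ({v. u \<bullet> v = 0} \<inter> E) else 0)"

lemma klain_sec_continuous:
  assumes E: "E \<in> grass (Suc j)" shows "continuous_on (sphere 0 1 \<inter> E) (\<lambda>u. klain \<phi> ({v. u \<bullet> v = 0} \<inter> E))"
  unfolding continuous_on_sequentially
proof (intro allI ballI impI)
  have sE: "subspace E" using E by (simp add: grass_def)
  fix s u assume u: "u \<in> sphere 0 1 \<inter> E" and s: "(\<forall>n. s n \<in> sphere 0 1 \<inter> E) \<and> s \<longlonglongrightarrow> u"
  have "(\<lambda>n. 2 * dist (s n) u) \<longlonglongrightarrow> 2 * 0"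
    using s by (intro tendsto_mult tendsto_const) (simp add: tendsto_dist_iff[symmetric])
  then have l: "(\<lambda>n. 2 * dist (s n) u) \<longlonglongrightarrow> 0" by simp
  have "(\<lambda>n. dist (projB ({v. s n \<bullet> v = 0} \<inter> E)) (projB ({v. u \<bullet> v = 0} \<inter> E))) \<longlonglongrightarrow> 0"
    by (rule tendsto_sandwich[OF _ _ tendsto_const l]) (use projB_hyperplane_section_dist[OF sE _ u] s in auto)
  then have "(\<lambda>n. projB ({v. s n \<bullet> v = 0} \<inter> E)) \<longlonglongrightarrow> projB ({v. u \<bullet> v = 0} \<inter> E)" by (rule tendsto_dist_iff[THEN iffD2])
  then show "((\<lambda>u. klain \<phi> ({v. u \<bullet> v = 0} \<inter> E)) \<circ> s) \<longlonglongrightarrow> klain \<phi> ({v. u \<bullet> v = 0} \<inter> E)"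
    unfolding comp_def by (intro klain_continuous grass_hyperplane_section[OF E]) (use s u in auto)
qed

lemma klain_sec_measurable: assumes E: "E \<in> grass (Suc j)" shows "klain_sec E \<in> borel_measurable borel"
  unfolding klain_sec_def[abs_def]
proof (rule borel_measurable_continuous_on_if)
  show "sphere 0 1 \<inter> E \<in> sets borel" using E by (intro sets.Int subspace_borel borel_closed) (auto simp: grass_def)
  show "continuous_on (sphere 0 1 \<inter> E) (\<lambda>u. klain \<phi> ({v. u \<bullet> v = 0} \<inter> E))" by (rule klain_sec_continuous[OF E])
qed auto

lemma klain_sec_continuous_on: assumes E: "E \<in> grass (Suc j)" shows "continuous_on (sphere 0 1 \<inter> E) (klain_sec E)"
  using klain_sec_continuous[OF E] by (rule continuous_on_eq) (simp add: klain_sec_def)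

lemma klain_sec_bounded: obtains C where "C > 0" "\<And>E u. E \<in> grass (Suc j) \<Longrightarrow> \<bar>klain_sec E u\<bar> \<le> C"
proof (rule klain_bounded)
  fix C assume C: "C > 0" "\<And>L. L \<in> grass j \<Longrightarrow> \<bar>klain \<phi> L\<bar> \<le> C"
  show ?thesis
  proof (rule that[OF C(1)])
    show "\<bar>klain_sec E u\<bar> \<le> C" if "E \<in> grass (Suc j)" for E u
      using C(1) C(2)[OF grass_hyperplane_section[OF that]] by (auto simp: klain_sec_def)
  qed
qed

lemma klain_sec_even: "subspace E \<Longrightarrow> klain_sec E (- u) = klain_sec E u"
  by (auto simp: klain_sec_def) (metis minus_minus subspace_neg)+

text \<open>The difference of the two sides has degree \<open>j\<close> in dimension
  \<open>Suc j\<close>, which is exactly the range of \<open>simplex_vanish_even\<close>. Hausdorff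
  continuity of \<open>\<phi>\<close> and continuity of \<open>klain_sec\<close> on the sphere give
  the outer continuity needed to pass to all bodies.\<close>

theorem phi_eq_area_integral:
  assumes E: "E \<in> grass (Suc j)" and ev: "even_val \<phi>" and P: "conv_body P" "P \<subseteq> E"
  shows "\<phi> P = (\<integral>u. klain_sec E u \<partial>area_codim1 E P)"
proof (rule klain_sec_bounded)
  fix C assume "C > 0" and C': "\<And>E u. E \<in> grass (Suc j) \<Longrightarrow> \<bar>klain_sec E u\<bar> \<le> C"
  have C: "\<bar>klain_sec E u\<bar> \<le> C" for u by (rule C'[OF E])
  have sE: "subspace E" and dE: "dim E = Suc j" using E by (auto simp: grass_def)
  note gm = klain_sec_measurable[OF E]
  let ?\<psi> = "\<lambda>K. area_int E K (klain_sec E)"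
  let ?\<theta> = "\<lambda>K. \<phi> K - ?\<psi> K"
  have aff: "?\<psi> ((\<lambda>x. t + s *\<^sub>R x) ` K) = \<bar>s\<bar> ^ j * ?\<psi> K"
    if "conv_body K" "K \<subseteq> E" "t \<in> E" "s \<noteq> 0" for K t s
  proof -
    have "klain_sec E (sgn s *\<^sub>R u) = klain_sec E u" for u using that(4) klain_sec_even[OF sE] by (cases "s > 0") auto
    then show ?thesis using area_int_affine[OF sE that dE gm C] by simp
  qed
  have S: "simple_val E (ext0 ?\<theta>) j"
  proof (rule simple_val_ext0[OF sE])
    fix K M :: "'a set" assume KM: "conv_body K" "K \<subseteq> E" "conv_body M" "M \<subseteq> E" "conv_body (K \<union> M)" "K \<inter> M \<noteq> {}"
    have "\<phi> (K \<union> M) + \<phi> (K \<inter> M) = \<phi> K + \<phi> M" using val KM by (auto simp: valuation_def)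
    then show "?\<theta> (K \<union> M) + ?\<theta> (K \<inter> M) = ?\<theta> K + ?\<theta> M"
      using area_int_valuation[OF sE KM gm C] by simp
  next
    fix K a assume K: "conv_body K" "a \<in> E" "a \<noteq> 0" "K \<subseteq> E \<inter> {x. a \<bullet> x = 0}"
    define u where "u = (1 / norm a) *\<^sub>R a"
    define M where "M = {x. u \<bullet> x = 0} \<inter> E"
    have u: "u \<in> sphere 0 1 \<inter> E" "norm u = 1" using K sE by (auto simp: u_def subspace_scale)
    have ua: "u \<bullet> x = 0 \<longleftrightarrow> a \<bullet> x = 0" for x using K(3) by (simp add: u_def)
    have MG: "M \<in> grass j" unfolding M_def by (rule grass_hyperplane_section[OF E u(1)])
    have sM: "subspace M" using MG by (simp add: grass_def)
    have uM: "u \<bullet> x = 0" if "x \<in> M" for x using that by (simp add: M_def)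
    have KM: "K \<subseteq> M" using K(4) ua by (auto simp: M_def)
    have "u \<noteq> 0" using u(2) by auto
    then have Esp: "span (insert u M) = E" using subspace_hyperplane_section(2)[OF sE, of u] u(1) by (simp add: M_def Int_commute)
    \<comment> \<open>The area measure of a flat body has half of its volume at each of the two
      normals; since \<open>klain_sec\<close> is even, the two halves combine to the Klain value of
      the hyperplane.\<close>
    have "?\<psi> K = (klain_sec E u + klain_sec E (- u)) / 2 * measure (lamE M) K"
      using area_int_flat[OF sM u(2) uM K(1) KM gm C] unfolding Esp .
    also have "\<dots> = klain_sec E u * measure (lamE M) K" unfolding klain_sec_even[OF sE] by simp
    also have "\<dots> = klain \<phi> M * measure (lamE M) K" using u(1) by (simp add: klain_sec_def M_def)
    also have "\<dots> = \<phi> K" using klain_works[OF MG K(1) KM] volE_eq_measure_lamE[OF sM conv_body_borel[OF K(1)]] by simp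
    finally show "?\<theta> K = 0" by simp
  next
    fix K t assume K: "conv_body K" "K \<subseteq> E" "t \<in> E"
    have "\<phi> ((\<lambda>x. t + x) ` K) = \<phi> K" using tr K by (auto simp: translation_invariant_def)
    moreover have "?\<psi> ((\<lambda>x. t + x) ` K) = ?\<psi> K" using aff[OF K, of 1] by simp
    ultimately show "?\<theta> ((\<lambda>x. t + x) ` K) = ?\<theta> K" by simp
  next
    fix K k assume K: "conv_body K" "K \<subseteq> E"
    have "\<phi> ((\<lambda>x. real (Suc k) *\<^sub>R x) ` K) = real (Suc k) ^ j * \<phi> K"
      using hom K unfolding homogeneous_val_def by (metis of_nat_0_le_iff)
    moreover have "?\<psi> ((\<lambda>x. real (Suc k) *\<^sub>R x) ` K) = real (Suc k) ^ j * ?\<psi> K"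
      using aff[OF K subspace_0[OF sE], of "real (Suc k)"] by simp
    ultimately show "?\<theta> ((\<lambda>x. real (Suc k) *\<^sub>R x) ` K) = real (Suc k) ^ j * ?\<theta> K" by (simp add: algebra_simps)
  qed
  interpret S: simple_val E "ext0 ?\<theta>" j by (rule S)
  have "(\<lambda>K. ext0 \<phi> K - 1 * ext0 ?\<psi> K) = ext0 ?\<theta>" by (rule ext) (simp add: ext0_def)
  then have oc: "outer_continuous E (ext0 ?\<theta>)"
    using outer_continuous_lincomb[OF outer_continuous_hausdorff[OF cont, of E] area_int_outer_continuous[OF sE gm C klain_sec_continuous_on[OF E]], of 1] by simp
  have "ext0 ?\<theta> P = 0"
  proof (rule S.vanish[OF _ _ _ P])
    show "1 \<le> dim E" using dE by simp
    show "ext0 ?\<theta> (orthoscheme E (dim E) w {..<dim E - 1}) = 0" if "simple_val_dual E (ext0 ?\<theta>) j (dim E) a w" for a w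
    proof -
      interpret D: simple_val_dual E "ext0 ?\<theta>" j "dim E" a w by (rule that)
      show ?thesis
      proof (rule D.simplex_vanish_even)
        fix K assume "S.body K"
        then show "ext0 ?\<theta> (uminus ` K) = ext0 ?\<theta> K"
        proof (rule S.body_cases[THEN disjE])
          assume K: "conv_body K \<and> K \<subseteq> E"
          then have cm: "conv_body (uminus ` K)" using conv_body_scale[of K "-1"] by simp
          have "\<phi> (uminus ` K) = \<phi> K" using ev K by (simp add: even_val_def)
          moreover have "?\<psi> (uminus ` K) = ?\<psi> K" using aff[OF _ _ subspace_0[OF sE], of K "-1"] K by simp
          ultimately show ?thesis using K cm by (simp add: ext0_conv_body)
        qed simp
      qed (use dE j in auto)
    qed
    show "(\<lambda>m. ext0 ?\<theta> (Q m)) \<longlonglongrightarrow> ext0 ?\<theta> K"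
      if "conv_body K" "K \<subseteq> E" "\<And>m. conv_body (Q m)" "\<And>m. Q m \<subseteq> E" "\<And>m. K \<subseteq> Q m"
        "\<And>m x. x \<in> Q m \<Longrightarrow> \<exists>k\<in>K. dist x k \<le> 1 / real (Suc m)" for K Q
      by (rule oc[unfolded outer_continuous_def, rule_format]) (use that in blast)
  qed
  then show ?thesis using P(1) by (simp add: ext0_conv_body area_int_def)
qed

end

section \<open>The invariant measure on the Grassmannian\<close>

lemma orthogonal_transformation_UNIV:
  fixes T :: "'a::euclidean_space \<Rightarrow> 'a"
  assumes T: "orthogonal_transformation T"
  obtains T' where "orthogonal_transformation T'" "\<And>x. T (T' x) = x" "\<And>x. T' (T x) = x"
proof (rule that[of "inv T"])
  show "orthogonal_transformation (inv T)" using T by (rule orthogonal_transformation_inv)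
  show "T (inv T x) = x" for x using T by (simp add: orthogonal_transformation_surj surj_f_inv_f)
  show "inv T (T x) = x" for x using T by (simp add: orthogonal_transformation_inj)
qed

text \<open>Both subspaces are orthogonal images of coordinate subspaces of equal dimension, and a
  permutation of \<open>Basis\<close> carries one coordinate subspace to the other.\<close>

lemma grass_transitive:
  fixes L M :: "'a::euclidean_space set"
  assumes "L \<in> grass k" "M \<in> grass k"
  obtains T where "orthogonal_transformation T" "T ` L = M"
proof -
  have ex: "\<exists>(T :: 'a \<Rightarrow> 'a) D. orthogonal_transformation T \<and> D \<subseteq> Basis \<and> E = T ` span D \<and> card D = k" if "E \<in> grass k" for E :: "'a set"
  proof (rule subspace_as_orthogonal_image)
    show "subspace E" using that by (simp add: grass_def)
    fix T :: "'a \<Rightarrow> 'a" and D assume "orthogonal_transformation T" "D \<subseteq> Basis" "E = T ` span D" "card D = dim E"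
    then show ?thesis using that by (intro exI[of _ T] exI[of _ D]) (simp add: grass_def)
  qed
  obtain T :: "'a \<Rightarrow> 'a" and D where T: "orthogonal_transformation T" "D \<subseteq> Basis" "L = T ` span D" "card D = k"
    using ex[OF assms(1)] by blast
  obtain T2 :: "'a \<Rightarrow> 'a" and D2 where T2: "orthogonal_transformation T2" "D2 \<subseteq> Basis" "M = T2 ` span D2" "card D2 = k"
    using ex[OF assms(2)] by blast
  have fin: "finite D" "finite D2" using finite_subset[OF T(2)] finite_subset[OF T2(2)] by auto
  obtain f where f: "bij_betw f D D2" using finite_same_card_bij[OF fin] T(4) T2(4) by auto
  have "card (Basis - D) = card (Basis - D2)" using fin T(2,4) T2(2,4) by (simp add: card_Diff_subset)
  then obtain g where g: "bij_betw g (Basis - D) (Basis - D2)"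
    using finite_same_card_bij[of "Basis - D" "Basis - D2"] by auto
  define h where "h i = (if i \<in> D then f i else g i)" for i
  have "bij_betw h D D2" using f by (rule bij_betw_cong[THEN iffD1, rotated]) (simp add: h_def)
  moreover have "bij_betw h (Basis - D) (Basis - D2)" using g by (rule bij_betw_cong[THEN iffD1, rotated]) (simp add: h_def)
  ultimately have "bij_betw h (D \<union> (Basis - D)) (D2 \<union> (Basis - D2))" by (rule bij_betw_combine) auto
  moreover have "D \<union> (Basis - D) = Basis" "D2 \<union> (Basis - D2) = Basis" using T(2) T2(2) by auto
  ultimately have h: "bij_betw h Basis Basis" by simp
  define S where "S = (\<lambda>x. \<Sum>i\<in>Basis. (x \<bullet> i) *\<^sub>R h i)"
  have po: "pairwise orthogonal (Basis :: 'a set)" by (auto simp: pairwise_def orthogonal_def inner_Basis)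
  have S: "orthogonal_transformation S" "\<And>i. i \<in> Basis \<Longrightarrow> S i = h i"
    using orthogonal_transformation_extend[OF po norm_Basis h] by (auto simp: S_def)
  have "S ` D = f ` D" by (rule image_cong) (use S(2) T(2) in \<open>auto simp: h_def\<close>)
  then have "S ` D = D2" using bij_betw_imp_surj_on[OF f] by simp
  then have SD: "S ` span D = span D2"
    using linear_span_image[OF orthogonal_transformation_linear[OF S(1)], of D] by simp
  obtain T' where T': "orthogonal_transformation T'" "\<And>x. T (T' x) = x" "\<And>x. T' (T x) = x"
    using orthogonal_transformation_UNIV[OF T(1)] by metis
  show thesis
  proof (rule that[of "T2 \<circ> (S \<circ> T')"])
    show "orthogonal_transformation (T2 \<circ> (S \<circ> T'))" by (intro orthogonal_transformation_compose T2(1) S(1) T'(1))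
    have "T' ` L = span D" unfolding T(3) by (simp add: image_image T'(3))
    moreover have "(T2 \<circ> (S \<circ> T')) ` L = T2 ` S ` T' ` L" by (simp only: image_comp)
    ultimately show "(T2 \<circ> (S \<circ> T')) ` L = M" unfolding T2(3) by (simp only: SD)
  qed
qed

lemma proj_orthogonal_image:
  fixes T :: "'a::euclidean_space \<Rightarrow> 'a"
  assumes T: "orthogonal_transformation T" "\<And>x. T (T' x) = x" and L: "subspace L"
  shows "proj (T ` L) x = T (proj L (T' x))"
  using proj_orthogonal_transformation[OF T(1) L, of "T' x"] T(2) by simp

lemma measurable_orthogonal_image:
  fixes T :: "'a::euclidean_space \<Rightarrow> 'a"
  assumes T: "orthogonal_transformation T"
  shows "(\<lambda>L. T ` L) \<in> grass_space k \<rightarrow>\<^sub>M grass_space k"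
proof (rule measurable_grass_spaceI)
  show TL: "T ` L \<in> grass k" if "L \<in> space (grass_space k)" for L :: "'a set" using that grass_orthogonal_image[OF T] by simp
  obtain T' where T': "orthogonal_transformation T'" "\<And>x. T (T' x) = x" "\<And>x. T' (T x) = x"
    using orthogonal_transformation_UNIV[OF T] by metis
  have [measurable]: "T \<in> borel_measurable borel" by (intro borel_measurable_linear orthogonal_transformation_linear T)
  show "(\<lambda>L. projB (T ` L)) \<in> borel_measurable (grass_space k)"
  proof (rule measurable_blinfunI)
    fix b :: 'a
    have "(\<lambda>L. T (proj L (T' b))) \<in> borel_measurable (grass_space k)" by measurable
    then show "(\<lambda>L. blinfun_apply (projB (T ` L)) b) \<in> borel_measurable (grass_space k)"
    proof (rule measurable_cong[THEN iffD1, rotated])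
      fix L :: "'a set" assume L: "L \<in> space (grass_space k)"
      then have "subspace L" "subspace (T ` L)" using TL[OF L] by (auto simp: grass_def)
      then show "T (proj L (T' b)) = blinfun_apply (projB (T ` L)) b"
        by (simp add: projB_apply proj_orthogonal_image[OF T T'(2)])
    qed
  qed
qed

text \<open>Conjugation with an orthogonal map preserves the operator norm, so rotations act by
  isometries. One inequality is enough because balls are later compared in both directions.\<close>

lemma projB_orthogonal_image_dist:
  fixes T :: "'a::euclidean_space \<Rightarrow> 'a"
  assumes T: "orthogonal_transformation T" and L: "subspace L" "subspace M"
  shows "dist (projB (T ` L)) (projB (T ` M)) \<le> dist (projB L) (projB M)"
  unfolding dist_norm
proof (rule norm_blinfun_bound)
  obtain T' where T': "orthogonal_transformation T'" "\<And>x. T (T' x) = x" "\<And>x. T' (T x) = x"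
    using orthogonal_transformation_UNIV[OF T] by metis
  have lin: "linear T" using T by (rule orthogonal_transformation_linear)
  have s: "subspace (T ` L)" "subspace (T ` M)" using L lin linear_subspace_image by blast+
  fix x
  have "blinfun_apply (projB (T ` L) - projB (T ` M)) x = T (proj L (T' x) - proj M (T' x))"
    by (simp add: blinfun.diff_left projB_apply s proj_orthogonal_image[OF T T'(2)] L linear_diff[OF lin])
  also have "norm \<dots> = norm (blinfun_apply (projB L - projB M) (T' x))"
    using T by (simp add: orthogonal_transformation_norm blinfun.diff_left projB_apply L)
  also have "\<dots> \<le> norm (projB L - projB M) * norm (T' x)" by (rule norm_blinfun)
  finally show "norm (blinfun_apply (projB (T ` L) - projB (T ` M)) x) \<le> norm (projB L - projB M) * norm x"
    using T'(1) by (simp add: orthogonal_transformation_norm)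
qed simp

text \<open>The condition under the definite description in \<open>nu\<close>, isolated so that
  existence and uniqueness can be proved separately.\<close>

definition rotation_invariant_prob :: "nat \<Rightarrow> 'a::euclidean_space set measure \<Rightarrow> bool" where
  "rotation_invariant_prob k M \<longleftrightarrow> sets M = sets (grass_space k) \<and> prob_space M \<and>
     (\<forall>T. orthogonal_transformation T \<longrightarrow> distr M M (\<lambda>L. T ` L) = M)"

definition gball :: "nat \<Rightarrow> real \<Rightarrow> 'a::euclidean_space set \<Rightarrow> 'a set set" where
  "gball k r L = {M \<in> grass k. dist (projB L) (projB M) < r}"

lemma gball_sets[measurable]: "gball k r L \<in> sets (grass_space k)"
proof -
  have "gball k r L = {M \<in> space (grass_space k). dist (projB L) (projB M) < r}" by (simp add: gball_def)
  also have "\<dots> \<in> sets (grass_space k)" by measurable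
  finally show ?thesis .
qed

text \<open>Rotations act transitively and by isometries, so an invariant measure depends only on
  the radius of a ball.\<close>

lemma gball_measure_eq:
  fixes M :: "'a::euclidean_space set measure"
  assumes M: "rotation_invariant_prob k M" and L: "L \<in> grass k" "L' \<in> grass k"
  shows "emeasure M (gball k r L) = emeasure M (gball k r L')"
proof -
  have le: "emeasure M (gball k r L) \<le> emeasure M (gball k r L')" if L: "L \<in> grass k" "L' \<in> grass k" for L L'
  proof -
    obtain T where T: "orthogonal_transformation T" "T ` L = L'" using grass_transitive[OF L] by metis
    have sM: "sets M = sets (grass_space k)" using M by (simp add: rotation_invariant_prob_def)
    have Tm: "(\<lambda>L. T ` L) \<in> M \<rightarrow>\<^sub>M M" using measurable_orthogonal_image[OF T(1)] by (simp cong: measurable_cong_sets add: sM)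
    have spM: "space M = grass k" using sets_eq_imp_space_eq[OF sM] by simp
    have "gball k r L \<subseteq> (\<lambda>L. T ` L) -` gball k r L' \<inter> space M"
    proof
      fix X assume X: "X \<in> gball k r L"
      then have "dist (projB L') (projB (T ` X)) \<le> dist (projB L) (projB X)"
        using projB_orthogonal_image_dist[OF T(1), of L X] L T(2) by (auto simp: gball_def grass_def)
      then show "X \<in> (\<lambda>L. T ` L) -` gball k r L' \<inter> space M"
        using X grass_orthogonal_image[OF T(1)] by (auto simp: gball_def spM)
    qed
    then have "emeasure M (gball k r L) \<le> emeasure M ((\<lambda>L. T ` L) -` gball k r L' \<inter> space M)"
      using measurable_sets[OF Tm, of "gball k r L'"] by (intro emeasure_mono) (auto simp: sM)
    also have "\<dots> = emeasure (distr M M (\<lambda>L. T ` L)) (gball k r L')"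
      by (rule emeasure_distr[symmetric, OF Tm]) (simp add: sM)
    also have "\<dots> = emeasure M (gball k r L')" using M T(1) by (simp add: rotation_invariant_prob_def)
    finally show ?thesis .
  qed
  show ?thesis by (intro antisym le L)
qed

text \<open>Countably many balls of the given radius cover the Grassmannian; if one were null, all
  would be, against total mass 1.\<close>

lemma gball_measure_pos:
  fixes M :: "'a::euclidean_space set measure"
  assumes M: "rotation_invariant_prob k M" and L: "L \<in> grass k" and r: "0 < r"
  shows "0 < emeasure M (gball k r L)"
proof (rule ccontr)
  assume "\<not> ?thesis"
  then have z: "emeasure M (gball k r X) = 0" if "X \<in> grass k" for X using gball_measure_eq[OF M that L] by simp
  have sM: "sets M = sets (grass_space k)" and pM: "prob_space M" using M by (auto simp: rotation_invariant_prob_def)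
  have spM: "space M = grass k" using sets_eq_imp_space_eq[OF sM] by simp
  let ?F = "(\<lambda>X. ball (projB X) r) ` grass k :: ('a \<Rightarrow>\<^sub>L 'a) set set"
  obtain F' where F': "F' \<subseteq> ?F" "countable F'" "\<Union>F' = \<Union>?F" using Lindelof[of ?F] by auto
  obtain C where C: "countable C" "C \<subseteq> grass k" "F' = (\<lambda>X. ball (projB X) r) ` C"
    using countable_image_eq_inj F'(1,2) by (metis countable_subset_image)
  have "grass k \<subseteq> (\<Union>X\<in>C. gball k r X)"
  proof
    fix Y :: "'a set" assume Y: "Y \<in> grass k"
    then have "projB Y \<in> \<Union>?F" using r by (intro UnionI[OF imageI]) auto
    then have "projB Y \<in> (\<Union>X\<in>C. ball (projB X) r)" using F'(3) C(3) by metis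
    then show "Y \<in> (\<Union>X\<in>C. gball k r X)" using Y by (auto simp: gball_def)
  qed
  moreover have "(\<Union>X\<in>C. gball k r X) \<in> null_sets M" using C z by (intro null_sets_UN') (auto simp: null_sets_def sM)
  ultimately have "grass k \<in> null_sets M" by (rule null_sets_subset[rotated 2]) (simp add: spM[symmetric])
  then show False using prob_space.emeasure_space_1[OF pM] by (simp add: null_sets_def spM)
qed

text \<open>Christensen's argument: Fubini shows that two invariant measures agree on balls, and then on
  open sets by averaging over balls of radius tending to \<open>0\<close>.\<close>
lemma rotation_invariant_fubini:
  fixes M N :: "'a::euclidean_space set measure"
  assumes M: "rotation_invariant_prob k M" and N: "rotation_invariant_prob k N" and U: "U \<in> sets (grass_space k)"
  shows "(\<integral>\<^sup>+ L. emeasure N (U \<inter> gball k r L) \<partial>M) = (\<integral>\<^sup>+ L. emeasure M (gball k r L) * indicator U L \<partial>N)"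
proof -
  have sM[measurable_cong]: "sets M = sets (grass_space k)" and pM: "prob_space M" using M by (auto simp: rotation_invariant_prob_def)
  have sN[measurable_cong]: "sets N = sets (grass_space k)" and pN: "prob_space N" using N by (auto simp: rotation_invariant_prob_def)
  have sp: "space M = grass k" "space N = grass k" using sets_eq_imp_space_eq[OF sM] sets_eq_imp_space_eq[OF sN] by auto
  interpret M: prob_space M by (rule pM)
  interpret N: prob_space N by (rule pN)
  interpret pair_sigma_finite M N ..
  note [measurable] = U
  define F :: "'a set \<times> 'a set \<Rightarrow> ennreal" where "F z = (if snd z \<in> U \<and> dist (projB (fst z)) (projB (snd z)) < r then 1 else 0)" for z
  have F[measurable]: "F \<in> borel_measurable (M \<Otimes>\<^sub>M N)" unfolding F_def[abs_def] by measurable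
  have "(\<integral>\<^sup>+ L. emeasure N (U \<inter> gball k r L) \<partial>M) = (\<integral>\<^sup>+ L. \<integral>\<^sup>+ L'. F (L, L') \<partial>N \<partial>M)"
  proof (rule nn_integral_cong)
    fix L
    have "emeasure N (U \<inter> gball k r L) = (\<integral>\<^sup>+ L'. indicator (U \<inter> gball k r L) L' \<partial>N)" by simp
    also have "\<dots> = (\<integral>\<^sup>+ L'. F (L, L') \<partial>N)"
      by (rule nn_integral_cong) (auto simp: F_def gball_def indicator_def sp)
    finally show "emeasure N (U \<inter> gball k r L) = (\<integral>\<^sup>+ L'. F (L, L') \<partial>N)" .
  qed
  also have "\<dots> = (\<integral>\<^sup>+ L'. \<integral>\<^sup>+ L. F (L, L') \<partial>M \<partial>N)" by (rule Fubini[symmetric]) (simp add: F)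
  also have "\<dots> = (\<integral>\<^sup>+ L'. emeasure M (gball k r L') * indicator U L' \<partial>N)"
  proof (rule nn_integral_cong)
    fix L'
    have "emeasure M (gball k r L') * indicator U L' = (\<integral>\<^sup>+ L. indicator (gball k r L') L * indicator U L' \<partial>M)"
      by (subst nn_integral_multc) auto
    also have "\<dots> = (\<integral>\<^sup>+ L. F (L, L') \<partial>M)"
      by (rule nn_integral_cong) (auto simp: F_def gball_def indicator_def sp dist_commute)
    finally show "(\<integral>\<^sup>+ L. F (L, L') \<partial>M) = emeasure M (gball k r L') * indicator U L'" by simp
  qed
  finally show ?thesis .
qed

text \<open>With the whole Grassmannian as \<open>U\<close>, both sides of
  \<open>rotation_invariant_fubini\<close> integrate a constant against a probability
  measure.\<close>

lemma rotation_invariant_gball_eq: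
  fixes M N :: "'a::euclidean_space set measure"
  assumes M: "rotation_invariant_prob k M" and N: "rotation_invariant_prob k N" and L: "L \<in> grass k"
  shows "emeasure M (gball k r L) = emeasure N (gball k r L)"
proof -
  have sM: "sets M = sets (grass_space k)" and pM: "prob_space M" using M by (auto simp: rotation_invariant_prob_def)
  have sN: "sets N = sets (grass_space k)" and pN: "prob_space N" using N by (auto simp: rotation_invariant_prob_def)
  have sp: "space M = grass k" "space N = grass k" using sets_eq_imp_space_eq[OF sM] sets_eq_imp_space_eq[OF sN] by auto
  have "emeasure N (gball k r L) = (\<integral>\<^sup>+ X. emeasure N (gball k r L) \<partial>M)"
    using prob_space.emeasure_space_1[OF pM] by simp
  also have "\<dots> = (\<integral>\<^sup>+ X. emeasure N (grass k \<inter> gball k r X) \<partial>M)"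
    by (rule nn_integral_cong) (use gball_measure_eq[OF N L] in \<open>auto simp: sp gball_def Collect_conj_eq[symmetric] Int_def conj_assoc[symmetric] cong: conj_cong\<close>)
  also have "\<dots> = (\<integral>\<^sup>+ X. emeasure M (gball k r X) * indicator (grass k) X \<partial>N)"
    using sets.top[of "grass_space k"] by (intro rotation_invariant_fubini[OF M N]) simp
  also have "\<dots> = (\<integral>\<^sup>+ X. emeasure M (gball k r L) \<partial>N)"
    by (rule nn_integral_cong) (use gball_measure_eq[OF M L] in \<open>auto simp: sp\<close>)
  also have "\<dots> = emeasure M (gball k r L)" using prob_space.emeasure_space_1[OF pN] by simp
  finally show ?thesis by simp
qed

text \<open>Local averages of the indicator of \<open>U\<close> over small balls have lower limit at
  least 1 on the open set. Each average has \<open>M\<close>-integral equal to the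
  \<open>N\<close>-measure of \<open>U\<close>, by Fubini and equality on balls, so Fatou gives the
  inequality.\<close>

lemma rotation_invariant_open_le:
  fixes M N :: "'a::euclidean_space set measure"
  assumes M: "rotation_invariant_prob k M" and N: "rotation_invariant_prob k N" and V: "open V"
  shows "emeasure M (projB -` V \<inter> grass k) \<le> emeasure N (projB -` V \<inter> grass k)"
proof (cases "grass k = ({} :: 'a set set)")
  case False
  then obtain L0 :: "'a set" where L0: "L0 \<in> grass k" by auto
  let ?U = "projB -` V \<inter> grass k"
  have sM[measurable_cong]: "sets M = sets (grass_space k)" and pM: "prob_space M" using M by (auto simp: rotation_invariant_prob_def)
  have sN[measurable_cong]: "sets N = sets (grass_space k)" and pN: "prob_space N" using N by (auto simp: rotation_invariant_prob_def)
  have sp: "space M = grass k" "space N = grass k" using sets_eq_imp_space_eq[OF sM] sets_eq_imp_space_eq[OF sN] by auto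
  interpret N: prob_space N by (rule pN)
  have U: "?U \<in> sets (grass_space k)" using measurable_sets[OF measurable_projB, of V k] V by simp
  let ?e = "\<lambda>m. 1 / real (Suc m)"
  define h where "h m = emeasure N (gball k (?e m) L0)" for m
  have hN: "emeasure N (gball k (?e m) L) = h m" if "L \<in> grass k" for L m
    unfolding h_def by (rule gball_measure_eq[OF N that L0])
  have hM: "emeasure M (gball k (?e m) L) = h m" if "L \<in> grass k" for L m
    using rotation_invariant_gball_eq[OF M N that] hN[OF that] by simp
  have h: "h m \<noteq> 0" "h m \<noteq> \<top>" for m using gball_measure_pos[OF N L0, of "?e m"] by (auto simp: h_def)
  \<comment> \<open>The proportion of the ball around \<open>L\<close> that lies in
    \<open>U\<close>; the denominator is the common measure of all balls of this radius, which is
    neither 0 nor infinite.\<close>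
  define f where "f m L = emeasure N (?U \<inter> gball k (?e m) L) / h m" for m L
  have fm: "f m \<in> borel_measurable M" for m
  proof -
    have Q: "{z \<in> space (M \<Otimes>\<^sub>M N). snd z \<in> ?U \<and> dist (projB (fst z)) (projB (snd z)) < ?e m} \<in> sets (M \<Otimes>\<^sub>M N)"
      using U by measurable
    have "(\<lambda>L. emeasure N (Pair L -` {z \<in> space (M \<Otimes>\<^sub>M N). snd z \<in> ?U \<and> dist (projB (fst z)) (projB (snd z)) < ?e m})) \<in> borel_measurable M"
      by (rule N.measurable_emeasure_Pair[OF Q])
    then have "(\<lambda>L. emeasure N (?U \<inter> gball k (?e m) L)) \<in> borel_measurable M"
      by (rule measurable_cong[THEN iffD1, rotated]) (auto simp: gball_def space_pair_measure sp intro!: arg_cong[where f="emeasure N"])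
    then show ?thesis unfolding f_def[abs_def] by measurable
  qed
  have fint: "(\<integral>\<^sup>+ L. f m L \<partial>M) = emeasure N ?U" for m
  proof -
    have fm': "(\<lambda>L. emeasure N (?U \<inter> gball k (?e m) L)) \<in> borel_measurable M"
    proof -
      have "(\<lambda>L. h m * f m L) \<in> borel_measurable M" using fm by measurable
      moreover have "h m * f m L = emeasure N (?U \<inter> gball k (?e m) L)" for L
        unfolding f_def ennreal_times_divide by (subst mult.commute) (rule mult_divide_eq_ennreal[OF h])
      ultimately show ?thesis by simp
    qed
    have "(\<integral>\<^sup>+ L. f m L \<partial>M) = (\<integral>\<^sup>+ L. emeasure N (?U \<inter> gball k (?e m) L) \<partial>M) / h m"
      unfolding f_def by (rule nn_integral_divide[OF fm'])
    also have "\<dots> = (\<integral>\<^sup>+ L. emeasure M (gball k (?e m) L) * indicator ?U L \<partial>N) / h m"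
      unfolding rotation_invariant_fubini[OF M N U] ..
    also have "(\<integral>\<^sup>+ L. emeasure M (gball k (?e m) L) * indicator ?U L \<partial>N) = (\<integral>\<^sup>+ L. h m * indicator ?U L \<partial>N)"
      by (rule nn_integral_cong) (use hM in \<open>auto simp: sp\<close>)
    also have "\<dots> = h m * emeasure N ?U" using U by (simp add: nn_integral_cmult_indicator sN)
    also have "\<dots> / h m = emeasure N ?U" by (subst mult.commute) (rule mult_divide_eq_ennreal[OF h])
    finally show ?thesis .
  qed
  have "emeasure M ?U = (\<integral>\<^sup>+ L. indicator ?U L \<partial>M)" using U by (simp add: sM)
  also have "\<dots> \<le> (\<integral>\<^sup>+ L. liminf (\<lambda>m. f m L) \<partial>M)"
  proof (rule nn_integral_mono)
    fix L assume "L \<in> space M"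
    show "indicator ?U L \<le> liminf (\<lambda>m. f m L)"
    proof (cases "L \<in> ?U")
      case True
      then obtain r where r: "r > 0" "ball (projB L) r \<subseteq> V" using V by (auto simp: open_contains_ball)
      have "eventually (\<lambda>m. ?e m < r) sequentially"
        using order_tendstoD(2)[OF LIMSEQ_Suc[OF lim_1_over_n] r(1)] by simp
      then have "eventually (\<lambda>m. 1 \<le> f m L) sequentially"
      proof eventually_elim
        case (elim m)
        have "gball k (?e m) L \<subseteq> ?U"
          using elim less_trans[OF _ elim] subsetD[OF r(2)] by (auto simp: gball_def simp del: of_nat_Suc)
        then have "?U \<inter> gball k (?e m) L = gball k (?e m) L" by auto
        then have "f m L = h m / h m" unfolding f_def using hN[of L m] True by simp
        also have "\<dots> = 1" using mult_divide_eq_ennreal[OF h, of 1 m] by simp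
        finally have "f m L = 1" .
        then show ?case by simp
      qed
      then have "1 \<le> liminf (\<lambda>m. f m L)" by (rule Liminf_bounded)
      then show ?thesis using True by simp
    qed simp
  qed
  also have "\<dots> \<le> liminf (\<lambda>m. \<integral>\<^sup>+ L. f m L \<partial>M)" by (rule nn_integral_liminf[OF fm])
  also have "\<dots> = emeasure N ?U" by (simp add: fint Liminf_const)
  finally show ?thesis .
qed simp

text \<open>Open sets form an intersection-stable generator of the Borel sets of operators, and the
  measurable sets of subspaces are the preimages of those Borel sets under
  \<open>projB\<close>.\<close>

lemma rotation_invariant_unique:
  fixes M N :: "'a::euclidean_space set measure"
  assumes M: "rotation_invariant_prob k M" and N: "rotation_invariant_prob k N"
  shows "M = N"
proof -
  have sM[measurable_cong]: "sets M = sets (grass_space k)" and pM: "prob_space M" using M by (auto simp: rotation_invariant_prob_def)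
  have sN[measurable_cong]: "sets N = sets (grass_space k)" and pN: "prob_space N" using N by (auto simp: rotation_invariant_prob_def)
  have sp: "space M = grass k" "space N = grass k" using sets_eq_imp_space_eq[OF sM] sets_eq_imp_space_eq[OF sN] by auto
  interpret M: prob_space M by (rule pM)
  have mM: "projB \<in> M \<rightarrow>\<^sub>M borel" "projB \<in> N \<rightarrow>\<^sub>M borel" by measurable
  have eq: "distr M borel projB = distr N borel projB"
  proof (rule measure_eqI_generator_eq[where E="{S. open S}" and \<Omega>=UNIV and A="\<lambda>_. UNIV"])
    fix V :: "('a \<Rightarrow>\<^sub>L 'a) set" assume "V \<in> {S. open S}"
    then have V: "open V" by simp
    have "emeasure M (projB -` V \<inter> grass k) = emeasure N (projB -` V \<inter> grass k)"
      by (intro antisym rotation_invariant_open_le[OF M N V] rotation_invariant_open_le[OF N M V])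
    then show "emeasure (distr M borel projB) V = emeasure (distr N borel projB) V"
      using V mM by (simp add: emeasure_distr sp)
  next
    show "emeasure (distr M borel projB) UNIV \<noteq> \<infinity>" for i :: nat using mM by (simp add: emeasure_distr M.emeasure_finite)
  qed (auto simp: Int_stable_def borel_def)
  show ?thesis
  proof (rule measure_eqI)
    fix A assume "A \<in> sets M"
    then have "A \<in> sets (vimage_algebra (grass k) projB borel)" by (simp add: sM grass_space_def projB_def[abs_def])
    then obtain B where B: "B \<in> sets borel" "A = projB -` B \<inter> grass k" by (auto simp: sets_vimage_algebra2)
    have "emeasure (distr M borel projB) B = emeasure (distr N borel projB) B" by (simp add: eq)
    then show "emeasure M A = emeasure N A" using B mM by (simp add: emeasure_distr sp)
  qed (simp add: sM sN)
qed

lemma uniform_ball_invariant: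
  fixes T :: "'a::euclidean_space \<Rightarrow> 'a"
  assumes T: "orthogonal_transformation T"
  shows "distr (uniform_measure lborel (cball 0 1)) borel T = uniform_measure lborel (cball 0 1)"
proof (rule measure_eqI)
  fix A :: "'a set" assume "A \<in> sets (distr (uniform_measure lborel (cball 0 1)) borel T)"
  then have A[measurable]: "A \<in> sets borel" by simp
  have [measurable]: "T \<in> borel_measurable borel" by (intro borel_measurable_linear orthogonal_transformation_linear T)
  have "cball 0 1 \<inter> T -` A = T -` (cball 0 1 \<inter> A)" using T by (auto simp: orthogonal_transformation_norm)
  then have "emeasure lborel (cball 0 1 \<inter> T -` A) = emeasure (distr lborel borel T) (cball 0 1 \<inter> A)"
    by (simp add: emeasure_distr)
  also have "\<dots> = emeasure lborel (cball 0 1 \<inter> A)" by (simp add: lborel_distr_orthogonal[OF T])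
  finally show "emeasure (distr (uniform_measure lborel (cball 0 1)) borel T) A = emeasure (uniform_measure lborel (cball 0 1)) A"
    using measurable_sets_borel[of T borel A] by (simp add: emeasure_distr)
qed simp

text \<open>One Gram-Schmidt step. The explicit formula makes the enlarged subspace depend
  measurably on the old subspace and the new vector.\<close>

lemma proj_span_insert:
  fixes L :: "'a::euclidean_space set"
  assumes L: "subspace L" and x: "x \<notin> L"
  defines "v \<equiv> x - proj L x"
  shows "proj (span (insert x L)) b = proj L b + ((v \<bullet> b) / (v \<bullet> v)) *\<^sub>R v" "v \<noteq> 0"
proof -
  show v0: "v \<noteq> 0" using x proj_in[OF L, of x] by (auto simp: v_def)
  have vL: "v \<bullet> w = 0" if "w \<in> L" for w unfolding v_def by (rule proj_orth[OF L that])
  have xS: "x \<in> span (insert x L)" and LS: "L \<subseteq> span (insert x L)" using span_superset[of "insert x L"] by auto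
  have vS: "v \<in> span (insert x L)" unfolding v_def using LS proj_in[OF L] by (intro span_diff xS) auto
  show "proj (span (insert x L)) b = proj L b + ((v \<bullet> b) / (v \<bullet> v)) *\<^sub>R v"
  proof (rule proj_eqI)
    show "proj L b + ((v \<bullet> b) / (v \<bullet> v)) *\<^sub>R v \<in> span (insert x L)"
      using LS proj_in[OF L] by (intro span_add span_scale vS) auto
    fix w assume "w \<in> span (insert x L)"
    then obtain c where c: "w - c *\<^sub>R x \<in> span L" by (auto simp: span_insert)
    then have "w - c *\<^sub>R x \<in> L" using L by (simp add: span_eq_iff[THEN iffD2])
    then have "w - c *\<^sub>R v \<in> L" using subspace_add[OF L, of "w - c *\<^sub>R x" "c *\<^sub>R proj L x"] subspace_scale[OF L proj_in[OF L]]
      by (simp add: v_def algebra_simps)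
    moreover define l where "l = w - c *\<^sub>R v"
    ultimately have l: "l \<in> L" "w = l + c *\<^sub>R v" by auto
    have 1: "(b - proj L b) \<bullet> l = 0" by (rule proj_orth[OF L l(1)])
    have 2: "proj L b \<bullet> v = 0" using vL[OF proj_in[OF L]] by (simp add: inner_commute)
    have 3: "l \<bullet> v = 0" using vL[OF l(1)] by (simp add: inner_commute)
    show "(b - (proj L b + ((v \<bullet> b) / (v \<bullet> v)) *\<^sub>R v)) \<bullet> w = 0"
      using 1 2 3 v0 vL[OF l(1)] unfolding l(2)
      by (simp add: inner_add_right inner_add_left inner_diff_left inner_commute[of b v] algebra_simps)
  qed simp
qed

lemma AE_not_in_subspace:
  fixes L :: "'a::euclidean_space set"
  assumes L: "subspace L" "dim L < DIM('a)"
  shows "AE x in uniform_measure lborel (cball 0 1). x \<notin> L"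
proof (rule AE_uniform_measureI)
  have Lb: "L \<in> sets borel" by (rule subspace_borel[OF L(1)])
  have "L \<in> null_sets lebesgue" using negligible_lowdim[OF L(2)] by (simp add: negligible_iff_null_sets)
  then have "L \<in> null_sets lborel" using Lb by (auto simp: null_sets_def)
  from AE_not_in[OF this] show "AE x in lborel. x \<in> cball 0 1 \<longrightarrow> x \<notin> L" by eventually_elim simp
qed simp

text \<open>Induction on the dimension: a random subspace together with an independent uniform point
  of the unit ball spans a random subspace of one dimension more, and both ingredients are rotation
  invariant.\<close>

lemma rotation_invariant_exists:
  "k \<le> DIM('a::euclidean_space) \<Longrightarrow> \<exists>M :: 'a set measure. rotation_invariant_prob k M"
proof (induction k)
  case 0
  let ?M = "return (grass_space 0) {0::'a}"
  have z: "{0::'a} \<in> space (grass_space 0)" by (simp add: grass_def subspace_0)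
  have "distr ?M ?M (\<lambda>L. T ` L) = ?M" if T: "orthogonal_transformation T" for T
  proof -
    have "return (grass_space 0) (T ` {0}) = ?M" using linear_0[OF orthogonal_transformation_linear[OF T]] by simp
    moreover have "(\<lambda>L. T ` L) \<in> grass_space 0 \<rightarrow>\<^sub>M ?M" using measurable_orthogonal_image[OF T] by (simp cong: measurable_cong_sets)
    ultimately show ?thesis using distr_return[of "\<lambda>L. T ` L" "grass_space 0" "?M" "{0}"] z
      by (simp cong: distr_cong return_cong)
  qed
  then have "rotation_invariant_prob 0 ?M" unfolding rotation_invariant_prob_def using prob_space_return[OF z] by simp
  then show ?case ..
next
  case (Suc k)
  then obtain M :: "'a set measure" where M: "rotation_invariant_prob k M" by auto
  have sM[measurable_cong]: "sets M = sets (grass_space k)" and pM: "prob_space M"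
    and iM: "\<And>T. orthogonal_transformation T \<Longrightarrow> distr M M (\<lambda>L. T ` L) = M" using M by (auto simp: rotation_invariant_prob_def)
  have sp: "space M = grass k" using sets_eq_imp_space_eq[OF sM] by simp
  define \<mu> where "\<mu> = uniform_measure lborel (cball (0::'a) 1)"
  have s\<mu>[measurable_cong]: "sets \<mu> = sets borel" and sp\<mu>: "space \<mu> = UNIV" by (simp_all add: \<mu>_def)
  have p\<mu>: "prob_space \<mu>" unfolding \<mu>_def
    using unit_ball_vol_pos[of "real DIM('a)"] by (intro prob_space_uniform_measure) (auto simp: emeasure_cball simp del: unit_ball_vol_pos)
  interpret M: prob_space M by (rule pM)
  interpret \<mu>: prob_space \<mu> by (rule p\<mu>)
  interpret P: pair_prob_space M \<mu> ..
  obtain U0 :: "'a set" where U0: "subspace U0" "dim U0 = Suc k"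
    using choose_subspace_of_subspace[of "Suc k" "UNIV :: 'a set"] Suc.prems by auto
  then have U: "U0 \<in> grass (Suc k)" by (simp add: grass_def)
  \<comment> \<open>The fixed subspace \<open>U0\<close> is a default for the null event that the
    point lies in the subspace. Off that event \<open>h\<close> commutes with rotations, which is
    all that the image measure sees.\<close>
  define h where "h z = (if snd z \<in> fst z then U0 else span (insert (snd z) (fst z)))" for z
  have hg: "h z \<in> grass (Suc k)" if "fst z \<in> grass k" for z
    using that U by (auto simp: h_def grass_def dim_insert span_eq_iff[THEN iffD2])
  have hm: "h \<in> M \<Otimes>\<^sub>M \<mu> \<rightarrow>\<^sub>M grass_space (Suc k)"
  proof (rule measurable_grass_spaceI)
    show "h z \<in> grass (Suc k)" if "z \<in> space (M \<Otimes>\<^sub>M \<mu>)" for z using that hg by (auto simp: space_pair_measure sp)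
    show "(\<lambda>z. projB (h z)) \<in> borel_measurable (M \<Otimes>\<^sub>M \<mu>)"
    proof (rule measurable_blinfunI)
      fix b :: 'a
      define p where "p z = proj (fst z) (snd z)" for z :: "'a set \<times> 'a"
      have [measurable]: "p \<in> borel_measurable (M \<Otimes>\<^sub>M \<mu>)" unfolding p_def[abs_def] by (rule measurable_proj_pair[of _ _ _ k]) measurable
      have [measurable]: "(\<lambda>z. proj (fst z) b) \<in> borel_measurable (M \<Otimes>\<^sub>M \<mu>)" by (rule measurable_proj_pair[of _ _ _ k]) measurable
      have "(\<lambda>z. if p z = snd z then proj U0 b else proj (fst z) b + (((snd z - p z) \<bullet> b) / ((snd z - p z) \<bullet> (snd z - p z))) *\<^sub>R (snd z - p z))
        \<in> borel_measurable (M \<Otimes>\<^sub>M \<mu>)" by measurable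
      then show "(\<lambda>z. blinfun_apply (projB (h z)) b) \<in> borel_measurable (M \<Otimes>\<^sub>M \<mu>)"
      proof (rule measurable_cong[THEN iffD1, rotated])
        fix z assume "z \<in> space (M \<Otimes>\<^sub>M \<mu>)"
        then have z: "fst z \<in> grass k" by (auto simp: space_pair_measure sp)
        then have s: "subspace (fst z)" "subspace (h z)" using hg[of z] by (auto simp: grass_def)
        have "p z = snd z \<longleftrightarrow> snd z \<in> fst z" unfolding p_def using proj_id[OF s(1)] proj_in[OF s(1)] by metis
        then show "(if p z = snd z then proj U0 b else proj (fst z) b + (((snd z - p z) \<bullet> b) / ((snd z - p z) \<bullet> (snd z - p z))) *\<^sub>R (snd z - p z))
          = blinfun_apply (projB (h z)) b"
          using proj_span_insert(1)[OF s(1), of "snd z" b] s(2) by (auto simp: projB_apply h_def p_def)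
      qed
    qed
  qed
  let ?N = "distr (M \<Otimes>\<^sub>M \<mu>) (grass_space (Suc k)) h"
  have "distr ?N ?N (\<lambda>L. T ` L) = ?N" if T: "orthogonal_transformation T" for T
  proof -
    have lin: "linear T" using T by (rule orthogonal_transformation_linear)
    have injT: "inj T" using T by (rule orthogonal_transformation_inj)
    have Tm: "T \<in> \<mu> \<rightarrow>\<^sub>M \<mu>" using borel_measurable_linear[OF lin] by (simp cong: measurable_cong_sets add: s\<mu>)
    have TM: "(\<lambda>L. T ` L) \<in> M \<rightarrow>\<^sub>M M" using measurable_orthogonal_image[OF T] by (simp cong: measurable_cong_sets add: sM)
    have d\<mu>: "distr \<mu> \<mu> T = \<mu>" using uniform_ball_invariant[OF T] unfolding \<mu>_def by (simp cong: distr_cong)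
    let ?TT = "\<lambda>(L, x). (T ` L, T x)"
    have TTm: "?TT \<in> M \<Otimes>\<^sub>M \<mu> \<rightarrow>\<^sub>M M \<Otimes>\<^sub>M \<mu>" using Tm TM by measurable
    have dP: "distr (M \<Otimes>\<^sub>M \<mu>) (M \<Otimes>\<^sub>M \<mu>) ?TT = M \<Otimes>\<^sub>M \<mu>"
      using pair_measure_distr[OF TM Tm] by (simp add: d\<mu> iM[OF T] \<mu>.sigma_finite_measure_axioms)
    have AE: "AE z in M \<Otimes>\<^sub>M \<mu>. T ` h z = h (?TT z)"
    proof -
      have "AE z in M \<Otimes>\<^sub>M \<mu>. snd z \<notin> fst z"
      proof (rule P.AE_pair_measure)
        have "{z \<in> space (M \<Otimes>\<^sub>M \<mu>). snd z \<notin> fst z} = {z \<in> space (M \<Otimes>\<^sub>M \<mu>). proj (fst z) (snd z) \<noteq> snd z}"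
          by (auto simp: space_pair_measure sp grass_def proj_id) (metis proj_in)
        also have "\<dots> \<in> sets (M \<Otimes>\<^sub>M \<mu>)"
        proof -
          have [measurable]: "(\<lambda>z. proj (fst z) (snd z)) \<in> borel_measurable (M \<Otimes>\<^sub>M \<mu>)" by (rule measurable_proj_pair[of _ _ _ k]) measurable
          show ?thesis by measurable
        qed
        finally show "{z \<in> space (M \<Otimes>\<^sub>M \<mu>). snd z \<notin> fst z} \<in> sets (M \<Otimes>\<^sub>M \<mu>)" .
        show "AE L in M. AE x in \<mu>. snd (L, x) \<notin> fst (L, x)"
        proof (rule AE_I2)
          fix L assume "L \<in> space M"
          then have L: "subspace L" "dim L < DIM('a)" using Suc.prems by (auto simp: sp grass_def)
          show "AE x in \<mu>. snd (L, x) \<notin> fst (L, x)" using AE_not_in_subspace[OF L] unfolding \<mu>_def by simp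
        qed
      qed
      then show ?thesis
      proof eventually_elim
        case (elim z)
        then have "T (snd z) \<notin> T ` fst z" using injT by (simp add: inj_image_mem_iff)
        then show ?case using elim linear_span_image[OF lin, of "insert (snd z) (fst z)"] by (simp add: h_def case_prod_beta)
      qed
    qed
    have Tm': "(\<lambda>L. T ` L) \<in> grass_space (Suc k) \<rightarrow>\<^sub>M grass_space (Suc k)" by (rule measurable_orthogonal_image[OF T])
    have "distr ?N ?N (\<lambda>L. T ` L) = distr ?N (grass_space (Suc k)) (\<lambda>L. T ` L)" by (rule distr_cong) auto
    also have "\<dots> = distr (M \<Otimes>\<^sub>M \<mu>) (grass_space (Suc k)) ((\<lambda>L. T ` L) \<circ> h)" by (rule distr_distr[OF Tm' hm])
    also have "\<dots> = distr (M \<Otimes>\<^sub>M \<mu>) (grass_space (Suc k)) (h \<circ> ?TT)"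
      by (rule distr_cong_AE) (use AE hm TTm Tm' in \<open>auto intro: measurable_comp\<close>)
    also have "\<dots> = distr (distr (M \<Otimes>\<^sub>M \<mu>) (M \<Otimes>\<^sub>M \<mu>) ?TT) (grass_space (Suc k)) h" by (rule distr_distr[symmetric, OF hm TTm])
    also have "\<dots> = ?N" unfolding dP ..
    finally show ?thesis .
  qed
  then have "rotation_invariant_prob (Suc k) ?N"
    unfolding rotation_invariant_prob_def using P.prob_space_distr[OF hm] by simp
  then show ?case ..
qed

lemma nu_rotation_invariant:
  assumes "k \<le> DIM('a::euclidean_space)"
  shows "rotation_invariant_prob k (nu k :: 'a set measure)"
proof -
  obtain M :: "'a set measure" where M: "rotation_invariant_prob k M" using rotation_invariant_exists[OF assms] by auto
  have "rotation_invariant_prob k (THE M :: 'a set measure. rotation_invariant_prob k M)"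
    by (rule theI[of _ M]) (use M rotation_invariant_unique in auto)
  then show ?thesis unfolding nu_def rotation_invariant_prob_def[abs_def] .
qed

lemma sets_nu: "k \<le> DIM('a) \<Longrightarrow> sets (nu k :: 'a::euclidean_space set measure) = sets (grass_space k)"
  and prob_space_nu: "k \<le> DIM('a) \<Longrightarrow> prob_space (nu k :: 'a set measure)"
  using nu_rotation_invariant[where 'a='a] by (auto simp: rotation_invariant_prob_def)

section \<open>The flag measure\<close>

text \<open>The measures \<open>\<kappa> E\<close> live on different spaces, namely the unit spheres
  of the subspaces \<open>E\<close> in the application. The maps \<open>u \<mapsto> (u, E)\<close>
  carry them into one common space \<open>G\<close>, and measurability in \<open>E\<close> is only
  required for the masses of sections of sets in \<open>G\<close>.\<close>

locale bounded_kernel =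
  fixes N :: "'b measure" and \<kappa> :: "'b \<Rightarrow> 'a measure" and G :: "('a \<times> 'b) measure" and B :: real
  assumes fin: "finite_measure N"
    and pair: "E \<in> space N \<Longrightarrow> (\<lambda>u. (u, E)) \<in> \<kappa> E \<rightarrow>\<^sub>M G"
    and meas: "A \<in> sets G \<Longrightarrow> (\<lambda>E. emeasure (\<kappa> E) ((\<lambda>u. (u, E)) -` A \<inter> space (\<kappa> E))) \<in> borel_measurable N"
    and bounded: "E \<in> space N \<Longrightarrow> emeasure (\<kappa> E) (space (\<kappa> E)) \<le> ennreal B"
begin

definition kernel_measure :: "('a \<times> 'b) measure" where
  "kernel_measure = measure_of (space G) (sets G) (\<lambda>A. \<integral>\<^sup>+ E. (\<integral>\<^sup>+ u. indicator A (u, E) \<partial>\<kappa> E) \<partial>N)"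

lemma sets_kernel_measure[simp, measurable_cong]: "sets kernel_measure = sets G" and space_kernel_measure[simp]: "space kernel_measure = space G"
  by (simp_all add: kernel_measure_def)

lemma measurable_kernel_measure[simp]: "measurable kernel_measure M = measurable G M"
  by (rule measurable_cong_sets) simp_all

lemma section_measurable: "E \<in> space N \<Longrightarrow> f \<in> G \<rightarrow>\<^sub>M M \<Longrightarrow> (\<lambda>u. f (u, E)) \<in> \<kappa> E \<rightarrow>\<^sub>M M"
  using measurable_comp[OF pair] by (simp add: comp_def)

lemma kernel_indicator:
  assumes "A \<in> sets G"
  shows "(\<lambda>E. \<integral>\<^sup>+ u. indicator A (u, E) \<partial>\<kappa> E) \<in> borel_measurable N"
proof (rule measurable_cong[THEN iffD1, OF _ meas[OF assms]])
  fix E assume E: "E \<in> space N"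
  let ?S = "(\<lambda>u. (u, E)) -` A \<inter> space (\<kappa> E)"
  have "?S \<in> sets (\<kappa> E)" using pair[OF E] assms by (rule measurable_sets)
  then have "emeasure (\<kappa> E) ?S = (\<integral>\<^sup>+ u. indicator ?S u \<partial>\<kappa> E)" by simp
  also have "\<dots> = (\<integral>\<^sup>+ u. indicator A (u, E) \<partial>\<kappa> E)" by (rule nn_integral_cong) (simp add: indicator_def)
  finally show "emeasure (\<kappa> E) ?S = (\<integral>\<^sup>+ u. indicator A (u, E) \<partial>\<kappa> E)" .
qed

lemma emeasure_kernel_measure:
  assumes "A \<in> sets G"
  shows "emeasure kernel_measure A = (\<integral>\<^sup>+ E. (\<integral>\<^sup>+ u. indicator A (u, E) \<partial>\<kappa> E) \<partial>N)"
proof (rule emeasure_measure_of[OF kernel_measure_def])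
  show "sets G \<subseteq> Pow (space G)" by (rule sets.space_closed)
  show "A \<in> sets kernel_measure" using assms by simp
  show "positive (sets kernel_measure) (\<lambda>A. \<integral>\<^sup>+ E. (\<integral>\<^sup>+ u. indicator A (u, E) \<partial>\<kappa> E) \<partial>N)" by (simp add: positive_def)
  show "countably_additive (sets kernel_measure) (\<lambda>A. \<integral>\<^sup>+ E. (\<integral>\<^sup>+ u. indicator A (u, E) \<partial>\<kappa> E) \<partial>N)"
  proof (rule countably_additiveI)
    fix A :: "nat \<Rightarrow> ('a \<times> 'b) set" assume A: "range A \<subseteq> sets kernel_measure" "disjoint_family A"
    then have A': "A i \<in> sets G" for i by auto
    have "(\<Sum>i. \<integral>\<^sup>+ E. (\<integral>\<^sup>+ u. indicator (A i) (u, E) \<partial>\<kappa> E) \<partial>N) = (\<integral>\<^sup>+ E. (\<Sum>i. \<integral>\<^sup>+ u. indicator (A i) (u, E) \<partial>\<kappa> E) \<partial>N)"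
      by (rule nn_integral_suminf[symmetric]) (rule kernel_indicator[OF A'])
    also have "\<dots> = (\<integral>\<^sup>+ E. (\<integral>\<^sup>+ u. indicator (\<Union>i. A i) (u, E) \<partial>\<kappa> E) \<partial>N)"
    proof (rule nn_integral_cong)
      fix E assume E: "E \<in> space N"
      have m: "(\<lambda>u. indicator (A i) (u, E) :: ennreal) \<in> borel_measurable (\<kappa> E)" for i
        by (rule section_measurable[OF E]) (use A' in simp)
      have "(\<Sum>i. \<integral>\<^sup>+ u. indicator (A i) (u, E) \<partial>\<kappa> E) = (\<integral>\<^sup>+ u. (\<Sum>i. indicator (A i) (u, E)) \<partial>\<kappa> E)"
        by (rule nn_integral_suminf[symmetric]) (rule m)
      also have "\<dots> = (\<integral>\<^sup>+ u. indicator (\<Union>i. A i) (u, E) \<partial>\<kappa> E)" by (simp add: suminf_indicator[OF A(2)])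
      finally show "(\<Sum>i. \<integral>\<^sup>+ u. indicator (A i) (u, E) \<partial>\<kappa> E) = (\<integral>\<^sup>+ u. indicator (\<Union>i. A i) (u, E) \<partial>\<kappa> E)" .
    qed
    finally show "(\<Sum>i. \<integral>\<^sup>+ E. (\<integral>\<^sup>+ u. indicator (A i) (u, E) \<partial>\<kappa> E) \<partial>N) = (\<integral>\<^sup>+ E. (\<integral>\<^sup>+ u. indicator (\<Union>(range A)) (u, E) \<partial>\<kappa> E) \<partial>N)" .
  qed
qed

text \<open>Measurability of the inner integral and the formula go through the induction together,
  since the sum and limit steps of the formula rely on the measurability.\<close>

lemma nn_integral_kernel_measure:
  assumes "f \<in> borel_measurable G"
  shows "(\<lambda>E. \<integral>\<^sup>+ u. f (u, E) \<partial>\<kappa> E) \<in> borel_measurable N \<and> (\<integral>\<^sup>+ z. f z \<partial>kernel_measure) = (\<integral>\<^sup>+ E. (\<integral>\<^sup>+ u. f (u, E) \<partial>\<kappa> E) \<partial>N)"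
  using assms
proof (induction rule: borel_measurable_induct)
  case (cong f g)
  have "(\<integral>\<^sup>+ u. f (u, E) \<partial>\<kappa> E) = (\<integral>\<^sup>+ u. g (u, E) \<partial>\<kappa> E)" if "E \<in> space N" for E
    by (rule nn_integral_cong) (use cong(3) measurable_space[OF pair[OF that]] in auto)
  moreover have "(\<integral>\<^sup>+ z. f z \<partial>kernel_measure) = (\<integral>\<^sup>+ z. g z \<partial>kernel_measure)" by (rule nn_integral_cong) (use cong(3) in auto)
  ultimately show ?case using cong(4) by (simp cong: measurable_cong nn_integral_cong)
next
  case (set A)
  then show ?case by (simp add: kernel_indicator emeasure_kernel_measure)
next
  case (mult u c)
  then have [measurable]: "(\<lambda>E. \<integral>\<^sup>+ v. u (v, E) \<partial>\<kappa> E) \<in> borel_measurable N" "u \<in> borel_measurable G" by auto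
  have eq: "(\<integral>\<^sup>+ v. c * u (v, E) \<partial>\<kappa> E) = c * (\<integral>\<^sup>+ v. u (v, E) \<partial>\<kappa> E)" if "E \<in> space N" for E
    by (rule nn_integral_cmult) (rule section_measurable[OF that mult(2)])
  have "(\<integral>\<^sup>+ z. c * u z \<partial>kernel_measure) = c * (\<integral>\<^sup>+ z. u z \<partial>kernel_measure)" by (rule nn_integral_cmult) measurable
  then show ?case using mult by (simp add: eq nn_integral_cmult cong: measurable_cong nn_integral_cong)
next
  case (add u v)
  then have [measurable]: "(\<lambda>E. \<integral>\<^sup>+ x. u (x, E) \<partial>\<kappa> E) \<in> borel_measurable N" "(\<lambda>E. \<integral>\<^sup>+ x. v (x, E) \<partial>\<kappa> E) \<in> borel_measurable N"
    and m[measurable]: "u \<in> borel_measurable G" "v \<in> borel_measurable G" by auto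
  have eq: "(\<integral>\<^sup>+ x. v (x, E) + u (x, E) \<partial>\<kappa> E) = (\<integral>\<^sup>+ x. v (x, E) \<partial>\<kappa> E) + (\<integral>\<^sup>+ x. u (x, E) \<partial>\<kappa> E)" if "E \<in> space N" for E
    by (rule nn_integral_add) (intro section_measurable[OF that] m)+
  have "(\<integral>\<^sup>+ z. v z + u z \<partial>kernel_measure) = (\<integral>\<^sup>+ z. v z \<partial>kernel_measure) + (\<integral>\<^sup>+ z. u z \<partial>kernel_measure)" by (rule nn_integral_add) measurable
  then show ?case using add by (simp add: eq nn_integral_add cong: measurable_cong nn_integral_cong)
next
  case (seq U)
  then have [measurable]: "(\<lambda>E. \<integral>\<^sup>+ x. U i (x, E) \<partial>\<kappa> E) \<in> borel_measurable N"
    and IH: "(\<integral>\<^sup>+ z. U i z \<partial>kernel_measure) = (\<integral>\<^sup>+ E. (\<integral>\<^sup>+ u. U i (u, E) \<partial>\<kappa> E) \<partial>N)"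
    and m[measurable]: "U i \<in> borel_measurable G" for i by auto
  have inc: "incseq (\<lambda>i x. U i (x, E))" for E using \<open>incseq U\<close> by (auto simp: incseq_def le_fun_def)
  have eq: "(\<integral>\<^sup>+ x. (SUP i. U i) (x, E) \<partial>\<kappa> E) = (SUP i. \<integral>\<^sup>+ x. U i (x, E) \<partial>\<kappa> E)" if "E \<in> space N" for E
    unfolding SUP_apply by (rule nn_integral_monotone_convergence_SUP[OF inc]) (intro section_measurable[OF that] m)
  have "(\<integral>\<^sup>+ z. (SUP i. U i) z \<partial>kernel_measure) = (SUP i. \<integral>\<^sup>+ z. U i z \<partial>kernel_measure)"
    unfolding SUP_apply by (rule nn_integral_monotone_convergence_SUP[OF \<open>incseq U\<close>]) measurable
  also have "\<dots> = (\<integral>\<^sup>+ E. (SUP i. \<integral>\<^sup>+ x. U i (x, E) \<partial>\<kappa> E) \<partial>N)"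
    unfolding IH by (rule nn_integral_monotone_convergence_SUP[symmetric])
      (use \<open>incseq U\<close> in \<open>auto simp: incseq_def le_fun_def intro!: nn_integral_mono\<close>)
  also have "\<dots> = (\<integral>\<^sup>+ E. (\<integral>\<^sup>+ x. (SUP i. U i) (x, E) \<partial>\<kappa> E) \<partial>N)" by (rule nn_integral_cong) (rule eq[symmetric])
  finally have 1: "(\<integral>\<^sup>+ z. (SUP i. U i) z \<partial>kernel_measure) = (\<integral>\<^sup>+ E. (\<integral>\<^sup>+ x. (SUP i. U i) (x, E) \<partial>\<kappa> E) \<partial>N)" .
  have "(\<lambda>E. SUP i. \<integral>\<^sup>+ x. U i (x, E) \<partial>\<kappa> E) \<in> borel_measurable N" by measurable
  then have "(\<lambda>E. \<integral>\<^sup>+ x. (SUP i. U i) (x, E) \<partial>\<kappa> E) \<in> borel_measurable N"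
    by (rule measurable_cong[THEN iffD1, rotated]) (rule eq[symmetric])
  then show ?case using 1 by (rule conjI)
qed

lemma finite_kernel_measure: "finite_measure kernel_measure"
proof (rule finite_measureI)
  have "emeasure kernel_measure (space kernel_measure) = (\<integral>\<^sup>+ E. (\<integral>\<^sup>+ u. indicator (space G) (u, E) \<partial>\<kappa> E) \<partial>N)" by (simp add: emeasure_kernel_measure)
  also have "\<dots> \<le> (\<integral>\<^sup>+ E. ennreal B \<partial>N)"
  proof (rule nn_integral_mono)
    fix E assume E: "E \<in> space N"
    have "(\<integral>\<^sup>+ u. indicator (space G) (u, E) \<partial>\<kappa> E) \<le> (\<integral>\<^sup>+ u. 1 \<partial>\<kappa> E)" by (rule nn_integral_mono) (simp add: indicator_def)
    also have "\<dots> \<le> ennreal B" using bounded[OF E] by simp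
    finally show "(\<integral>\<^sup>+ u. indicator (space G) (u, E) \<partial>\<kappa> E) \<le> ennreal B" .
  qed
  also have "\<dots> < \<infinity>" using finite_measure.finite_emeasure_space[OF fin] by (simp add: ennreal_mult_less_top less_top)
  finally show "emeasure kernel_measure (space kernel_measure) \<noteq> \<infinity>" by simp
qed

lemma finite_kernel: assumes "E \<in> space N" shows "finite_measure (\<kappa> E)"
  using bounded[OF assms] by (intro finite_measureI) (auto simp: top_unique)

lemma integral_kernel_measure_nonneg:
  fixes f :: "'a \<times> 'b \<Rightarrow> real"
  assumes f: "f \<in> borel_measurable G" "\<And>z. 0 \<le> f z" "\<And>z. f z \<le> C"
  shows "(\<integral>z. f z \<partial>kernel_measure) = (\<integral>E. (\<integral>u. f (u, E) \<partial>\<kappa> E) \<partial>N)" "integrable N (\<lambda>E. \<integral>u. f (u, E) \<partial>\<kappa> E)"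
proof -
  interpret N: finite_measure N by (rule fin)
  have f': "(\<lambda>z. ennreal (f z)) \<in> borel_measurable G" using f(1) by measurable
  have inner: "(\<integral>\<^sup>+ u. ennreal (f (u, E)) \<partial>\<kappa> E) = ennreal (\<integral>u. f (u, E) \<partial>\<kappa> E)" if E: "E \<in> space N" for E
  proof -
    interpret K: finite_measure "\<kappa> E" by (rule finite_kernel[OF E])
    have "integrable (\<kappa> E) (\<lambda>u. f (u, E))"
      using f section_measurable[OF E f(1)] by (intro K.integrable_const_bound[where B=C]) auto
    then show ?thesis using f(2) by (intro nn_integral_eq_integral) auto
  qed
  have nn: "0 \<le> (\<integral>u. f (u, E) \<partial>\<kappa> E)" for E using f(2) by (intro Bochner_Integration.integral_nonneg) auto
  have "(\<lambda>E. \<integral>\<^sup>+ u. ennreal (f (u, E)) \<partial>\<kappa> E) \<in> borel_measurable N" using nn_integral_kernel_measure[OF f'] by blast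
  then have "(\<lambda>E. enn2real (\<integral>\<^sup>+ u. ennreal (f (u, E)) \<partial>\<kappa> E)) \<in> borel_measurable N" by measurable
  then have m: "(\<lambda>E. \<integral>u. f (u, E) \<partial>\<kappa> E) \<in> borel_measurable N"
    by (rule measurable_cong[THEN iffD1, rotated]) (simp add: inner nn)
  have "(\<integral>z. f z \<partial>kernel_measure) = enn2real (\<integral>\<^sup>+ z. ennreal (f z) \<partial>kernel_measure)"
    using f by (intro integral_eq_nn_integral) auto
  also have "(\<integral>\<^sup>+ z. ennreal (f z) \<partial>kernel_measure) = (\<integral>\<^sup>+ E. ennreal (\<integral>u. f (u, E) \<partial>\<kappa> E) \<partial>N)"
    using nn_integral_kernel_measure[OF f'] by (simp add: inner cong: nn_integral_cong)
  also have "enn2real \<dots> = (\<integral>E. (\<integral>u. f (u, E) \<partial>\<kappa> E) \<partial>N)"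
    using m nn by (intro integral_eq_nn_integral[symmetric]) auto
  finally show "(\<integral>z. f z \<partial>kernel_measure) = (\<integral>E. (\<integral>u. f (u, E) \<partial>\<kappa> E) \<partial>N)" .
  have B: "(\<integral>u. f (u, E) \<partial>\<kappa> E) \<le> C * enn2real (ennreal B)" if E: "E \<in> space N" for E
  proof -
    interpret K: finite_measure "\<kappa> E" by (rule finite_kernel[OF E])
    have C: "0 \<le> C" using f(2,3) order_trans by blast
    have "integrable (\<kappa> E) (\<lambda>u. f (u, E))"
      using f section_measurable[OF E f(1)] by (intro K.integrable_const_bound[where B=C]) auto
    then have "(\<integral>u. f (u, E) \<partial>\<kappa> E) \<le> (\<integral>u. C \<partial>\<kappa> E)" using f(3) by (intro Bochner_Integration.integral_mono) auto
    also have "\<dots> = C * measure (\<kappa> E) (space (\<kappa> E))" by (simp add: mult.commute)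
    also have "\<dots> \<le> C * enn2real (ennreal B)"
      unfolding measure_def using bounded[OF E] C by (intro mult_left_mono enn2real_mono) auto
    finally show ?thesis .
  qed
  show "integrable N (\<lambda>E. \<integral>u. f (u, E) \<partial>\<kappa> E)"
    by (rule N.integrable_const_bound[where B="C * enn2real (ennreal B)"]) (use m nn B in auto)
qed

text \<open>Adding \<open>C\<close> makes the integrand nonnegative; finiteness of all measures
  involved allows the constant to be subtracted again.\<close>

lemma integral_kernel_measure:
  fixes f :: "'a \<times> 'b \<Rightarrow> real"
  assumes f: "f \<in> borel_measurable G" "\<And>z. \<bar>f z\<bar> \<le> C"
  shows "(\<integral>z. f z \<partial>kernel_measure) = (\<integral>E. (\<integral>u. f (u, E) \<partial>\<kappa> E) \<partial>N)"
proof -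
  interpret F: finite_measure kernel_measure by (rule finite_kernel_measure)
  have b: "0 \<le> f z + C" "f z + C \<le> 2 * C" "0 \<le> C" for z using f(2)[of z] by auto
  have m: "(\<lambda>z. f z + C) \<in> borel_measurable G" using f(1) by measurable
  have iF: "integrable kernel_measure f" using f by (intro F.integrable_const_bound[where B=C]) (auto simp: measurable_cong_sets[OF sets_kernel_measure refl])
  note 1 = integral_kernel_measure_nonneg[OF m b(1,2)]
  note 2 = integral_kernel_measure_nonneg[of "\<lambda>_. C" C, OF _ b(3) order_refl, simplified]
  have "(\<integral>z. f z \<partial>kernel_measure) = (\<integral>z. f z + C \<partial>kernel_measure) - (\<integral>z. C \<partial>kernel_measure)"
    using iF by simp
  also have "\<dots> = (\<integral>E. (\<integral>u. f (u, E) + C \<partial>\<kappa> E) \<partial>N) - (\<integral>E. (\<integral>u. C \<partial>\<kappa> E) \<partial>N)"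
    using 1(1) integral_kernel_measure_nonneg(1)[of "\<lambda>_. C" C] b(3) by simp
  also have "\<dots> = (\<integral>E. (\<integral>u. f (u, E) + C \<partial>\<kappa> E) - (\<integral>u. C \<partial>\<kappa> E) \<partial>N)"
    using 1(2) integral_kernel_measure_nonneg(2)[of "\<lambda>_. C" C] b(3) by (intro Bochner_Integration.integral_diff[symmetric]) auto
  also have "\<dots> = (\<integral>E. (\<integral>u. f (u, E) \<partial>\<kappa> E) \<partial>N)"
  proof (rule Bochner_Integration.integral_cong[OF refl])
    fix E assume E: "E \<in> space N"
    interpret K: finite_measure "\<kappa> E" by (rule finite_kernel[OF E])
    have "integrable (\<kappa> E) (\<lambda>u. f (u, E))"
      using f section_measurable[OF E f(1)] by (intro K.integrable_const_bound[where B=C]) auto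
    then show "(\<integral>u. f (u, E) + C \<partial>\<kappa> E) - (\<integral>u. C \<partial>\<kappa> E) = (\<integral>u. f (u, E) \<partial>\<kappa> E)" by simp
  qed
  finally show ?thesis .
qed

end

section \<open>Measurable dependence of the area measure of a projection on the subspace\<close>

lemma conv_body_proj: "subspace E \<Longrightarrow> conv_body K \<Longrightarrow> conv_body (proj E ` K)"
  unfolding conv_body_def
  by (auto intro: compact_continuous_image continuous_on_proj convex_linear_image[OF linear_proj])

lemma proj_image_subset: "subspace E \<Longrightarrow> proj E ` K \<subseteq> E"
  using proj_in by auto

lemma dense_sequence:
  fixes K :: "'a::euclidean_space set"
  assumes "K \<noteq> {}"
  obtains k :: "nat \<Rightarrow> 'a" where "\<And>i. k i \<in> K" "\<And>x e. x \<in> K \<Longrightarrow> 0 < e \<Longrightarrow> \<exists>i. dist x (k i) < e"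
proof -
  obtain T where T: "countable T" "T \<subseteq> K" "K \<subseteq> closure T" using separable[of K] by metis
  have "T \<noteq> {}" using T(3) assms by auto
  then have r: "range (from_nat_into T) = T" using T(1) by (simp add: range_from_nat_into)
  show thesis
  proof (rule that[of "from_nat_into T"])
    show "from_nat_into T i \<in> K" for i using r T(2) by auto
    show "\<exists>i. dist x (from_nat_into T i) < e" if xe: "x \<in> K" "0 < e" for x e
    proof -
      have "x \<in> closure T" using T(3) xe(1) by auto
      then obtain t where "t \<in> T" "dist t x < e" using xe(2) by (auto simp: closure_approachable)
      then show ?thesis using r by (metis dist_commute imageE)
    qed
  qed
qed

locale projected_body =
  fixes K :: "'a::euclidean_space set" and n :: nat
  assumes K: "conv_body K"
begin

abbreviation "proj_pair \<equiv> \<lambda>z :: 'a set \<times> 'a. proj (fst z) (snd z)"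
abbreviation "grass_borel \<equiv> grass_space n \<Otimes>\<^sub>M (borel :: 'a measure)"

lemma proj_pair_measurable: "proj_pair \<in> borel_measurable grass_borel" "(\<lambda>z. proj (fst z) x) \<in> borel_measurable grass_borel"
  by (rule measurable_proj_pair[of _ _ _ n]; measurable)+

text \<open>Projections do not increase distances, so a dense sequence of \<open>K\<close> projects
  to a dense sequence. Strict distance bounds thus become countable disjunctions and hence
  measurable in the subspace.\<close>

lemma infdist_less_dense:
  assumes k: "\<And>i. k i \<in> K" "\<And>x e. x \<in> K \<Longrightarrow> 0 < e \<Longrightarrow> \<exists>i. dist x (k i) < e" and E: "subspace E"
  shows "infdist y (proj E ` K) < a \<longleftrightarrow> (\<exists>i::nat. dist y (proj E (k i)) < a)"
proof
  assume a: "infdist y (proj E ` K) < a"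
  have "conv_body (proj E ` K)" by (rule conv_body_proj[OF E K])
  then obtain z where z: "z \<in> proj E ` K" "infdist y (proj E ` K) = dist y z"
    using infdist_attains_inf[of "proj E ` K" y] by (auto simp: conv_body_def compact_imp_closed)
  then obtain x where x: "x \<in> K" "z = proj E x" by auto
  obtain i where "dist x (k i) < a - dist y z" using k(2)[OF x(1), of "a - dist y z"] a z(2) by auto
  then have "dist y (proj E (k i)) < a"
    using dist_triangle[of y "proj E (k i)" z] dist_proj_le[OF E, of x "k i"] x(2) by simp
  then show "\<exists>i. dist y (proj E (k i)) < a" ..
next
  assume "\<exists>i. dist y (proj E (k i)) < a"
  then show "infdist y (proj E ` K) < a" using infdist_le[of "proj E (k _)" "proj E ` K" y] k(1) by (meson imageI le_less_trans)
qed

abbreviation "dist_pair \<equiv> \<lambda>z :: 'a set \<times> 'a. infdist (proj_pair z) (proj (fst z) ` K)"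
abbreviation "nearest_pair \<equiv> \<lambda>z :: 'a set \<times> 'a. closest_point (proj (fst z) ` K) (proj_pair z)"

text \<open>The nearest point is a limit of measurably selected members of the projected dense
  sequence; \<open>dist_closest_point_sq\<close> shows that almost nearest members converge to
  it.\<close>

lemma dist_pair_measurable: "dist_pair \<in> borel_measurable grass_borel" and nearest_pair_measurable: "nearest_pair \<in> borel_measurable grass_borel"
proof -
  note [measurable] = proj_pair_measurable
  have "K \<noteq> {}" using K by (simp add: conv_body_def)
  then obtain k :: "nat \<Rightarrow> 'a" where k: "\<And>i. k i \<in> K" "\<And>x e. x \<in> K \<Longrightarrow> 0 < e \<Longrightarrow> \<exists>i. dist x (k i) < e"
    by (rule dense_sequence) blast
  have sub: "subspace (fst z)" if "z \<in> space grass_borel" for z using that by (auto simp: space_pair_measure grass_def)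
  show D[measurable]: "dist_pair \<in> borel_measurable grass_borel"
  proof (subst borel_measurable_iff_less, intro allI)
    fix a
    have "{z \<in> space grass_borel. dist_pair z < a} = {z \<in> space grass_borel. \<exists>i. dist (proj_pair z) (proj (fst z) (k i)) < a}"
      using infdist_less_dense[OF k sub] by auto
    also have "\<dots> \<in> sets grass_borel" by measurable
    finally show "{z \<in> space grass_borel. dist_pair z < a} \<in> sets grass_borel" .
  qed
  \<comment> \<open>Taking the least admissible index makes the selection measurable.\<close>
  define I where "I m z = (LEAST i. dist (proj_pair z) (proj (fst z) (k i)) < dist_pair z + 1 / real (Suc m))" for m and z :: "'a set \<times> 'a"
  have Im: "I m \<in> grass_borel \<rightarrow>\<^sub>M count_space UNIV" for m unfolding I_def[abs_def] by measurable
  show "nearest_pair \<in> borel_measurable grass_borel"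
  proof (rule borel_measurable_LIMSEQ_metric)
    show "(\<lambda>z. proj (fst z) (k (I m z))) \<in> borel_measurable grass_borel" for m
      by (rule measurable_compose_countable[OF _ Im[of m], of "\<lambda>i z. proj (fst z) (k i)"]) measurable
    fix z :: "'a set \<times> 'a" assume "z \<in> space grass_borel"
    then have sE: "subspace (fst z)" by (rule sub)
    let ?P = "proj (fst z) ` K" and ?y = "proj_pair z" and ?e = "\<lambda>m. 1 / real (Suc m)"
    interpret body_in UNIV ?P by unfold_locales (use conv_body_proj[OF sE K] in auto)
    let ?c = "\<lambda>m. proj (fst z) (k (I m z))"
    have c: "dist ?y (?c m) < dist_pair z + ?e m" for m
      unfolding I_def by (rule LeastI_ex) (use infdist_less_dense[OF k sE, of ?y "dist_pair z + ?e m"] in simp)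
    have le: "dist (?c m) (nearest_pair z) \<le> sqrt ((dist_pair z + ?e m)\<^sup>2 - (dist_pair z)\<^sup>2)" for m
    proof -
      have "?c m \<in> ?P" using k(1) by auto
      then have "(dist (?c m) (nearest_pair z))\<^sup>2 \<le> (dist ?y (?c m))\<^sup>2 - (dist_pair z)\<^sup>2" by (rule dist_closest_point_sq)
      also have "(dist ?y (?c m))\<^sup>2 \<le> (dist_pair z + ?e m)\<^sup>2" using c[of m] by (intro power_mono) auto
      finally show ?thesis by (intro real_le_rsqrt) simp
    qed
    have "(\<lambda>m. sqrt ((dist_pair z + ?e m)\<^sup>2 - (dist_pair z)\<^sup>2)) \<longlonglongrightarrow> sqrt ((dist_pair z + 0)\<^sup>2 - (dist_pair z)\<^sup>2)"
      by (intro tendsto_intros LIMSEQ_Suc[OF lim_1_over_n])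
    then have l: "(\<lambda>m. sqrt ((dist_pair z + ?e m)\<^sup>2 - (dist_pair z)\<^sup>2)) \<longlonglongrightarrow> 0" by simp
    have "(\<lambda>m. dist (?c m) (nearest_pair z)) \<longlonglongrightarrow> 0"
      by (rule tendsto_sandwich[OF always_eventually[OF allI] always_eventually[OF allI] tendsto_const l]) (rule zero_le_dist le)+
    then show "?c \<longlonglongrightarrow> nearest_pair z" by (rule tendsto_dist_iff[THEN iffD2])
  qed
qed

abbreviation "flag_space \<equiv> restrict_space ((borel :: 'a measure) \<Otimes>\<^sub>M grass_space n) (flags n)"

lemma flags_sets: "flags n \<in> sets ((borel :: 'a measure) \<Otimes>\<^sub>M grass_space n)"
proof -
  have [measurable]: "(\<lambda>z. proj (snd z) (fst z)) \<in> borel_measurable ((borel :: 'a measure) \<Otimes>\<^sub>M grass_space n)"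
    by (rule measurable_proj_pair[of _ _ _ n]) measurable
  have "flags n = {z \<in> space ((borel :: 'a measure) \<Otimes>\<^sub>M grass_space n). norm (fst z) = 1 \<and> proj (snd z) (fst z) = fst z}"
  proof (rule set_eqI)
    fix z :: "'a \<times> 'a set"
    have "proj (snd z) (fst z) = fst z \<longleftrightarrow> fst z \<in> snd z" if "subspace (snd z)"
      using proj_in[OF that] proj_id[OF that] by metis
    then show "z \<in> flags n \<longleftrightarrow> z \<in> {z \<in> space ((borel :: 'a measure) \<Otimes>\<^sub>M grass_space n). norm (fst z) = 1 \<and> proj (snd z) (fst z) = fst z}"
      by (cases z) (auto simp: flags_def space_pair_measure grass_def)
  qed
  also have "\<dots> \<in> sets ((borel :: 'a measure) \<Otimes>\<^sub>M grass_space n)" by measurable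
  finally show ?thesis .
qed

lemma sets_flag_space: "A \<in> sets flag_space \<longleftrightarrow> A \<in> sets ((borel :: 'a measure) \<Otimes>\<^sub>M grass_space n) \<and> A \<subseteq> flags n"
  using flags_sets sets.sets_into_space[OF flags_sets] by (subst sets_restrict_space_iff) (auto simp: Int_absorb2)

lemma space_flag_space: "space flag_space = flags n"
  using sets.sets_into_space[OF flags_sets] by (auto simp: space_restrict_space)

lemma body: "E \<in> grass n \<Longrightarrow> body_in E (proj E ` K)"
  by unfold_locales (auto simp: grass_def conv_body_proj K proj_in)

abbreviation "\<kappa> \<equiv> \<lambda>E. area_codim1 E (proj E ` K)"

lemma pair_kernel: assumes EG: "E \<in> grass n" shows "(\<lambda>u. (u, E)) \<in> \<kappa> E \<rightarrow>\<^sub>M flag_space"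
proof (rule measurable_restrict_space2)
  interpret body_in E "proj E ` K" by (rule body[OF EG])
  show "(\<lambda>u. (u, E)) \<in> space (\<kappa> E) \<rightarrow> flags n" using EG by (auto simp: space_area flags_def)
  have "(\<lambda>u. (u, E)) \<in> borel \<rightarrow>\<^sub>M borel \<Otimes>\<^sub>M grass_space n" using EG by (intro measurable_Pair2') simp
  then have "(\<lambda>u. (u, E)) \<in> restrict_space borel (sphere 0 1 \<inter> E) \<rightarrow>\<^sub>M borel \<Otimes>\<^sub>M grass_space n" by (rule measurable_restrict_space1)
  then show "(\<lambda>u. (u, E)) \<in> \<kappa> E \<rightarrow>\<^sub>M borel \<Otimes>\<^sub>M grass_space n" by (simp cong: measurable_cong_sets add: sets_area)
qed

text \<open>All cylinders over the local parallel sets, for all subspaces at once, as one set in the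
  product. The subspace comes first here, unlike in flags, so that the sections over a fixed
  \<open>E\<close> are sets of points measured by \<open>lborel\<close>.\<close>

definition collar :: "('a \<times> 'a set) set \<Rightarrow> real \<Rightarrow> ('a set \<times> 'a) set" where
  "collar A \<epsilon> = {z \<in> space grass_borel. 0 < dist_pair z \<and> dist_pair z \<le> \<epsilon> \<and>
         ((1 / dist_pair z) *\<^sub>R (proj_pair z - nearest_pair z), fst z) \<in> A \<and> norm (snd z - proj_pair z) \<le> 1}"

text \<open>The mass of a section is a limit of normalised volumes of sections of
  \<open>collar A\<close>, with normalising factors that do not depend on \<open>E\<close>.\<close>

lemma kernel_section:
  assumes EG: "E \<in> grass n" and A: "A \<in> sets flag_space"
  defines "\<omega> \<equiv> (\<lambda>u. (u, E)) -` A"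
  shows "\<omega> \<in> sets borel" "\<omega> \<subseteq> sphere 0 1 \<inter> E"
    "(\<lambda>m. measure lborel {x. (E, x) \<in> collar A (1 / real (Suc m))}
       / kappa (DIM('a) - n) / (2 * (1 / real (Suc m)))) \<longlonglongrightarrow> enn2real (emeasure (\<kappa> E) \<omega>)"
    "emeasure (\<kappa> E) \<omega> \<noteq> \<top>"
proof -
  interpret body_in E "proj E ` K" by (rule body[OF EG])
  have sE: "subspace E" "dim E = n" using EG by (auto simp: grass_def)
  have "(\<lambda>u. (u, E)) \<in> borel \<rightarrow>\<^sub>M borel \<Otimes>\<^sub>M grass_space n" using EG by (intro measurable_Pair2') simp
  then show \<omega>: "\<omega> \<in> sets borel" using A unfolding \<omega>_def sets_flag_space by (auto intro: measurable_sets_borel)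
  show \<omega>2: "\<omega> \<subseteq> sphere 0 1 \<inter> E" using A unfolding \<omega>_def sets_flag_space by (auto simp: flags_def)
  have em: "emeasure (\<kappa> E) \<omega> = ennreal (alim \<omega>)" by (rule emeasure_area[OF \<omega> \<omega>2])
  then show "emeasure (\<kappa> E) \<omega> \<noteq> \<top>" by simp
  have eq: "measure lborel {x. (E, x) \<in> collar A \<epsilon>} / kappa (DIM('a) - n) / (2 * \<epsilon>) = quot \<epsilon> (UNIV \<times> \<omega>)" for \<epsilon>
  proof -
    have "quot \<epsilon> (UNIV \<times> \<omega>) = volE E (shell E (proj E ` K) 0 \<epsilon> (UNIV \<times> \<omega>)) / (2 * \<epsilon>)"
      unfolding quot_def by (subst volE_eq_measure_lamE[OF sE(1) shell_borel[OF UNIV_Times_borel[OF \<omega>]]]) simp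
    also have "{x. proj E x \<in> shell E (proj E ` K) 0 \<epsilon> (UNIV \<times> \<omega>) \<and> norm (x - proj E x) \<le> 1} =
      {x. (E, x) \<in> collar A \<epsilon>}"
      using EG proj_in[OF sE(1)] by (auto simp: shell_def collar_def \<omega>_def unit_nrm_def space_pair_measure)
    then have "volE E (shell E (proj E ` K) 0 \<epsilon> (UNIV \<times> \<omega>)) = measure lborel {x. (E, x) \<in> collar A \<epsilon>} / kappa (DIM('a) - n)"
      unfolding volE_def sE(2) by simp
    finally show ?thesis by simp
  qed
  have "(\<lambda>m. quot (1 / real (Suc m)) (UNIV \<times> \<omega>)) \<longlonglongrightarrow> alim \<omega>"
    by (rule at_right_0_seq[OF alim(1)[OF \<omega>] _ LIMSEQ_Suc[OF lim_1_over_n]]) simp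
  then show "(\<lambda>m. measure lborel {x. (E, x) \<in> collar A (1 / real (Suc m))}
       / kappa (DIM('a) - n) / (2 * (1 / real (Suc m)))) \<longlonglongrightarrow> enn2real (emeasure (\<kappa> E) \<omega>)"
    unfolding eq em using alim(2)[OF \<omega>] by simp
qed

text \<open>Volumes of sections of a measurable set depend measurably on \<open>E\<close>, and so
  does their pointwise limit; finiteness of the masses permits the return from real to extended
  values.\<close>

lemma kernel_measurable:
  assumes A: "A \<in> sets flag_space"
  shows "(\<lambda>E. emeasure (\<kappa> E) ((\<lambda>u. (u, E)) -` A \<inter> space (\<kappa> E))) \<in> borel_measurable (grass_space n)"
proof -
  note [measurable] = proj_pair_measurable dist_pair_measurable nearest_pair_measurable
  have [measurable]: "A \<in> sets (borel \<Otimes>\<^sub>M grass_space n)" using A by (simp add: sets_flag_space)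
  define W where "W m = collar A (1 / real (Suc m))" for m
  have W: "W m \<in> sets (grass_space n \<Otimes>\<^sub>M lborel)" for m
  proof -
    have "W m \<in> sets grass_borel" unfolding W_def collar_def by measurable
    moreover have "sets grass_borel = sets (grass_space n \<Otimes>\<^sub>M lborel)" by (rule sets_pair_measure_cong) auto
    ultimately show ?thesis by simp
  qed
  have m: "(\<lambda>E. measure lborel {x. (E, x) \<in> W m} / kappa (DIM('a) - n) / (2 * (1 / real (Suc m)))) \<in> borel_measurable (grass_space n)" for m
  proof -
    have [measurable]: "(\<lambda>E. emeasure lborel (Pair E -` W m)) \<in> borel_measurable (grass_space n)"
      by (rule lborel.measurable_emeasure_Pair[OF W])
    have "(\<lambda>E. enn2real (emeasure lborel (Pair E -` W m)) / kappa (DIM('a) - n) / (2 * (1 / real (Suc m)))) \<in> borel_measurable (grass_space n)"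
      by measurable
    then show ?thesis by (simp add: measure_def vimage_def)
  qed
  have "(\<lambda>E. enn2real (emeasure (\<kappa> E) ((\<lambda>u. (u, E)) -` A))) \<in> borel_measurable (grass_space n)"
    by (rule borel_measurable_LIMSEQ_metric[OF m]) (use kernel_section(3)[OF _ A] in \<open>simp add: W_def\<close>)
  then have "(\<lambda>E. ennreal (enn2real (emeasure (\<kappa> E) ((\<lambda>u. (u, E)) -` A)))) \<in> borel_measurable (grass_space n)" by measurable
  then show ?thesis
  proof (rule measurable_cong[THEN iffD1, rotated])
    fix E :: "'a set" assume "E \<in> space (grass_space n)"
    then have EG: "E \<in> grass n" by simp
    interpret body_in E "proj E ` K" by (rule body[OF EG])
    have "(\<lambda>u. (u, E)) -` A \<inter> space (\<kappa> E) = (\<lambda>u. (u, E)) -` A" using kernel_section(2)[OF EG A] by (auto simp: space_area)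
    then show "ennreal (enn2real (emeasure (\<kappa> E) ((\<lambda>u. (u, E)) -` A))) = emeasure (\<kappa> E) ((\<lambda>u. (u, E)) -` A \<inter> space (\<kappa> E))"
      using kernel_section(4)[OF EG A] by (simp add: less_top)
  qed
qed

text \<open>The area measure is bounded by the shell quotient of width 1. In the radius
  \<open>r + 2\<close>, foot points have norm at most \<open>r\<close>, the shell adds 1 and the
  cylinder adds 1.\<close>

lemma kernel_bounded:
  obtains B where "\<And>E. E \<in> grass n \<Longrightarrow> emeasure (\<kappa> E) (space (\<kappa> E)) \<le> ennreal B"
proof -
  have "bounded K" using K by (simp add: conv_body_def compact_imp_bounded)
  then obtain r where r: "\<And>k. k \<in> K \<Longrightarrow> norm k \<le> r" by (auto simp: bounded_iff)
  let ?B = "measure lborel (cball (0::'a) (r + 2)) / kappa (DIM('a) - n) / 2"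
  show thesis
  proof (rule that[of ?B])
    fix E :: "'a set" assume EG: "E \<in> grass n"
    interpret body_in E "proj E ` K" by (rule body[OF EG])
    have sE: "subspace E" "dim E = n" using EG by (auto simp: grass_def)
    let ?\<Omega> = "sphere 0 1 \<inter> E" and ?S = "shell E (proj E ` K) 0 1 (UNIV \<times> (sphere 0 1 \<inter> E))"
    have "emeasure (\<kappa> E) (space (\<kappa> E)) = ennreal (alim ?\<Omega>)" unfolding space_area by (rule emeasure_area) auto
    also have "alim ?\<Omega> \<le> quot 1 (UNIV \<times> ?\<Omega>)" by (rule alim(3)) auto
    also have "\<dots> = volE E ?S / 2"
      unfolding quot_def by (subst volE_eq_measure_lamE[OF sE(1) shell_borel]) auto
    also have "\<dots> \<le> ?B"
      unfolding volE_def sE(2)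
    proof (intro divide_right_mono measure_mono_fmeasurable)
      show "{x. proj E x \<in> ?S \<and> norm (x - proj E x) \<le> 1} \<subseteq> cball 0 (r + 2)"
      proof
        fix x assume x: "x \<in> {x. proj E x \<in> ?S \<and> norm (x - proj E x) \<le> 1}"
        let ?c = "closest_point (proj E ` K) (proj E x)"
        obtain w where w: "w \<in> K" "?c = proj E w" using cp_in by blast
        have "norm ?c \<le> r" using w r[OF w(1)] norm_proj_le[OF sE(1), of w] by simp
        moreover have "norm (proj E x - ?c) \<le> 1" using x infdist_cp[of "proj E x"] by (simp add: shell_def)
        moreover have "norm (x - proj E x) \<le> 1" using x by simp
        ultimately show "x \<in> cball 0 (r + 2)"
          using norm_triangle_sub[of x "proj E x"] norm_triangle_sub[of "proj E x" ?c] by simp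
      qed
      have "{x. proj E x \<in> ?S \<and> norm (x - proj E x) \<le> 1} = cyl E ?S" by (simp add: cyl_def)
      then show "{x. proj E x \<in> ?S \<and> norm (x - proj E x) \<le> 1} \<in> sets lborel"
        using cyl_borel[OF sE(1) shell_borel[OF UNIV_Times_borel[OF Omega_borel]]] by simp
      show "cball (0::'a) (r + 2) \<in> fmeasurable lborel" using emeasure_lborel_cball_finite[of "0::'a" "r + 2"] by (intro fmeasurableI) auto
    qed (use kappa_pos[of "DIM('a) - n"] in auto)
    finally show "emeasure (\<kappa> E) (space (\<kappa> E)) \<le> ennreal ?B" by (simp add: ennreal_leI)
  qed
qed

end

text \<open>Removing the line of \<open>u\<close> from \<open>L\<close> subtracts a rank-one term
  from the projection, and this expression is measurable in the flag.\<close>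

lemma flag_section_measurable:
  "(\<lambda>(u :: 'a::euclidean_space, L). {v. u \<bullet> v = 0} \<inter> L)
    \<in> restrict_space (borel \<Otimes>\<^sub>M grass_space (Suc j)) (flags (Suc j)) \<rightarrow>\<^sub>M grass_space j"
proof (rule measurable_grass_spaceI)
  let ?G = "restrict_space ((borel :: 'a measure) \<Otimes>\<^sub>M grass_space (Suc j)) (flags (Suc j))"
  have flag: "snd z \<in> grass (Suc j)" "fst z \<in> sphere 0 1 \<inter> snd z" if "z \<in> space ?G" for z
    using that by (auto simp: space_restrict_space flags_def)
  show g: "(case z of (u, L) \<Rightarrow> {v. u \<bullet> v = 0} \<inter> L) \<in> grass j" if "z \<in> space ?G" for z
    using grass_hyperplane_section[OF flag[OF that]] by (simp add: case_prod_beta)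
  show "(\<lambda>z. projB (case z of (u, L) \<Rightarrow> {v. u \<bullet> v = 0} \<inter> L)) \<in> borel_measurable ?G"
  proof (rule measurable_blinfunI)
    fix b :: 'a
    have [measurable]: "(\<lambda>z. proj (snd z) b) \<in> borel_measurable ((borel :: 'a measure) \<Otimes>\<^sub>M grass_space (Suc j))"
      by (rule measurable_proj_pair[of _ _ _ "Suc j"]) measurable
    have "(\<lambda>z. proj (snd z) b - (fst z \<bullet> b) *\<^sub>R fst z) \<in> borel_measurable ((borel :: 'a measure) \<Otimes>\<^sub>M grass_space (Suc j))"
      by measurable
    then have "(\<lambda>z. proj (snd z) b - (fst z \<bullet> b) *\<^sub>R fst z) \<in> borel_measurable ?G" by (rule measurable_restrict_space1)
    then show "(\<lambda>z. blinfun_apply (projB (case z of (u, L) \<Rightarrow> {v. u \<bullet> v = 0} \<inter> L)) b) \<in> borel_measurable ?G"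
    proof (rule measurable_cong[THEN iffD1, rotated])
      fix z assume z: "z \<in> space ?G"
      have "subspace (snd z)" using flag(1)[OF z] by (simp add: grass_def)
      moreover have "subspace ({v. fst z \<bullet> v = 0} \<inter> snd z)" using g[OF z] by (simp add: grass_def case_prod_beta)
      ultimately show "proj (snd z) b - (fst z \<bullet> b) *\<^sub>R fst z = blinfun_apply (projB (case z of (u, L) \<Rightarrow> {v. u \<bullet> v = 0} \<inter> L)) b"
        using proj_hyperplane_section[OF _ flag(2)[OF z], of b] by (simp add: projB_apply case_prod_beta)
    qed
  qed
qed

theorem theorem3p1:
  fixes \<phi> :: "'a::euclidean_space set \<Rightarrow> real" and K :: "'a set" and j :: nat
  assumes "DIM('a) \<ge> 3" and "1 \<le> j" and "j \<le> DIM('a) - 2"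
    and "conv_body K" and "uminus ` K = K"
    and "valuation \<phi>" and "even_val \<phi>" and "homogeneous_val j \<phi>"
    and "translation_invariant \<phi>" and "hausdorff_continuous \<phi>"
  shows "(\<integral>M. klain \<phi> M \<partial>grassmann_measure j K) = (\<integral>L. \<phi> (proj L ` K) \<partial>nu (j + 1))"
proof -
  interpret hom_valuation \<phi> j using assms by unfold_locales auto
  interpret P: projected_body K "Suc j" using assms by unfold_locales
  have le: "Suc j \<le> DIM('a)" using assms(1,3) by simp
  let ?N = "nu (Suc j) :: 'a set measure"
  have sN[measurable_cong]: "sets ?N = sets (grass_space (Suc j))" by (rule sets_nu[OF le])
  have spN: "space ?N = grass (Suc j)" using sets_eq_imp_space_eq[OF sN] by simp
  have pN: "prob_space ?N" by (rule prob_space_nu[OF le])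
  obtain B where B: "\<And>E. E \<in> grass (Suc j) \<Longrightarrow> emeasure (P.\<kappa> E) (space (P.\<kappa> E)) \<le> ennreal B"
    using P.kernel_bounded by blast
  interpret k: bounded_kernel ?N "P.\<kappa>" "P.flag_space" B
  proof (rule bounded_kernel.intro)
    show "finite_measure ?N" using pN by (rule prob_space.finite_measure)
  qed (use P.pair_kernel P.kernel_measurable B in \<open>auto simp: spN measurable_cong_sets[OF sN refl]\<close>)
  have F: "flag_measure j K = k.kernel_measure" by (simp add: flag_measure_def k.kernel_measure_def P.space_flag_space)
  let ?h = "\<lambda>(u :: 'a, L). {v. u \<bullet> v = 0} \<inter> L"
  have hm: "?h \<in> P.flag_space \<rightarrow>\<^sub>M grass_space j" by (rule flag_section_measurable)
  then have hF: "?h \<in> k.kernel_measure \<rightarrow>\<^sub>M grass_space j" by simp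
  obtain C where C: "C > 0" "\<And>L. L \<in> grass j \<Longrightarrow> \<bar>klain \<phi> L\<bar> \<le> C" using klain_bounded by metis
  \<comment> \<open>Set to 0 off the flags, because \<open>integral_kernel_measure\<close> asks for
    a bound at every point and \<open>klain\<close> is controlled only on
    \<open>grass j\<close>.\<close>
  define f where "f z = (if z \<in> flags (Suc j) then klain \<phi> (?h z) else 0)" for z
  have fb: "\<bar>f z\<bar> \<le> C" for z
  proof (cases "z \<in> flags (Suc j)")
    case True
    then have "?h z \<in> grass j" using measurable_space[OF hm, of z] by (simp add: P.space_flag_space)
    then show ?thesis using C(2) True by (simp add: f_def)
  qed (use C(1) in \<open>simp add: f_def\<close>)
  have "(\<lambda>z. klain \<phi> (?h z)) \<in> borel_measurable P.flag_space" by (rule measurable_compose[OF hm klain_measurable])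
  then have fm: "f \<in> borel_measurable P.flag_space"
    by (rule measurable_cong[THEN iffD1, rotated]) (simp add: f_def P.space_flag_space)
  \<comment> \<open>Transfer along the flag map, then integrate fibre by fibre over
    \<open>E\<close>; on each fibre the integrand is \<open>klain_sec E\<close>, where the formula
    for a single subspace applies.\<close>
  have "(\<integral>M. klain \<phi> M \<partial>grassmann_measure j K) = (\<integral>z. klain \<phi> (?h z) \<partial>k.kernel_measure)"
    unfolding grassmann_measure_def F by (rule integral_distr[OF hF klain_measurable])
  also have "\<dots> = (\<integral>z. f z \<partial>k.kernel_measure)"
    by (rule Bochner_Integration.integral_cong) (auto simp: f_def P.space_flag_space)
  also have "\<dots> = (\<integral>E. (\<integral>u. f (u, E) \<partial>P.\<kappa> E) \<partial>?N)" by (rule k.integral_kernel_measure[OF fm fb])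
  also have "\<dots> = (\<integral>E. \<phi> (proj E ` K) \<partial>?N)"
  proof (rule Bochner_Integration.integral_cong[OF refl])
    fix E assume "E \<in> space ?N"
    then have E: "E \<in> grass (Suc j)" by (simp add: spN)
    then have sE: "subspace E" by (simp add: grass_def)
    have "f (u, E) = klain_sec E u" for u using E by (auto simp: f_def klain_sec_def flags_def)
    then show "(\<integral>u. f (u, E) \<partial>P.\<kappa> E) = \<phi> (proj E ` K)"
      using phi_eq_area_integral[OF E assms(7) conv_body_proj[OF sE assms(4)] proj_image_subset[OF sE]] by simp
  qed
  finally show ?thesis by simp
qed

end
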